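(* Let $\mathfrak g$ be one of the type I Lie superalgebras $\mathfrak{gl}(m|n)$, $\mathfrak{sl}(m|n)$, $\mathfrak{psl}(n|n)$ with $n>2$, or $\mathfrak{osp}(2|2n)$. Let $N=\dim\mathfrak g_1=\dim\mathfrak g_{\overline 1}/2$ and let $\zeta_{N+1}\in k$ be a primitive $(N+1)$th root of unity. Then $$\mathcal Z_{full}=\bigoplus_{i=0}^{N}\mathcal A_{\zeta_{N+1}^i}.$$
   Context: $k$ is an algebraically closed field of characteristic zero. $\mathfrak g=\mathfrak g_{-1}\oplus\mathfrak g_0\oplus\mathfrak g_1$ is the $\mathbb Z$-grading with $\mathfrak g_0=\mathfrak g_{\overline 0}$ and $\mathfrak g_{\overline 1}=\mathfrak g_{-1}\oplus\mathfrak g_1$. $\operatorname{Aut}(\mathfrak g,\mathfrak g_{\overline 0})$ is the group of automorphisms of $\mathfrak g$ fixing $\mathfrak g_{\overline 0}$ pointwise. For $\phi$ in it, $\operatorname{ad}_\phi(u)(v)=uv-(-1)^{\overline u\,\overline v}v\phi(u)$ ($u\in\mathfrak g$, $v\in\mathcal U\mathfrak g$), and $\mathcal A_\phi=\{v\in\mathcal U\mathfrak g:\operatorname{ad}_\phi(u)(v)=0\ \forall u\in\mathfrak g\}$. The full ghost centre is the subalgebra $\mathcal Z_{full}=\sum_{\phi\in\operatorname{Aut}(\mathfrak g,\mathfrak g_{\overline 0})}\mathcal A_\phi$ of $\mathcal U\mathfrak g$. For these $\mathfrak g$, $\operatorname{Aut}(\mathfrak g,\mathfrak g_{\overline 0})$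 is identified with $k^\times$, with $c\in k^\times$ corresponding to $\phi_c=c\,\mathbf 1_{\mathfrak g_{-1}}\oplus\mathbf 1_{\mathfrak g_0}\oplus c^{-1}\mathbf 1_{\mathfrak g_1}$; write $\mathcal A_c=\mathcal A_{\phi_c}$, so $\mathcal A_1$ is the center of $\mathcal U\mathfrak g$.
   Formalization: The case sl(1|1) is excluded: there the automorphisms fixing the even part form O(2) rather than k^×, and a reflection contributes a nonzero odd element to the full ghost centre, so the stated decomposition fails. *)

theory Defs
  imports
    "Jordan_Normal_Form.VS_Connect"
    "HOL-Algebra.QuotRing"
    "HOL-Library.Poly_Mapping"
    "HOL-Library.Z2"
begin

section \<open>Direct sums of subspaces\<close>

text \<open>Vector spaces over the type-class field \<open>'k\<close> are modules in the sense of HOL-Algebra over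
  \<^term>\<open>class_ring\<close>. Their record type inherits the fields \<open>mult\<close> and \<open>one\<close> from rings; these are
  meaningless unless the space is an associative algebra.\<close>

definition internal_direct_sum ::
  "('k::field, 'a, 'm) module_scheme \<Rightarrow> 'i set \<Rightarrow> ('i \<Rightarrow> 'a set) \<Rightarrow> 'a set \<Rightarrow> bool" where
  "internal_direct_sum M I A W \<longleftrightarrow>
     (\<forall>i\<in>I. subspace class_ring (A i) M) \<and>
     bij_betw (\<lambda>v. \<Oplus>\<^bsub>M\<^esub>i\<in>I. v i) (\<Pi>\<^sub>E i\<in>I. A i) W"

text \<open>The family of components of \<open>x\<close>; meaningful only if \<open>x\<close> lies in a direct sum of the \<open>A i\<close>.\<close>

definition component ::
  "('k::field, 'a, 'm) module_scheme \<Rightarrow> 'i set \<Rightarrow> ('i \<Rightarrow> 'a set) \<Rightarrow> 'a \<Rightarrow> 'i \<Rightarrow> 'a" where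
  "component M I A x = the_inv_into (\<Pi>\<^sub>E i\<in>I. A i) (\<lambda>v. \<Oplus>\<^bsub>M\<^esub>i\<in>I. v i) x"

definition primitive_root_of_unity :: "nat \<Rightarrow> 'k::field \<Rightarrow> bool" where
  "primitive_root_of_unity n z \<longleftrightarrow> n > 0 \<and> z ^ n = 1 \<and> (\<forall>j. 0 < j \<and> j < n \<longrightarrow> z ^ j \<noteq> 1)"


section \<open>Lie superalgebras\<close>

text \<open>Parities are elements of \<open>\<int>/2\<close>, i.e. of the type \<^typ>\<open>bit\<close>.\<close>

record ('k, 'g) lie_superalgebra = "('k, 'g) module" +
  bracket :: "'g \<Rightarrow> 'g \<Rightarrow> 'g"
  part :: "bit \<Rightarrow> 'g set"

definition super_sign :: "bit \<Rightarrow> bit \<Rightarrow> 'k::field" where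
  "super_sign p q = (if p = 1 \<and> q = 1 then - 1 else 1)"

locale lie_superalgebra = vectorspace class_ring L
  for L :: "('k::field, 'g) lie_superalgebra" (structure) +
  assumes parity_decomposition: "internal_direct_sum L UNIV (part L) (carrier L)"
    and bracket_closed:
      "\<And>x y. x \<in> carrier L \<Longrightarrow> y \<in> carrier L \<Longrightarrow> bracket L x y \<in> carrier L"
    and bracket_add_left:
      "\<And>x y z. x \<in> carrier L \<Longrightarrow> y \<in> carrier L \<Longrightarrow> z \<in> carrier L \<Longrightarrow>
        bracket L (x \<oplus> y) z = bracket L x z \<oplus> bracket L y z"
    and bracket_add_right:
      "\<And>x y z. x \<in> carrier L \<Longrightarrow> y \<in> carrier L \<Longrightarrow> z \<in> carrier L \<Longrightarrow>
        bracket L x (y \<oplus> z) = bracket L x y \<oplus> bracket L x z"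
    and bracket_smult_left:
      "\<And>c x y. x \<in> carrier L \<Longrightarrow> y \<in> carrier L \<Longrightarrow> bracket L (c \<odot> x) y = c \<odot> bracket L x y"
    and bracket_smult_right:
      "\<And>c x y. x \<in> carrier L \<Longrightarrow> y \<in> carrier L \<Longrightarrow> bracket L x (c \<odot> y) = c \<odot> bracket L x y"
    and bracket_parity:
      "\<And>p q x y. x \<in> part L p \<Longrightarrow> y \<in> part L q \<Longrightarrow> bracket L x y \<in> part L (p + q)"
    and super_skew:
      "\<And>p q x y. x \<in> part L p \<Longrightarrow> y \<in> part L q \<Longrightarrow>
        bracket L x y = \<ominus> (super_sign p q \<odot> bracket L y x)"
    and super_jacobi:
      "\<And>p q x y z. x \<in> part L p \<Longrightarrow> y \<in> part L q \<Longrightarrow> z \<in> carrier L \<Longrightarrow>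
        bracket L x (bracket L y z) =
          bracket L (bracket L x y) z \<oplus> super_sign p q \<odot> bracket L y (bracket L x z)"

definition lsa_iso ::
  "('k::field, 'g) lie_superalgebra \<Rightarrow> ('k, 'h) lie_superalgebra \<Rightarrow> ('g \<Rightarrow> 'h) \<Rightarrow> bool" where
  "lsa_iso L L' \<phi> \<longleftrightarrow>
     \<phi> \<in> LinearCombinations.module_hom class_ring L L' \<and> bij_betw \<phi> (carrier L) (carrier L') \<and>
     (\<forall>p. \<phi> ` part L p = part L' p) \<and>
     (\<forall>x\<in>carrier L. \<forall>y\<in>carrier L. \<phi> (bracket L x y) = bracket L' (\<phi> x) (\<phi> y))"

definition lsa_isomorphic ::
  "('k::field, 'g) lie_superalgebra \<Rightarrow> ('k, 'h) lie_superalgebra \<Rightarrow> bool" where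
  "lsa_isomorphic L L' \<longleftrightarrow> (\<exists>\<phi>. lsa_iso L L' \<phi>)"

text \<open>The automorphisms that fix the even part pointwise.\<close>

definition Aut_even :: "('k::field, 'g) lie_superalgebra \<Rightarrow> ('g \<Rightarrow> 'g) set" where
  "Aut_even L = {\<phi> \<in> extensional (carrier L). lsa_iso L L \<phi> \<and> (\<forall>x\<in>part L 0. \<phi> x = x)}"

text \<open>A \<open>\<int>\<close>-grading \<open>\<gg> = \<gg>\<^sub>-\<^sub>1 \<oplus> \<gg>\<^sub>0 \<oplus> \<gg>\<^sub>1\<close> whose degree-zero part is the even part of \<open>\<gg>\<close> and
  whose other two parts make up the odd part.\<close>

definition type_I_grading ::
  "('k::field, 'g) lie_superalgebra \<Rightarrow> (int \<Rightarrow> 'g set) \<Rightarrow> bool" where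
  "type_I_grading L G \<longleftrightarrow>
     internal_direct_sum L {-1, 0, 1} G (carrier L) \<and>
     (\<forall>i. i \<notin> {-1, 0, 1} \<longrightarrow> G i = {\<zero>\<^bsub>L\<^esub>}) \<and>
     (\<forall>i j. \<forall>x\<in>G i. \<forall>y\<in>G j. bracket L x y \<in> G (i + j)) \<and>
     G 0 = part L 0 \<and>
     internal_direct_sum L {-1, 1} G (part L 1)"

definition grading_scaling ::
  "('k::field, 'g) lie_superalgebra \<Rightarrow> (int \<Rightarrow> 'g set) \<Rightarrow> 'k \<Rightarrow> 'g \<Rightarrow> 'g" where
  "grading_scaling L G c = (\<lambda>x\<in>carrier L.
     let x' = component L {-1, 0, 1} G x
     in c \<odot>\<^bsub>L\<^esub> x' (-1) \<oplus>\<^bsub>L\<^esub> x' 0 \<oplus>\<^bsub>L\<^esub> inverse c \<odot>\<^bsub>L\<^esub> x' 1)"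


section \<open>The Lie superalgebras \<open>\<gg>\<ll>\<close>, \<open>\<ss>\<ll>\<close>, \<open>\<pp>\<ss>\<ll>\<close> and \<open>\<oo>\<ss>\<pp>\<close>\<close>

text \<open>The parity of the \<open>i\<close>-th standard basis vector of \<open>k\<^bsup>m|n\<^esup>\<close>, counting from \<open>0\<close>.\<close>

definition index_parity :: "nat \<Rightarrow> nat \<Rightarrow> bit" where
  "index_parity m i = (if i < m then 0 else 1)"

definition matrix_part :: "nat \<Rightarrow> bit \<Rightarrow> 'k::field mat \<Rightarrow> 'k mat" where
  "matrix_part m p A = mat (dim_row A) (dim_col A)
     (\<lambda>(i, j). if index_parity m i + index_parity m j = p then A $$ (i, j) else 0)"

text \<open>The bilinear extension of \<open>[A, B] = A B - (-1)\<^bsup>p q\<^esup> B A\<close> for \<open>A\<close>, \<open>B\<close> of parities \<open>p\<close>, \<open>q\<close>.\<close>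

definition supercommutator :: "nat \<Rightarrow> 'k::field mat \<Rightarrow> 'k mat \<Rightarrow> 'k mat" where
  "supercommutator m A B = A * B -
     (matrix_part m 0 B * matrix_part m 0 A + matrix_part m 1 B * matrix_part m 0 A +
      matrix_part m 0 B * matrix_part m 1 A - matrix_part m 1 B * matrix_part m 1 A)"

definition gl :: "nat \<Rightarrow> nat \<Rightarrow> ('k::field, 'k mat) lie_superalgebra" where
  "gl m n = module.extend (module_mat TYPE('k) (m + n) (m + n))
     \<lparr>bracket = supercommutator m,
      part = (\<lambda>p. {A \<in> carrier_mat (m + n) (m + n). matrix_part m p A = A})\<rparr>"

definition graded_subalgebra ::
  "('k::field, 'g) lie_superalgebra \<Rightarrow> 'g set \<Rightarrow> ('k, 'g) lie_superalgebra" where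
  "graded_subalgebra L S = L\<lparr>carrier := S, part := (\<lambda>p. part L p \<inter> S)\<rparr>"

definition supertrace :: "nat \<Rightarrow> nat \<Rightarrow> 'k::field mat \<Rightarrow> 'k" where
  "supertrace m n A = (\<Sum>i<m. A $$ (i, i)) - (\<Sum>i\<in>{m..<m+n}. A $$ (i, i))"

text \<open>\<open>sl 1 1\<close> is exceptional: it is the Heisenberg superalgebra \<open>[e, f] = z\<close> with \<open>z\<close> central and
  spanning the even part, so \<open>Aut_even (sl 1 1)\<close> is the orthogonal group \<open>O(2)\<close> and not \<open>k\<^sup>\<times>\<close>.\<close>

definition sl :: "nat \<Rightarrow> nat \<Rightarrow> ('k::field, 'k mat) lie_superalgebra" where
  "sl m n = graded_subalgebra (gl m n) {A \<in> carrier (gl m n). supertrace m n A = 0}"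

text \<open>The operations on cosets follow \<^const>\<open>FactRing\<close> and \<^const>\<open>rcoset_mult\<close>; the fields
  \<open>mult\<close> and \<open>one\<close> are again meaningless.\<close>

definition lsa_quotient ::
  "('k::field, 'g) lie_superalgebra \<Rightarrow> 'g set \<Rightarrow> ('k, 'g set) lie_superalgebra" where
  "lsa_quotient L J =
     \<lparr>carrier = a_rcosets\<^bsub>L\<^esub> J, mult = rcoset_mult L J, one = J +>\<^bsub>L\<^esub> \<one>\<^bsub>L\<^esub>,
      zero = J, add = set_add L,
      smult = (\<lambda>c X. \<Union>x\<in>X. J +>\<^bsub>L\<^esub> (c \<odot>\<^bsub>L\<^esub> x)),
      bracket = (\<lambda>X Y. \<Union>x\<in>X. \<Union>y\<in>Y. J +>\<^bsub>L\<^esub> bracket L x y),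
      part = (\<lambda>p. (\<lambda>x. J +>\<^bsub>L\<^esub> x) ` part L p)\<rparr>"

definition psl :: "nat \<Rightarrow> ('k::field, 'k mat set) lie_superalgebra" where
  "psl n = lsa_quotient (sl n n) {c \<cdot>\<^sub>m 1\<^sub>m (n + n) | c. True}"

text \<open>The Gram matrix of an even nondegenerate form on \<open>k\<^bsup>m|2n\<^esup>\<close>, symmetric on \<open>k\<^bsup>m\<^esup>\<close>,
  alternating on \<open>k\<^bsup>2n\<^esup>\<close> and zero between the two. Over an algebraically closed field of
  characteristic not \<open>2\<close> all such forms are equivalent.\<close>

definition osp_form :: "nat \<Rightarrow> nat \<Rightarrow> 'k::field mat" where
  "osp_form m n = mat (m + 2 * n) (m + 2 * n) (\<lambda>(i, j).
     if i < m then (if j = i then 1 else 0)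
     else if i < m + n then (if j = i + n then 1 else 0)
     else (if m \<le> j \<and> i = j + n then - 1 else 0))"

text \<open>A matrix \<open>A\<close> of parity \<open>p\<close> preserves the form \<open>b\<close> if
  \<open>b(A v, w) + (-1)\<^bsup>p |v|\<^esup> b(v, A w) = 0\<close>; here \<open>v\<close>, \<open>w\<close> run through the standard basis.\<close>

definition preserves_osp_form :: "nat \<Rightarrow> nat \<Rightarrow> bit \<Rightarrow> 'k::field mat \<Rightarrow> bool" where
  "preserves_osp_form m n p A \<longleftrightarrow> (\<forall>i<m + 2 * n. \<forall>j<m + 2 * n.
     (transpose_mat A * osp_form m n) $$ (i, j)
       + super_sign p (index_parity m i) * (osp_form m n * A) $$ (i, j) = 0)"

text \<open>\<open>osp m n\<close> is \<open>\<oo>\<ss>\<pp>(m|2n)\<close>.\<close>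

definition osp :: "nat \<Rightarrow> nat \<Rightarrow> ('k::field, 'k mat) lie_superalgebra" where
  "osp m n = graded_subalgebra (gl m (2 * n))
     {A \<in> carrier (gl m (2 * n)). \<forall>p. preserves_osp_form m n p (matrix_part m p A)}"


section \<open>The universal enveloping superalgebra\<close>

text \<open>The free monoid, written additively: finitely supported functions on it then form its monoid
  algebra, i.e. the free associative algebra, with the convolution product of
  \<^type>\<open>poly_mapping\<close>.\<close>

datatype 'g free_word = Word (letters: "'g list")

instantiation free_word :: (type) monoid_add
begin

definition "0 = Word []"

definition "v + w = Word (letters v @ letters w)"

instance
  by standard (simp_all add: zero_free_word_def plus_free_word_def)

end

definition free_algebra :: "'g set \<Rightarrow> ('g free_word \<Rightarrow>\<^sub>0 'k::field) ring" where
  "free_algebra X =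
     \<lparr>carrier = {f. \<forall>w\<in>Poly_Mapping.keys f. set (letters w) \<subseteq> X}, mult = (*), one = 1, zero = 0, add = (+)\<rparr>"

definition free_gen :: "'g \<Rightarrow> 'g free_word \<Rightarrow>\<^sub>0 'k::field" where
  "free_gen x = Poly_Mapping.single (Word [x]) 1"

definition free_scalar :: "'k \<Rightarrow> 'g free_word \<Rightarrow>\<^sub>0 'k::field" where
  "free_scalar c = Poly_Mapping.single 0 c"

text \<open>The first two sets of relations turn the free algebra on the set \<open>\<gg>\<close> into the tensor algebra
  of the vector space \<open>\<gg>\<close>.\<close>

definition env_relations ::
  "('k::field, 'g) lie_superalgebra \<Rightarrow> ('g free_word \<Rightarrow>\<^sub>0 'k) set" where
  "env_relations L =
     {free_gen (x \<oplus>\<^bsub>L\<^esub> y) - (free_gen x + free_gen y) | x y. x \<in> carrier L \<and> y \<in> carrier L} \<union>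
     {free_gen (c \<odot>\<^bsub>L\<^esub> x) - free_scalar c * free_gen x | c x. x \<in> carrier L} \<union>
     {free_gen x * free_gen y - free_scalar (super_sign p q) * free_gen y * free_gen x
        - free_gen (bracket L x y) | p q x y. x \<in> part L p \<and> y \<in> part L q}"

definition env_ideal ::
  "('k::field, 'g) lie_superalgebra \<Rightarrow> ('g free_word \<Rightarrow>\<^sub>0 'k) set" where
  "env_ideal L = Idl\<^bsub>free_algebra (carrier L)\<^esub> (env_relations L)"

definition env ::
  "('k::field, 'g) lie_superalgebra \<Rightarrow> ('k, ('g free_word \<Rightarrow>\<^sub>0 'k) set) module" where
  "env L =
     (let T = free_algebra (carrier L); J = env_ideal L
      in ring.extend (T Quot J)
           \<lparr>smult = (\<lambda>c X. (J +>\<^bsub>T\<^esub> free_scalar c) \<otimes>\<^bsub>T Quot J\<^esub> X)\<rparr>)"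

definition env_emb ::
  "('k::field, 'g) lie_superalgebra \<Rightarrow> 'g \<Rightarrow> ('g free_word \<Rightarrow>\<^sub>0 'k) set" where
  "env_emb L x = env_ideal L +>\<^bsub>free_algebra (carrier L)\<^esub> free_gen x"

text \<open>Products of homogeneous elements of \<open>\<gg>\<close> with total parity as indicated.\<close>

inductive env_monomial ::
  "('k::field, 'g) lie_superalgebra \<Rightarrow> bit \<Rightarrow> ('g free_word \<Rightarrow>\<^sub>0 'k) set \<Rightarrow> bool"
  for L where
  "env_monomial L 0 \<one>\<^bsub>env L\<^esub>"
| "x \<in> part L p \<Longrightarrow> env_monomial L q v \<Longrightarrow> env_monomial L (p + q) (env_emb L x \<otimes>\<^bsub>env L\<^esub> v)"

definition env_part ::
  "('k::field, 'g) lie_superalgebra \<Rightarrow> bit \<Rightarrow> ('g free_word \<Rightarrow>\<^sub>0 'k) set set" where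
  "env_part L p = LinearCombinations.module.span class_ring (env L) (Collect (env_monomial L p))"


section \<open>The full ghost centre\<close>

text \<open>The bilinear extension of \<open>ad\<^sub>\<phi>(u)(v) = u v - (-1)\<^bsup>p q\<^esup> v \<phi>(u)\<close> for \<open>u\<close>, \<open>v\<close> of parities
  \<open>p\<close>, \<open>q\<close>.\<close>

definition twisted_ad ::
  "('k::field, 'g) lie_superalgebra \<Rightarrow> ('g \<Rightarrow> 'g) \<Rightarrow> 'g \<Rightarrow>
     ('g free_word \<Rightarrow>\<^sub>0 'k) set \<Rightarrow> ('g free_word \<Rightarrow>\<^sub>0 'k) set" where
  "twisted_ad L \<phi> u v =
     (\<Oplus>\<^bsub>env L\<^esub>p\<in>UNIV. \<Oplus>\<^bsub>env L\<^esub>q\<in>UNIV.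
        let u' = component L UNIV (part L) u p;
            v' = component (env L) UNIV (env_part L) v q
        in env_emb L u' \<otimes>\<^bsub>env L\<^esub> v' \<ominus>\<^bsub>env L\<^esub>
             super_sign p q \<odot>\<^bsub>env L\<^esub> (v' \<otimes>\<^bsub>env L\<^esub> env_emb L (\<phi> u')))"

definition twisted_centre ::
  "('k::field, 'g) lie_superalgebra \<Rightarrow> ('g \<Rightarrow> 'g) \<Rightarrow> ('g free_word \<Rightarrow>\<^sub>0 'k) set set" where
  "twisted_centre L \<phi> =
     {v \<in> carrier (env L). \<forall>u\<in>carrier L. twisted_ad L \<phi> u v = \<zero>\<^bsub>env L\<^esub>}"

text \<open>The sum of a family of subspaces is the span of their union.\<close>

definition full_ghost_centre ::
  "('k::field, 'g) lie_superalgebra \<Rightarrow> ('g free_word \<Rightarrow>\<^sub>0 'k) set set" where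
  "full_ghost_centre L =
     LinearCombinations.module.span class_ring (env L) (\<Union>\<phi>\<in>Aut_even L. twisted_centre L \<phi>)"

end

theory Submission
  imports Defs "HOL-Library.Multiset_Order"
begin

text \<open>Write \<open>\<gg> = \<gg>\<^sub>-\<^sub>1 \<oplus> \<gg>\<^sub>0 \<oplus> \<gg>\<^sub>1\<close>. Two facts about the algebras in question are used, and nothing else: there is a
linear form \<open>h\<close> and there are bases \<open>e i\<close> of \<open>\<gg>\<^sub>1\<close> and \<open>f i\<close> of \<open>\<gg>\<^sub>-\<^sub>1\<close> with \<open>h [e i, f j] = \<delta>\<close>, and every
automorphism fixing the even part multiplies all \<open>f i\<close> by one scalar \<open>c\<close> and all \<open>e i\<close> by its inverse.
This is \<open>kac_type\<close>; it is invariant under isomorphism and is checked for the four families on matrices.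
It does not mention the grading: applied to the scaling by \<open>2\<close> of an arbitrary grading, rigidity shows that the
grading is the expected one up to exchanging the roles of \<open>e\<close> and \<open>f\<close> (\<open>rigid_oriented\<close>).

By the PBW theorem, the enveloping algebra is realised faithfully as an algebra \<open>U\<close> of operators. Let \<open>T\<^sup>+\<close>
and \<open>T\<^sup>-\<close> be the products of all \<open>e i\<close> and of all \<open>f i\<close>. The left module \<open>K = U T\<^sup>+\<close> has the shape
\<open>\<Oplus>\<^sub>I f\<^sub>I U(\<gg>\<^sub>0) T\<^sup>+\<close>, graded by \<open>|I| = k\<close> with \<open>0 \<le> k \<le> N\<close>. It carries all the information:
\<^item> \<open>T\<^sup>+ T\<^sup>- T\<^sup>+ = P T\<^sup>+\<close> with \<open>0 \<noteq> P \<in> U(\<gg>\<^sub>0)\<close> (\<open>Ph\<close>), as one sees by evaluating the leading symbol at \<open>h\<close>.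
  As \<open>U(\<gg>\<^sub>0)\<close> is a domain, \<open>U\<close> acts faithfully on \<open>K\<close> (\<open>faithful\<close>).
\<^item> If \<open>v\<close> lies in \<open>A\<^sub>c\<close>, then \<open>v T\<^sup>+ = F T\<^sup>+\<close> for some \<open>F \<in> U(\<gg>\<^sub>0)\<close>, and moving \<open>v\<close> past \<open>k\<close> letters \<open>f\<close> shows that \<open>v\<close>
  acts on the degree \<open>k\<close> piece of \<open>K\<close> as \<open>c\<^bsup>-k\<^esup>\<close> times right multiplication by \<open>F\<close>.
\<^item> If \<open>c \<noteq> 1\<close>, then \<open>F T\<^sup>+\<close> is a multiple of \<open>T\<^sup>+ T\<^sup>-\<close> (\<open>Acent_divisible\<close>), and from this one constructs for each \<open>k\<close> an
  element \<open>E\<^sub>k\<close> of \<open>U\<close> acting by \<open>F\<close> on the degree \<open>k\<close> piece and by zero on the others (\<open>Acent_pieces\<close>).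

Hence \<open>v = \<Sum>\<^sub>k c\<^bsup>-k\<^esup> E\<^sub>k\<close>, while \<open>\<Sum>\<^sub>k \<zeta>\<^bsup>-jk\<^esup> E\<^sub>k\<close> belongs to \<open>A\<close> at \<open>\<zeta>\<^sup>j\<close> by faithfulness. A discrete Fourier
transform over the \<open>N + 1\<close> values of \<open>k\<close> writes \<open>v\<close> as a sum of elements of the \<open>A\<close> at powers of \<open>\<zeta>\<close>
(\<open>Acent_decompose\<close>). Conversely, the scalars \<open>\<zeta>\<^bsup>-jk\<^esup>\<close> separate the summands on \<open>K\<close>, so the sum is direct
(\<open>Acent_independent\<close>).\<close>

section \<open>Rigid dual bases\<close>

text \<open>Everything about the four families that the later sections use is collected in \<open>kac_type\<close>. The conditions are phrased
without finite sums in the algebra, so that they pass along isomorphisms and to quotients by hand: \<open>spans\<close> quantifies over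
subsets closed under the operations, and finite-dimensionality is stated as the existence of finitely many separating
linear functionals. An \<open>odd_symmetry\<close> is what remains on the odd part of an automorphism fixing the even part.\<close>

definition linear_functional :: "('k::field, 'g) lie_superalgebra => ('g => 'k) => bool" where
 "linear_functional L F \<longleftrightarrow>
     (\<forall>x\<in>carrier L. \<forall>y\<in>carrier L. F (x \<oplus>\<^bsub>L\<^esub> y) = F x + F y) \<and>
     (\<forall>c. \<forall>x\<in>carrier L. F (c \<odot>\<^bsub>L\<^esub> x) = c * F x)"

definition separated :: "('k::field, 'g) lie_superalgebra => bool" where
 "separated L \<longleftrightarrow> (\<exists>(r::nat) lam. (\<forall>t<r. linear_functional L (lam t)) \<and>
     (\<forall>x\<in>carrier L. \<forall>y\<in>carrier L. (\<forall>t<r. lam t x = lam t y) --> x = y))"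

definition odd_symmetry :: "('k::field, 'g) lie_superalgebra => ('g => 'g) => bool" where
 "odd_symmetry L \<phi> \<longleftrightarrow>
     (\<forall>z\<in>part L 1. \<phi> z : part L 1) \<and>
     (\<forall>c. \<forall>z\<in>part L 1. \<phi> (c \<odot>\<^bsub>L\<^esub> z) = c \<odot>\<^bsub>L\<^esub> \<phi> z) \<and>
     (\<forall>x\<in>part L 0. \<forall>z\<in>part L 1. \<phi> (bracket L x z) = bracket L x (\<phi> z)) \<and>
     (\<forall>z\<in>part L 1. \<forall>w\<in>part L 1. bracket L (\<phi> z) (\<phi> w) = bracket L z w)"

definition spans :: "('k::field, 'g) lie_superalgebra => 'g set => 'g set => bool" where
 "spans L B P \<longleftrightarrow> (\<forall>W. W <= carrier L & W ~= {} & B <= W \<and>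
     (\<forall>x\<in>W. \<forall>y\<in>W. x \<oplus>\<^bsub>L\<^esub> y : W) & (\<forall>c. \<forall>x\<in>W. c \<odot>\<^bsub>L\<^esub> x : W) --> P <= W)"

definition rigid_dual_bases ::
 "('k::field, 'g) lie_superalgebra => 'i set => ('i => 'g) => ('i => 'g) => ('g => 'k) => bool" where
 "rigid_dual_bases L I e f h \<longleftrightarrow> finite I & e ` I <= part L 1 & f ` I <= part L 1 \<and>
     spans L (e ` I \<union> f ` I) (part L 1) & linear_functional L h \<and>
     (\<forall>i\<in>I. \<forall>j\<in>I. h (bracket L (e i) (f j)) = (if i = j then 1 else 0)) \<and>
     (\<forall>\<phi>. odd_symmetry L \<phi> -->
  (\<exists>c. c ~= 0 & (\<forall>i\<in>I. \<phi> (e i) = inverse c \<odot>\<^bsub>L\<^esub> e i & \<phi> (f i) = c \<odot>\<^bsub>L\<^esub> f i)))"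

definition kac_type :: "('k::field, 'g) lie_superalgebra => bool" where
 "kac_type L \<longleftrightarrow> separated L & (\<exists>(N::nat) e f h. rigid_dual_bases L {..<N} e f h)"

lemma rigid_dual_bases_reindex:
 assumes "rigid_dual_bases L I e f h"
 shows "\<exists>(N::nat) e f. rigid_dual_bases L {..<N} e f h"
proof -
 have "finite I" using assms by (simp add: rigid_dual_bases_def)
 then obtain g where g: "bij_betw g {0..<card I} I" using ex_bij_betw_nat_finite by blast
 let ?N = "card I"
 have im: "g ` {..<?N} = I" and inj: "inj_on g {..<?N}" using g by (auto simp: bij_betw_def lessThan_atLeast0)
 have gi: "g i : I" if "i < ?N" for i using im that by auto
 have eq: "g i = g j \<longleftrightarrow> i = j" if "i < ?N" "j < ?N" for i j using inj that by (auto simp: inj_on_def)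
 have im': "(%i. e (g i)) ` {..<?N} = e ` I" "(%i. f (g i)) ` {..<?N} = f ` I"
  using image_image[of e g "{..<?N}"] image_image[of f g "{..<?N}"] im by simp_all
 note R = assms[unfolded rigid_dual_bases_def]
 have dual: "\<forall>i\<in>I. \<forall>j\<in>I. h (bracket L (e i) (f j)) = (if i = j then 1 else 0)" using R by (elim conjE)
 have "rigid_dual_bases L {..<?N} (%i. e (g i)) (%i. f (g i)) h"
  unfolding rigid_dual_bases_def im'
 proof (intro conjI ballI allI impI)
  show "e ` I <= part L 1" using R by (elim conjE)
  show "f ` I <= part L 1" using R by (elim conjE)
  show "spans L (e ` I \<union> f ` I) (part L 1)" using R by (elim conjE)
  show "linear_functional L h" using R by (elim conjE)
 next
  fix i j assume "i : {..<?N}" "j : {..<?N}"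
  hence ij: "i < ?N" "j < ?N" by auto
  have "h (bracket L (e (g i)) (f (g j))) = (if g i = g j then 1 else 0)"
  by (rule dual[rule_format, OF gi[OF ij(1)] gi[OF ij(2)]])
  thus "h (bracket L (e (g i)) (f (g j))) = (if i = j then 1 else 0)" unfolding eq[OF ij] .
 next
  fix \<phi> assume \<phi>: "odd_symmetry L \<phi>"
  hence "\<exists>c. c ~= 0 & (\<forall>i\<in>I. \<phi> (e i) = inverse c \<odot>\<^bsub>L\<^esub> e i & \<phi> (f i) = c \<odot>\<^bsub>L\<^esub> f i)"
  using R by (elim conjE allE[of _ \<phi>] impE)
  thus "\<exists>c. c ~= 0 & (\<forall>i\<in>{..<?N}. \<phi> (e (g i)) = inverse c \<odot>\<^bsub>L\<^esub> e (g i) & \<phi> (f (g i)) = c \<odot>\<^bsub>L\<^esub> f (g i))"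
  using gi by (elim ex_forward conj_forward) auto
 qed simp
 thus ?thesis by (intro exI)
qed

lemma kac_typeI: "separated L ==> rigid_dual_bases L I e f h ==> kac_type L"
 unfolding kac_type_def using rigid_dual_bases_reindex by blast

section \<open>Matrix superalgebras: \<open>\<gg>\<ll>\<close> and \<open>\<ss>\<ll>\<close>\<close>

lemma sum_only:
 assumes "l < (N::nat)" "!!k. k < N ==> k ~= l ==> F k = 0"
 shows "(\<Sum>k<N. F k) = (F l :: 'a::comm_monoid_add)"
proof -
 have "(\<Sum>k<N. F k) = (\<Sum>k\<in>{l}. F k)" by (rule sum.mono_neutral_right) (use assms in auto)
 thus ?thesis by simp
qed

lemma sum_only2:
 assumes "l < (N::nat)" "l' < N" "l ~= l'" "!!k. k < N ==> k ~= l ==> k ~= l' ==> F k = 0"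
 shows "(\<Sum>k<N. F k) = F l + (F l' :: 'a::comm_monoid_add)"
proof -
 have "(\<Sum>k<N. F k) = (\<Sum>k\<in>{l, l'}. F k)" by (rule sum.mono_neutral_right) (use assms in auto)
 thus ?thesis using assms by simp
qed

lemma mult_entry:
 "A : carrier_mat N N ==> B : carrier_mat N N ==> x < N ==> y < N ==>
  (A * B) $$ (x, y) = (\<Sum>k<N. A $$ (x, k) * B $$ (k, y))"
 by (simp add: scalar_prod_def lessThan_atLeast0)

lemma mp_in: "A : carrier_mat N N ==> matrix_part m p A : carrier_mat N N"
proof -
 assume "A : carrier_mat N N"
 hence "dim_row A = N" "dim_col A = N" by auto
 thus ?thesis unfolding matrix_part_def by (simp only: mat_carrier)
qed

lemma mp_entry:
 "A : carrier_mat N N ==> x < N ==> y < N ==>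
  matrix_part m p A $$ (x, y) = (if (p = 1 \<longleftrightarrow> (x < m) ~= (y < m)) then A $$ (x, y) else 0)"
 by (cases p) (auto simp: matrix_part_def index_parity_def)

text \<open>Of the products of homogeneous parts, exactly one is nonzero in each entry and for each inner index; this turns the
supercommutator into one sum with a sign.\<close>

lemma sc_entry:
 assumes A: "A : carrier_mat N N" and B: "B : carrier_mat N N" and x: "x < N" and y: "y < N"
 shows "supercommutator m A B $$ (x, y) = (\<Sum>k<N. A $$ (x, k) * B $$ (k, y) -
  (if (x < m) ~= (k < m) & (k < m) ~= (y < m) then - 1 else 1) * (B $$ (x, k) * A $$ (k, y)))"
proof -
 note c = mp_in[OF A, of m] mp_in[OF B, of m]
 have mm: "P * Q : carrier_mat N N" if "P : carrier_mat N N" "Q : carrier_mat N N" for P Q :: "'a mat"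
  using that by (rule mult_carrier_mat)
 have gen: "(P0 - (P1 + P2 + P3 - P4)) $$ (x, y) =
  P0 $$ (x, y) - (P1 $$ (x, y) + P2 $$ (x, y) + P3 $$ (x, y) - P4 $$ (x, y))"
  if "P0 : carrier_mat N N" "P1 : carrier_mat N N" "P2 : carrier_mat N N" "P3 : carrier_mat N N" "P4 : carrier_mat N N"
  for P0 P1 P2 P3 P4 :: "'a mat" using that x y by simp
 have "supercommutator m A B $$ (x, y) = (A * B) $$ (x, y) -
     ((matrix_part m 0 B * matrix_part m 0 A) $$ (x, y) + (matrix_part m 1 B * matrix_part m 0 A) $$ (x, y) +
  (matrix_part m 0 B * matrix_part m 1 A) $$ (x, y) - (matrix_part m 1 B * matrix_part m 1 A) $$ (x, y))"
  unfolding supercommutator_def by (rule gen) (intro mm c A B)+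
 also have "... = (\<Sum>k<N. A $$ (x, k) * B $$ (k, y) -
     (matrix_part m 0 B $$ (x, k) * matrix_part m 0 A $$ (k, y) + matrix_part m 1 B $$ (x, k) * matrix_part m 0 A $$ (k, y) +
  matrix_part m 0 B $$ (x, k) * matrix_part m 1 A $$ (k, y) - matrix_part m 1 B $$ (x, k) * matrix_part m 1 A $$ (k, y)))"
  unfolding mult_entry[OF A B x y] mult_entry[OF c(2)[of 0] c(1)[of 0] x y] mult_entry[OF c(2)[of 1] c(1)[of 0] x y]
  mult_entry[OF c(2)[of 0] c(1)[of 1] x y] mult_entry[OF c(2)[of 1] c(1)[of 1] x y]
  by (simp only: sum_subtractf sum.distrib)
 also have "... = (\<Sum>k<N. A $$ (x, k) * B $$ (k, y) -
  (if (x < m) ~= (k < m) & (k < m) ~= (y < m) then - 1 else 1) * (B $$ (x, k) * A $$ (k, y)))"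
 proof (rule sum.cong[OF refl])
  fix k assume "k : {..<N}"
  hence k: "k < N" by simp
  show "A $$ (x, k) * B $$ (k, y) -
     (matrix_part m 0 B $$ (x, k) * matrix_part m 0 A $$ (k, y) + matrix_part m 1 B $$ (x, k) * matrix_part m 0 A $$ (k, y) +
  matrix_part m 0 B $$ (x, k) * matrix_part m 1 A $$ (k, y) - matrix_part m 1 B $$ (x, k) * matrix_part m 1 A $$ (k, y)) =
  A $$ (x, k) * B $$ (k, y) -
  (if (x < m) ~= (k < m) & (k < m) ~= (y < m) then - 1 else 1) * (B $$ (x, k) * A $$ (k, y))"
  unfolding mp_entry[OF A k y] mp_entry[OF B x k]
  by (cases "x < m"; cases "k < m"; cases "y < m") simp_all
 qed
 finally show ?thesis .
qed

lemma sc_carrier: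
 "A : carrier_mat N N ==> B : carrier_mat N N ==> supercommutator m A B : carrier_mat N N"
 unfolding supercommutator_def
 by (intro minus_carrier_mat add_carrier_mat mult_carrier_mat[where n = N] mp_in)

definition odd_mat :: "nat => nat => 'k::field mat => bool" where
 "odd_mat m N A \<longleftrightarrow> A : carrier_mat N N & (\<forall>x<N. \<forall>y<N. (x < m) = (y < m) --> A $$ (x, y) = 0)"

definition elem_mat :: "nat => nat => nat => 'k::field mat" where
 "elem_mat N i j = mat N N (%(x, y). if x = i & y = j then 1 else 0)"

definition diagonal :: "nat => (nat => 'k::field) => 'k mat" where
 "diagonal N d = mat N N (%(x, y). if x = y then d x else 0)"

definition weighted :: "nat => (nat => 'k::field) => 'k mat => 'k mat" where
 "weighted N d z = mat N N (%(x, y). (d x - d y) * z $$ (x, y))"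

lemma elem_mat_entry [simp]: "x < N ==> y < N ==> elem_mat N i j $$ (x, y) = (if x = i & y = j then 1 else 0)"
 by (simp add: elem_mat_def)
lemma elem_mat_carrier [simp]: "elem_mat N i j : carrier_mat N N"
 and elem_mat_dim [simp]: "dim_row (elem_mat N i j) = N" "dim_col (elem_mat N i j) = N"
 by (simp_all add: elem_mat_def)
lemma diagonal_carrier [simp]: "diagonal N d : carrier_mat N N"
 and diagonal_dim [simp]: "dim_row (diagonal N d) = N" "dim_col (diagonal N d) = N"
 by (simp_all add: diagonal_def)
lemma diagonal_entry [simp]: "x < N ==> y < N ==> diagonal N d $$ (x, y) = (if x = y then d x else 0)"
 by (simp add: diagonal_def)

lemma odd_matD: "odd_mat m N A ==> A : carrier_mat N N"
 "odd_mat m N A ==> x < N ==> y < N ==> (x < m) = (y < m) ==> A $$ (x, y) = 0"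
 by (auto simp: odd_mat_def)

lemma odd_mat_elem: "(i < m) ~= (j < m) ==> odd_mat m N (elem_mat N i j)" by (auto simp: odd_mat_def)
lemma odd_mat_smult: "odd_mat m N A ==> odd_mat m N (c \<cdot>\<^sub>m A)" by (auto simp: odd_mat_def)

lemma sc_odd_entry:
 assumes A: "odd_mat m N A" and B: "odd_mat m N B" and x: "x < N" and y: "y < N"
 shows "supercommutator m A B $$ (x, y) = (\<Sum>k<N. A $$ (x, k) * B $$ (k, y) + B $$ (x, k) * A $$ (k, y))"
 unfolding sc_entry[OF odd_matD(1)[OF A] odd_matD(1)[OF B] x y]
proof (rule sum.cong[OF refl])
 fix k assume "k : {..<N}"
 hence k: "k < N" by simp
 show "A $$ (x, k) * B $$ (k, y) -
  (if (x < m) ~= (k < m) & (k < m) ~= (y < m) then - 1 else 1) * (B $$ (x, k) * A $$ (k, y)) =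
  A $$ (x, k) * B $$ (k, y) + B $$ (x, k) * A $$ (k, y)"
  using odd_matD(2)[OF B x k] odd_matD(2)[OF A k y] by auto
qed

lemma supercommutator_odd:
 assumes A: "odd_mat m N A" and B: "odd_mat m N B"
 shows "supercommutator m A B = A * B + B * A"
proof (rule eq_matI)
 note c = odd_matD(1)[OF A] odd_matD(1)[OF B]
 show "dim_row (supercommutator m A B) = dim_row (A * B + B * A)" "dim_col (supercommutator m A B) = dim_col (A * B + B * A)"
  using sc_carrier[OF c, of m] c by auto
 fix x y assume "x < dim_row (A * B + B * A)" "y < dim_col (A * B + B * A)"
 hence xy: "x < N" "y < N" using c by auto
 thus "supercommutator m A B $$ (x, y) = (A * B + B * A) $$ (x, y)"
  using c by (simp add: sc_odd_entry[OF A B] sum.distrib mult_entry del: index_mult_mat(1))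
qed

lemma supercommutator_diagonal:
 assumes z: "z : carrier_mat N N"
 shows "supercommutator m (diagonal N d) z = weighted N d z"
proof (rule eq_matI)
 show "dim_row (supercommutator m (diagonal N d) z) = dim_row (weighted N d z)"
  "dim_col (supercommutator m (diagonal N d) z) = dim_col (weighted N d z)"
  using sc_carrier[OF diagonal_carrier z, of m] by (auto simp: weighted_def)
 fix x y assume "x < dim_row (weighted N d z)" "y < dim_col (weighted N d z)"
 hence xy: "x < N" "y < N" by (auto simp: weighted_def)
 have 1: "(\<Sum>k<N. diagonal N d $$ (x, k) * z $$ (k, y)) = d x * z $$ (x, y)"
  by (subst sum_only[OF xy(1)]) (use xy in auto)
 have 2: "(\<Sum>k<N. (if (x < m) ~= (k < m) & (k < m) ~= (y < m) then - 1 else 1) * (z $$ (x, k) * diagonal N d $$ (k, y))) =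
     d y * z $$ (x, y)"
  by (subst sum_only[OF xy(2)]) (use xy in auto)
 show "supercommutator m (diagonal N d) z $$ (x, y) = weighted N d z $$ (x, y)"
  unfolding sc_entry[OF diagonal_carrier z xy] sum_subtractf 1 2
  using xy by (simp add: weighted_def algebra_simps)
qed

lemma mat_induct:
 assumes zero: "0\<^sub>m N N : W" and add: "!!A B. A : W ==> B : W ==> A + B : W"
  and E: "!!x y c. (x, y) : S ==> c \<cdot>\<^sub>m elem_mat N x y : W"
  and S: "finite S" and A: "A : carrier_mat N N" "!!x y. x < N ==> y < N ==> (x, y) \<notin> S ==> A $$ (x, y) = 0"
 shows "A : W"
 using S E A
proof (induction S arbitrary: A rule: finite_induct)
 case empty
 hence "A = 0\<^sub>m N N" by (intro eq_matI) auto
 thus ?case using zero by simp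
next
 case (insert s S)
 obtain x y where s: "s = (x, y)" by (cases s)
 define A' where "A' = mat N N (%(u, v). if u = x & v = y then 0 else A $$ (u, v))"
 define c where "c = (if x < N & y < N then A $$ (x, y) else 0)"
 have "A' : W"
 proof (rule insert.IH)
  show "c \<cdot>\<^sub>m elem_mat N x y : W" if "(x, y) : S" for x y c using insert.prems(1) that by auto
  show "A' : carrier_mat N N" by (simp add: A'_def)
  show "A' $$ (u, v) = 0" if "u < N" "v < N" "(u, v) \<notin> S" for u v
  using insert.prems(3)[of u v] that s by (auto simp: A'_def)
 qed
 moreover have "c \<cdot>\<^sub>m elem_mat N x y : W" using insert.prems(1) s by auto
 moreover have "A = A' + c \<cdot>\<^sub>m elem_mat N x y"
  using insert.prems(2) by (intro eq_matI) (auto simp: A'_def c_def elem_mat_def)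
 ultimately show ?case using add by metis
qed

text \<open>The odd symmetries of all variants of \<open>\<gg>\<ll>\<close> at once. The set \<open>D\<close> consists of the available diagonal even matrices. Brackets
need only be preserved up to a scalar matrix, which is what is visible in \<open>\<pp>\<ss>\<ll>\<close>; for \<open>m + n \<le> 4\<close> they are preserved
exactly, because then weights alone do not suffice: in \<open>\<ss>\<ll>(2|2)\<close> the matrix units at \<open>(x, y)\<close> and \<open>(u, v)\<close> with
\<open>{u, v}\<close> complementary to \<open>{x, y}\<close> have equal weight.\<close>

locale odd_matrix_symmetry =
 fixes m n :: nat and \<phi> :: "'k::field_char_0 mat => 'k mat" and D :: "(nat => 'k) set"
 assumes \<phi>_odd: "odd_mat m (m + n) z ==> odd_mat m (m + n) (\<phi> z)"
  and \<phi>_smult: "odd_mat m (m + n) z ==> \<phi> (c \<cdot>\<^sub>m z) = c \<cdot>\<^sub>m \<phi> z"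
  and \<phi>_diag: "d : D ==> odd_mat m (m + n) z ==> \<phi> (weighted (m + n) d z) = weighted (m + n) d (\<phi> z)"
  and \<phi>_br: "odd_mat m (m + n) z ==> odd_mat m (m + n) w ==>
  \<exists>s. (s ~= 0 --> m + n > 4) & \<phi> z * \<phi> w + \<phi> w * \<phi> z = z * w + w * z + s \<cdot>\<^sub>m 1\<^sub>m (m + n)"
  and D1: "p < m + n ==> q < m + n ==> (p < m) ~= (q < m) ==>
  (%x. (if x = p then 1 else 0) + (if x = q then 1 else 0)) : D"
  and D2: "m = 1 ==> n = 1 ==> (%x. if x < m then 1 else 0) : D"
begin

abbreviation "N \<equiv> m + n"
abbreviation E :: "nat => nat => 'k mat" where "E \<equiv> elem_mat N"
definition "Z x y = \<phi> (E x y)"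

lemma Z_odd: "(x < m) ~= (y < m) ==> odd_mat m N (Z x y)"
 unfolding Z_def by (intro \<phi>_odd odd_mat_elem)

lemma Z_weight:
 assumes "(x < m) ~= (y < m)" "x < N" "y < N" "u < N" "v < N" "d : D" "Z x y $$ (u, v) ~= 0"
 shows "d u - d v = d x - d y"
proof -
 have "weighted N d (E x y) = (d x - d y) \<cdot>\<^sub>m E x y"
  using assms by (intro eq_matI) (auto simp: weighted_def elem_mat_def)
 hence "weighted N d (Z x y) = (d x - d y) \<cdot>\<^sub>m Z x y"
  using \<phi>_diag[OF assms(6) odd_mat_elem[OF assms(1)]] \<phi>_smult[OF odd_mat_elem[OF assms(1)]] by (simp add: Z_def)
 hence "weighted N d (Z x y) $$ (u, v) = ((d x - d y) \<cdot>\<^sub>m Z x y) $$ (u, v)" by simp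
 thus ?thesis using assms odd_matD(1)[OF Z_odd[OF assms(1)]] by (simp add: weighted_def)
qed

lemma outside:
 assumes "finite S" "card S < N" shows "\<exists>r<N. r \<notin> S"
proof (rule ccontr)
 assume "~ (\<exists>r<N. r \<notin> S)"
 hence "{..<N} <= S" by auto
 hence "card {..<N} <= card S" by (rule card_mono[OF assms(1)])
 thus False using assms(2) by simp
qed

text \<open>A comparison of weights: a diagonal matrix with two entries \<open>1\<close> at suitable indices distinguishes any two odd matrix units,
except for the coincidence in \<open>\<ss>\<ll>(2|2)\<close>.\<close>

lemma Z_support_weak:
 assumes o: "(x < m) ~= (y < m)" and lt: "x < N" "y < N" "u < N" "v < N" and nz: "Z x y $$ (u, v) ~= 0"
 shows "u = x & v = y \<or> N = 4 & u ~= x & u ~= y & v ~= x & v ~= y & (u < m) = (y < m)"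
proof -
 have ouv: "(u < m) ~= (v < m)" using odd_matD(2)[OF Z_odd[OF o] lt(3,4)] nz by blast
 define \<delta> :: "nat => nat => nat => 'k" where "\<delta> p q x = (if x = p then 1 else 0) + (if x = q then 1 else 0)" for p q x
 have w: "\<delta> p q u - \<delta> p q v = \<delta> p q x - \<delta> p q y" if "p < N" "q < N" "(p < m) ~= (q < m)" for p q
  using Z_weight[OF o lt D1[OF that] nz] by (simp add: \<delta>_def)
 have ne: "x ~= y" "u ~= v" using o ouv by auto
 have one: "(- 1 :: 'k) ~= 1" "(1 :: 'k) ~= - 1" by simp_all
 show ?thesis
 proof (cases "(u < m) = (x < m)")
  case True
  have n2: "u ~= y" "v ~= x" using True o ouv by auto
  have xv: "(x < m) ~= (v < m)" using True ouv by auto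
  have ux: "u = x"
  proof (rule ccontr)
  assume "u ~= x"
  thus False using w[OF lt(1,4) xv] ne n2 by (auto simp: \<delta>_def split: if_splits)
  qed
  have "v = y"
  proof (rule ccontr)
  assume "v ~= y"
  thus False using w[OF lt(1,2) o] ne n2 ux by (auto simp: \<delta>_def split: if_splits)
  qed
  thus ?thesis using ux by simp
 next
  case False
  have p: "(u < m) = (y < m)" "(v < m) = (x < m)" using False o ouv by auto
  have n2: "u ~= x" "v ~= y" using p o ouv by auto
  have third: False if r: "r < N" "r \<notin> {u, v, x, y}" for r
  proof (cases "(r < m) = (x < m)")
  case True
  hence "(r < m) ~= (y < m)" using o by auto
  from w[OF r(1) lt(2) this] show False using r ne n2 by (auto simp: \<delta>_def split: if_splits)
  next
  case False
  hence "(x < m) ~= (r < m)" by auto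
  from w[OF lt(1) r(1) this] show False using r ne n2 by (auto simp: \<delta>_def split: if_splits)
  qed
  have small: "N <= card {u, v, x, y}" using third outside[of "{u, v, x, y}"] by fastforce
  have uy: "u = y \<longleftrightarrow> v = x"
  using w[OF lt(1,2) o] ne n2 by (auto simp: \<delta>_def split: if_splits)
  have "u ~= y"
  proof
  assume "u = y"
  hence "{u, v, x, y} = {x, y}" using uy by auto
  hence "N <= 2" using small card_insert_le_m1[of 2 "{y}" x] by (simp add: card_insert_if split: if_splits)
  hence mn: "m = 1" "n = 1" using o lt by auto
  show False using Z_weight[OF o lt D2[OF mn] nz] \<open>u = y\<close> uy o by (auto split: if_splits)
  qed
  moreover have "v ~= x" using uy calculation by simp
  moreover have "card {u, v, x, y} = 4" using calculation ne n2 by simp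
  moreover have "card {u, v, x, y} <= N" using card_mono[of "{..<N}" "{u, v, x, y}"] lt by simp
  ultimately show ?thesis using small n2 p by auto
 qed
qed

lemma br_entries:
 assumes z: "odd_mat m N z" and w: "odd_mat m N w"
 obtains s where "s ~= 0 ==> N > 4" "!!a b. a < N ==> b < N ==>
  (\<Sum>k<N. \<phi> z $$ (a, k) * \<phi> w $$ (k, b)) + (\<Sum>k<N. \<phi> w $$ (a, k) * \<phi> z $$ (k, b)) =
  (\<Sum>k<N. z $$ (a, k) * w $$ (k, b)) + (\<Sum>k<N. w $$ (a, k) * z $$ (k, b)) + (if a = b then s else 0)"
proof -
 obtain s where s: "s ~= 0 --> m + n > 4" and e: "\<phi> z * \<phi> w + \<phi> w * \<phi> z = z * w + w * z + s \<cdot>\<^sub>m 1\<^sub>m N"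
  using \<phi>_br[OF z w] by blast
 note c = odd_matD(1)[OF z] odd_matD(1)[OF w] odd_matD(1)[OF \<phi>_odd[OF z]] odd_matD(1)[OF \<phi>_odd[OF w]]
 have "(\<Sum>k<N. \<phi> z $$ (a, k) * \<phi> w $$ (k, b)) + (\<Sum>k<N. \<phi> w $$ (a, k) * \<phi> z $$ (k, b)) =
  (\<Sum>k<N. z $$ (a, k) * w $$ (k, b)) + (\<Sum>k<N. w $$ (a, k) * z $$ (k, b)) + (if a = b then s else 0)"
  if ab: "a < N" "b < N" for a b
 proof -
  have "(\<phi> z * \<phi> w) $$ (a, b) + (\<phi> w * \<phi> z) $$ (a, b) = (z * w) $$ (a, b) + (w * z) $$ (a, b) + (if a = b then s else 0)"
  using arg_cong[OF e, of "%A. A $$ (a, b)"] ab c by (simp del: index_mult_mat(1))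
  thus ?thesis using ab c by (simp only: mult_entry)
 qed
 thus thesis using that s by blast
qed

lemma Z_prod_opp:
 assumes o: "(x < m) ~= (y < m)" and lt: "x < N" "y < N"
 shows "Z x y $$ (x, y) * Z y x $$ (y, x) = 1"
proof -
 have o': "(y < m) ~= (x < m)" and ne: "x ~= y" using o by auto
 obtain s where s: "s ~= 0 ==> N > 4" "!!a b. a < N ==> b < N ==>
  (\<Sum>k<N. Z x y $$ (a, k) * Z y x $$ (k, b)) + (\<Sum>k<N. Z y x $$ (a, k) * Z x y $$ (k, b)) =
  (\<Sum>k<N. E x y $$ (a, k) * E y x $$ (k, b)) + (\<Sum>k<N. E y x $$ (a, k) * E x y $$ (k, b)) + (if a = b then s else 0)"
  using br_entries[OF odd_mat_elem[OF o] odd_mat_elem[OF o'], folded Z_def] by blast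
 have "s = 0"
 proof (rule ccontr)
  assume "s ~= 0"
  hence N: "N > 4" using s(1) by blast
  obtain r where r: "r < N" "r \<notin> {x, y}" using outside[of "{x, y}"] N ne by auto
  have 1: "Z x y $$ (r, k) = 0" "Z y x $$ (r, k) = 0" if "k < N" for k
  using Z_support_weak[OF o lt r(1) that] Z_support_weak[OF o' lt(2,1) r(1) that] r N by auto
  have "(\<Sum>k<N. E x y $$ (r, k) * E y x $$ (k, r)) = 0" "(\<Sum>k<N. E y x $$ (r, k) * E x y $$ (k, r)) = 0"
  using r by (auto intro!: sum.neutral)
  thus False using s(2)[OF r(1) r(1)] 1 \<open>s ~= 0\<close> by simp
 qed
 have zx: "Z x y $$ (x, k) = 0" if "k < N" "k ~= y" for k using Z_support_weak[OF o lt lt(1) that(1)] that by auto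
 have zy: "Z y x $$ (x, k) = 0" if "k < N" for k using Z_support_weak[OF o' lt(2,1) lt(1) that] ne by auto
 have "(\<Sum>k<N. Z x y $$ (x, k) * Z y x $$ (k, x)) = Z x y $$ (x, y) * Z y x $$ (y, x)"
  by (rule sum_only[OF lt(2)]) (simp add: zx)
 moreover have "(\<Sum>k<N. Z y x $$ (x, k) * Z x y $$ (k, x)) = 0" by (rule sum.neutral) (simp add: zy)
 moreover have "(\<Sum>k<N. E x y $$ (x, k) * E y x $$ (k, x)) = E x y $$ (x, y) * E y x $$ (y, x)"
  by (rule sum_only[OF lt(2)]) (use lt in simp)
 moreover have "(\<Sum>k<N. E y x $$ (x, k) * E x y $$ (k, x)) = 0" by (rule sum.neutral) (use lt ne in auto)
 ultimately show ?thesis using s(2)[OF lt(1) lt(1)] \<open>s = 0\<close> lt by simp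
qed

text \<open>The exceptional entry is excluded by the bracket of the images of two matrix units whose own bracket vanishes: it would
contribute a nonzero product to the diagonal.\<close>

lemma Z_support:
 assumes o: "(x < m) ~= (y < m)" and lt: "x < N" "y < N" "u < N" "v < N" and nz: "Z x y $$ (u, v) ~= 0"
 shows "u = x & v = y"
proof (rule ccontr)
 assume "~ (u = x & v = y)"
 hence ex: "N = 4" "u ~= x" "u ~= y" "v ~= x" "v ~= y" "(u < m) = (y < m)"
  using Z_support_weak[OF o lt nz] by blast+
 have ouv: "(u < m) ~= (v < m)" using odd_matD(2)[OF Z_odd[OF o] lt(3,4)] nz by blast
 hence ovu: "(v < m) ~= (u < m)" by auto
 have ne: "u ~= v" using ouv by auto
 obtain s where s: "s ~= 0 ==> N > 4" "!!a b. a < N ==> b < N ==>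
  (\<Sum>k<N. Z v u $$ (a, k) * Z x y $$ (k, b)) + (\<Sum>k<N. Z x y $$ (a, k) * Z v u $$ (k, b)) =
  (\<Sum>k<N. E v u $$ (a, k) * E x y $$ (k, b)) + (\<Sum>k<N. E x y $$ (a, k) * E v u $$ (k, b)) + (if a = b then s else 0)"
  using br_entries[OF odd_mat_elem[OF ovu] odd_mat_elem[OF o], folded Z_def] by blast
 have s0: "s = 0" using s(1) ex(1) by auto
 have z1: "Z v u $$ (v, k) = 0" if "k < N" "k ~= u" for k using Z_support_weak[OF ovu lt(4,3) lt(4) that(1)] that by auto
 have z2: "Z x y $$ (v, k) = 0" if "k < N" for k using Z_support_weak[OF o lt(1,2) lt(4) that] ex ouv by auto
 have "(\<Sum>k<N. Z v u $$ (v, k) * Z x y $$ (k, v)) = Z v u $$ (v, u) * Z x y $$ (u, v)"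
  by (rule sum_only[OF lt(3)]) (simp add: z1)
 moreover have "(\<Sum>k<N. Z x y $$ (v, k) * Z v u $$ (k, v)) = 0" by (rule sum.neutral) (simp add: z2)
 moreover have "(\<Sum>k<N. E v u $$ (v, k) * E x y $$ (k, v)) = 0" by (rule sum.neutral) (use lt ex in auto)
 moreover have "(\<Sum>k<N. E x y $$ (v, k) * E v u $$ (k, v)) = 0" by (rule sum.neutral) (use lt ex in auto)
 ultimately have "Z v u $$ (v, u) * Z x y $$ (u, v) = 0" using s(2)[OF lt(4) lt(4)] s0 by simp
 thus False using nz Z_prod_opp[OF ovu lt(4,3)] by auto
qed

lemma Z_product_adjacent:
 assumes o: "(x < m) ~= (y < m)" "(x < m) ~= (y' < m)" and lt: "x < N" "y < N" "y' < N"
 shows "Z x y $$ (x, y) * Z y' x $$ (y', x) = 1"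
proof (cases "y' = y")
 case True
 thus ?thesis using Z_prod_opp[OF o(1) lt(1,2)] by simp
next
 case False
 have o': "(y' < m) ~= (x < m)" and ne: "x ~= y" "x ~= y'" using o by auto
 obtain s where s: "s ~= 0 ==> N > 4" "!!a b. a < N ==> b < N ==>
  (\<Sum>k<N. Z x y $$ (a, k) * Z y' x $$ (k, b)) + (\<Sum>k<N. Z y' x $$ (a, k) * Z x y $$ (k, b)) =
  (\<Sum>k<N. E x y $$ (a, k) * E y' x $$ (k, b)) + (\<Sum>k<N. E y' x $$ (a, k) * E x y $$ (k, b)) + (if a = b then s else 0)"
  using br_entries[OF odd_mat_elem[OF o(1)] odd_mat_elem[OF o'], folded Z_def] by blast
 have z1: "Z x y $$ (y', k) = 0" if "k < N" for k using Z_support[OF o(1) lt(1,2) lt(3) that] ne by auto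
 have z2: "Z y' x $$ (y', k) = 0" if "k < N" "k ~= x" for k using Z_support[OF o' lt(3,1) lt(3) that(1)] that by auto
 have "(\<Sum>k<N. Z x y $$ (y', k) * Z y' x $$ (k, y)) = 0" by (rule sum.neutral) (simp add: z1)
 moreover have "(\<Sum>k<N. Z y' x $$ (y', k) * Z x y $$ (k, y)) = Z y' x $$ (y', x) * Z x y $$ (x, y)"
  by (rule sum_only[OF lt(1)]) (simp add: z2)
 moreover have "(\<Sum>k<N. E x y $$ (y', k) * E y' x $$ (k, y)) = 0" by (rule sum.neutral) (use lt ne in auto)
 moreover have "(\<Sum>k<N. E y' x $$ (y', k) * E x y $$ (k, y)) = E y' x $$ (y', x) * E x y $$ (x, y)"
  by (rule sum_only[OF lt(1)]) (use lt in simp)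
 ultimately show ?thesis using s(2)[OF lt(3) lt(2)] False lt by (simp add: mult.commute)
qed

lemma Z_eq: assumes "(x < m) ~= (y < m)" "x < N" "y < N" shows "\<phi> (E x y) = Z x y $$ (x, y) \<cdot>\<^sub>m E x y"
proof (rule eq_matI)
 have c: "\<phi> (E x y) : carrier_mat N N" using odd_matD(1)[OF Z_odd[OF assms(1)]] by (simp add: Z_def)
 thus "dim_row (\<phi> (E x y)) = dim_row (Z x y $$ (x, y) \<cdot>\<^sub>m E x y)" "dim_col (\<phi> (E x y)) = dim_col (Z x y $$ (x, y) \<cdot>\<^sub>m E x y)"
  by (auto simp: elem_mat_def)
 fix u v assume "u < dim_row (Z x y $$ (x, y) \<cdot>\<^sub>m E x y)" "v < dim_col (Z x y $$ (x, y) \<cdot>\<^sub>m E x y)"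
 hence "u < N" "v < N" by (auto simp: elem_mat_def)
 thus "\<phi> (E x y) $$ (u, v) = (Z x y $$ (x, y) \<cdot>\<^sub>m E x y) $$ (u, v)"
  using Z_support[OF assms, of u v] elem_mat_carrier[of N x y] by (auto simp: Z_def)
qed

theorem scalars:
 "\<exists>c. c ~= 0 & (\<forall>i a. i < m --> m <= a --> a < N --> \<phi> (E i a) = inverse c \<cdot>\<^sub>m E i a & \<phi> (E a i) = c \<cdot>\<^sub>m E a i)"
proof (cases "m = 0 \<or> n = 0")
 case True thus ?thesis by (intro exI[of _ 1]) auto
next
 case False
 hence lt0: "0 < m" "m < N" by auto
 have pr: "Z i a $$ (i, a) * Z b i $$ (b, i) = 1" if "i < m" "m <= a" "a < N" "m <= b" "b < N" for i a b
  using Z_product_adjacent[of i a b] that by simp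
 have pr': "Z b i $$ (b, i) * Z j b $$ (j, b) = 1" if "i < m" "j < m" "m <= b" "b < N" for i j b
  using Z_product_adjacent[of b i j] that by simp
 define c where "c = Z m 0 $$ (m, 0)"
 have c0: "Z 0 m $$ (0, m) * c = 1" using pr[of 0 m m] lt0 by (simp add: c_def)
 hence cn: "c ~= 0" by auto
 have inv: "Z 0 m $$ (0, m) = inverse c" using inverse_unique[of c "Z 0 m $$ (0, m)"] c0 by (simp add: mult.commute)
 have up: "Z i a $$ (i, a) = inverse c" if "i < m" "m <= a" "a < N" for i a
 proof -
  have "Z i a $$ (i, a) * Z m i $$ (m, i) = 1" using pr[of i a m] that lt0 by simp
  moreover have "Z 0 m $$ (0, m) * Z m i $$ (m, i) = 1" using pr'[of i 0 m] that lt0 by (simp add: mult.commute)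
  ultimately show ?thesis using inv by (metis mult_right_cancel mult_zero_right zero_neq_one)
 qed
 have "Z a i $$ (a, i) = c" if "i < m" "m <= a" "a < N" for i a
  using pr[of i a a] up[of i a] that cn by (simp add: field_simps)
 thus ?thesis using up cn Z_eq lt0 by (intro exI[of _ c]) auto
qed

end

lemma gl_simps:
 "carrier (gl m n) = carrier_mat (m + n) (m + n)" "x \<oplus>\<^bsub>gl m n\<^esub> y = x + y" "c \<odot>\<^bsub>gl m n\<^esub> x = c \<cdot>\<^sub>m x"
 "bracket (gl m n) = supercommutator m" "part (gl m n) p = {A : carrier_mat (m + n) (m + n). matrix_part m p A = A}"
 "zero (gl m n) = 0\<^sub>m (m + n) (m + n)"
 by (simp_all add: gl_def module.defs module_mat_simps)

lemma gl_odd: "part (gl m n) 1 = {A. odd_mat m (m + n) A}"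
proof -
 have "matrix_part m 1 A = A \<longleftrightarrow> odd_mat m (m + n) A" if A: "A : carrier_mat (m + n) (m + n)" for A :: "'a mat"
 proof
  assume e: "matrix_part m 1 A = A"
  have "A $$ (x, y) = 0" if "x < m + n" "y < m + n" "(x < m) = (y < m)" for x y
  using mp_entry[OF A that(1,2), of m 1] that(3) e by simp
  thus "odd_mat m (m + n) A" using A by (simp add: odd_mat_def)
 next
  assume o: "odd_mat m (m + n) A"
  show "matrix_part m 1 A = A"
  by (rule eq_matI) (use A o mp_in[OF A, of m 1] in \<open>auto simp: mp_entry odd_mat_def\<close>)
 qed
 thus ?thesis by (auto simp: gl_simps odd_mat_def)
qed

lemma diagonal_even: "diagonal (m + n) d : part (gl m n) 0"
proof -
 have "matrix_part m 0 (diagonal (m + n) d) = diagonal (m + n) d"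
  by (rule eq_matI) (use mp_in[OF diagonal_carrier[of "m + n" d], of m 0] in
  \<open>auto simp: mp_entry[OF diagonal_carrier] diagonal_def[of "m + n" d, THEN arg_cong[where f = dim_row]]
  diagonal_def[of "m + n" d, THEN arg_cong[where f = dim_col]]\<close>)
 thus ?thesis by (simp add: gl_simps)
qed

definition wtrace :: "nat => (nat => 'k::field) => 'k mat => 'k" where
 "wtrace N w A = (\<Sum>p<N. w p * A $$ (p, p))"

text \<open>A weighted trace pairs the two odd blocks. For \<open>\<pp>\<ss>\<ll>\<close> the weights must sum to zero, so they cannot be the indicator of one
block; this is why the dual basis is rescaled.\<close>

lemma wtrace_dual:
 assumes lt: "i < m" "j < m" "m <= a" "a < N" "m <= b" "b < N" and mN: "m <= N" and w: "w j + w b ~= (0::'k::field)"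
 shows "wtrace N w (supercommutator m (elem_mat N i a) (inverse (w j + w b) \<cdot>\<^sub>m elem_mat N b j)) =
  (if i = j & a = b then 1 else 0)"
proof -
 let ?t = "inverse (w j + w b)"
 have ltN: "i < N" "j < N" using lt mN by auto
 have o: "odd_mat m N (elem_mat N i a :: 'k mat)" "odd_mat m N (?t \<cdot>\<^sub>m elem_mat N b j :: 'k mat)"
  using lt by (auto intro!: odd_mat_elem odd_mat_smult)
 have e: "(?t \<cdot>\<^sub>m elem_mat N b j) $$ (x, y) = (if x = b & y = j then ?t else 0)" if "x < N" "y < N" for x y
  using that by (simp add: elem_mat_def)
 have "supercommutator m (elem_mat N i a) (?t \<cdot>\<^sub>m elem_mat N b j) $$ (p, p) =
     (if i = j & a = b then (if p = i then ?t else 0) + (if p = a then ?t else 0) else 0)" if p: "p < N" for p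
 proof -
  have 1: "(\<Sum>k<N. elem_mat N i a $$ (p, k) * (?t \<cdot>\<^sub>m elem_mat N b j) $$ (k, p)) = (if p = i & a = b & p = j then ?t else 0)"
  by (subst sum_only[OF lt(4)]) (use p lt ltN e in auto)
  have 2: "(\<Sum>k<N. (?t \<cdot>\<^sub>m elem_mat N b j) $$ (p, k) * elem_mat N i a $$ (k, p)) = (if p = b & j = i & p = a then ?t else 0)"
  by (subst sum_only[OF ltN(2)]) (use p lt ltN e in auto)
  show ?thesis unfolding sc_odd_entry[OF o p p] sum.distrib 1 2 by auto
 qed
 hence "wtrace N w (supercommutator m (elem_mat N i a) (?t \<cdot>\<^sub>m elem_mat N b j)) =
  (\<Sum>p<N. if i = j & a = b then (if p = i then w i * ?t else 0) + (if p = a then w a * ?t else 0) else 0)"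
  unfolding wtrace_def by (intro sum.cong) auto
 also have "... = (if i = j & a = b then (w j + w b) * ?t else 0)"
 proof (cases "i = j & a = b")
  case True
  thus ?thesis using lt ltN by (simp add: sum.distrib distrib_right)
 next
  case False
  thus ?thesis by (simp only: if_False sum.neutral_const)
 qed
 finally show ?thesis using w by simp
qed

definition mat_space :: "('k::field, 'k mat) lie_superalgebra => nat => nat => bool" where
 "mat_space L m N \<longleftrightarrow> carrier L <= carrier_mat N N & (\<forall>x y. x \<oplus>\<^bsub>L\<^esub> y = x + y) & (\<forall>c x. c \<odot>\<^bsub>L\<^esub> x = c \<cdot>\<^sub>m x) \<and>
     bracket L = supercommutator m"

lemma mat_sep: assumes "mat_space L m N" shows "separated L"
proof -
 have c: "carrier L <= carrier_mat N N" and op: "!!x y. x \<oplus>\<^bsub>L\<^esub> y = x + y" "!!c x. c \<odot>\<^bsub>L\<^esub> x = c \<cdot>\<^sub>m x"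
  using assms by (auto simp: mat_space_def)
 let ?l = "%t A. A $$ (t div N, t mod N)"
 have "linear_functional L (?l t)" if "t < N * N" for t
 proof -
  have "N > 0" using that by (cases N) auto
  hence "t div N < N" "t mod N < N" using that by (auto simp: less_mult_imp_div_less)
  moreover have "dim_row x = N & dim_col x = N" if "x : carrier L" for x using c that by auto
  ultimately show ?thesis unfolding linear_functional_def op by auto
 qed
 moreover have "x = y" if xy: "x : carrier L" "y : carrier L" "\<forall>t<N*N. ?l t x = ?l t y" for x y
 proof (rule eq_matI)
  have cc: "x : carrier_mat N N" "y : carrier_mat N N" using c xy by auto
  thus "dim_row x = dim_row y" "dim_col x = dim_col y" by auto
  fix i j assume "i < dim_row y" "j < dim_col y"
  hence ij: "i < N" "j < N" using cc by auto
  have "i * N + j < (i + 1) * N" using ij by simp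
  also have "... <= N * N" using ij by (intro mult_le_mono1) simp
  finally have "?l (i * N + j) x = ?l (i * N + j) y" using xy(3) by blast
  moreover have "(i * N + j) div N = i" "(i * N + j) mod N = j" using ij by (simp_all add: add.commute[of "i * N"])
  ultimately show "x $$ (i, j) = y $$ (i, j)" by simp
 qed
 ultimately show ?thesis unfolding separated_def by (intro exI[of _ "N * N"] exI[of _ ?l]) blast
qed

lemma wtrace_add:
 assumes "A : carrier_mat N N" "B : carrier_mat N N"
 shows "wtrace N w (A + B) = wtrace N w A + wtrace N w B"
proof -
 have "wtrace N w (A + B) = (\<Sum>p<N. w p * A $$ (p, p) + w p * B $$ (p, p))"
  unfolding wtrace_def by (rule sum.cong) (use assms in \<open>auto simp: distrib_left\<close>)
 thus ?thesis by (simp only: wtrace_def sum.distrib)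
qed

lemma wtrace_smult:
 assumes "A : carrier_mat N N"
 shows "wtrace N w (c \<cdot>\<^sub>m A) = c * wtrace N w A"
 unfolding wtrace_def sum_distrib_left by (rule sum.cong) (use assms in auto)

lemma mat_space_lin: assumes M: "mat_space L m N" shows "linear_functional L (wtrace N w)"
proof -
 have c: "x : carrier_mat N N" if "x : carrier L" for x using M that unfolding mat_space_def by blast
 have op: "x \<oplus>\<^bsub>L\<^esub> y = x + y" "e \<odot>\<^bsub>L\<^esub> x = e \<cdot>\<^sub>m x" for x y e using M unfolding mat_space_def by blast+
 show ?thesis unfolding linear_functional_def op using wtrace_add[OF c c] wtrace_smult[OF c] by blast
qed

lemma gl_like_kac_type:
 fixes L :: "('k::field_char_0, 'k mat) lie_superalgebra"
 assumes M: "mat_space L m (m + n)" and odd: "part L 1 = {A. odd_mat m (m + n) A}"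
  and even: "!!d. d : D ==> diagonal (m + n) d : part L 0"
  and D1: "!!p q. p < m + n ==> q < m + n ==> (p < m) ~= (q < m) ==>
  (%x. (if x = p then 1 else 0) + (if x = q then 1 else 0)) : D"
  and D2: "m = 1 ==> n = 1 ==> (%x. if x < m then 1 else 0) : D"
 shows "kac_type L"
proof -
 let ?N = "m + n" and ?I = "{..<m} \<times> {m..<m + n}" and ?w = "%p. if p < m then 1 else (0::'k)"
 let ?e = "%(i, a). elem_mat ?N i a" and ?f = "%(i, a). inverse (?w i + ?w a) \<cdot>\<^sub>m elem_mat ?N a i"
 have c: "carrier L <= carrier_mat ?N ?N" and op: "!!x y. x \<oplus>\<^bsub>L\<^esub> y = x + y" "!!c x. c \<odot>\<^bsub>L\<^esub> x = c \<cdot>\<^sub>m x"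
  and br: "bracket L = supercommutator m"
  using M by (auto simp: mat_space_def)
 have f1: "?f (i, a) = elem_mat ?N a i" if "i < m" "m <= a" for i a using that by (intro eq_matI) (auto simp: elem_mat_def)
 have "rigid_dual_bases L ?I ?e ?f (wtrace ?N ?w)"
  unfolding rigid_dual_bases_def
 proof (intro conjI ballI allI impI)
  show "finite ?I" by simp
  show "?e ` ?I <= part L 1" "?f ` ?I <= part L 1" unfolding odd by (auto intro!: odd_mat_smult odd_mat_elem)
  show "linear_functional L (wtrace ?N ?w)" by (rule mat_space_lin[OF M])
  show "spans L (?e ` ?I \<union> ?f ` ?I) (part L 1)" unfolding spans_def op
  proof (intro allI impI subsetI)
  fix W A
  assume W: "W <= carrier L & W ~= {} & ?e ` ?I \<union> ?f ` ?I <= W & (\<forall>x\<in>W. \<forall>y\<in>W. x + y : W) & (\<forall>c. \<forall>x\<in>W. c \<cdot>\<^sub>m x : W)"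
  and A: "A : part L 1"
  obtain B where B: "B : W" "B : carrier_mat ?N ?N" using W c by blast
  have "0 \<cdot>\<^sub>m B = 0\<^sub>m ?N ?N" using B(2) by (intro eq_matI) auto
  hence zero: "0\<^sub>m ?N ?N : W" using W B(1) by metis
  let ?S = "{(x, y). x < ?N & y < ?N & (x < m) ~= (y < m)}"
  have fin: "finite ?S" by (rule finite_subset[of _ "{..<?N} \<times> {..<?N}"]) auto
  have E: "elem_mat ?N x y : W" if xy: "(x, y) : ?S" for x y
  proof (cases "x < m")
  case True
  hence "(x, y) : ?I" using xy by auto
  hence "?e (x, y) : W" using W by blast
  thus ?thesis by simp
  next
  case False
  hence i: "(y, x) : ?I" using xy by auto
  hence "?f (y, x) : W" using W by blast
  thus ?thesis using f1[of y x] i by auto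
  qed
  show "A : W"
  proof (rule mat_induct[OF zero _ _ fin])
  show "P + Q : W" if "P : W" "Q : W" for P Q using W that by blast
  show "c \<cdot>\<^sub>m elem_mat ?N x y : W" if "(x, y) : ?S" for x y c using W E[OF that] by blast
  show "A : carrier_mat ?N ?N" using A by (simp add: odd odd_mat_def)
  show "A $$ (x, y) = 0" if "x < ?N" "y < ?N" "(x, y) \<notin> ?S" for x y
  using A that by (auto simp: odd odd_mat_def)
  qed
  qed
 next
  fix s t assume "s : ?I" "t : ?I"
  then obtain i a j b where "s = (i, a)" "t = (j, b)" "i < m" "j < m" "m <= a" "a < ?N" "m <= b" "b < ?N" by auto
  thus "wtrace ?N ?w (bracket L (?e s) (?f t)) = (if s = t then 1 else 0)"
  using wtrace_dual[of i m j a ?N b ?w] unfolding br by auto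
 next
  fix \<phi> assume \<phi>: "odd_symmetry L \<phi>"
  have \<phi>o: "odd_mat m ?N (\<phi> z)" if "odd_mat m ?N z" for z using \<phi> that unfolding odd_symmetry_def odd by blast
  interpret odd_matrix_symmetry m n \<phi> D
  proof
  show "odd_mat m ?N z ==> odd_mat m ?N (\<phi> z)" for z by (rule \<phi>o)
  show "odd_mat m ?N z ==> \<phi> (c \<cdot>\<^sub>m z) = c \<cdot>\<^sub>m \<phi> z" for z c
  using \<phi> unfolding odd_symmetry_def odd op by blast
  show "\<phi> (weighted ?N d z) = weighted ?N d (\<phi> z)" if d: "d : D" and z: "odd_mat m ?N z" for d z
  proof -
  have "\<phi> (bracket L (diagonal ?N d) z) = bracket L (diagonal ?N d) (\<phi> z)"
  using \<phi> even[OF d] z unfolding odd_symmetry_def odd by blast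
  thus ?thesis unfolding br using supercommutator_diagonal odd_matD(1) z \<phi>o[OF z] by metis
  qed
  show "\<exists>s. (s ~= 0 --> m + n > 4) & \<phi> z * \<phi> w + \<phi> w * \<phi> z = z * w + w * z + s \<cdot>\<^sub>m 1\<^sub>m ?N"
  if z: "odd_mat m ?N z" and w: "odd_mat m ?N w" for z w
  proof -
  have "bracket L (\<phi> z) (\<phi> w) = bracket L z w" using \<phi> z w unfolding odd_symmetry_def odd by blast
  hence "\<phi> z * \<phi> w + \<phi> w * \<phi> z = z * w + w * z"
  unfolding br using supercommutator_odd z w \<phi>o by metis
  moreover have "z * w + w * z + 0 \<cdot>\<^sub>m 1\<^sub>m ?N = z * w + w * z" using odd_matD(1)[OF z] odd_matD(1)[OF w] by (intro eq_matI) auto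
  ultimately show ?thesis by (intro exI[of _ 0]) simp
  qed
  qed (use D1 D2 in blast)+
  obtain c where c: "c ~= 0" "!!i a. i < m ==> m <= a ==> a < ?N ==>
       \<phi> (elem_mat ?N i a) = inverse c \<cdot>\<^sub>m elem_mat ?N i a & \<phi> (elem_mat ?N a i) = c \<cdot>\<^sub>m elem_mat ?N a i"
  using scalars by blast
  show "\<exists>c. c ~= 0 & (\<forall>i\<in>?I. \<phi> (?e i) = inverse c \<odot>\<^bsub>L\<^esub> ?e i & \<phi> (?f i) = c \<odot>\<^bsub>L\<^esub> ?f i)"
  proof (intro exI conjI ballI)
  fix s assume "s : ?I"
  then obtain i a where s: "s = (i, a)" "i < m" "m <= a" "a < ?N" by auto
  show "\<phi> (?e s) = inverse c \<odot>\<^bsub>L\<^esub> ?e s" using c(2)[OF s(2-4)] by (simp add: s(1) op)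
  show "\<phi> (?f s) = c \<odot>\<^bsub>L\<^esub> ?f s" unfolding s(1) f1[OF s(2,3)] op using c(2)[OF s(2-4)] by simp
  qed (rule c(1))
 qed
 thus ?thesis using kac_typeI mat_sep[OF M] by blast
qed

lemma gl_kac_type: "kac_type (gl m n :: ('k::field_char_0, 'k mat) lie_superalgebra)"
 by (rule gl_like_kac_type[where D = UNIV and m = m and n = n])
  (auto simp: mat_space_def gl_simps(1-4) gl_odd diagonal_even)

lemma sl_simps:
 "carrier (sl m n) = {A : carrier_mat (m + n) (m + n). supertrace m n A = 0}" "x \<oplus>\<^bsub>sl m n\<^esub> y = x + y"
 "c \<odot>\<^bsub>sl m n\<^esub> x = c \<cdot>\<^sub>m x" "bracket (sl m n) = supercommutator m"
 "part (sl m n) p = part (gl m n) p \<inter> {A : carrier_mat (m + n) (m + n). supertrace m n A = 0}"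
 by (simp_all add: sl_def graded_subalgebra_def gl_simps(1-4))

lemma sl_odd: "part (sl m n) 1 = {A. odd_mat m (m + n) A}"
 unfolding sl_simps gl_odd by (auto simp: supertrace_def odd_mat_def)

lemma sl_diagonal:
 assumes "(\<Sum>i<m. d i) = (\<Sum>i\<in>{m..<m+n}. d i)" shows "diagonal (m + n) d : part (sl m n) 0"
 using assms diagonal_even[of m n d] unfolding sl_simps by (simp add: supertrace_def)

lemma sl_torus:
 fixes m n :: nat
 assumes pq: "p < m + n" "q < m + n" "(p < m) ~= (q < m)"
 shows "(\<Sum>i<m. (if i = p then 1 else 0) + (if i = q then 1 else 0)) =
  (\<Sum>i\<in>{m..<m+n}. (if i = p then 1 else 0) + (if i = q then 1 else (0 :: 'k::field)))"
proof -
 define d :: "nat => 'k" where "d i = (if i = p then 1 else 0) + (if i = q then 1 else 0)" for i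
 have \<delta>: "(\<Sum>i\<in>A. d i) = (if p : A then 1 else 0) + (if q : A then 1 else 0)" if "finite A" for A
  unfolding d_def sum.distrib sum.delta[OF that] by (rule refl)
 have "(\<Sum>i<m. d i) = (if p < m then 1 else 0) + (if q < m then 1 else 0)" by (subst \<delta>) auto
 moreover have "(\<Sum>i\<in>{m..<m+n}. d i) = (if p < m then 0 else 1) + (if q < m then 0 else 1)"
  using pq by (subst \<delta>) auto
 ultimately have "(\<Sum>i<m. d i) = (\<Sum>i\<in>{m..<m+n}. d i)" using pq by auto
 thus ?thesis by (simp only: d_def)
qed

lemma sl_kac_type:
 assumes "(m, n) ~= (1, 1)" shows "kac_type (sl m n :: ('k::field_char_0, 'k mat) lie_superalgebra)"
proof (rule gl_like_kac_type[where D = "{d. (\<Sum>i<m. d i) = (\<Sum>i\<in>{m..<m+n}. d i)}" and m = m and n = n])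
 show "mat_space (sl m n) m (m + n)" by (auto simp: mat_space_def sl_simps(1-4))
 show "m = 1 ==> n = 1 ==> (%x. if x < m then 1 else 0) : {d. (\<Sum>i<m. d i) = (\<Sum>i\<in>{m..<m+n}. d i)}" using assms by simp
 show "part (sl m n) 1 = {A. odd_mat m (m + n) A}" by (rule sl_odd)
 show "diagonal (m + n) d : part (sl m n) 0" if "d : {d. (\<Sum>i<m. d i) = (\<Sum>i\<in>{m..<m+n}. d i)}" for d
  using that by (intro sl_diagonal) simp
 show "(%x. (if x = p then 1 else 0) + (if x = q then 1 else (0 :: 'k))) : {d. (\<Sum>i<m. d i) = (\<Sum>i\<in>{m..<m+n}. d i)}"
  if "p < m + n" "q < m + n" "(p < m) ~= (q < m)" for p q
  by (rule CollectI) (rule sl_torus[OF that])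
qed

section \<open>The quotient \<open>\<pp>\<ss>\<ll>\<close>\<close>

definition scoset :: "nat => 'k::field mat => 'k mat set" where
 "scoset N A = {B : carrier_mat N N. \<exists>c. \<forall>x<N. \<forall>y<N. B $$ (x, y) = A $$ (x, y) + (if x = y then c else 0)}"

lemma scoset_self: "A : carrier_mat N N ==> A : scoset N A"
 by (auto simp: scoset_def intro!: exI[of _ 0])

lemma scoset_eq: assumes "B : scoset N A" shows "scoset N B = scoset N A"
proof -
 obtain c where c: "\<forall>x<N. \<forall>y<N. B $$ (x, y) = A $$ (x, y) + (if x = y then c else 0)"
  using assms by (auto simp: scoset_def)
 show ?thesis
 proof (intro equalityI subsetI)
  fix X assume "X : scoset N B"
  then obtain d where X: "X : carrier_mat N N" "\<forall>x<N. \<forall>y<N. X $$ (x, y) = B $$ (x, y) + (if x = y then d else 0)"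
  by (auto simp: scoset_def)
  hence "\<forall>x<N. \<forall>y<N. X $$ (x, y) = A $$ (x, y) + (if x = y then c + d else 0)" using c by auto
  thus "X : scoset N A" using X(1) by (auto simp: scoset_def)
 next
  fix X assume "X : scoset N A"
  then obtain d where X: "X : carrier_mat N N" "\<forall>x<N. \<forall>y<N. X $$ (x, y) = A $$ (x, y) + (if x = y then d else 0)"
  by (auto simp: scoset_def)
  hence "\<forall>x<N. \<forall>y<N. X $$ (x, y) = B $$ (x, y) + (if x = y then d - c else 0)" using c by auto
  thus "X : scoset N B" using X(1) by (auto simp: scoset_def)
 qed
qed

lemma scoset_smult: "B : scoset N A ==> A : carrier_mat N N ==> e \<cdot>\<^sub>m B : scoset N (e \<cdot>\<^sub>m A)"
proof -
 assume B: "B : scoset N A" and A: "A : carrier_mat N N"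
 then obtain c where c: "B : carrier_mat N N" "\<forall>x<N. \<forall>y<N. B $$ (x, y) = A $$ (x, y) + (if x = y then c else 0)"
  by (auto simp: scoset_def)
 hence "\<forall>x<N. \<forall>y<N. (e \<cdot>\<^sub>m B) $$ (x, y) = (e \<cdot>\<^sub>m A) $$ (x, y) + (if x = y then e * c else 0)"
  using A by (auto simp: distrib_left)
 thus ?thesis using c(1) unfolding scoset_def by (intro CollectI conjI exI[of _ "e * c"]) simp_all
qed

text \<open>Scalar matrices are even and central, so the bracket is well defined on cosets.\<close>

lemma supercommutator_scalar:
 assumes A: "A : carrier_mat N N" "A' : scoset N A" and B: "B : carrier_mat N N" "B' : scoset N B"
 shows "supercommutator m A' B' = supercommutator m A B"
proof -
 obtain c where c: "A' : carrier_mat N N" "\<forall>x<N. \<forall>y<N. A' $$ (x, y) = A $$ (x, y) + (if x = y then c else 0)"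
  using A(2) by (auto simp: scoset_def)
 obtain d where d: "B' : carrier_mat N N" "\<forall>x<N. \<forall>y<N. B' $$ (x, y) = B $$ (x, y) + (if x = y then d else 0)"
  using B(2) by (auto simp: scoset_def)
 define sg :: "nat => nat => nat => 'a" where
  "sg x k y = (if (x < m) ~= (k < m) & (k < m) ~= (y < m) then - 1 else 1)" for x k y
 show ?thesis
 proof (rule eq_matI)
  show "dim_row (supercommutator m A' B') = dim_row (supercommutator m A B)"
  "dim_col (supercommutator m A' B') = dim_col (supercommutator m A B)"
  using sc_carrier[OF c(1) d(1), of m] sc_carrier[OF A(1) B(1), of m] by auto
  fix x y assume "x < dim_row (supercommutator m A B)" "y < dim_col (supercommutator m A B)"
  hence x: "x < N" and y: "y < N" using sc_carrier[OF A(1) B(1), of m] by auto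
  have "(\<Sum>k<N. A' $$ (x, k) * B' $$ (k, y) - sg x k y * (B' $$ (x, k) * A' $$ (k, y))) =
  (\<Sum>k<N. A $$ (x, k) * B' $$ (k, y) - sg x k y * (B' $$ (x, k) * A $$ (k, y))) +
  (\<Sum>k<N. if k = x then c * B' $$ (k, y) else 0) - (\<Sum>k<N. if k = y then sg x k y * (B' $$ (x, k) * c) else 0)"
  unfolding sum.distrib[symmetric] sum_subtractf[symmetric]
  by (rule sum.cong) (use c(2) x y in \<open>auto simp: algebra_simps\<close>)
  also have "... = (\<Sum>k<N. A $$ (x, k) * B' $$ (k, y) - sg x k y * (B' $$ (x, k) * A $$ (k, y)))"
  using x y by (simp add: sg_def mult.commute)
  also have "... = (\<Sum>k<N. A $$ (x, k) * B $$ (k, y) - sg x k y * (B $$ (x, k) * A $$ (k, y))) +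
  (\<Sum>k<N. if k = y then A $$ (x, k) * d else 0) - (\<Sum>k<N. if k = x then sg x k y * (d * A $$ (k, y)) else 0)"
  unfolding sum.distrib[symmetric] sum_subtractf[symmetric]
  by (rule sum.cong) (use d(2) x y in \<open>auto simp: algebra_simps\<close>)
  also have "... = (\<Sum>k<N. A $$ (x, k) * B $$ (k, y) - sg x k y * (B $$ (x, k) * A $$ (k, y)))"
  using x y by (simp add: sg_def mult.commute)
  finally show "supercommutator m A' B' $$ (x, y) = supercommutator m A B $$ (x, y)"
  unfolding sc_entry[OF c(1) d(1) x y] sc_entry[OF A(1) B(1) x y] sg_def .
 qed
qed

lemma UN_const_on: "a : A ==> (!!x. x : A ==> F x = F a) ==> (\<Union>x\<in>A. F x) = F a" by blast

abbreviation "pj n \<equiv> scoset (n + n)"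

lemma sl_coset:
 assumes A: "A : carrier_mat (n + n) (n + n)"
 shows "{c \<cdot>\<^sub>m 1\<^sub>m (n + n) | c. True} +>\<^bsub>sl n n\<^esub> A = pj n (A :: 'k::field mat)"
proof -
 let ?N = "n + n"
 have 1: "c \<cdot>\<^sub>m 1\<^sub>m ?N + A : pj n A" for c using A by (auto simp: scoset_def intro!: exI[of _ c])
 have 2: "\<exists>c. B = c \<cdot>\<^sub>m 1\<^sub>m ?N + A" if B: "B : pj n A" for B
 proof -
  obtain c where c: "B : carrier_mat ?N ?N" "\<forall>x<?N. \<forall>y<?N. B $$ (x, y) = A $$ (x, y) + (if x = y then c else 0)"
  using B by (auto simp: scoset_def)
  have "B = c \<cdot>\<^sub>m 1\<^sub>m ?N + A" by (rule eq_matI) (use A c in auto)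
  thus ?thesis by blast
 qed
 show ?thesis unfolding a_r_coset_def' sl_simps
 proof (intro equalityI subsetI)
  fix B assume "B : (\<Union>h\<in>{c \<cdot>\<^sub>m 1\<^sub>m ?N | c. True}. {h + A})"
  then obtain c where "B = c \<cdot>\<^sub>m 1\<^sub>m ?N + A" by auto
  thus "B : pj n A" using 1[of c] by simp
 next
  fix B assume "B : pj n A"
  then obtain c where c: "B = c \<cdot>\<^sub>m 1\<^sub>m ?N + A" using 2 by blast
  show "B : (\<Union>h\<in>{c \<cdot>\<^sub>m 1\<^sub>m ?N | c. True}. {h + A})" by (rule UN_I[of "c \<cdot>\<^sub>m 1\<^sub>m ?N"]) (use c in auto)
 qed
qed

lemma psl_carrier: "carrier (psl n :: ('k::field, 'k mat set) lie_superalgebra) = pj n ` carrier (sl n n)"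
proof -
 have "carrier (psl n :: ('k, 'k mat set) lie_superalgebra) =
  (\<Union>a\<in>carrier (sl n n). {{c \<cdot>\<^sub>m 1\<^sub>m (n + n) | c. True} +>\<^bsub>sl n n\<^esub> a})"
  by (simp add: psl_def lsa_quotient_def A_RCOSETS_def')
 also have "... = (\<Union>a\<in>carrier (sl n n). {pj n a})"
 proof (rule SUP_cong[OF refl])
  fix a :: "'k mat" assume "a : carrier (sl n n)"
  hence "a : carrier_mat (n + n) (n + n)" by (simp add: sl_simps)
  thus "{{c \<cdot>\<^sub>m 1\<^sub>m (n + n) | c. True} +>\<^bsub>sl n n\<^esub> a} = {pj n a}" by (simp only: sl_coset)
 qed
 finally show ?thesis by auto
qed

lemma psl_part: "part (psl n :: ('k::field, 'k mat set) lie_superalgebra) p = pj n ` part (sl n n) p"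
proof -
 have "part (psl n :: ('k, 'k mat set) lie_superalgebra) p =
  (%x. {c \<cdot>\<^sub>m 1\<^sub>m (n + n) | c. True} +>\<^bsub>sl n n\<^esub> x) ` part (sl n n) p"
  by (simp add: psl_def lsa_quotient_def)
 also have "... = pj n ` part (sl n n) p"
 proof (rule image_cong[OF refl])
  fix a :: "'k mat" assume "a : part (sl n n) p"
  hence "a : carrier_mat (n + n) (n + n)" by (simp add: sl_simps)
  thus "{c \<cdot>\<^sub>m 1\<^sub>m (n + n) | c. True} +>\<^bsub>sl n n\<^esub> a = pj n a" by (simp only: sl_coset)
 qed
 finally show ?thesis .
qed

lemma psl_ops:
 fixes A B :: "'k::field mat"
 assumes A: "A : carrier_mat (n + n) (n + n)" and B: "B : carrier_mat (n + n) (n + n)"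
 shows "pj n A \<oplus>\<^bsub>psl n\<^esub> pj n B = pj n (A + B)" "e \<odot>\<^bsub>psl n\<^esub> pj n A = pj n (e \<cdot>\<^sub>m A)"
  "bracket (psl n) (pj n A) (pj n B) = pj n (supercommutator n A B)"
proof -
 let ?N = "n + n"
 have cc: "X : carrier_mat ?N ?N" if "X : pj n Y" for X Y :: "'k mat" using that by (simp add: scoset_def)
 have "pj n A \<oplus>\<^bsub>psl n\<^esub> pj n B = (\<Union>h\<in>pj n A. \<Union>k\<in>pj n B. {h + k})"
  by (simp add: psl_def lsa_quotient_def set_add_def' sl_simps)
 also have "... = pj n (A + B)"
 proof (intro equalityI subsetI)
  fix X assume "X : (\<Union>h\<in>pj n A. \<Union>k\<in>pj n B. {h + k})"
  then obtain h k where X: "h : pj n A" "k : pj n B" "X = h + k" by blast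
  obtain c d where "\<forall>x<?N. \<forall>y<?N. h $$ (x, y) = A $$ (x, y) + (if x = y then c else 0)"
  "\<forall>x<?N. \<forall>y<?N. k $$ (x, y) = B $$ (x, y) + (if x = y then d else 0)" using X by (auto simp: scoset_def)
  hence "\<forall>x<?N. \<forall>y<?N. X $$ (x, y) = (A + B) $$ (x, y) + (if x = y then c + d else 0)"
  using X cc[OF X(1)] cc[OF X(2)] A B by auto
  thus "X : pj n (A + B)" using X cc[OF X(1)] cc[OF X(2)] unfolding scoset_def by auto
 next
  fix X assume "X : pj n (A + B)"
  then obtain c where X: "X : carrier_mat ?N ?N" "\<forall>x<?N. \<forall>y<?N. X $$ (x, y) = (A + B) $$ (x, y) + (if x = y then c else 0)"
  by (auto simp: scoset_def)
  have h: "A + c \<cdot>\<^sub>m 1\<^sub>m ?N : pj n A" using A by (auto simp: scoset_def intro!: exI[of _ c])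
  have "X = (A + c \<cdot>\<^sub>m 1\<^sub>m ?N) + B" by (rule eq_matI) (use X A B in auto)
  thus "X : (\<Union>h\<in>pj n A. \<Union>k\<in>pj n B. {h + k})" using h scoset_self[OF B] by blast
 qed
 finally show "pj n A \<oplus>\<^bsub>psl n\<^esub> pj n B = pj n (A + B)" .
 have "e \<odot>\<^bsub>psl n\<^esub> pj n A = (\<Union>x\<in>pj n A. {c \<cdot>\<^sub>m 1\<^sub>m ?N | c. True} +>\<^bsub>sl n n\<^esub> (e \<cdot>\<^sub>m x))"
  by (simp add: psl_def lsa_quotient_def sl_simps)
 also have "... = (\<Union>x\<in>pj n A. pj n (e \<cdot>\<^sub>m x))"
 proof (rule SUP_cong[OF refl])
  fix x assume "x : pj n A"
  hence "e \<cdot>\<^sub>m x : carrier_mat ?N ?N" using cc by simp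
  thus "{c \<cdot>\<^sub>m 1\<^sub>m ?N | c. True} +>\<^bsub>sl n n\<^esub> (e \<cdot>\<^sub>m x) = pj n (e \<cdot>\<^sub>m x)" by (simp only: sl_coset)
 qed
 also have "... = pj n (e \<cdot>\<^sub>m A)"
  by (rule UN_const_on[OF scoset_self[OF A]]) (rule scoset_eq[OF scoset_smult[OF _ A]])
 finally show "e \<odot>\<^bsub>psl n\<^esub> pj n A = pj n (e \<cdot>\<^sub>m A)" .
 have "bracket (psl n) (pj n A) (pj n B) =
  (\<Union>x\<in>pj n A. \<Union>y\<in>pj n B. {c \<cdot>\<^sub>m 1\<^sub>m ?N | c. True} +>\<^bsub>sl n n\<^esub> supercommutator n x y)"
  by (simp add: psl_def lsa_quotient_def sl_simps)
 also have "... = (\<Union>x\<in>pj n A. \<Union>y\<in>pj n B. pj n (supercommutator n A B))"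
 proof (intro SUP_cong refl)
  fix x y assume xy: "x : pj n A" "y : pj n B"
  show "{c \<cdot>\<^sub>m 1\<^sub>m ?N | c. True} +>\<^bsub>sl n n\<^esub> supercommutator n x y = pj n (supercommutator n A B)"
  unfolding sl_coset[OF sc_carrier[OF cc[OF xy(1)] cc[OF xy(2)]]]
  unfolding supercommutator_scalar[OF A xy(1) B xy(2)] ..
 qed
 also have "... = pj n (supercommutator n A B)" using scoset_self[OF A] scoset_self[OF B] by blast
 finally show "bracket (psl n) (pj n A) (pj n B) = pj n (supercommutator n A B)" .
qed

lemma pj_eqD: "A : carrier_mat (n + n) (n + n) ==> pj n A = pj n B ==>
   \<exists>c. \<forall>x<n+n. \<forall>y<n+n. A $$ (x, y) = B $$ (x, y) + (if x = y then c else 0)"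
 using scoset_self[of A "n + n"] by (auto simp: scoset_def)

lemma pj_odd_inj:
 assumes A: "odd_mat n (n + n) A" and B: "odd_mat n (n + n) B" and eq: "pj n A = pj n B"
 shows "A = B"
proof (rule eq_matI)
 note c = odd_matD(1)[OF A] odd_matD(1)[OF B]
 show "dim_row A = dim_row B" "dim_col A = dim_col B" using c by auto
 fix x y assume "x < dim_row B" "y < dim_col B"
 hence xy: "x < n + n" "y < n + n" using c by auto
 obtain d where d: "\<forall>x<n+n. \<forall>y<n+n. A $$ (x, y) = B $$ (x, y) + (if x = y then d else 0)" using pj_eqD[OF c(1) eq] by blast
 show "A $$ (x, y) = B $$ (x, y)"
 proof (cases "x = y")
  case True thus ?thesis using odd_matD(2)[OF A xy] odd_matD(2)[OF B xy] by simp
 next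
  case False thus ?thesis using d xy by simp
 qed
qed

text \<open>An odd symmetry of the quotient lifts uniquely to odd matrices, since a nonzero scalar matrix is not odd. The weights are
\<open>1\<close> except at index \<open>0\<close>, where the value makes their sum vanish; \<open>n > 2\<close> keeps the sums of two weights nonzero.\<close>

lemma psl_kac_type:
 assumes n: "n > 2" shows "kac_type (psl n :: ('k::field_char_0, 'k mat set) lie_superalgebra)"
proof -
 let ?N = "n + n" and ?I = "{..<n} \<times> {n..<n + n}"
 let ?L = "psl n :: ('k, 'k mat set) lie_superalgebra"
 define w :: "nat => 'k" where "w p = 1 - (if p = 0 then of_nat ?N else 0)" for p
 let ?e = "%(i, a). elem_mat ?N i a :: 'k mat" and ?f = "%(i, a). inverse (w i + w a) \<cdot>\<^sub>m elem_mat ?N a i"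
 have w0: "(\<Sum>p<?N. w p) = 0" using n by (simp add: w_def sum_subtractf)
 have wne: "w i + w a ~= 0" if "i < n" "n <= a" for i a
 proof -
  have "(of_nat ?N :: 'k) ~= of_nat 2" using n by (subst of_nat_eq_iff) simp
  thus ?thesis using that n by (auto simp: w_def)
 qed
 have cmat: "A : carrier_mat ?N ?N" if "A : carrier (sl n n)" for A :: "'k mat" using that by (simp add: sl_simps)
 have carr: "!!X. X : carrier ?L ==> \<exists>A. A : carrier_mat ?N ?N & X = pj n A" using cmat unfolding psl_carrier by blast
 have lin: "linear_functional ?L (%X. F (SOME A. A : X))"
  if add: "!!A B. A : carrier_mat ?N ?N ==> B : carrier_mat ?N ?N ==> F (A + B) = F A + F B"
  and smult: "!!c A. A : carrier_mat ?N ?N ==> F (c \<cdot>\<^sub>m A) = c * F A"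
  and inv: "!!A B. A : carrier_mat ?N ?N ==> B : pj n A ==> F B = F A" for F :: "'k mat => 'k"
 proof -
  have rep: "F (SOME B. B : pj n A) = F A" if A: "A : carrier_mat ?N ?N" for A
  by (rule inv[OF A]) (rule someI[of "%B. B : pj n A", OF scoset_self[OF A]])
  show ?thesis unfolding linear_functional_def
  proof (intro conjI ballI allI)
  fix X Y assume "X : carrier ?L" "Y : carrier ?L"
  then obtain A B where AB: "A : carrier_mat ?N ?N" "X = pj n A" "B : carrier_mat ?N ?N" "Y = pj n B" using carr by meson
  show "F (SOME A. A : X \<oplus>\<^bsub>?L\<^esub> Y) = F (SOME A. A : X) + F (SOME A. A : Y)"
  unfolding AB(2,4) psl_ops(1)[OF AB(1,3)] using AB(1,3) by (simp add: rep add)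
  next
  fix c X assume "X : carrier ?L"
  then obtain A where A: "A : carrier_mat ?N ?N" "X = pj n A" using carr by meson
  show "F (SOME A. A : c \<odot>\<^bsub>?L\<^esub> X) = c * F (SOME A. A : X)"
  unfolding A(2) psl_ops(2)[OF A(1,1)] using A(1) by (simp add: rep smult)
  qed
 qed
 have rep: "F (SOME B. B : pj n A) = F A" if A: "A : carrier_mat ?N ?N" and inv: "!!B. B : pj n A ==> F B = F A" for F :: "'k mat => 'k" and A
  by (rule inv) (rule someI[of "%B. B : pj n A", OF scoset_self[OF A]])
 have winv: "wtrace ?N w B = wtrace ?N w A" if "A : carrier_mat ?N ?N" and B: "B : pj n A" for A B
 proof -
  obtain c where c: "\<forall>x<?N. \<forall>y<?N. B $$ (x, y) = A $$ (x, y) + (if x = y then c else 0)" using B by (auto simp: scoset_def)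
  have "wtrace ?N w B = (\<Sum>p<?N. w p * A $$ (p, p) + w p * c)"
  unfolding wtrace_def by (rule sum.cong) (use c in \<open>auto simp: distrib_left\<close>)
  also have "... = wtrace ?N w A + (\<Sum>p<?N. w p) * c" by (simp only: wtrace_def sum.distrib sum_distrib_right)
  finally show ?thesis by (simp add: w0)
 qed
 have "separated ?L"
 proof -
  define F where "F t A = (if t div ?N = t mod ?N then A $$ (t div ?N, t div ?N) - A $$ (0, 0) else A $$ (t div ?N, t mod ?N))"
  for t and A :: "'k mat"
  have N0: "?N > 0" using n by simp
  have lt: "t div ?N < ?N" "t mod ?N < ?N" if "t < ?N * ?N" for t using that N0 by (auto simp: less_mult_imp_div_less)
  have inv: "F t B = F t A" if t: "t < ?N * ?N" and AB: "A : carrier_mat ?N ?N" "B : pj n A" for t A B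
  proof -
  obtain c where c: "\<forall>x<?N. \<forall>y<?N. B $$ (x, y) = A $$ (x, y) + (if x = y then c else 0)" using AB(2) by (auto simp: scoset_def)
  have e1: "B $$ (t div ?N, t div ?N) = A $$ (t div ?N, t div ?N) + c"
  using c[rule_format, OF lt(1)[OF t] lt(1)[OF t]] by simp
  have e0: "B $$ (0, 0) = A $$ (0, 0) + c" using c[rule_format, OF N0 N0] by simp
  show ?thesis
  proof (cases "t div ?N = t mod ?N")
  case True thus ?thesis unfolding F_def if_P[OF True] e1 e0 by simp
  next
  case False
  thus ?thesis unfolding F_def if_not_P[OF False] using c[rule_format, OF lt(1)[OF t] lt(2)[OF t]] by simp
  qed
  qed
  have "linear_functional ?L (%X. F t (SOME A. A : X))" if t: "t < ?N * ?N" for t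
  proof (rule lin)
  show "F t (A + B) = F t A + F t B" if "A : carrier_mat ?N ?N" "B : carrier_mat ?N ?N" for A B
  using that lt[OF t] N0 by (auto simp: F_def)
  show "F t (c \<cdot>\<^sub>m A) = c * F t A" if "A : carrier_mat ?N ?N" for c A
  using that lt[OF t] N0 by (auto simp: F_def right_diff_distrib)
  qed (rule inv[OF t])
  moreover have "X = Y" if XY: "X : carrier ?L" "Y : carrier ?L" "\<forall>t<?N*?N. F t (SOME A. A : X) = F t (SOME A. A : Y)" for X Y
  proof -
  obtain A B where AB: "A : carrier_mat ?N ?N" "X = pj n A" "B : carrier_mat ?N ?N" "Y = pj n B" using carr XY by meson
  have e: "F t A = F t B" if "t < ?N * ?N" for t
  proof -
  have 1: "F t (SOME M. M : X) = F t A" unfolding AB(2) by (rule rep[where F = "F t", OF AB(1)]) (rule inv[OF that AB(1)])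
  have 2: "F t (SOME M. M : Y) = F t B" unfolding AB(4) by (rule rep[where F = "F t", OF AB(3)]) (rule inv[OF that AB(3)])
  show ?thesis using XY(3)[rule_format, OF that] 1 2 by simp
  qed
  have "A $$ (x, y) = B $$ (x, y) + (if x = y then A $$ (0, 0) - B $$ (0, 0) else 0)" if xy: "x < ?N" "y < ?N" for x y
  proof -
  have "x * ?N + y < (x + 1) * ?N" using xy by simp
  also have "... <= ?N * ?N" using xy by (intro mult_le_mono1) simp
  finally have "F (y + x * ?N) A = F (y + x * ?N) B" by (intro e) (simp add: add.commute)
  moreover have "(y + x * ?N) div ?N = x" "(y + x * ?N) mod ?N = y" using xy by simp_all
  ultimately show ?thesis unfolding F_def by (auto simp: algebra_simps split: if_splits)
  qed
  hence "A : pj n B" unfolding scoset_def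
  by (intro CollectI conjI AB(1) exI[of _ "A $$ (0, 0) - B $$ (0, 0)"] allI impI)
  from scoset_eq[OF this] show ?thesis unfolding AB(2,4) .
  qed
  ultimately show ?thesis unfolding separated_def
  by (intro exI[of _ "?N * ?N"] exI[of _ "%t X. F t (SOME A. A : X)"]) blast
 qed
 moreover have p1: "part ?L 1 = pj n ` {A. odd_mat n ?N A}" unfolding psl_part sl_odd ..
 have odd_e: "odd_mat n ?N (?e s)" "odd_mat n ?N (?f s)" if "s : ?I" for s
  using that by (auto intro!: odd_mat_elem odd_mat_smult)
 have "rigid_dual_bases ?L ?I (%s. pj n (?e s)) (%s. pj n (?f s)) (%X. wtrace ?N w (SOME A. A : X))"
  unfolding rigid_dual_bases_def
 proof (intro conjI ballI allI impI)
  show "finite ?I" by simp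
  show "(%s. pj n (?e s)) ` ?I <= part ?L 1" "(%s. pj n (?f s)) ` ?I <= part ?L 1" unfolding p1 using odd_e by blast+
  show "linear_functional ?L (%X. wtrace ?N w (SOME A. A : X))"
  by (rule lin) (rule wtrace_add wtrace_smult winv; assumption)+
  show "spans ?L ((%s. pj n (?e s)) ` ?I \<union> (%s. pj n (?f s)) ` ?I) (part ?L 1)" unfolding spans_def
  proof (intro allI impI subsetI)
  fix W Z
  assume W: "W <= carrier ?L & W ~= {} & (%s. pj n (?e s)) ` ?I \<union> (%s. pj n (?f s)) ` ?I <= W \<and>
  (\<forall>x\<in>W. \<forall>y\<in>W. x \<oplus>\<^bsub>?L\<^esub> y : W) & (\<forall>c. \<forall>x\<in>W. c \<odot>\<^bsub>?L\<^esub> x : W)" and Z: "Z : part ?L 1"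
  note W1 = W[THEN conjunct1] and W2 = W[THEN conjunct2, THEN conjunct1] and W3 = W[THEN conjunct2, THEN conjunct2, THEN conjunct1]
  and W4 = W[THEN conjunct2, THEN conjunct2, THEN conjunct2, THEN conjunct1]
  and W5 = W[THEN conjunct2, THEN conjunct2, THEN conjunct2, THEN conjunct2]
  from Z[unfolded p1] obtain A where A: "odd_mat n ?N A" "Z = pj n A" by auto
  define W' where "W' = {A : carrier_mat ?N ?N. pj n A : W}"
  obtain X0 where X0: "X0 : W" using W2 by auto
  obtain B where B: "B : carrier_mat ?N ?N" "pj n B : W" using carr[OF subsetD[OF W1 X0]] X0 by auto
  have sm: "c \<cdot>\<^sub>m X : W'" if "X : W'" for c X
  proof -
  have X: "X : carrier_mat ?N ?N" "pj n X : W" using that by (auto simp: W'_def)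
  have "c \<odot>\<^bsub>?L\<^esub> pj n X : W" by (rule W5[rule_format, OF X(2)])
  thus ?thesis using X(1) unfolding psl_ops(2)[OF X(1,1)] by (simp add: W'_def)
  qed
  have "0 \<cdot>\<^sub>m B = 0\<^sub>m ?N ?N" using B(1) by (intro eq_matI) auto
  hence zero: "0\<^sub>m ?N ?N : W'" using sm[of B 0] B by (simp add: W'_def)
  let ?S = "{(x, y). x < ?N & y < ?N & (x < n) ~= (y < n)}"
  have fin: "finite ?S" by (rule finite_subset[of _ "{..<?N} \<times> {..<?N}"]) auto
  have E: "elem_mat ?N x y : W'" if xy: "(x, y) : ?S" for x y
  proof (cases "x < n")
  case True
  hence "(x, y) : ?I" using xy by auto
  hence "pj n (?e (x, y)) : W" using imageI[of "(x, y)" ?I "%s. pj n (?e s)"] W3 by blast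
  thus ?thesis by (simp add: W'_def)
  next
  case False
  hence i: "(y, x) : ?I" using xy by auto
  hence "pj n (?f (y, x)) : W" using imageI[of "(y, x)" ?I "%s. pj n (?f s)"] W3 by blast
  hence "?f (y, x) : W'" by (simp add: W'_def)
  hence "(w y + w x) \<cdot>\<^sub>m ?f (y, x) : W'" by (rule sm)
  moreover have "(w y + w x) \<cdot>\<^sub>m ?f (y, x) = elem_mat ?N x y"
  using wne[of y x] i by (intro eq_matI) auto
  ultimately show ?thesis by simp
  qed
  have "A : W'"
  proof (rule mat_induct[OF zero _ _ fin])
  show "P + Q : W'" if "P : W'" "Q : W'" for P Q
  proof -
  have X: "P : carrier_mat ?N ?N" "Q : carrier_mat ?N ?N" "pj n P : W" "pj n Q : W" using that by (auto simp: W'_def)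
  have "pj n P \<oplus>\<^bsub>?L\<^esub> pj n Q : W" by (rule W4[rule_format, OF X(3,4)])
  thus ?thesis using X(1,2) unfolding psl_ops(1)[OF X(1,2)] by (simp add: W'_def)
  qed
  show "c \<cdot>\<^sub>m elem_mat ?N x y : W'" if "(x, y) : ?S" for x y c by (rule sm[OF E[OF that]])
  show "A : carrier_mat ?N ?N" by (rule odd_matD(1)[OF A(1)])
  show "A $$ (x, y) = 0" if "x < ?N" "y < ?N" "(x, y) \<notin> ?S" for x y
  using odd_matD(2)[OF A(1) that(1,2)] that by auto
  qed
  thus "Z : W" using A(2) by (simp add: W'_def)
  qed
 next
  fix s t assume "s : ?I" "t : ?I"
  then obtain i a j b where st: "s = (i, a)" "t = (j, b)" "i < n" "j < n" "n <= a" "a < ?N" "n <= b" "b < ?N" by auto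
  have c: "?e s : carrier_mat ?N ?N" "?f t : carrier_mat ?N ?N" using st by auto
  have "wtrace ?N w (SOME A. A : bracket ?L (pj n (?e s)) (pj n (?f t))) = wtrace ?N w (supercommutator n (?e s) (?f t))"
  unfolding psl_ops(3)[OF c]
  by (rule rep[where F = "wtrace ?N w", OF sc_carrier[OF c]]) (rule winv[OF sc_carrier[OF c]])
  also have "... = (if s = t then 1 else 0)"
  using wtrace_dual[OF st(3-8), of w] wne[OF st(4,7)] st by simp
  finally show "wtrace ?N w (SOME A. A : bracket ?L (pj n (?e s)) (pj n (?f t))) = (if s = t then 1 else 0)" .
 next
  fix \<phi> assume \<phi>: "odd_symmetry ?L \<phi>"
  note \<phi>' = \<phi>[unfolded odd_symmetry_def]
  have s1: "\<forall>z\<in>part ?L 1. \<phi> z : part ?L 1" using \<phi>' by (elim conjE)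
  have s2: "\<forall>c. \<forall>z\<in>part ?L 1. \<phi> (c \<odot>\<^bsub>?L\<^esub> z) = c \<odot>\<^bsub>?L\<^esub> \<phi> z" using \<phi>' by (elim conjE)
  have s3: "\<forall>x\<in>part ?L 0. \<forall>z\<in>part ?L 1. \<phi> (bracket ?L x z) = bracket ?L x (\<phi> z)" using \<phi>' by (elim conjE)
  have s4: "\<forall>z\<in>part ?L 1. \<forall>w\<in>part ?L 1. bracket ?L (\<phi> z) (\<phi> w) = bracket ?L z w" using \<phi>' by (elim conjE)
  have pin: "pj n z : part ?L 1" if "odd_mat n ?N z" for z unfolding p1 using that by blast
  have "\<exists>v. odd_mat n ?N v & pj n v = \<phi> (pj n z)" if "odd_mat n ?N z" for z using s1[rule_format, OF pin[OF that]] unfolding p1 by auto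
  then obtain \<psi> where \<psi>: "!!z. odd_mat n ?N z ==> odd_mat n ?N (\<psi> z)" "!!z. odd_mat n ?N z ==> pj n (\<psi> z) = \<phi> (pj n z)" by metis
  define D where "D = {d :: nat => 'k. (\<Sum>i<n. d i) = (\<Sum>i\<in>{n..<n+n}. d i)}"
  interpret odd_matrix_symmetry n n \<psi> D
  proof
  show "odd_mat n ?N z ==> odd_mat n ?N (\<psi> z)" for z by (rule \<psi>)
  show sm: "\<psi> (c \<cdot>\<^sub>m z) = c \<cdot>\<^sub>m \<psi> z" if z: "odd_mat n ?N z" for z c
  proof (rule pj_odd_inj)
  note zc = odd_matD(1)[OF z] odd_matD(1)[OF \<psi>(1)[OF z]]
  show "odd_mat n ?N (\<psi> (c \<cdot>\<^sub>m z))" "odd_mat n ?N (c \<cdot>\<^sub>m \<psi> z)" using z by (simp_all add: \<psi>(1) odd_mat_smult)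
  have "pj n (\<psi> (c \<cdot>\<^sub>m z)) = \<phi> (pj n (c \<cdot>\<^sub>m z))" using z by (simp add: \<psi>(2) odd_mat_smult)
  also have "... = c \<odot>\<^bsub>?L\<^esub> \<phi> (pj n z)" using s2[rule_format, OF pin[OF z], of c] psl_ops(2)[OF zc(1,1)] by simp
  also have "... = pj n (c \<cdot>\<^sub>m \<psi> z)" unfolding \<psi>(2)[OF z, symmetric] by (rule psl_ops(2)[OF zc(2,2)])
  finally show "pj n (\<psi> (c \<cdot>\<^sub>m z)) = pj n (c \<cdot>\<^sub>m \<psi> z)" .
  qed
  have wo: "odd_mat n ?N (weighted ?N d z)" if "odd_mat n ?N z" for d :: "nat => 'k" and z
  using that by (auto simp: odd_mat_def weighted_def)
  show "\<psi> (weighted ?N d z) = weighted ?N d (\<psi> z)" if d: "d : D" and z: "odd_mat n ?N z" for d z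
  proof (rule pj_odd_inj)
  note zc = odd_matD(1)[OF z] odd_matD(1)[OF \<psi>(1)[OF z]]
  show "odd_mat n ?N (\<psi> (weighted ?N d z))" "odd_mat n ?N (weighted ?N d (\<psi> z))" using z by (simp_all add: \<psi>(1) wo)
  have dd: "pj n (diagonal ?N d) : part ?L 0" unfolding psl_part using sl_diagonal[of d n n] d by (auto simp: D_def)
  have "pj n (\<psi> (weighted ?N d z)) = \<phi> (pj n (weighted ?N d z))" using z by (simp add: \<psi>(2) wo)
  also have "pj n (weighted ?N d z) = bracket ?L (pj n (diagonal ?N d)) (pj n z)"
  unfolding psl_ops(3)[OF diagonal_carrier zc(1)] supercommutator_diagonal[OF zc(1)] ..
  also have "\<phi> ... = bracket ?L (pj n (diagonal ?N d)) (\<phi> (pj n z))" by (rule s3[rule_format, OF dd pin[OF z]])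
  also have "... = pj n (weighted ?N d (\<psi> z))"
  unfolding \<psi>(2)[OF z, symmetric] psl_ops(3)[OF diagonal_carrier zc(2)] supercommutator_diagonal[OF zc(2)] ..
  finally show "pj n (\<psi> (weighted ?N d z)) = pj n (weighted ?N d (\<psi> z))" .
  qed
  show "\<exists>s. (s ~= 0 --> n + n > 4) & \<psi> z * \<psi> v + \<psi> v * \<psi> z = z * v + v * z + s \<cdot>\<^sub>m 1\<^sub>m ?N"
  if z: "odd_mat n ?N z" and v: "odd_mat n ?N v" for z v
  proof -
  note zc = odd_matD(1)[OF z] odd_matD(1)[OF v] odd_matD(1)[OF \<psi>(1)[OF z]] odd_matD(1)[OF \<psi>(1)[OF v]]
  have "bracket ?L (\<phi> (pj n z)) (\<phi> (pj n v)) = bracket ?L (pj n z) (pj n v)" by (rule s4[rule_format, OF pin[OF z] pin[OF v]])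
  hence e: "pj n (\<psi> z * \<psi> v + \<psi> v * \<psi> z) = pj n (z * v + v * z)"
  unfolding \<psi>(2)[OF z, symmetric] \<psi>(2)[OF v, symmetric] psl_ops(3)[OF zc(1,2)] psl_ops(3)[OF zc(3,4)]
  supercommutator_odd[OF z v] supercommutator_odd[OF \<psi>(1)[OF z] \<psi>(1)[OF v]] .
  have cl: "P * Q + Q * P : carrier_mat ?N ?N" if "P : carrier_mat ?N ?N" "Q : carrier_mat ?N ?N" for P Q :: "'k mat"
  using that by (intro add_carrier_mat mult_carrier_mat)
  obtain s where s: "\<forall>x<?N. \<forall>y<?N. (\<psi> z * \<psi> v + \<psi> v * \<psi> z) $$ (x, y) = (z * v + v * z) $$ (x, y) + (if x = y then s else 0)"
  using pj_eqD[OF cl[OF zc(3,4)] e] by blast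
  have "\<psi> z * \<psi> v + \<psi> v * \<psi> z = (z * v + v * z) + s \<cdot>\<^sub>m 1\<^sub>m ?N"
  proof (rule eq_matI)
  fix x y assume "x < dim_row ((z * v + v * z) + s \<cdot>\<^sub>m 1\<^sub>m ?N)" "y < dim_col ((z * v + v * z) + s \<cdot>\<^sub>m 1\<^sub>m ?N)"
  hence xy: "x < ?N" "y < ?N" by auto
  have "((z * v + v * z) + s \<cdot>\<^sub>m 1\<^sub>m ?N) $$ (x, y) = (z * v + v * z) $$ (x, y) + (if x = y then s else 0)"
  using xy by (subst index_add_mat(1)) auto
  thus "(\<psi> z * \<psi> v + \<psi> v * \<psi> z) $$ (x, y) = ((z * v + v * z) + s \<cdot>\<^sub>m 1\<^sub>m ?N) $$ (x, y)"
  using s xy by simp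
  qed (use cl[OF zc(3,4)] zc in auto)
  thus ?thesis using n by (intro exI[of _ s]) simp
  qed
  show "(%x. (if x = p then 1 else 0) + (if x = q then 1 else 0)) : D"
  if "p < n + n" "q < n + n" "(p < n) ~= (q < n)" for p q
  unfolding D_def by (rule CollectI) (rule sl_torus[OF that])
  qed (use n in simp)
  obtain c where c: "c ~= 0" "!!i a. i < n ==> n <= a ==> a < ?N ==>
       \<psi> (elem_mat ?N i a) = inverse c \<cdot>\<^sub>m elem_mat ?N i a & \<psi> (elem_mat ?N a i) = c \<cdot>\<^sub>m elem_mat ?N a i"
  using scalars by blast
  show "\<exists>c. c ~= 0 & (\<forall>s\<in>?I. \<phi> (pj n (?e s)) = inverse c \<odot>\<^bsub>?L\<^esub> pj n (?e s) & \<phi> (pj n (?f s)) = c \<odot>\<^bsub>?L\<^esub> pj n (?f s))"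
  proof (intro exI conjI ballI)
  fix s assume sI: "s : ?I"
  then obtain i a where s: "s = (i, a)" "i < n" "n <= a" "a < ?N" by auto
  note oe = odd_e[OF sI]
  note cc = oe[THEN odd_matD(1)]
  have "\<psi> (?e s) = inverse c \<cdot>\<^sub>m ?e s" using c(2)[OF s(2-4)] by (simp add: s(1))
  thus "\<phi> (pj n (?e s)) = inverse c \<odot>\<^bsub>?L\<^esub> pj n (?e s)"
  unfolding \<psi>(2)[OF oe(1), symmetric] psl_ops(2)[OF cc(1,1)] by simp
  have "odd_mat n ?N (elem_mat ?N a i :: 'k mat)" using s by (intro odd_mat_elem) auto
  hence "\<psi> (?f s) = inverse (w i + w a) \<cdot>\<^sub>m (c \<cdot>\<^sub>m elem_mat ?N a i)"
  using c(2)[OF s(2-4)] by (simp add: s(1) \<phi>_smult)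
  also have "... = c \<cdot>\<^sub>m ?f s" by (intro eq_matI) (auto simp: s(1))
  finally show "\<phi> (pj n (?f s)) = c \<odot>\<^bsub>?L\<^esub> pj n (?f s)"
  unfolding \<psi>(2)[OF oe(2), symmetric] psl_ops(2)[OF cc(2,2)] by simp
  qed (rule c(1))
 qed
 thus ?thesis using kac_typeI calculation by blast
qed

section \<open>The orthosymplectic case\<close>

context
 fixes n :: nat
begin

lemmas [simp del] = add_2_eq_Suc add_2_eq_Suc'

abbreviation (input) "NN \<equiv> 2 + 2 * n"

definition opp :: "nat => nat" where "opp y = (if y < 2 + n then y + n else y - n)"
definition dsg :: "nat => 'k::field" where "dsg y = (if y < 2 + n then 1 else - 1)"

lemma opp:
 assumes "2 <= y" "y < NN"
 shows "2 <= opp y" "opp y < NN" "opp (opp y) = y" "opp y ~= y"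
  "dsg (opp y) = - (dsg y :: 'k::field)"
 using assms by (auto simp: opp_def dsg_def)

lemma dsg: "dsg y * dsg y = (1 :: 'k::field)" "dsg y ~= (0 :: 'k)"
 by (auto simp: dsg_def)

lemma opp_eq: "2 <= y ==> y < NN ==> 2 <= z ==> z < NN ==> opp y = opp z \<longleftrightarrow> y = z"
 by (metis opp(3))

definition fidx :: "nat => nat" where "fidx i = (if i < 2 then i else opp i)"
definition fsgn :: "nat => 'k::field" where "fsgn i = (if i < 2 then 1 else dsg i)"

lemma fidx: "i < NN ==> fidx i < NN" "i < NN ==> fidx (fidx i) = i"
 "i < NN ==> fidx i < 2 \<longleftrightarrow> i < 2"
 using opp[of i] by (auto simp: fidx_def)

lemma osp_form_entry: "i < NN ==> j < NN ==>
  osp_form 2 n $$ (i, j) = (if j = fidx i then fsgn i else (0 :: 'k::field))"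
 by (auto simp: osp_form_def fidx_def fsgn_def opp_def dsg_def)

lemma osp_form_carrier: "osp_form 2 n : carrier_mat NN NN" by (simp add: osp_form_def)

lemma preserves_iff:
 assumes A: "(A :: 'k::field mat) : carrier_mat NN NN"
 shows "preserves_osp_form 2 n p A \<longleftrightarrow> (\<forall>i<NN. \<forall>j<NN.
  fsgn (fidx j) * A $$ (fidx j, i) +
  super_sign p (index_parity 2 i) * (fsgn i * A $$ (fidx i, j)) = 0)"
proof -
 have "(transpose_mat A * osp_form 2 n) $$ (i, j) = fsgn (fidx j) * A $$ (fidx j, i)"
  if ij: "i < NN" "j < NN" for i j
 proof -
  have "(transpose_mat A * osp_form 2 n) $$ (i, j) = (\<Sum>k<NN. transpose_mat A $$ (i, k) * osp_form 2 n $$ (k, j))"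
  using A osp_form_carrier ij by (intro mult_entry) auto
  also have "... = transpose_mat A $$ (i, fidx j) * osp_form 2 n $$ (fidx j, j)"
  proof (rule sum_only[OF fidx(1)[OF ij(2)]])
  fix k assume k: "k < NN" "k ~= fidx j"
  have "j ~= fidx k" using fidx(2)[OF k(1)] k(2) by metis
  thus "transpose_mat A $$ (i, k) * osp_form 2 n $$ (k, j) = 0" by (simp add: osp_form_entry[OF k(1) ij(2)])
  qed
  finally show ?thesis using ij A fidx[OF ij(2)] by (simp add: osp_form_entry mult.commute)
 qed
 moreover have "(osp_form 2 n * A) $$ (i, j) = fsgn i * A $$ (fidx i, j)" if ij: "i < NN" "j < NN" for i j
 proof -
  have "(osp_form 2 n * A) $$ (i, j) = (\<Sum>k<NN. osp_form 2 n $$ (i, k) * A $$ (k, j))"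
  using A osp_form_carrier ij by (intro mult_entry) auto
  also have "... = osp_form 2 n $$ (i, fidx i) * A $$ (fidx i, j)"
  by (rule sum_only[OF fidx(1)[OF ij(1)]]) (simp add: osp_form_entry[OF ij(1)])
  finally show ?thesis using ij fidx[OF ij(1)] by (simp add: osp_form_entry)
 qed
 ultimately show ?thesis unfolding preserves_osp_form_def by simp
qed

definition osp_odd :: "'k::field mat => bool" where
 "osp_odd A \<longleftrightarrow> odd_mat 2 NN A \<and>
     (\<forall>y i. 2 <= y --> y < NN --> i < 2 --> A $$ (y, i) = - (dsg y * A $$ (i, opp y)))"

lemma matrix_part_self: "odd_mat m N A ==> matrix_part m 1 A = A" "odd_mat m N A ==> matrix_part m 0 A = 0\<^sub>m N N"
proof -
 assume A: "odd_mat m N A"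
 note c = odd_matD(1)[OF A]
 show "matrix_part m 1 A = A" "matrix_part m 0 A = 0\<^sub>m N N"
  by (rule eq_matI; use A c mp_in[OF c, of m] in \<open>auto simp: mp_entry odd_mat_def\<close>)+
qed

lemma osp_simps:
 "x \<oplus>\<^bsub>osp 2 n\<^esub> y = x + y" "c \<odot>\<^bsub>osp 2 n\<^esub> x = c \<cdot>\<^sub>m x" "bracket (osp 2 n) = supercommutator 2"
 "carrier (osp 2 n) = {A : carrier_mat NN NN. \<forall>p. preserves_osp_form 2 n p (matrix_part 2 p A)}"
 "part (osp 2 n) p = part (gl 2 (2 * n)) p \<inter> {A : carrier_mat NN NN. \<forall>p. preserves_osp_form 2 n p (matrix_part 2 p A)}"
 by (simp_all add: osp_def graded_subalgebra_def gl_simps(1-4))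

lemma preserves_zero: "preserves_osp_form 2 n p (0\<^sub>m NN NN :: 'k::field mat)"
 using fidx by (simp add: preserves_iff)

lemma osp_odd_part: "part (osp 2 n) 1 = {A :: 'k::field mat. osp_odd A}"
proof -
 have "(\<forall>p. preserves_osp_form 2 n p (matrix_part 2 p A)) \<longleftrightarrow> osp_odd A" if A: "odd_mat 2 NN A" for A :: "'k mat"
 proof -
  note c = odd_matD(1)[OF A]
  have "(\<forall>p. preserves_osp_form 2 n p (matrix_part 2 p A)) \<longleftrightarrow> preserves_osp_form 2 n 1 A"
  proof
  assume "\<forall>p. preserves_osp_form 2 n p (matrix_part 2 p A)"
  thus "preserves_osp_form 2 n 1 A" using matrix_part_self(1)[OF A] by metis
  next
  assume P: "preserves_osp_form 2 n 1 A"
  show "\<forall>p. preserves_osp_form 2 n p (matrix_part 2 p A)"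
  proof
  fix p :: bit
  show "preserves_osp_form 2 n p (matrix_part 2 p A)"
  by (cases p) (simp_all add: matrix_part_self[OF A] preserves_zero P)
  qed
  qed
  also have "... \<longleftrightarrow> osp_odd A"
  proof
  assume P: "preserves_osp_form 2 n 1 A"
  show "osp_odd A" unfolding osp_odd_def
  proof (intro conjI A allI impI)
  fix y i assume y: "2 <= y" "y < NN" and i: "i < (2::nat)"
  note dy = opp[OF y]
  have "i < NN" using i by simp
  from P[unfolded preserves_iff[OF c], rule_format, OF this dy(2)] i dy y
  have "dsg y * A $$ (y, i) + A $$ (i, opp y) = 0"
  by (simp add: fidx_def fsgn_def super_sign_def index_parity_def)
  hence "dsg y * (dsg y * A $$ (y, i)) = - (dsg y * A $$ (i, opp y))"
  by (metis add.inverse_unique add.commute mult_minus_right)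
  thus "A $$ (y, i) = - (dsg y * A $$ (i, opp y))"
  by (simp add: mult.assoc[symmetric] dsg)
  qed
  next
  assume O: "osp_odd A"
  hence rel: "A $$ (y, i) = - (dsg y * A $$ (i, opp y))" if "2 <= y" "y < NN" "i < 2" for y i
  using that by (simp add: osp_odd_def)
  show "preserves_osp_form 2 n 1 A" unfolding preserves_iff[OF c]
  proof (intro allI impI)
  fix i j assume ij: "i < NN" "j < NN"
  consider "(i < 2) = (j < 2)" | "i < 2" "~ j < 2" | "~ i < 2" "j < 2" by auto
  thus "fsgn (fidx j) * A $$ (fidx j, i) +
  super_sign 1 (index_parity 2 i) * (fsgn i * A $$ (fidx i, j)) = 0"
  proof cases
  case 1
  hence "A $$ (fidx j, i) = 0" "A $$ (fidx i, j) = 0"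
  using odd_matD(2)[OF A] fidx ij by auto
  thus ?thesis by simp
  next
  case 2
  hence j: "2 <= j" by simp
  note dj = opp[OF j ij(2)]
  have "A $$ (opp j, i) = dsg j * A $$ (i, j)"
  using rel[OF dj(1,2) 2(1)] dj(3) dj(5)[where 'k = 'k] by simp
  thus ?thesis using 2 j dj(1-4) dj(5)[where 'k = 'k] dsg[of j, where 'k = 'k]
  by (simp add: fidx_def fsgn_def super_sign_def index_parity_def mult.assoc[symmetric])
  next
  case 3
  hence i: "2 <= i" by simp
  note di = opp[OF i ij(1)]
  have "A $$ (opp i, j) = dsg i * A $$ (j, i)"
  using rel[OF di(1,2) 3(2)] di(3) di(5)[where 'k = 'k] by simp
  thus ?thesis using 3 i di(1-4) di(5)[where 'k = 'k] dsg[of i, where 'k = 'k]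
  by (simp add: fidx_def fsgn_def super_sign_def index_parity_def mult.assoc[symmetric])
  qed
  qed
  qed
  finally show ?thesis .
 qed
 thus ?thesis unfolding osp_simps gl_odd by (auto simp: osp_odd_def odd_mat_def)
qed

lemma osp_even_part:
 assumes A: "(A :: 'k::field mat) : carrier_mat NN NN" and e: "!!x y. x < NN ==> y < NN ==> (x < 2) ~= (y < 2) ==> A $$ (x, y) = 0"
  and P: "preserves_osp_form 2 n 0 A"
 shows "A : part (osp 2 n) 0"
proof -
 have 1: "matrix_part 2 0 A = A" "matrix_part 2 1 A = 0\<^sub>m NN NN"
  by (rule eq_matI; use A e mp_in[OF A, of 2] in \<open>auto simp: mp_entry\<close>)+
 have "preserves_osp_form 2 n p (matrix_part 2 p A)" for p
  by (cases p) (simp_all add: 1 P preserves_zero)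
 thus ?thesis unfolding osp_simps gl_simps using A 1 by simp
qed

lemma smult_smult_mat: "a \<cdot>\<^sub>m (b \<cdot>\<^sub>m A) = (a * b) \<cdot>\<^sub>m (A :: 'k::field mat)"
 by (rule eq_matI) (simp_all add: mult.assoc)

definition osp_rot :: "'k::field mat" where
 "osp_rot = mat NN NN (%(x, y). if x = 0 & y = 1 then 1 else if x = 1 & y = 0 then - 1 else 0)"

lemma osp_rot_even: "(osp_rot :: 'k::field mat) : part (osp 2 n) 0"
proof (rule osp_even_part)
 show c: "(osp_rot :: 'k mat) : carrier_mat NN NN" by (simp add: osp_rot_def)
 show "(osp_rot :: 'k mat) $$ (x, y) = 0" if "x < NN" "y < NN" "(x < 2) ~= (y < 2)" for x y
  using that by (auto simp: osp_rot_def)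
 show "preserves_osp_form 2 n 0 (osp_rot :: 'k mat)" unfolding preserves_iff[OF c]
 proof (intro allI impI)
  fix i j assume ij: "i < NN" "j < NN"
  show "fsgn (fidx j) * (osp_rot :: 'k mat) $$ (fidx j, i) +
  super_sign 0 (index_parity 2 i) * (fsgn i * osp_rot $$ (fidx i, j)) = 0"
  proof (cases "i < 2 & j < 2")
  case True
  hence "i = 0 \<or> i = 1" "j = 0 \<or> j = 1" by auto
  thus ?thesis by (auto simp: osp_rot_def fidx_def fsgn_def super_sign_def)
  next
  case False
  hence "(osp_rot :: 'k mat) $$ (fidx j, i) = 0" "(osp_rot :: 'k mat) $$ (fidx i, j) = 0"
  using ij fidx[OF ij(1)] fidx[OF ij(2)] by (auto simp: osp_rot_def)
  thus ?thesis by simp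
  qed
 qed
qed

definition twt :: "nat => nat => 'k::field" where
 "twt l x = (if x = l then 1 else if x = opp l then - 1 else 0)"

lemma osp_torus_even:
 assumes l: "2 <= l" "l < NN" shows "diagonal NN (twt l :: nat => 'k::field) : part (osp 2 n) 0"
proof (rule osp_even_part)
 show "(diagonal NN (twt l) :: 'k mat) $$ (x, y) = 0" if "x < NN" "y < NN" "(x < 2) ~= (y < 2)" for x y
  using that by auto
 note dl = opp[OF l]
 have tw: "twt l (fidx i) = - (twt l i :: 'k)" if "i < NN" for i
 proof (cases "i < 2")
  case True thus ?thesis using l dl by (auto simp: twt_def fidx_def)
 next
  case False
  hence i: "2 <= i" by simp
  have "opp i = l \<longleftrightarrow> i = opp l" using opp[OF i that] dl by metis
  moreover have "opp i = opp l \<longleftrightarrow> i = l" using opp_eq[OF i that l] .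
  ultimately show ?thesis using False dl by (auto simp: twt_def fidx_def)
 qed
 show "preserves_osp_form 2 n 0 (diagonal NN (twt l) :: 'k mat)" unfolding preserves_iff[OF diagonal_carrier]
 proof (intro allI impI)
  fix i j assume ij: "i < NN" "j < NN"
  show "fsgn (fidx j) * (diagonal NN (twt l) :: 'k mat) $$ (fidx j, i) +
  super_sign 0 (index_parity 2 i) * (fsgn i * diagonal NN (twt l) $$ (fidx i, j)) = 0"
  proof (cases "fidx j = i")
  case True
  hence "fidx i = j" using fidx(2)[OF ij(2)] by simp
  thus ?thesis using True ij tw[OF ij(2)] tw[OF ij(1)] by (simp add: super_sign_def)
  next
  case False
  hence "fidx i ~= j" using fidx(2)[OF ij(1)] by auto
  thus ?thesis using False ij fidx(1)[OF ij(1)] fidx(1)[OF ij(2)] by simp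
  qed
 qed
qed simp

text \<open>For \<open>s\<close> a square root of \<open>-1\<close> the line spanned by \<open>(1, s)\<close> is isotropic in the two-dimensional orthogonal space, and the
matrices \<open>osp_vec s y\<close> are a basis of the corresponding half of the odd part.\<close>

definition osp_vec :: "'k::field => nat => 'k mat" where
 "osp_vec s y = mat NN NN (%(u, v). if v = y & u = 0 then 1 else if v = y & u = 1 then s else
     if u = opp y & v = 0 then dsg y else if u = opp y & v = 1 then dsg y * s else 0)"

lemma osp_vec_entry: "u < NN ==> v < NN ==> osp_vec s y $$ (u, v) = (if v = y & u = 0 then 1 else if v = y & u = 1 then s else
     if u = opp y & v = 0 then dsg y else if u = opp y & v = 1 then dsg y * s else 0)"
 by (simp add: osp_vec_def)

lemma osp_vec_odd:
 fixes s :: "'k::field"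
 assumes y: "2 <= y" "y < NN" shows "osp_odd (osp_vec s y)"
proof -
 note dy = opp(1-4)[OF y]
 have sg: "dsg (opp y) = - (dsg y :: 'k)" by (rule opp(5)[OF y])
 have c: "osp_vec s y : carrier_mat NN NN" by (simp add: osp_vec_def)
 have "osp_vec s y $$ (z, i) = - (dsg z * osp_vec s y $$ (i, opp z))" if z: "2 <= z" "z < NN" and i: "i < 2" for z i
 proof -
  note dz = opp[OF z]
  have zy: "opp z = y \<longleftrightarrow> z = opp y" using dz dy by metis
  have i': "i = 0 \<or> i = 1" "i < NN" using i by auto
  show ?thesis unfolding osp_vec_entry[OF z(2) i'(2)] osp_vec_entry[OF i'(2) dz(2)] zy
  using i'(1) y z dy sg by auto
 qed
 moreover have "odd_mat 2 NN (osp_vec s y)" unfolding odd_mat_def using c y dy by (auto simp: osp_vec_entry)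
 ultimately show ?thesis by (simp add: osp_odd_def)
qed

lemma osp_odd_eqI:
 assumes "osp_odd A" "osp_odd B" "!!k. 2 <= k ==> k < NN ==> A $$ (0, k) = B $$ (0, k) & A $$ (1, k) = B $$ (1, k)"
 shows "A = B"
proof (rule eq_matI)
 have o: "odd_mat 2 NN A" "odd_mat 2 NN B" using assms by (auto simp: osp_odd_def)
 show "dim_row A = dim_row B" "dim_col A = dim_col B" using odd_matD(1)[OF o(1)] odd_matD(1)[OF o(2)] by auto
 fix x y assume "x < dim_row B" "y < dim_col B"
 hence xy: "x < NN" "y < NN" using odd_matD(1)[OF o(2)] by auto
 have top: "A $$ (i, k) = B $$ (i, k)" if "i < 2" "2 <= k" "k < NN" for i k
 proof -
  have "i = 0 \<or> i = 1" using that by auto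
  thus ?thesis using assms(3)[OF that(2,3)] by auto
 qed
 consider "(x < 2) = (y < 2)" | "x < 2" "2 <= y" | "2 <= x" "y < 2" by linarith
 thus "A $$ (x, y) = B $$ (x, y)"
 proof cases
  case 1 thus ?thesis using odd_matD(2)[OF o(1) xy] odd_matD(2)[OF o(2) xy] by simp
 next
  case 2 thus ?thesis using top xy by simp
 next
  case 3
  hence "A $$ (x, y) = - (dsg x * A $$ (y, opp x))" "B $$ (x, y) = - (dsg x * B $$ (y, opp x))"
  using assms(1,2) xy by (auto simp: osp_odd_def)
  thus ?thesis using top[OF 3(2)] opp[OF 3(1) xy(1)] by simp
 qed
qed

lemma osp_odd_comb:
 assumes A: "osp_odd A" and B: "osp_odd B"
 shows "osp_odd (A + B)" "osp_odd (c \<cdot>\<^sub>m A)"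
proof -
 have oA: "odd_mat 2 NN A" and oB: "odd_mat 2 NN B" using A B by (simp_all only: osp_odd_def)
 note cA = odd_matD(1)[OF oA] and cB = odd_matD(1)[OF oB]
 have rA: "A $$ (y, i) = - (dsg y * A $$ (i, opp y))" if "2 <= y" "y < NN" "i < 2" for y i
  using A that unfolding osp_odd_def by blast
 have rB: "B $$ (y, i) = - (dsg y * B $$ (i, opp y))" if "2 <= y" "y < NN" "i < 2" for y i
  using B that unfolding osp_odd_def by blast
 have ent: "(A + B) $$ (x, y) = A $$ (x, y) + B $$ (x, y)" "(c \<cdot>\<^sub>m A) $$ (x, y) = c * A $$ (x, y)"
  if "x < NN" "y < NN" for x y using that cA cB by simp_all
 have i2: "i < NN" if "i < 2" for i using that by linarith
 show "osp_odd (A + B)" unfolding osp_odd_def odd_mat_def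
 proof (intro conjI allI impI)
  show "A + B : carrier_mat NN NN" using cA cB by simp
  show "(A + B) $$ (x, y) = 0" if "x < NN" "y < NN" "(x < 2) = (y < 2)" for x y
  unfolding ent(1)[OF that(1,2)] odd_matD(2)[OF oA that] odd_matD(2)[OF oB that] by simp
  show "(A + B) $$ (y, i) = - (dsg y * (A + B) $$ (i, opp y))" if y: "2 <= y" "y < NN" and i: "i < 2" for y i
  unfolding ent(1)[OF y(2) i2[OF i]] ent(1)[OF i2[OF i] opp(2)[OF y]] rA[OF y i] rB[OF y i]
  by (simp add: distrib_left)
 qed
 show "osp_odd (c \<cdot>\<^sub>m A)" unfolding osp_odd_def odd_mat_def
 proof (intro conjI allI impI)
  show "c \<cdot>\<^sub>m A : carrier_mat NN NN" using cA by simp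
  show "(c \<cdot>\<^sub>m A) $$ (x, y) = 0" if "x < NN" "y < NN" "(x < 2) = (y < 2)" for x y
  unfolding ent(2)[OF that(1,2)] odd_matD(2)[OF oA that] by simp
  show "(c \<cdot>\<^sub>m A) $$ (y, i) = - (dsg y * (c \<cdot>\<^sub>m A) $$ (i, opp y))" if y: "2 <= y" "y < NN" and i: "i < 2" for y i
  unfolding ent(2)[OF y(2) i2[OF i]] ent(2)[OF i2[OF i] opp(2)[OF y]] rA[OF y i]
  by (simp add: mult.left_commute)
 qed
qed

lemma osp_vec_bracket:
 fixes s t :: "'k::field"
 assumes y: "2 <= y" "y < NN" and z: "2 <= z" "z < NN"
 shows "supercommutator 2 (osp_vec s y) (osp_vec t z) $$ (0, 1) = (if y = opp z then dsg z * (t - s) else 0)"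
  "t = - s ==> s * s = - 1 ==>
  supercommutator 2 (osp_vec s y) (osp_vec t z) $$ (opp y, z) = dsg y * (if y = z then 4 else 2)"
proof -
 note dy = opp[OF y] and dz = opp[OF z]
 have o: "odd_mat 2 NN (osp_vec s y)" "odd_mat 2 NN (osp_vec t z)" using osp_vec_odd y z by (auto simp: osp_odd_def)
 have N: "0 < NN" "1 < NN" by auto
 have yz: "y = opp z \<longleftrightarrow> z = opp y" using dy dz by metis
 have 1: "(\<Sum>k<NN. osp_vec s y $$ (0, k) * osp_vec t z $$ (k, 1)) = osp_vec s y $$ (0, y) * osp_vec t z $$ (y, 1)"
  by (rule sum_only[OF y(2)]) (use y dy in \<open>auto simp: osp_vec_entry\<close>)
 have 2: "(\<Sum>k<NN. osp_vec t z $$ (0, k) * osp_vec s y $$ (k, 1)) = osp_vec t z $$ (0, z) * osp_vec s y $$ (z, 1)"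
  by (rule sum_only[OF z(2)]) (use z dz in \<open>auto simp: osp_vec_entry\<close>)
 have sg: "dsg y = - (dsg z :: 'k)" if "y = opp z" using dz(5)[where 'k = 'k] that by simp
 have ents: "osp_vec s y $$ (0, y) = 1" "osp_vec t z $$ (0, z) = 1"
  "osp_vec t z $$ (y, 1) = (if y = opp z then dsg z * t else 0)"
  "osp_vec s y $$ (z, 1) = (if z = opp y then dsg y * s else 0)"
  using y z dy dz by (auto simp: osp_vec_entry)
 show "supercommutator 2 (osp_vec s y) (osp_vec t z) $$ (0, 1) = (if y = opp z then dsg z * (t - s) else 0)"
  unfolding sc_odd_entry[OF o N] sum.distrib 1 2 ents yz[symmetric] using sg by (auto simp: algebra_simps)
 assume ts: "t = - s" "s * s = - 1"
 have d0: "opp y ~= 0" "opp y ~= 1" "opp z ~= 0" "opp z ~= 1" using dy dz by auto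
 have 3: "(\<Sum>k<NN. osp_vec s y $$ (opp y, k) * osp_vec t z $$ (k, z)) =
     osp_vec s y $$ (opp y, 0) * osp_vec t z $$ (0, z) + osp_vec s y $$ (opp y, 1) * osp_vec t z $$ (1, z)"
  by (rule sum_only2[OF N]) (use y z dy dz d0 in \<open>auto simp: osp_vec_entry\<close>)
 have 4: "(\<Sum>k<NN. osp_vec t z $$ (opp y, k) * osp_vec s y $$ (k, z)) =
     osp_vec t z $$ (opp y, 0) * osp_vec s y $$ (0, z) + osp_vec t z $$ (opp y, 1) * osp_vec s y $$ (1, z)"
  by (rule sum_only2[OF N]) (use y z dy dz d0 in \<open>auto simp: osp_vec_entry\<close>)
 have e3: "osp_vec s y $$ (opp y, 0) = dsg y" "osp_vec s y $$ (opp y, 1) = dsg y * s"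
  "osp_vec t z $$ (0, z) = 1" "osp_vec t z $$ (1, z) = t"
  "osp_vec t z $$ (opp y, 0) = (if y = z then dsg z else 0)"
  "osp_vec t z $$ (opp y, 1) = (if y = z then dsg z * t else 0)"
  "osp_vec s y $$ (0, z) = (if y = z then 1 else 0)" "osp_vec s y $$ (1, z) = (if y = z then s else 0)"
  using y z dy dz d0 opp_eq[OF y z] by (auto simp: osp_vec_entry)
 have q: "dsg w * s * (- s) = (dsg w :: 'k)" "dsg w * (- s) * s = (dsg w :: 'k)" for w
  using ts(2) by (simp_all add: mult.assoc)
 have n4: "x + x + (x + x) = x * 4" "x + x = x * 2" for x :: 'k
 proof -
  have "x * 4 = x * (2 + 2)" by simp
  thus "x + x + (x + x) = x * 4" by (simp only: distrib_left mult_2_right)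
  show "x + x = x * 2" by (simp only: mult_2_right)
 qed
 show "supercommutator 2 (osp_vec s y) (osp_vec t z) $$ (opp y, z) = dsg y * (if y = z then 4 else 2)"
  unfolding sc_odd_entry[OF o dy(2) z(2)] sum.distrib 3 4 e3
  unfolding ts(1)
  by (cases "y = z") (simp_all only: if_True if_False mult_1_right mult_zero_right mult_zero_left add_0_right q n4, simp add: mult.assoc ts(2))
qed

lemma osp_rot_bracket:
 assumes Z: "osp_odd (Z :: 'k::field mat)" and k: "2 <= k" "k < NN"
 shows "supercommutator 2 osp_rot Z $$ (0, k) = Z $$ (1, k)" "supercommutator 2 osp_rot Z $$ (1, k) = - Z $$ (0, k)"
proof -
 have c: "(osp_rot :: 'k mat) : carrier_mat NN NN" "Z : carrier_mat NN NN"
  using Z odd_matD(1) by (auto simp: osp_odd_def osp_rot_def)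
 have N: "0 < NN" "1 < NN" by auto
 have e: "(osp_rot :: 'k mat) $$ (x, y) = (if x = 0 & y = 1 then 1 else if x = 1 & y = 0 then - 1 else 0)" if "x < NN" "y < NN" for x y
  using that by (simp add: osp_rot_def)
 have 2: "(\<Sum>l<NN. (if (x < 2) ~= (l < 2) & (l < 2) ~= (k < 2) then - 1 else 1) * (Z $$ (x, l) * (osp_rot :: 'k mat) $$ (l, k))) = 0" for x
  by (rule sum.neutral) (use k e in auto)
 have 3: "(\<Sum>l<NN. (osp_rot :: 'k mat) $$ (0, l) * Z $$ (l, k)) = osp_rot $$ (0, 1) * Z $$ (1, k)"
  by (rule sum_only[OF N(2)]) (use k e in auto)
 have 4: "(\<Sum>l<NN. (osp_rot :: 'k mat) $$ (1, l) * Z $$ (l, k)) = osp_rot $$ (1, 0) * Z $$ (0, k)"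
  by (rule sum_only[OF N(1)]) (use k e in auto)
 show "supercommutator 2 osp_rot Z $$ (0, k) = Z $$ (1, k)"
  unfolding sc_entry[OF c N(1) k(2)] sum_subtractf 2 3 using e[OF N] by simp
 show "supercommutator 2 osp_rot Z $$ (1, k) = - Z $$ (0, k)"
  unfolding sc_entry[OF c N(2) k(2)] sum_subtractf 2 4 using e[OF N(2,1)] by simp
qed

text \<open>The rotation \<open>osp_rot\<close> has eigenvalues \<open>\<iota>\<close> and \<open>-\<iota>\<close> on the two halves of the odd part, and the symplectic torus separates
the basis vectors of each half. Any two basis vectors from different halves have nonzero bracket, which ties all the
eigenvalues of a symmetry together.\<close>

lemma osp_kac_type_aux:
 fixes \<iota> :: "'k::field_char_0"
 assumes \<iota>: "\<iota> * \<iota> = - 1"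
 shows "kac_type (osp 2 n :: ('k, 'k mat) lie_superalgebra)"
proof -
 let ?L = "osp 2 n :: ('k, 'k mat) lie_superalgebra" and ?I = "{2..<NN}"
 let ?e = "%y. osp_vec \<iota> y" and ?f = "%y. inverse (2 * \<iota> * dsg y) \<cdot>\<^sub>m osp_vec (- \<iota>) (opp y)"
 have M: "mat_space ?L 2 NN" by (auto simp: mat_space_def osp_simps)
 have \<iota>0: "\<iota> ~= 0" using \<iota> by auto
 have vo: "osp_odd (osp_vec s y)" if "y : ?I" for s :: 'k and y using that by (intro osp_vec_odd) simp_all
 have dI: "opp y : ?I" if "y : ?I" for y using opp[of y] that by simp
 have so: "osp_odd (c \<cdot>\<^sub>m A)" if "osp_odd A" for c and A :: "'k mat" using osp_odd_comb(2)[OF that that] .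
 have cm: "A : carrier_mat NN NN" if "osp_odd A" for A :: "'k mat" using that odd_matD(1) by (auto simp: osp_odd_def)
 have N: "0 < NN" "1 < NN" by auto
 have ve: "osp_vec s y $$ (0, k) = (if k = y then 1 else 0)" "osp_vec s y $$ (1, k) = (if k = y then s else 0)"
  if "2 <= k" "k < NN" "y : ?I" for s :: 'k and y k
  using that opp[of y] by (auto simp: osp_vec_entry)
 have "rigid_dual_bases ?L ?I ?e ?f (%A. A $$ (0, 1))" unfolding rigid_dual_bases_def
 proof (intro conjI ballI allI impI)
  show "finite ?I" by simp
  show "?e ` ?I <= part ?L 1" "?f ` ?I <= part ?L 1" unfolding osp_odd_part using vo so dI by auto
  show "linear_functional ?L (%A. A $$ (0, 1))" unfolding linear_functional_def osp_simps by auto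
  show "spans ?L (?e ` ?I \<union> ?f ` ?I) (part ?L 1)" unfolding spans_def osp_simps(1,2)
  proof (intro allI impI subsetI)
  fix W and A :: "'k mat"
  assume W: "W <= carrier ?L & W ~= {} & ?e ` ?I \<union> ?f ` ?I <= W & (\<forall>x\<in>W. \<forall>y\<in>W. x + y : W) & (\<forall>c. \<forall>x\<in>W. c \<cdot>\<^sub>m x : W)"
  and A: "A : part ?L 1"
  obtain B where B: "B : W" "B : carrier_mat NN NN" using W by (auto simp: osp_simps)
  have "0 \<cdot>\<^sub>m B = 0\<^sub>m NN NN" using B(2) by (intro eq_matI) auto
  hence zero: "0\<^sub>m NN NN : W" using W B(1) by metis
  have sm: "c \<cdot>\<^sub>m X : W" if "X : W" for c X using W that by blast
  have ad: "X + Y : W" if "X : W" "Y : W" for X Y using W that by blast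
  have eW: "osp_vec \<iota> y : W" if "y : ?I" for y using W that by blast
  have fW: "osp_vec (- \<iota>) y : W" if y: "y : ?I" for y
  proof -
  let ?c = "2 * \<iota> * dsg (opp y)"
  have dd: "opp (opp y) = y" using opp[of y] y by simp
  have "?f (opp y) : W" using W dI[OF y] by blast
  hence "?c \<cdot>\<^sub>m ?f (opp y) : W" by (rule sm)
  moreover have "?c \<cdot>\<^sub>m ?f (opp y) = osp_vec (- \<iota>) y"
  proof -
  have c0: "?c ~= 0" using \<iota>0 dsg(2)[of "opp y", where 'k = 'k] by simp
  show ?thesis unfolding dd smult_smult_mat right_inverse[OF c0] by (rule eq_matI) simp_all
  qed
  ultimately show ?thesis by simp
  qed
  have "A : W" if "finite S" "S <= ?I" "osp_odd A" "\<forall>k\<in>?I - S. A $$ (0, k) = 0 & A $$ (1, k) = 0" for S and A :: "'k mat"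
  using that
  proof (induction S arbitrary: A rule: finite_induct)
  case empty
  have z: "osp_odd (0\<^sub>m NN NN :: 'k mat)" using opp by (simp add: osp_odd_def odd_mat_def)
  have "A = 0\<^sub>m NN NN" by (rule osp_odd_eqI[OF empty(2) z]) (use empty in simp)
  thus ?case using zero by simp
  next
  case (insert y S)
  have y: "y : ?I" using insert by simp
  define p q where "p = (A $$ (0, y) - \<iota> * A $$ (1, y)) / 2" and "q = (A $$ (0, y) + \<iota> * A $$ (1, y)) / 2"
  have \<iota>a: "\<iota> * (\<iota> * r) = - r" for r using \<iota> by (simp add: mult.assoc[symmetric])
  have pq: "p + q = A $$ (0, y)" "\<iota> * p - \<iota> * q = A $$ (1, y)"
  by (simp_all add: p_def q_def field_simps \<iota>a)
  let ?B = "p \<cdot>\<^sub>m osp_vec \<iota> y + q \<cdot>\<^sub>m osp_vec (- \<iota>) y"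
  have Bo: "osp_odd ?B" by (rule osp_odd_comb(1)[OF so[OF vo[OF y]] so[OF vo[OF y]]])
  have BW: "?B : W" by (intro ad sm eW fW y)
  let ?A = "A + (- 1) \<cdot>\<^sub>m ?B"
  have Ao: "osp_odd ?A" by (rule osp_odd_comb(1)[OF insert.prems(2) so[OF Bo]])
  note cc = cm[OF insert.prems(2)] cm[OF vo[OF y, of \<iota>]] cm[OF vo[OF y, of "- \<iota>"]]
  have be: "?B $$ (0, k) = (if k = y then A $$ (0, y) else 0)" "?B $$ (1, k) = (if k = y then A $$ (1, y) else 0)"
  if "k : ?I" for k
  using that cc ve[of k y \<iota>] ve[of k y "- \<iota>"] y pq by (auto simp: mult.commute)
  have ae: "?A $$ (i, k) = A $$ (i, k) - ?B $$ (i, k)" if "i < NN" "k < NN" for i k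
  using that cc by simp
  have "?A : W"
  proof (rule insert.IH)
  show "S <= ?I" using insert.prems by simp
  show "\<forall>k\<in>?I - S. ?A $$ (0, k) = 0 & ?A $$ (1, k) = 0"
  proof
  fix k assume k: "k : ?I - S"
  hence kI: "k : ?I" "k < NN" by auto
  show "?A $$ (0, k) = 0 & ?A $$ (1, k) = 0"
  unfolding ae[OF N(1) kI(2)] ae[OF N(2) kI(2)] be[OF kI(1)]
  using insert.prems(3) k by (cases "k = y") auto
  qed
  qed (rule Ao)
  hence "?A + ?B : W" using BW by (rule ad)
  moreover have "?A + ?B = A" using cc by (intro eq_matI) auto
  ultimately show ?case by simp
  qed
  from this[of ?I A] show "A : W" using A by (simp add: osp_odd_part)
  qed
 next
  fix y z assume yI: "y : ?I" and zI: "z : ?I"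
  hence y: "2 <= y" "y < NN" and z: "2 <= z" "z < NN" by auto
  note dz = opp[OF z]
  let ?t = "inverse (2 * \<iota> * dsg z)" and ?g = "osp_vec (- \<iota>) (opp z)"
  have o: "odd_mat 2 NN (?e y)" "odd_mat 2 NN ?g" "odd_mat 2 NN (?t \<cdot>\<^sub>m ?g)"
  using vo[OF yI] vo[OF dI[OF zI]] so by (auto simp: osp_odd_def)
  have ge: "(?t \<cdot>\<^sub>m ?g) $$ (u, v) = ?t * ?g $$ (u, v)" if "u < NN" "v < NN" for u v using that odd_matD(1)[OF o(2)] by simp
  have gen: "(\<Sum>k<NN. P k * (r * Q k) + (r * Q' k) * P' k) = r * (\<Sum>k<NN. P k * Q k + Q' k * P' k)"
  for r :: 'k and P P' Q Q' unfolding sum_distrib_left by (simp add: distrib_left mult.assoc mult.left_commute)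
  have "supercommutator 2 (?e y) (?t \<cdot>\<^sub>m ?g) $$ (0, 1) =
       (\<Sum>k<NN. ?e y $$ (0, k) * (?t * ?g $$ (k, 1)) + (?t * ?g $$ (0, k)) * ?e y $$ (k, 1))"
  unfolding sc_odd_entry[OF o(1,3) N]
  proof (rule sum.cong[OF refl])
  fix k assume "k : {..<NN}"
  hence k: "k < NN" by simp
  show "?e y $$ (0, k) * (?t \<cdot>\<^sub>m ?g) $$ (k, 1) + (?t \<cdot>\<^sub>m ?g) $$ (0, k) * ?e y $$ (k, 1) =
  ?e y $$ (0, k) * (?t * ?g $$ (k, 1)) + (?t * ?g $$ (0, k)) * ?e y $$ (k, 1)"
  unfolding ge[OF k N(2)] ge[OF N(1) k] ..
  qed
  also have "... = ?t * supercommutator 2 (?e y) ?g $$ (0, 1)"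
  unfolding sc_odd_entry[OF o(1,2) N] by (rule gen)
  finally have "supercommutator 2 (?e y) (?t \<cdot>\<^sub>m ?g) $$ (0, 1) = ?t * supercommutator 2 (?e y) ?g $$ (0, 1)" .
  also have "... = ?t * (if y = z then dsg (opp z) * (- \<iota> - \<iota>) else 0)"
  unfolding osp_vec_bracket(1)[OF y dz(1,2)] dz(3) ..
  also have "... = (if y = z then 1 else 0)"
  using \<iota>0 dsg(2)[of z, where 'k = 'k] dz(5)[where 'k = 'k] by (simp add: field_simps)
  finally show "bracket ?L (?e y) (?f z) $$ (0, 1) = (if y = z then 1 else 0)" unfolding osp_simps .
 next
  fix \<phi> assume \<phi>: "odd_symmetry ?L \<phi>"
  note \<phi>' = \<phi>[unfolded odd_symmetry_def osp_odd_part osp_simps(2,3)]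
  have s1: "\<forall>z\<in>{A. osp_odd A}. \<phi> z : {A. osp_odd A}" using \<phi>' by (elim conjE)
  have s2: "\<forall>c. \<forall>z\<in>{A. osp_odd A}. \<phi> (c \<cdot>\<^sub>m z) = c \<cdot>\<^sub>m \<phi> z" using \<phi>' by (elim conjE)
  have s3: "\<forall>x\<in>part ?L 0. \<forall>z\<in>{A. osp_odd A}. \<phi> (supercommutator 2 x z) = supercommutator 2 x (\<phi> z)" using \<phi>' by (elim conjE)
  have s4: "\<forall>z\<in>{A. osp_odd A}. \<forall>w\<in>{A. osp_odd A}. supercommutator 2 (\<phi> z) (\<phi> w) = supercommutator 2 z w" using \<phi>' by (elim conjE)
  have eig: "\<exists>a. \<phi> (osp_vec s y) = a \<cdot>\<^sub>m osp_vec s y" if s: "s * s = - 1" and yI: "y : ?I" for s y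
  proof -
  have y: "2 <= y" "y < NN" using yI by auto
  note dy = opp[OF y]
  let ?g = "osp_vec s y" and ?Z = "\<phi> (osp_vec s y)" and ?H = "diagonal NN (twt y :: nat => 'k)"
  have go: "osp_odd ?g" by (rule vo[OF yI])
  have Zo: "osp_odd ?Z" using s1 go by blast
  have scl: "\<phi> (c \<cdot>\<^sub>m ?g) = c \<cdot>\<^sub>m ?Z" for c using s2 go by blast
  have ro: "supercommutator 2 osp_rot ?g = s \<cdot>\<^sub>m ?g" if "osp_odd (supercommutator 2 osp_rot ?g)"
  proof (rule osp_odd_eqI[OF that so[OF go]])
  fix k assume k: "2 <= k" "k < NN"
  show "supercommutator 2 osp_rot ?g $$ (0, k) = (s \<cdot>\<^sub>m ?g) $$ (0, k) \<and>
  supercommutator 2 osp_rot ?g $$ (1, k) = (s \<cdot>\<^sub>m ?g) $$ (1, k)"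
  unfolding osp_rot_bracket[OF go k] using cm[OF go] k ve[OF k yI, of s] s by auto
  qed
  have roto: "osp_odd (supercommutator 2 osp_rot ?g)"
  proof -
  have c: "(osp_rot :: 'k mat) : carrier_mat NN NN" by (simp add: osp_rot_def)
  have e: "(osp_rot :: 'k mat) $$ (x, y) = (if x = 0 & y = 1 then 1 else if x = 1 & y = 0 then - 1 else 0)" if "x < NN" "y < NN" for x y
  using that by (simp add: osp_rot_def)
  have "supercommutator 2 osp_rot ?g = s \<cdot>\<^sub>m ?g"
  proof (rule eq_matI)
  show "dim_row (supercommutator 2 osp_rot ?g) = dim_row (s \<cdot>\<^sub>m ?g)" "dim_col (supercommutator 2 osp_rot ?g) = dim_col (s \<cdot>\<^sub>m ?g)"
  using sc_carrier[OF c cm[OF go], of 2] cm[OF go] by auto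
  fix u v assume "u < dim_row (s \<cdot>\<^sub>m ?g)" "v < dim_col (s \<cdot>\<^sub>m ?g)"
  hence uv: "u < NN" "v < NN" using cm[OF go] by auto
  have A: "(\<Sum>k<NN. osp_rot $$ (u, k) * ?g $$ (k, v)) = osp_rot $$ (u, 0) * ?g $$ (0, v) + osp_rot $$ (u, 1) * ?g $$ (1, v)"
  by (rule sum_only2[OF N]) (use uv e in auto)
  have B: "(\<Sum>k<NN. (if (u < 2) ~= (k < 2) & (k < 2) ~= (v < 2) then - 1 else 1) * (?g $$ (u, k) * osp_rot $$ (k, v))) =
             (if (u < 2) ~= (0 < (2::nat)) & (0 < (2::nat)) ~= (v < 2) then - 1 else 1) * (?g $$ (u, 0) * osp_rot $$ (0, v)) +
             (if (u < 2) ~= (1 < (2::nat)) & (1 < (2::nat)) ~= (v < 2) then - 1 else 1) * (?g $$ (u, 1) * osp_rot $$ (1, v))"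
  by (rule sum_only2[OF N]) (use uv e in auto)
  have cs: "s * (dsg y * s) = - (dsg y :: 'k)" "s * (s * dsg y) = - (dsg y :: 'k)"
  proof -
  have "s * (dsg y * s) = (s * s) * dsg y" "s * (s * dsg y) = (s * s) * (dsg y :: 'k)"
  by (simp_all only: mult_ac)
  thus "s * (dsg y * s) = - (dsg y :: 'k)" "s * (s * dsg y) = - (dsg y :: 'k)"
  by (simp_all add: s)
  qed
  have d2: "y ~= 0" "y ~= 1" "opp y ~= 0" "opp y ~= 1" using y dy by auto
  have sg: "(s \<cdot>\<^sub>m ?g) $$ (u, v) = s * ?g $$ (u, v)" using uv cm[OF go] by simp
  have g0: "?g $$ (0, v) = (if v = y then 1 else 0)" and g1: "?g $$ (1, v) = (if v = y then s else 0)"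
  unfolding osp_vec_entry[OF N(1) uv(2)] osp_vec_entry[OF N(2) uv(2)] using d2 by simp_all
  have gl: "?g $$ (u, 0) = (if u = opp y then dsg y else 0)"
  "?g $$ (u, 1) = (if u = opp y then dsg y * s else 0)"
  unfolding osp_vec_entry[OF uv(1) N(1)] osp_vec_entry[OF uv(1) N(2)] using d2 by simp_all
  consider "u = 0" | "u = 1" | "2 <= u" "v = 0" | "2 <= u" "v = 1" | "2 <= u" "2 <= v" by linarith
  thus "supercommutator 2 osp_rot ?g $$ (u, v) = (s \<cdot>\<^sub>m ?g) $$ (u, v)"
  proof cases
  case 1
  have "?g $$ (u, v) = (if v = y then 1 else 0)" using g0 1 by simp
  thus ?thesis unfolding sc_entry[OF c cm[OF go] uv] sum_subtractf A B sg
  e[OF uv(1) N(1)] e[OF uv(1) N(2)] g0 g1 gl using 1 d2 by simp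
  next
  case 2
  have "?g $$ (u, v) = (if v = y then s else 0)" using g1 2 by simp
  thus ?thesis unfolding sc_entry[OF c cm[OF go] uv] sum_subtractf A B sg
  e[OF uv(1) N(1)] e[OF uv(1) N(2)] g0 g1 gl using 2 d2 s by simp
  next
  case 3
  have "?g $$ (u, v) = (if u = opp y then dsg y else 0)" using gl(1) 3 by simp
  thus ?thesis unfolding sc_entry[OF c cm[OF go] uv] sum_subtractf A B sg
  e[OF uv(1) N(1)] e[OF uv(1) N(2)] e[OF N(1) uv(2)] e[OF N(2) uv(2)] gl using 3 by (simp add: mult.commute)
  next
  case 4
  have "?g $$ (u, v) = (if u = opp y then dsg y * s else 0)" using gl(2) 4 by simp
  thus ?thesis unfolding sc_entry[OF c cm[OF go] uv] sum_subtractf A B sg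
  e[OF uv(1) N(1)] e[OF uv(1) N(2)] e[OF N(1) uv(2)] e[OF N(2) uv(2)] gl using 4 cs(1) by simp
  next
  case 5
  have "?g $$ (u, v) = 0" unfolding osp_vec_entry[OF uv] using 5 by simp
  thus ?thesis unfolding sc_entry[OF c cm[OF go] uv] sum_subtractf A B sg
  e[OF uv(1) N(1)] e[OF uv(1) N(2)] e[OF N(1) uv(2)] e[OF N(2) uv(2)] using 5 by simp
  qed
  qed
  thus ?thesis using so[OF go] by simp
  qed
  have J: "supercommutator 2 osp_rot ?Z = s \<cdot>\<^sub>m ?Z"
  using s3[rule_format, OF osp_rot_even, of ?g] go ro[OF roto] scl[of s] by simp
  have tor: "weighted NN (twt y) ?g = (- 1) \<cdot>\<^sub>m ?g"
  by (rule eq_matI) (use y dy cm[OF go] in \<open>auto simp: weighted_def osp_vec_entry twt_def\<close>)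
  have H: "weighted NN (twt y) ?Z = (- 1) \<cdot>\<^sub>m ?Z"
  using s3[rule_format, OF osp_torus_even[OF y], of ?g] go scl[of "- 1"]
  supercommutator_diagonal[OF cm[OF go], of 2 "twt y"] supercommutator_diagonal[OF cm[OF Zo], of 2 "twt y"] tor by simp
  have row1: "?Z $$ (1, k) = s * ?Z $$ (0, k)" if k: "2 <= k" "k < NN" for k
  using arg_cong[OF J, of "%A. A $$ (0, k)"] osp_rot_bracket(1)[OF Zo k] cm[OF Zo] k by simp
  have row0: "?Z $$ (0, k) = 0" if k: "2 <= k" "k < NN" "k ~= y" for k
  proof -
  have "(twt y 0 - twt y k) * ?Z $$ (0, k) = - ?Z $$ (0, k)"
  using arg_cong[OF H, of "%A. A $$ (0, k)"] cm[OF Zo] k by (simp add: weighted_def)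
  moreover have "twt y 0 = (0 :: 'k)" using y dy by (auto simp: twt_def)
  moreover have "twt y k = (0 :: 'k) \<or> twt y k = (- 1 :: 'k)" using k by (auto simp: twt_def)
  ultimately have "?Z $$ (0, k) = - ?Z $$ (0, k) \<or> ?Z $$ (0, k) = 0" by auto
  thus ?thesis
  proof
  assume "?Z $$ (0, k) = - ?Z $$ (0, k)"
  hence "?Z $$ (0, k) + ?Z $$ (0, k) = 0" using eq_neg_iff_add_eq_0 by blast
  hence "2 * ?Z $$ (0, k) = 0" by (simp only: mult_2)
  thus ?thesis by simp
  qed
  qed
  have "?Z = ?Z $$ (0, y) \<cdot>\<^sub>m ?g"
  proof (rule osp_odd_eqI[OF Zo so[OF go]])
  fix k assume k: "2 <= k" "k < NN"
  show "?Z $$ (0, k) = (?Z $$ (0, y) \<cdot>\<^sub>m ?g) $$ (0, k) & ?Z $$ (1, k) = (?Z $$ (0, y) \<cdot>\<^sub>m ?g) $$ (1, k)"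
  using row1[OF k] row0[OF k] ve[OF k yI, of s] cm[OF go] k by (cases "k = y") auto
  qed
  thus ?thesis by blast
  qed
  have \<iota>m: "- \<iota> * - \<iota> = - 1" using \<iota> by simp
  obtain a where a: "!!y. y : ?I ==> \<phi> (osp_vec \<iota> y) = a y \<cdot>\<^sub>m osp_vec \<iota> y" using eig[OF \<iota>] by metis
  obtain b where b: "!!y. y : ?I ==> \<phi> (osp_vec (- \<iota>) y) = b y \<cdot>\<^sub>m osp_vec (- \<iota>) y" using eig[OF \<iota>m] by metis
  have ab: "a y * b z = 1" if yI: "y : ?I" and zI: "z : ?I" for y z
  proof -
  have y: "2 <= y" "y < NN" and z: "2 <= z" "z < NN" using that by auto
  note dy = opp[OF y]
  let ?e = "osp_vec \<iota> y" and ?g = "osp_vec (- \<iota>) z"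
  note eo = vo[OF yI, of \<iota>] and go = vo[OF zI, of "- \<iota>"]
  have o: "odd_mat 2 NN ?e" "odd_mat 2 NN ?g" "odd_mat 2 NN (a y \<cdot>\<^sub>m ?e)" "odd_mat 2 NN (b z \<cdot>\<^sub>m ?g)"
  using eo go so[OF eo] so[OF go] by (auto simp: osp_odd_def)
  let ?x = "supercommutator 2 ?e ?g $$ (opp y, z)"
  have "supercommutator 2 (a y \<cdot>\<^sub>m ?e) (b z \<cdot>\<^sub>m ?g) $$ (opp y, z) = (a y * b z) * ?x"
  unfolding sc_odd_entry[OF o(3,4) dy(2) z(2)] sc_odd_entry[OF o(1,2) dy(2) z(2)] sum_distrib_left
  proof (rule sum.cong[OF refl])
  fix k assume "k : {..<NN}"
  hence k: "k < NN" by simp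
  have es: "(a y \<cdot>\<^sub>m ?e) $$ (u, v) = a y * ?e $$ (u, v)" "(b z \<cdot>\<^sub>m ?g) $$ (u, v) = b z * ?g $$ (u, v)"
  if "u < NN" "v < NN" for u v using that odd_matD(1)[OF o(1)] odd_matD(1)[OF o(2)] by simp_all
  have ring: "(\<alpha> * P) * (\<beta> * Q) + (\<beta> * Q') * (\<alpha> * P') = \<alpha> * \<beta> * (P * Q + Q' * P')" for \<alpha> \<beta> P P' Q Q' :: 'k
  by (simp add: distrib_left mult.assoc mult.left_commute)
  show "(a y \<cdot>\<^sub>m ?e) $$ (opp y, k) * (b z \<cdot>\<^sub>m ?g) $$ (k, z) + (b z \<cdot>\<^sub>m ?g) $$ (opp y, k) * (a y \<cdot>\<^sub>m ?e) $$ (k, z) =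
  a y * b z * (?e $$ (opp y, k) * ?g $$ (k, z) + ?g $$ (opp y, k) * ?e $$ (k, z))"
  unfolding es[OF dy(2) k] es[OF k z(2)] by (rule ring)
  qed
  moreover have "supercommutator 2 (\<phi> ?e) (\<phi> ?g) = supercommutator 2 ?e ?g" using s4 eo go by blast
  ultimately have "(a y * b z) * ?x = ?x" using a[OF yI] b[OF zI] by simp
  moreover have "?x ~= 0" using osp_vec_bracket(2)[OF y z refl \<iota>] dsg(2)[of y, where 'k = 'k] by auto
  ultimately show ?thesis by simp
  qed
  show "\<exists>c. c ~= 0 & (\<forall>y\<in>?I. \<phi> (?e y) = inverse c \<odot>\<^bsub>?L\<^esub> ?e y & \<phi> (?f y) = c \<odot>\<^bsub>?L\<^esub> ?f y)"
  proof (cases "?I = {}")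
  case True thus ?thesis by (intro exI[of _ 1]) simp
  next
  case False
  then obtain y0 where y0: "y0 : ?I" by blast
  have c0: "b y0 ~= 0" using ab[OF y0 y0] by auto
  have ay: "a y = inverse (b y0)" if "y : ?I" for y
  using inverse_unique[of "b y0" "a y"] ab[OF that y0] by (simp add: mult.commute)
  have bz: "b z = b y0" if "z : ?I" for z
  using inverse_unique[OF ab[OF y0 that]] inverse_unique[OF ab[OF y0 y0]] by simp
  show ?thesis
  proof (intro exI conjI ballI)
  fix y assume y: "y : ?I"
  show "\<phi> (?e y) = inverse (b y0) \<odot>\<^bsub>?L\<^esub> ?e y" using a[OF y] ay[OF y] by (simp add: osp_simps)
  have "\<phi> (?f y) = inverse (2 * \<iota> * dsg y) \<cdot>\<^sub>m (b y0 \<cdot>\<^sub>m osp_vec (- \<iota>) (opp y))"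
  using s2 vo[OF dI[OF y], of "- \<iota>"] b[OF dI[OF y]] bz[OF dI[OF y]] by simp
  thus "\<phi> (?f y) = b y0 \<odot>\<^bsub>?L\<^esub> ?f y" unfolding osp_simps by (simp add: smult_smult_mat mult.commute)
  qed (rule c0)
  qed
 qed
 thus ?thesis using kac_typeI mat_sep[OF M] by blast
qed

end

lemma osp_kac_type: "kac_type (osp 2 n :: ('k::{alg_closed_field, field_char_0}, 'k mat) lie_superalgebra)"
proof -
 obtain \<iota> :: 'k where "\<iota> ^ 2 = - 1" using nth_root_exists[of 2 "- 1 :: 'k"] by auto
 thus ?thesis by (intro osp_kac_type_aux) (simp add: power2_eq_square)
qed

section \<open>The PBW theorem by rewriting functionals on words\<close>

text \<open>Structure constants of a Lie superalgebra on the basis \<open>{..<d}\<close>, with \<open>par\<close> the odd basis elements. Words in the basis are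
lists of natural numbers.\<close>

locale super_structure_constants =
 fixes d :: nat and par :: "nat => bool" and C :: "nat => nat => nat => 'k::field_char_0"
 assumes C_bound: "C a b k ~= 0 ==> k < d"
  and C_par: "C a b k ~= 0 ==> par k \<longleftrightarrow> par a ~= par b"
  and C_skew: "C a b k = - ((if par a & par b then - 1 else 1) * C b a k)"
  and C_jacobi: "(\<Sum>k<d. C b c k * C a k l) =
  (\<Sum>k<d. C a b k * C k c l) + (if par a & par b then - 1 else 1) * (\<Sum>k<d. C a c k * C b k l)"
begin

definition sg :: "nat => nat => 'k" where "sg a b = (if par a & par b then - 1 else 1)"

lemma sg_sym: "sg a b = sg b a" by (simp add: sg_def)
lemma sg_sq: "sg a b * sg a b = 1" by (simp add: sg_def)
lemma sg_sq': "sg a b * (sg a b * x) = x" by (simp add: sg_def)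

definition bad :: "nat => nat => bool" where "bad a b \<longleftrightarrow> b < a \<or> a = b & par a"

definition standard :: "nat list => bool" where
 "standard w \<longleftrightarrow> ~ (\<exists>u a b v. w = u @ a # b # v & bad a b)"

definition bad_split :: "nat list => nat list \<times> nat \<times> nat \<times> nat list" where
 "bad_split w = (SOME (u, a, b, v). w = u @ a # b # v & bad a b)"

lemma bad_splitD:
 assumes "~ standard w" "bad_split w = (u, a, b, v)"
 shows "w = u @ a # b # v & bad a b"
proof -
 have "\<exists>x. case x of (u, a, b, v) => w = u @ a # b # v & bad a b"
  using assms(1) by (auto simp: standard_def)
 from someI_ex[OF this] show ?thesis using assms(2) by (simp add: bad_split_def)
qed

lemma bad_splitD':
 assumes "~ standard w" "(u, y) = bad_split w" "(a, z) = y" "(b, v) = z"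
 shows "w = u @ a # b # v & bad a b"
 using bad_splitD[OF assms(1), of u a b v] assms(2-4) by simp

end

fun invs :: "nat list => nat" where
 "invs [] = 0" | "invs (a # w) = length (filter (%b. b < a) w) + invs w"

lemma invs_swap: "b < a ==> invs (u @ b # a # v) < invs (u @ a # b # v)"
 by (induction u) auto

lemma invs_append_left:
 assumes "mset w = mset w'" "invs w < invs w'"
 shows "invs (u @ w) < invs (u @ w')"
proof (induction u)
 case (Cons a u)
 have "length (filter (%b. b < a) w) = length (filter (%b. b < a) w')"
  using assms(1) by (metis mset_filter size_mset)
 with Cons show ?case by simp
qed (use assms in simp)

context super_structure_constants
begin

definition s1 :: "nat => nat => 'k" where "s1 a b = (if a = b then 0 else sg a b)"
definition C1 :: "nat => nat => nat => 'k" where "C1 a b k = (if a = b then C a b k / 2 else C a b k)"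

function ext :: "(nat list => 'k) => nat list => 'k" where
 "ext g w = (if standard w then g w else
     (case bad_split w of (u, a, b, v) =>
       (if a = b then 0 else sg a b * ext g (u @ b # a # v)) +
       (\<Sum>k<d. C1 a b k * ext g (u @ k # v))))"
 by pat_completeness auto
termination
proof (relation "inv_image (less_than <*lex*> less_than) (%(g, w). (length w, invs w))", goal_cases)
 case 1 thus ?case by auto
next
 case prems: 2
 thus ?case using bad_splitD'[OF prems(1-4)] invs_swap by (auto simp: bad_def)
next
 case prems: 3
 thus ?case using bad_splitD'[OF prems(1-4)] by auto
qed

declare ext.simps[simp del]

definition val :: "(nat list => 'k) => nat list => nat => nat => nat list => 'k" where
 "val g u a b v = s1 a b * ext g (u @ b # a # v) + (\<Sum>k<d. C1 a b k * ext g (u @ k # v))"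

lemma ext_standard: "standard w ==> ext g w = g w" by (subst ext.simps) simp

lemma ext_val: "~ standard w ==> bad_split w = (u, a, b, v) ==> ext g w = val g u a b v"
 by (subst ext.simps) (auto simp: val_def s1_def)

definition rel_at :: "(nat list => 'k) => nat list => nat => nat => nat list => bool" where
 "rel_at G u a b v \<longleftrightarrow>
     G (u @ a # b # v) = sg a b * G (u @ b # a # v) + (\<Sum>k<d. C a b k * G (u @ k # v))"

lemma val_iff_rel: assumes "bad a b" shows "ext g (u @ a # b # v) = val g u a b v \<longleftrightarrow> rel_at (ext g) u a b v"
proof (cases "a = b")
 case True
 hence "sg a b = -1" using assms by (auto simp: bad_def sg_def)
 thus ?thesis using True
  by (simp add: val_def rel_at_def s1_def C1_def sum_divide_distrib[symmetric] field_simps)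
next
 case False thus ?thesis by (simp add: val_def rel_at_def s1_def C1_def)
qed

lemma rel_sym: assumes "rel_at G u b a v" shows "rel_at G u a b v"
proof -
 have "C b a k = - sg a b * C a b k" for k using C_skew[of b a k] by (auto simp: sg_def)
 hence "(\<Sum>k<d. C b a k * G (u @ k # v)) = - sg a b * (\<Sum>k<d. C a b k * G (u @ k # v))"
  by (simp add: sum_distrib_left mult.assoc)
 thus ?thesis using assms unfolding rel_at_def sg_sym[of b a]
  by (cases "par a & par b") (auto simp: sg_def algebra_simps)
qed

lemma rel_even_refl: assumes "~ par a" shows "rel_at G u a a v"
proof -
 have "C a a k = 0" for k using C_skew[of a a k] assms by simp
 thus ?thesis using assms by (simp add: rel_at_def sg_def)
qed

definition good_word where
 "good_word g w \<longleftrightarrow> (\<forall>u a b v. w = u @ a # b # v --> bad a b --> ext g w = val g u a b v)"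

lemma good_wordD: "good_word g w ==> w = u @ a # b # v ==> bad a b ==> ext g w = val g u a b v"
 by (simp add: good_word_def)

definition smaller :: "nat list => nat list => bool" where
 "smaller w' w \<longleftrightarrow> length w' < length w \<or> length w' = length w & invs w' < invs w"

lemma rel_short:
 assumes "!!w'. length w' <= n ==> good_word g w'" "length u + length v + 2 <= n"
 shows "rel_at (ext g) u a b v"
proof -
 have *: "rel_at (ext g) u a b v" if "bad a b" for a b
  using assms(1)[of "u @ a # b # v"] assms(2) that unfolding val_iff_rel[OF that, symmetric]
  by (auto simp: good_word_def)
 consider "bad a b" | "bad b a" | "a = b" "~ par a" unfolding bad_def by (cases a b rule: linorder_cases) blast+
 thus ?thesis using * rel_sym rel_even_refl by cases auto
qed

lemma bracket_left:
 assumes "!!k. rel_at (ext g) u k c v"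
 shows "(\<Sum>k<d. C a b k * ext g (u @ k # c # v)) - sg a c * sg b c * (\<Sum>k<d. C a b k * ext g (u @ c # k # v))
  = (\<Sum>l<d. (\<Sum>k<d. C a b k * C k c l) * ext g (u @ l # v))" (is "?lhs = ?rhs")
proof -
 let ?t = "%k l. C a b k * C k c l * ext g (u @ l # v)"
 have *: "C a b k * (ext g (u @ k # c # v) - sg a c * sg b c * ext g (u @ c # k # v))
  = (\<Sum>l<d. C a b k * C k c l * ext g (u @ l # v))" for k
 proof (cases "C a b k = 0")
  case False
  hence "sg k c = sg a c * sg b c" using C_par[of a b k] by (auto simp: sg_def)
  thus ?thesis using assms[of k] by (simp add: rel_at_def sum_distrib_left algebra_simps)
 qed simp
 have "(\<Sum>k<d. \<Sum>l<d. ?t k l) = ?lhs" unfolding *[symmetric]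
  by (simp add: right_diff_distrib sum_subtractf sum_distrib_left mult_ac)
 hence "?lhs = (\<Sum>k<d. \<Sum>l<d. ?t k l)" ..
 also have "... = ?rhs" unfolding sum_distrib_right by (rule sum.swap)
 finally show ?thesis .
qed

lemma bracket_right:
 assumes "!!k. rel_at (ext g) u a k v"
 shows "(\<Sum>k<d. C b c k * ext g (u @ a # k # v)) - sg a b * sg a c * (\<Sum>k<d. C b c k * ext g (u @ k # a # v))
  = (\<Sum>l<d. (\<Sum>k<d. C b c k * C a k l) * ext g (u @ l # v))" (is "?lhs = ?rhs")
proof -
 let ?t = "%k l. C b c k * C a k l * ext g (u @ l # v)"
 have *: "C b c k * (ext g (u @ a # k # v) - sg a b * sg a c * ext g (u @ k # a # v))
  = (\<Sum>l<d. C b c k * C a k l * ext g (u @ l # v))" for k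
 proof (cases "C b c k = 0")
  case False
  hence "sg a k = sg a b * sg a c" using C_par[of b c k] by (auto simp: sg_def)
  thus ?thesis using assms[of k] by (simp add: rel_at_def sum_distrib_left algebra_simps)
 qed simp
 have "(\<Sum>k<d. \<Sum>l<d. ?t k l) = ?lhs" unfolding *[symmetric]
  by (simp add: right_diff_distrib sum_subtractf sum_distrib_left mult_ac)
 hence "?lhs = (\<Sum>k<d. \<Sum>l<d. ?t k l)" ..
 also have "... = ?rhs" unfolding sum_distrib_right by (rule sum.swap)
 finally show ?thesis .
qed

lemma confluent_disjoint:
 assumes IH: "!!w'. smaller w' (u @ a # b # m @ a' # b' # v) ==> good_word g w'"
  and bad: "bad a b" "bad a' b'"
 shows "val g u a b (m @ a' # b' # v) = val g (u @ a # b # m) a' b' v"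
proof -
 have 1: "s1 a b * ext g (u @ b # a # m @ a' # b' # v) = s1 a b * val g (u @ b # a # m) a' b' v"
 proof (cases "a = b")
  case False
  hence "smaller (u @ b # a # m @ a' # b' # v) (u @ a # b # m @ a' # b' # v)"
  using bad invs_swap[of b a u "m @ a' # b' # v"] by (auto simp: smaller_def bad_def)
  from IH[OF this] have "ext g (u @ b # a # m @ a' # b' # v) = val g (u @ b # a # m) a' b' v"
  by (rule good_wordD) (use bad in simp_all)
  thus ?thesis by simp
 qed (simp add: s1_def)
 have 2: "ext g (u @ k # m @ a' # b' # v) = val g (u @ k # m) a' b' v" for k
  by (rule good_wordD[OF IH]) (use bad in \<open>simp_all add: smaller_def\<close>)
 have 3: "s1 a' b' * ext g (u @ a # b # m @ b' # a' # v) = s1 a' b' * val g u a b (m @ b' # a' # v)"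
 proof (cases "a' = b'")
  case False
  hence "smaller (u @ a # b # m @ b' # a' # v) (u @ a # b # m @ a' # b' # v)"
  using bad invs_swap[of b' a' "u @ a # b # m" "v"] by (auto simp: smaller_def bad_def)
  from IH[OF this] have "ext g (u @ a # b # m @ b' # a' # v) = val g u a b (m @ b' # a' # v)"
  by (rule good_wordD) (use bad in simp_all)
  thus ?thesis by simp
 qed (simp add: s1_def)
 have 4: "ext g (u @ a # b # m @ k # v) = val g u a b (m @ k # v)" for k
  by (rule good_wordD[OF IH]) (use bad in \<open>simp_all add: smaller_def\<close>)
 let ?s = "s1 a b" and ?s' = "s1 a' b'" and ?c = "C1 a b" and ?c' = "C1 a' b'"
 have L: "val g u a b (m @ a' # b' # v) =
  ?s * (?s' * ext g (u @ b # a # m @ b' # a' # v) + (\<Sum>l<d. ?c' l * ext g (u @ b # a # m @ l # v)))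
  + (\<Sum>k<d. ?c k * (?s' * ext g (u @ k # m @ b' # a' # v) + (\<Sum>l<d. ?c' l * ext g (u @ k # m @ l # v))))"
  unfolding val_def[of g u] 1 2 by (simp add: val_def)
 have R: "val g (u @ a # b # m) a' b' v =
  ?s' * (?s * ext g (u @ b # a # m @ b' # a' # v) + (\<Sum>k<d. ?c k * ext g (u @ k # m @ b' # a' # v)))
  + (\<Sum>l<d. ?c' l * (?s * ext g (u @ b # a # m @ l # v) + (\<Sum>k<d. ?c k * ext g (u @ k # m @ l # v))))"
  using 3 4 unfolding val_def[of g "u @ a # b # m"] by (simp add: val_def)
 have sw: "(\<Sum>k<d. ?c k * (\<Sum>l<d. ?c' l * ext g (u @ k # m @ l # v))) =
  (\<Sum>l<d. ?c' l * (\<Sum>k<d. ?c k * ext g (u @ k # m @ l # v)))"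
  unfolding sum_distrib_left by (subst sum.swap) (simp add: mult_ac)
 show ?thesis unfolding L R distrib_left sum.distrib sw
  by (simp add: sum_distrib_left mult_ac)
qed

lemma confluent_overlap:
 assumes IH: "!!w'. smaller w' (u @ a # b # c # v) ==> good_word g w'"
  and bad: "bad a b" "bad b c"
 shows "val g u a b (c # v) = val g (u @ [a]) b c v"
proof -
 have short: "rel_at (ext g) u x y v" for x y
  by (rule rel_short[of "length u + length v + 2"]) (auto intro!: IH simp: smaller_def)
 have gw: "ext g w' = val g u' a' b' v'"
  if "w' = u' @ a' # b' # v'" "bad a' b'" "smaller w' (u @ a # b # c # v)" for w' u' a' b' v'
  by (rule good_wordD[OF IH[OF that(3)] that(1,2)])
 note B1 = bracket_left[OF short] and B2 = bracket_right[OF short]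
 have inv3: "invs (u @ x # y # z # v) < invs (u @ x' # y' # z' # v)"
  if "invs (x # y # z # v) < invs (x' # y' # z' # v)"
       "mset [x,y,z] = mset [x',y',z']" for x y z x' y' z'
 proof (rule invs_append_left)
  have "mset (x # y # z # v) = mset [x,y,z] + mset v" by simp
  also have "... = mset (x' # y' # z' # v)" unfolding that(2) by simp
  finally show "mset (x # y # z # v) = mset (x' # y' # z' # v)" .
 qed (rule that)
 consider (lt) "c < b" "b < a" | (eql) "a = b" "c < b" "par a" | (eqr) "b < a" "b = c" "par b"
  | (eqq) "a = b" "b = c" "par a"
  using bad by (auto simp: bad_def)
 thus ?thesis
 proof cases
  case lt
  have 1: "ext g (u @ b # a # c # v) = sg a c * ext g (u @ b # c # a # v) + (\<Sum>k<d. C a c k * ext g (u @ b # k # v))"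
  using gw[of "u @ b # a # c # v" "u @ [b]" a c v] lt inv3[of b a c a b c]
  by (auto simp: bad_def smaller_def val_def s1_def C1_def add_mset_commute)
  have 2: "ext g (u @ b # c # a # v) = sg b c * ext g (u @ c # b # a # v) + (\<Sum>k<d. C b c k * ext g (u @ k # a # v))"
  using gw[of "u @ b # c # a # v" "u" b c "a # v"] lt inv3[of b c a a b c]
  by (auto simp: bad_def smaller_def val_def s1_def C1_def add_mset_commute)
  have 3: "ext g (u @ a # c # b # v) = sg a c * ext g (u @ c # a # b # v) + (\<Sum>k<d. C a c k * ext g (u @ k # b # v))"
  using gw[of "u @ a # c # b # v" "u" a c "b # v"] lt inv3[of a c b a b c]
  by (auto simp: bad_def smaller_def val_def s1_def C1_def add_mset_commute)
  have 4: "ext g (u @ c # a # b # v) = sg a b * ext g (u @ c # b # a # v) + (\<Sum>k<d. C a b k * ext g (u @ c # k # v))"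
  using gw[of "u @ c # a # b # v" "u @ [c]" a b "v"] lt inv3[of c a b a b c]
  by (auto simp: bad_def smaller_def val_def s1_def C1_def add_mset_commute)
  have J: "(\<Sum>l<d. (\<Sum>k<d. C b c k * C a k l) * ext g (u @ l # v)) =
  (\<Sum>l<d. (\<Sum>k<d. C a b k * C k c l) * ext g (u @ l # v)) +
  sg a b * (\<Sum>l<d. (\<Sum>k<d. C a c k * C b k l) * ext g (u @ l # v))"
  proof -
  have "(\<Sum>k<d. C b c k * C a k l) * ext g (u @ l # v) =
  (\<Sum>k<d. C a b k * C k c l) * ext g (u @ l # v) +
  sg a b * ((\<Sum>k<d. C a c k * C b k l) * ext g (u @ l # v))" for l
  unfolding C_jacobi[of b c a l] sg_def by (simp add: algebra_simps)
  thus ?thesis by (simp only: sum.distrib sum_distrib_left[symmetric])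
  qed
  show ?thesis
  using J lt unfolding B1[symmetric] B2[symmetric] val_def
  by (cases "par a"; cases "par b"; cases "par c") (simp_all add: s1_def C1_def 1 2 3 4 sg_def algebra_simps)
 next
  case eql
  have 1: "ext g (u @ a # c # a # v) = sg a c * ext g (u @ c # a # a # v) + (\<Sum>k<d. C a c k * ext g (u @ k # a # v))"
  using gw[of "u @ a # c # a # v" "u" a c "a # v"] eql inv3[of a c a a b c]
  by (auto simp: bad_def smaller_def val_def s1_def C1_def add_mset_commute)
  have 2: "ext g (u @ c # a # a # v) = (\<Sum>k<d. C a a k / 2 * ext g (u @ c # k # v))"
  using gw[of "u @ c # a # a # v" "u @ [c]" a a "v"] eql inv3[of c a a a b c]
  by (auto simp: bad_def smaller_def val_def s1_def C1_def add_mset_commute)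
  have J: "2 * (\<Sum>l<d. (\<Sum>k<d. C a c k * C a k l) * ext g (u @ l # v)) =
  (\<Sum>l<d. (\<Sum>k<d. C a a k * C k c l) * ext g (u @ l # v))"
  proof -
  have "2 * (\<Sum>k<d. C a c k * C a k l) = (\<Sum>k<d. C a a k * C k c l)" for l
  using C_jacobi[of a c a l] eql(3) by simp
  thus ?thesis by (simp add: sum_distrib_left mult.assoc[symmetric])
  qed
  have sa: "sg a a = -1" using eql by (simp add: sg_def)
  have L: "2 * val g u a a (c # v) = (\<Sum>k<d. C a a k * ext g (u @ k # c # v))"
  by (simp add: val_def s1_def C1_def sum_distrib_left)
  have R: "2 * val g (u @ [a]) a c v = (\<Sum>k<d. C a a k * ext g (u @ c # k # v))
  + 2 * sg a c * (\<Sum>k<d. C a c k * ext g (u @ k # a # v)) + 2 * (\<Sum>k<d. C a c k * ext g (u @ a # k # v))"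
  using eql(1,2) by (simp add: val_def s1_def C1_def 1[unfolded eql(1)] 2[unfolded eql(1)] sg_sq' distrib_left sum_distrib_left[symmetric] sum_divide_distrib[symmetric])
  have "2 * val g u a a (c # v) = 2 * val g (u @ [a]) a c v"
  using J unfolding B1[symmetric] B2[symmetric] L R sa
  by (simp add: algebra_simps sg_sq sg_sq')
  thus ?thesis using eql(1) by simp
 next
  case eqr
  have 1: "ext g (u @ b # a # b # v) = sg a b * ext g (u @ b # b # a # v) + (\<Sum>k<d. C a b k * ext g (u @ b # k # v))"
  using gw[of "u @ b # a # b # v" "u @ [b]" a b "v"] eqr inv3[of b a b a b c]
  by (auto simp: bad_def smaller_def val_def s1_def C1_def add_mset_commute)
  have 2: "ext g (u @ b # b # a # v) = (\<Sum>k<d. C b b k / 2 * ext g (u @ k # a # v))"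
  using gw[of "u @ b # b # a # v" "u" b b "a # v"] eqr inv3[of b b a a b c]
  by (auto simp: bad_def smaller_def val_def s1_def C1_def add_mset_commute)
  have J: "(\<Sum>l<d. (\<Sum>k<d. C b b k * C a k l) * ext g (u @ l # v)) =
  2 * (\<Sum>l<d. (\<Sum>k<d. C a b k * C k b l) * ext g (u @ l # v))"
  proof -
  have "sg a b * (C a b k * C b k l) = C a b k * C k b l" for k l
  using C_par[of a b k] C_skew[of k b l] eqr by (cases "C a b k = 0") (auto simp: sg_def)
  hence "sg a b * (\<Sum>k<d. C a b k * C b k l) = (\<Sum>k<d. C a b k * C k b l)" for l
  by (simp only: sum_distrib_left)
  hence "(\<Sum>k<d. C b b k * C a k l) = 2 * (\<Sum>k<d. C a b k * C k b l)" for l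
  using C_jacobi[of b b a l] by (simp add: sg_def[symmetric])
  thus ?thesis by (simp add: sum_distrib_left mult.assoc[symmetric])
  qed
  have sa: "sg b b = -1" using eqr by (simp add: sg_def)
  have R: "2 * val g (u @ [a]) b b v = (\<Sum>k<d. C b b k * ext g (u @ a # k # v))"
  by (simp add: val_def s1_def C1_def sum_distrib_left)
  have L: "2 * val g u a b (b # v) = (\<Sum>k<d. C b b k * ext g (u @ k # a # v))
  + 2 * sg a b * (\<Sum>k<d. C a b k * ext g (u @ b # k # v)) + 2 * (\<Sum>k<d. C a b k * ext g (u @ k # b # v))"
  using eqr(1) by (simp add: val_def s1_def C1_def 1 2 sg_sq' distrib_left sum_distrib_left[symmetric] sum_divide_distrib[symmetric])
  have "2 * val g u a b (b # v) = 2 * val g (u @ [a]) b b v"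
  using J unfolding B1[symmetric] B2[symmetric] L R sa
  by (simp add: algebra_simps sg_sq sg_sq')
  thus ?thesis using eqr(2) by simp
 next
  case eqq
  have "(\<Sum>k<d. C a a k * C a k l) = 0" for l
  proof -
  have "C a a k * C k a l = - (C a a k * C a k l)" for k
  using C_par[of a a k] C_skew[of k a l] by (cases "C a a k = 0") auto
  hence "(\<Sum>k<d. C a a k * C k a l) = - (\<Sum>k<d. C a a k * C a k l)"
  by (simp add: sum_negf)
  hence "3 * (\<Sum>k<d. C a a k * C a k l) = 0" using C_jacobi[of a a a l] eqq by simp
  thus ?thesis by simp
  qed
  hence "(\<Sum>k<d. C a a k * ext g (u @ a # k # v)) = (\<Sum>k<d. C a a k * ext g (u @ k # a # v))"
  using B2[of a a a] by (simp add: sg_sq)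
  thus ?thesis using eqq
  by (simp add: val_def s1_def C1_def sum_divide_distrib[symmetric])
 qed
qed

text \<open>The diamond lemma. By induction on length and number of inversions, the value of a word does not depend on which bad pair is
rewritten first: disjoint pairs are independent, and overlapping ones agree by the Jacobi identity.\<close>

lemma good_words: "good_word g w"
proof -
 have "wf (inv_image (less_than <*lex*> less_than) (%w. (length w, invs w)))" by auto
 thus ?thesis
proof (induction w rule: wf_induct_rule)
 case (less w)
 hence IH: "!!w'. smaller w' w ==> good_word g w'" by (auto simp: smaller_def)
 have conf: "val g u a b v = val g u' a' b' v'"
  if w: "w = u @ a # b # v" "w = u' @ a' # b' # v'" and bad: "bad a b" "bad a' b'"
  and le: "length u < length u'" for u a b v u' a' b' v'
 proof -
  have "u @ a # b # v = u' @ a' # b' # v'" using w by simp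
  then obtain z where z: "u' = u @ z" "a # b # v = z @ a' # b' # v'"
  using le by (auto simp: append_eq_append_conv2)
  with le obtain z' where z': "z = a # z'" "b # v = z' @ a' # b' # v'" by (cases z) auto
  show ?thesis
  proof (cases z')
  case Nil
  thus ?thesis using confluent_overlap[of u a b b' v' g] IH w z z' bad by auto
  next
  case (Cons x m)
  thus ?thesis using confluent_disjoint[of u a b m a' b' v' g] IH w z z' bad by auto
  qed
 qed
 show ?case unfolding good_word_def
 proof (intro allI impI)
  fix u a b v assume w: "w = u @ a # b # v" and bad: "bad a b"
  hence ns: "~ standard w" by (auto simp: standard_def)
  obtain u' a' b' v' where s: "bad_split w = (u', a', b', v')" by (cases "bad_split w")
  note bs = bad_splitD[OF ns s]
  have "val g u' a' b' v' = val g u a b v"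
  proof (cases "length u" "length u'" rule: linorder_cases)
  case less thus ?thesis using conf[OF w _ bad] bs by metis
  next
  case greater thus ?thesis using conf[of u' a' b' v' u a b v] bs w bad by metis
  next
  case equal
  thus ?thesis using bs w by (simp add: append_eq_append_conv)
  qed
  thus "ext g w = val g u a b v" using ext_val[OF ns s] by simp
 qed
qed
qed

text \<open>A functional on standard words thus extends to all words so that it vanishes on the defining relations. This is the PBW
theorem in dual form.\<close>

lemma ext_rel: "ext g (u @ a # b # v) = sg a b * ext g (u @ b # a # v) + (\<Sum>k<d. C a b k * ext g (u @ k # v))"
 using rel_short[of "length u + length v + 2" g u v a b] good_words by (simp add: rel_at_def)

end
section \<open>Operators on functionals\<close>

typedef (overloaded) ('a, 'k::field) operator =
 "{A :: ('a => 'k) => 'a => 'k.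
     (\<forall>f g. A (%x. f x + g x) = (%x. A f x + A g x)) & (\<forall>c f. A (%x. c * f x) = (%x. c * A f x))}"
 morphisms act Operator
 by (rule exI[of _ "%f. f"]) auto

lemma act_add: "act A (%x. f x + g x) = (%x. act A f x + act A g x)"
 and act_scale: "act A (%x. c * f x) = (%x. c * act A f x)"
 using act[of A] by auto

lemma operator_eqI: "(!!f x. act A f x = act B f x) ==> A = B"
 by (metis act_inject ext)

instantiation operator :: (type, field) ring_1
begin

definition "0 = Operator (%f x. 0)"
definition "1 = Operator (%f. f)"
definition "A + B = Operator (%f x. act A f x + act B f x)"
definition "A - B = Operator (%f x. act A f x - act B f x)"
definition "- A = Operator (%f x. - act A f x)"
definition "A * B = Operator (%f. act A (act B f))"

lemma act_zero: "act 0 f x = 0"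
 and act_one: "act 1 f = f"
 and act_plus: "act (A + B) f x = act A f x + act B f x"
 and act_minus: "act (A - B) f x = act A f x - act B f x"
 and act_uminus: "act (- A) f x = - act A f x"
 and act_times: "act (A * B) f = act A (act B f)"
 by (auto simp: zero_operator_def one_operator_def plus_operator_def minus_operator_def uminus_operator_def
  times_operator_def Operator_inverse act_add act_scale algebra_simps)

lemma act_plus': "act (A + B) f = (%x. act A f x + act B f x)"
 by (simp add: act_plus fun_eq_iff)

instance
proof
 have "act (0 :: ('a, 'b) operator) (%_. 1) undefined ~= act 1 (%_. 1) undefined"
  by (simp add: act_zero act_one)
 thus "(0 :: ('a, 'b) operator) ~= 1" by metis
qed (auto intro!: operator_eqI simp: act_zero act_one act_plus' act_minus act_uminus act_times act_add)

end

definition sc :: "'k => ('a, 'k::field) operator" where "sc c = Operator (%f x. c * f x)"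

lemma act_sc: "act (sc c) f x = c * f x"
 by (simp add: sc_def Operator_inverse algebra_simps)

lemmas act_simps = act_zero act_one act_plus act_minus act_uminus act_times act_sc

lemma sc_comm: "(A :: ('a, 'k::field) operator) * sc c = sc c * A"
proof (rule operator_eqI)
 fix f :: "'a => 'k" and x
 have "act (sc c) f = (%x. c * f x)" by (simp add: act_sc fun_eq_iff)
 thus "act (A * sc c) f x = act (sc c * A) f x" by (simp add: act_simps act_scale)
qed

lemma sc_mult: "sc c * sc c' = sc (c * c')" by (rule operator_eqI) (simp add: act_simps)
lemma sc_mult': "sc c * (sc c' * A) = sc (c * c') * A" by (simp add: sc_mult mult.assoc[symmetric])
lemma sc_add: "sc (c + c') = sc c + sc c'" by (rule operator_eqI) (simp add: act_simps algebra_simps)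
lemma sc_minus: "sc (c - c') = sc c - sc c'" by (rule operator_eqI) (simp add: act_simps algebra_simps)
lemma sc_uminus: "sc (- c) = - sc c" by (rule operator_eqI) (simp add: act_simps algebra_simps)
lemma sc_0 [simp]: "sc 0 = 0" by (rule operator_eqI) (simp add: act_simps)
lemma sc_1 [simp]: "sc 1 = 1" by (rule operator_eqI) (simp add: act_simps)
lemma sc_left_comm: "A * (sc c * B) = sc c * (A * B)" by (metis mult.assoc sc_comm)
lemma sc_sum: "sc (sum f S) = (\<Sum>i\<in>S. sc (f i))"
 by (induction S rule: infinite_finite_induct) (auto simp: sc_add)

lemma sc_cancel: "c ~= 0 ==> sc c * A = 0 ==> A = 0"
 by (metis left_inverse mult_zero_right sc_1 sc_mult' mult_1)

interpretation op: vector_space "%c A. sc c * (A :: ('a, 'k::field) operator)"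
 by standard (auto simp: distrib_left distrib_right sc_add sc_mult')

context super_structure_constants
begin

lemma word_induct [case_names std step]:
 assumes std: "!!w. standard w ==> P w"
  and step: "!!u a b v. bad a b ==> (a ~= b ==> P (u @ b # a # v)) ==>
  (!!k. C a b k ~= 0 ==> P (u @ k # v)) ==> P (u @ a # b # v)"
 shows "P w"
proof -
 have "wf (inv_image (less_than <*lex*> less_than) (%w. (length w, invs w)))" by auto
 thus ?thesis
 proof (induction w rule: wf_induct_rule)
  case (less w)
  show ?case
  proof (cases "standard w")
  case False
  then obtain u a b v where w: "w = u @ a # b # v" "bad a b" by (auto simp: standard_def)
  show ?thesis unfolding w(1)
  proof (rule step[OF w(2)])
  assume "a ~= b"
  thus "P (u @ b # a # v)" using w invs_swap[of b a u v] by (intro less) (auto simp: bad_def)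
  next
  fix k show "P (u @ k # v)" using w by (intro less) auto
  qed
  qed (rule std)
 qed
qed

lemma ext_step: "bad a b ==> ext g (u @ a # b # v) = s1 a b * ext g (u @ b # a # v) + (\<Sum>k<d. C1 a b k * ext g (u @ k # v))"
 using good_wordD[OF good_words refl] by (simp add: val_def)

lemma C1_0: "C a b k = 0 ==> C1 a b k = 0" by (cases "a = b") (auto simp: C1_def)

lemma ext_cong_step:
 assumes "bad a b" "a ~= b ==> ext g (u @ b # a # v) = x"
  "!!k. C a b k ~= 0 ==> ext g (u @ k # v) = y k"
 shows "ext g (u @ a # b # v) = s1 a b * x + (\<Sum>k<d. C1 a b k * y k)"
proof -
 have "(\<Sum>k<d. C1 a b k * ext g (u @ k # v)) = (\<Sum>k<d. C1 a b k * y k)"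
  by (rule sum.cong) (use assms(3) C1_0 in force)+
 moreover have "s1 a b * ext g (u @ b # a # v) = s1 a b * x" using assms(2) by (cases "a = b") (auto simp: s1_def)
 ultimately show ?thesis using ext_step[OF assms(1)] by simp
qed

lemma ext_add: "ext (%x. f x + g x) w = ext f w + ext g w"
proof (induction w rule: word_induct)
 case (step u a b v)
 show ?case
  by (subst ext_cong_step[OF step(1), of _ _ _ "ext f (u @ b # a # v) + ext g (u @ b # a # v)"
  "%k. ext f (u @ k # v) + ext g (u @ k # v)"])
  (use step(2,3) in \<open>simp_all add: ext_step[OF step(1)] algebra_simps sum.distrib\<close>)
qed (simp add: ext_standard)

lemma ext_scale: "ext (%x. c * f x) w = c * ext f w"
proof (induction w rule: word_induct)
 case (step u a b v)
 show ?case
  by (subst ext_cong_step[OF step(1), of _ _ _ "c * ext f (u @ b # a # v)" "%k. c * ext f (u @ k # v)"])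
  (use step(2,3) in \<open>simp_all add: ext_step[OF step(1)] algebra_simps sum_distrib_left\<close>)
qed (simp add: ext_standard)

definition sgnw :: "nat list => 'k" where "sgnw w = prod_list (map (%a. if par a then - 1 else 1) w)"

lemma sgnw_simps [simp]: "sgnw [] = 1" "sgnw (a # w) = (if par a then - 1 else 1) * sgnw w"
 "sgnw (u @ v) = sgnw u * sgnw v"
 by (simp_all add: sgnw_def)

lemma sgnw_sq: "sgnw w * sgnw w = 1" "sgnw w * (sgnw w * x) = x" by (induction w) auto

lemma ext_sgnw: "ext (%w. sgnw w * g w) w = sgnw w * ext g w"
proof (induction w rule: word_induct)
 case (step u a b v)
 have "sgnw (u @ k # v) = sgnw (u @ a # b # v)" if "C a b k ~= 0" for k
  using C_par[OF that] by simp
 moreover have "sgnw (u @ b # a # v) = sgnw (u @ a # b # v)" by simp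
 ultimately show ?case
  by (subst ext_cong_step[OF step(1), of _ _ _ "sgnw (u @ a # b # v) * ext g (u @ b # a # v)"
  "%k. sgnw (u @ a # b # v) * ext g (u @ k # v)"])
  (use step(2,3) in \<open>simp_all add: ext_step[OF step(1)] algebra_simps sum_distrib_left del: sgnw_simps\<close>)
qed (simp add: ext_standard)

lemma ext_fix:
 assumes "!!u a b v. rel_at G u a b v" shows "ext G w = G w"
proof (induction w rule: word_induct)
 case (step u a b v)
 have "G (u @ a # b # v) = s1 a b * G (u @ b # a # v) + (\<Sum>k<d. C1 a b k * G (u @ k # v))"
 proof (cases "a = b")
  case True
  hence "sg a b = -1" using step(1) by (auto simp: bad_def sg_def)
  thus ?thesis using True assms[of u a b v]
  by (simp add: rel_at_def s1_def C1_def sum_divide_distrib[symmetric] field_simps)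
 next
  case False thus ?thesis using assms[of u a b v] by (simp add: rel_at_def s1_def C1_def)
 qed
 thus ?case using ext_cong_step[OF step(1), of G u v "G (u @ b # a # v)" "%k. G (u @ k # v)"] step(2,3) by simp
qed (simp add: ext_standard)

definition X :: "nat => (nat list, 'k) operator" where
 "X a = Operator (%g w. ext g (w @ [a]))"

lemma act_X: "act (X a) g w = ext g (w @ [a])"
 by (simp add: X_def Operator_inverse ext_add ext_scale)

definition XW :: "nat list => (nat list, 'k) operator" where "XW w = prod_list (map X w)"

lemma XW_simps [simp]: "XW [] = 1" "XW (a # w) = X a * XW w" by (simp_all add: XW_def)
lemma XW_append: "XW (u @ v) = XW u * XW v" by (simp add: XW_def)

lemma act_XW: "w ~= [] ==> act (XW w) g u = ext g (u @ w)"
proof (induction w arbitrary: u)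
 case (Cons a w)
 show ?case
 proof (cases "w = []")
  case False
  hence "act (XW w) g = (%u. ext g (u @ w))" using Cons by auto
  hence "act (XW (a # w)) g u = ext (%u. ext g (u @ w)) (u @ [a])" by (simp add: act_simps act_X)
  also have "... = ext g ((u @ [a]) @ w)"
  proof (rule ext_fix)
  fix u a b v
  show "rel_at (%u. ext g (u @ w)) u a b v" using ext_rel[of g u a b "v @ w"] by (simp add: rel_at_def)
  qed
  finally show ?thesis by simp
 qed (simp add: act_X act_simps)
qed simp

lemma act_sum: "act (\<Sum>i\<in>S. F i) f x = (\<Sum>i\<in>S. act (F i) f x)"
 by (induction S rule: infinite_finite_induct) (auto simp: act_simps)

lemma X_rel: "X a * X b = sc (sg a b) * (X b * X a) + (\<Sum>k<d. sc (C a b k) * X k)"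
proof (rule operator_eqI)
 fix g w
 have "act (X a * X b) g w = ext g (w @ [a, b])" for a b
  using act_XW[of "[a, b]" g w] by simp
 thus "act (X a * X b) g w = act (sc (sg a b) * (X b * X a) + (\<Sum>k<d. sc (C a b k) * X k)) g w"
  using ext_rel[of g w a b "[]"]
  by (simp only: act_plus act_times[of "sc _"] act_sc act_sum act_X)
qed

lemma XW_rel: "XW (u @ a # b # v) = sc (sg a b) * XW (u @ b # a # v) + (\<Sum>k<d. sc (C a b k) * XW (u @ k # v))"
proof -
 have "XW (u @ a # b # v) = XW u * (X a * X b) * XW v" by (simp add: XW_append mult.assoc)
 also have "... = sc (sg a b) * XW (u @ b # a # v) + (\<Sum>k<d. sc (C a b k) * XW (u @ k # v))"
  unfolding X_rel[of a b]
  by (simp add: XW_append distrib_left distrib_right sum_distrib_left sum_distrib_right mult.assoc sc_left_comm)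
 finally show ?thesis .
qed

lemma XW_step: assumes "bad a b"
 shows "XW (u @ a # b # v) = sc (s1 a b) * XW (u @ b # a # v) + (\<Sum>k<d. sc (C1 a b k) * XW (u @ k # v))"
proof (cases "a = b")
 case True
 hence "sg a b = -1" using assms by (auto simp: bad_def sg_def)
 let ?T = "XW (u @ a # b # v)" and ?S = "\<Sum>k<d. sc (C a b k) * XW (u @ k # v)"
 have "?T = - ?T + ?S"
  using XW_rel[of u a b v] \<open>sg a b = -1\<close> True by (simp add: sc_uminus)
 hence "?T + ?T = ?T + (- ?T + ?S)" by (rule arg_cong)
 also have "... = ?S" by (simp only: add.assoc[symmetric] right_minus add_0_left)
 finally have "?T + ?T = ?S" .
 moreover have "sc 2 * ?T = ?T + ?T" by (metis distrib_right mult_1 one_add_one sc_1 sc_add)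
 ultimately have "sc (1/2) * (sc 2 * ?T) = sc (1/2) * ?S" by simp
 thus ?thesis using True
  by (simp add: sc_mult' s1_def C1_def sum_distrib_left del: XW_simps)
next
 case False thus ?thesis using XW_rel[of u a b v] by (simp add: s1_def C1_def)
qed

definition co :: "(nat list => 'k) => (nat list, 'k) operator => 'k" where "co g A = act A g []"

lemma standard_Nil [simp]: "standard []" by (simp add: standard_def)

lemma co_XW: "co g (XW w) = ext g w"
 by (cases "w = []") (simp_all add: co_def act_XW act_simps ext_standard del: XW_simps(2))

lemma co_add: "co g (A + B) = co g A + co g B"
 and co_minus: "co g (A - B) = co g A - co g B"
 and co_sc: "co g (sc c * A) = c * co g A"
 and co_0 [simp]: "co g 0 = 0"
 and co_sum: "co g (\<Sum>i\<in>S. F i) = (\<Sum>i\<in>S. co g (F i))"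
 by (simp_all add: co_def act_simps act_sum)

lemma XW_std_span:
 assumes "!!u a b v. u @ a # b # v : S ==> u @ b # a # v : S"
  and "!!u a b v k. u @ a # b # v : S ==> C a b k ~= 0 ==> u @ k # v : S"
  and "w : S"
 shows "XW w : op.span (XW ` {w : S. standard w})"
 using assms(3)
proof (induction w rule: word_induct)
 case (std w) thus ?case by (auto intro: op.span_base)
next
 case (step u a b v)
 have "sc (s1 a b) * XW (u @ b # a # v) : op.span (XW ` {w : S. standard w})"
  using step(2) assms(1)[OF step.prems] by (cases "a = b") (auto simp: s1_def op.span_zero intro!: op.span_scale)
 moreover have "sc (C1 a b k) * XW (u @ k # v) : op.span (XW ` {w : S. standard w})" for k
  using step(3) assms(2)[OF step.prems] C1_0[of a b k] by (cases "C a b k = 0") (auto simp: op.span_zero intro!: op.span_scale)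
 ultimately show ?case unfolding XW_step[OF step(1)] by (intro op.span_add op.span_sum)
qed

lemma span_words:
 assumes "x : op.span (XW ` S)"
 obtains A a where "finite A" "A <= S" "x = (\<Sum>w\<in>A. sc (a w) * XW w)"
proof -
 from assms obtain t r where t: "finite t" "t <= XW ` S" "x = (\<Sum>y\<in>t. sc (r y) * y)"
  by (auto simp: op.span_explicit)
 let ?A = "inv_into S XW ` t"
 have inj: "inj_on (inv_into S XW) t" using t(2) by (simp add: inj_on_inv_into)
 have "(\<Sum>w\<in>?A. sc (r (XW w)) * XW w) = x" unfolding t(3) sum.reindex[OF inj]
 proof (rule sum.cong[OF refl])
  fix y assume "y : t"
  hence "XW (inv_into S XW y) = y" using t(2) by (intro f_inv_into_f) blast
  thus "((%w. sc (r (XW w)) * XW w) \<circ> inv_into S XW) y = sc (r y) * y" by simp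
 qed
 moreover have "?A <= S" using t(2) inv_into_into[of _ XW S] by blast
 ultimately show thesis using that[of ?A "%w. r (XW w)"] t(1) by auto
qed

lemma co_std_sum:
 assumes "finite A" "!!w. w : A ==> standard w"
 shows "co g (\<Sum>w\<in>A. sc (a w) * XW w) = (\<Sum>w\<in>A. a w * g w)"
 using assms by (simp add: co_sum co_sc co_XW ext_standard)

definition delta :: "nat list => nat list => 'k" where "delta w = (%w'. if w' = w then 1 else 0)"

lemma co_delta_sum:
 assumes "finite A" "!!w. w : A ==> standard w" "w : A"
 shows "co (delta w) (\<Sum>w\<in>A. sc (a w) * XW w) = a w"
 using co_std_sum[OF assms(1,2), of "delta w" a] assms by (simp add: delta_def if_distrib cong: if_cong)

lemma std_span_zero:
 assumes "x : op.span (XW ` S)" "!!w. w : S ==> standard w" "!!w. w : S ==> co (delta w) x = 0"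
 shows "x = 0"
proof -
 obtain A a where A: "finite A" "A <= S" "x = (\<Sum>w\<in>A. sc (a w) * XW w)" by (rule span_words[OF assms(1)])
 have "a w = 0" if "w : A" for w
 proof -
  have "co (delta w) x = a w" unfolding A(3)
  by (rule co_delta_sum[OF A(1) _ that]) (use A(2) assms(2) in auto)
  thus ?thesis using assms(3) A(2) that by auto
 qed
 thus ?thesis using A by simp
qed

lemma standard_iff: "standard w \<longleftrightarrow> sorted_wrt (%a b. ~ bad a b) w"
proof (induction w)
 case (Cons a w)
 have "standard (a # w) \<longleftrightarrow> (\<forall>b v. w = b # v --> ~ bad a b) & standard w"
 proof
  assume s: "standard (a # w)"
  have "~ bad a b" if "w = b # v" for b v
  using s that unfolding standard_def by (metis append_Nil)
  moreover have "standard w" using s unfolding standard_def by (metis append_Cons)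
  ultimately show "(\<forall>b v. w = b # v --> ~ bad a b) & standard w" by blast
 next
  assume r: "(\<forall>b v. w = b # v --> ~ bad a b) & standard w"
  show "standard (a # w)" unfolding standard_def
  proof clarify
  fix u x y v assume "a # w = u @ x # y # v" "bad x y"
  thus False using r unfolding standard_def by (cases u) (simp_all, blast+)
  qed
 qed
 also have "... \<longleftrightarrow> sorted_wrt (%a b. ~ bad a b) (a # w)"
  unfolding Cons by (cases w) (auto simp: bad_def)
 finally show ?case .
qed simp

lemma standard_count: "standard w ==> par a ==> count (mset w) a <= 1"
proof (induction w)
 case (Cons b w)
 hence "a = b ==> count (mset w) a = 0" by (auto simp: standard_iff bad_def count_eq_zero_iff)
 thus ?case using Cons by (auto simp: standard_iff)
qed simp

lemma standard_sorted: "standard w ==> sorted w"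
 unfolding standard_iff by (rule sorted_wrt_mono_rel[of w "%a b. ~ bad a b" "(\<le>)"]) (auto simp: bad_def)

lemma standard_append: "standard (u @ v) \<longleftrightarrow> standard u & standard v & (\<forall>a\<in>set u. \<forall>b\<in>set v. ~ bad a b)"
 by (simp add: standard_iff sorted_wrt_append)

lemma standard_unique: "standard w ==> standard w' ==> mset w = mset w' ==> w = w'"
 by (metis standard_sorted properties_for_sort)

lemma ext_zero: "(!!w'. length w' <= length w ==> g w' = 0) ==> ext g w = 0"
proof (induction w rule: word_induct)
 case (step u a b v)
 thus ?case using ext_cong_step[OF step(1), of g u v 0 "%_. 0"] by simp
qed (simp add: ext_standard)

text \<open>Modulo shorter words, a word is a nonzero multiple of its sorted form, unless an odd letter repeats.\<close>

lemma ext_top: "\<exists>\<epsilon>. (standard (sort w) --> \<epsilon> ~= 0) \<and>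
  (\<forall>g. (\<forall>w'. length w' < length w --> g w' = 0) --> ext g w = \<epsilon> * g (sort w))"
proof (induction w rule: word_induct)
 case (std w)
 hence "sort w = w" using standard_sorted by (simp add: sorted_sort_id)
 thus ?case using std by (intro exI[of _ 1]) (simp add: ext_standard)
next
 case (step u a b v)
 have low: "ext g (u @ k # v) = 0" if "\<forall>w'. length w' < length (u @ a # b # v) --> g w' = 0" for g k
  by (rule ext_zero) (use that in auto)
 have st: "sort (u @ b # a # v) = sort (u @ a # b # v)"
  by (rule properties_for_sort) (simp_all add: add_mset_commute)
 show ?case
 proof (cases "a = b")
  case True
  hence "par a" using step(1) by (simp add: bad_def)
  have "~ standard (sort (u @ a # b # v))"
  using standard_count[OF _ \<open>par a\<close>, of "sort (u @ a # b # v)"] True by auto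
  thus ?thesis using ext_step[OF step(1)] low True by (intro exI[of _ 0]) (simp add: s1_def)
 next
  case False
  then obtain \<epsilon> where e: "standard (sort (u @ b # a # v)) --> \<epsilon> ~= 0"
  "!!g. (\<forall>w'. length w' < length (u @ b # a # v) --> g w' = 0) ==> ext g (u @ b # a # v) = \<epsilon> * g (sort (u @ b # a # v))"
  using step(2) by blast
  have "s1 a b ~= 0" using False by (simp add: s1_def sg_def)
  thus ?thesis using e unfolding st
  by (intro exI[of _ "s1 a b * \<epsilon>"]) (auto simp: ext_step[OF step(1)] low)
 qed
qed

definition Sg :: "(nat list, 'k) operator" where "Sg = Operator (%g w. sgnw w * g w)"

lemma act_Sg: "act Sg g w = sgnw w * g w"
 by (simp add: Sg_def Operator_inverse algebra_simps)

lemma Sg_Sg: "Sg * Sg = 1"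
 by (rule operator_eqI) (simp add: act_simps act_Sg sgnw_sq)

lemma X_Sg: "X a * Sg = sc (if par a then - 1 else 1) * (Sg * X a)"
proof (rule operator_eqI)
 fix g w
 have "act Sg g = (%w. sgnw w * g w)" by (simp add: act_Sg fun_eq_iff)
 thus "act (X a * Sg) g w = act (sc (if par a then - 1 else 1) * (Sg * X a)) g w"
  by (simp add: act_simps act_Sg act_X ext_sgnw)
qed

definition kappa :: "(nat list, 'k) operator => (nat list, 'k) operator" where "kappa A = Sg * A * Sg"

lemma kappa_mult: "kappa (A * B) = kappa A * kappa B"
proof -
 have "Sg * A * Sg * (Sg * B * Sg) = Sg * A * (Sg * Sg) * B * Sg" by (simp only: mult.assoc)
 thus ?thesis by (simp add: kappa_def Sg_Sg mult.assoc)
qed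

lemma kappa_kappa [simp]: "kappa (kappa A) = A"
proof -
 have "Sg * (Sg * A * Sg) * Sg = (Sg * Sg) * A * (Sg * Sg)" by (simp only: mult.assoc)
 thus ?thesis by (simp add: kappa_def Sg_Sg)
qed

lemma kappa_add: "kappa (A + B) = kappa A + kappa B"
 and kappa_minus: "kappa (A - B) = kappa A - kappa B"
 and kappa_sc: "kappa (sc c * A) = sc c * kappa A"
 and kappa_1 [simp]: "kappa 1 = 1"
 and kappa_0 [simp]: "kappa 0 = 0"
 by (simp_all add: kappa_def algebra_simps Sg_Sg sc_left_comm)

lemma kappa_sum: "kappa (\<Sum>i\<in>S. F i) = (\<Sum>i\<in>S. kappa (F i))"
 by (induction S rule: infinite_finite_induct) (auto simp: kappa_add)

lemma kappa_X: "kappa (X a) = sc (if par a then - 1 else 1) * X a"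
proof -
 have "kappa (X a) = Sg * (X a * Sg)" by (simp add: kappa_def mult.assoc)
 also have "... = sc (if par a then - 1 else 1) * ((Sg * Sg) * X a)" unfolding X_Sg by (simp only: sc_left_comm mult.assoc)
 finally show ?thesis by (simp add: Sg_Sg)
qed

lemma kappa_XW: "kappa (XW w) = sc (sgnw w) * XW w"
proof (induction w)
 case (Cons a w)
 thus ?case
  by (simp only: XW_simps kappa_mult kappa_X mult.assoc sc_left_comm[of "X a"] sc_mult' sgnw_simps)
qed simp

end
section \<open>The module generated by the product of the positive odd elements\<close>

definition type_I_degree :: "nat => nat => nat => int" where
 "type_I_degree N M a = (if a < N then - 1 else if a < M then 0 else if a < M + N then 1 else 0)"

text \<open>The letters below \<open>N\<close> are the \<open>f i\<close>, those from \<open>N\<close> to \<open>M\<close> span the even part, and the last \<open>N\<close> letters are the \<open>e i\<close>.\<close>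

locale type_I_constants = super_structure_constants d par C
 for d par and C :: "nat => nat => nat => 'k::field_char_0" +
 fixes N M :: nat and h :: "nat => 'k"
 assumes d_eq: "d = M + N" and N_le_M: "N <= M"
  and par_iff: "par a \<longleftrightarrow> a < N \<or> M <= a & a < M + N"
  and C_degree: "C a b k ~= 0 ==> a < d & b < d \<and>
  type_I_degree N M k = type_I_degree N M a + type_I_degree N M b"
  and dual: "i < N ==> j < N ==> (\<Sum>k<d. C (M + i) j k * h k) = (if i = j then 1 else 0)"
begin

abbreviation "LF \<equiv> {..<N}"
abbreviation "LZ \<equiv> {N..<M}"
abbreviation "LE \<equiv> {M..<M+N}"

lemma C_F_F: "a : LF ==> b : LF ==> C a b k = 0"
 and C_E_E: "a : LE ==> b : LE ==> C a b k = 0"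
 and C_Z_F: "a : LZ ==> b : LF ==> C a b k ~= 0 ==> k : LF"
 and C_Z_E: "a : LZ ==> b : LE ==> C a b k ~= 0 ==> k : LE"
 and C_E_F: "a : LE ==> b : LF ==> C a b k ~= 0 ==> k : LZ"
 and C_Z_Z: "a : LZ ==> b : LZ ==> C a b k ~= 0 ==> k : LZ"
 using C_degree[of a b k] C_bound[of a b k] N_le_M d_eq
 by (cases "C a b k = 0"; auto simp: type_I_degree_def split: if_splits)+

definition anti :: "nat set => bool" where
 "anti S \<longleftrightarrow> (\<forall>a\<in>S. \<forall>b\<in>S. X a * X b = - (X b * X a))"

lemma anti_F: "anti LF" and anti_E: "anti LE"
proof -
 have "X a * X b = - (X b * X a)" if "a : LF" "b : LF" for a b
 proof -
  have "(\<Sum>k<d. sc (C a b k) * X k) = 0" using C_F_F[OF that] by simp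
  moreover have "sg a b = - 1" using that by (simp add: sg_def par_iff)
  ultimately show ?thesis using X_rel[of a b] by (simp only: sc_uminus sc_1 mult_minus_left mult_1 add_0_right)
 qed
 thus "anti LF" unfolding anti_def by blast
 have "X a * X b = - (X b * X a)" if "a : LE" "b : LE" for a b
 proof -
  have "(\<Sum>k<d. sc (C a b k) * X k) = 0" using C_E_E[OF that] by simp
  moreover have "sg a b = - 1" using that by (simp add: sg_def par_iff)
  ultimately show ?thesis using X_rel[of a b] by (simp only: sc_uminus sc_1 mult_minus_left mult_1 add_0_right)
 qed
 thus "anti LE" unfolding anti_def by blast
qed

lemma antiD: "anti S ==> a : S ==> b : S ==> X a * X b = - (X b * X a)"
 unfolding anti_def by blast

lemma X_sq: "anti S ==> a : S ==> X a * X a = 0"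
proof -
 assume "anti S" "a : S"
 hence e: "X a * X a = - (X a * X a)" unfolding anti_def by blast
 have "X a * X a + X a * X a = 0" by (subst e) simp
 hence "sc 2 * (X a * X a) = 0" by (metis distrib_right mult_1 one_add_one sc_1 sc_add)
 thus ?thesis by (rule sc_cancel[rotated]) simp
qed

lemma XW_move: "anti S ==> set u <= S ==> a : S ==> XW u * X a = sc ((-1) ^ length u) * (X a * XW u)"
proof (induction u)
 case (Cons b u)
 have "XW (b # u) * X a = X b * (XW u * X a)" by (simp add: mult.assoc)
 also have "... = sc ((-1) ^ length u) * (X b * X a * XW u)"
  using Cons by (simp add: sc_left_comm[of "X b"] mult.assoc)
 also have "X b * X a = - (X a * X b)" by (rule antiD[OF Cons.prems(1)]) (use Cons.prems in simp_all)
 finally show ?case by (simp add: mult.assoc sc_uminus)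
qed simp

lemma XW_not_distinct: "anti S ==> set w <= S ==> ~ distinct w ==> XW w = 0"
proof -
 assume S: "anti S" "set w <= S" "~ distinct w"
 then obtain u v z a where w: "w = u @ [a] @ v @ [a] @ z" using not_distinct_decomp by blast
 have "XW w = XW u * (X a * (XW v * X a)) * XW z" unfolding w by (simp add: XW_append mult.assoc)
 also have "X a * (XW v * X a) = sc ((-1) ^ length v) * (X a * X a * XW v)"
  using XW_move[OF S(1), of v a] S(2) w by (simp only: sc_left_comm[of "X a"] mult.assoc) (auto simp: sc_left_comm[of "X a"])
 also have "X a * X a = 0" using X_sq[OF S(1), of a] S(2) w by auto
 finally show ?thesis by simp
qed

lemma XW_perm: "anti S ==> set w <= S ==> mset w = mset w' ==> \<exists>s. s ~= 0 & XW w = sc s * XW w'"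
proof (induction w' arbitrary: w)
 case Nil thus ?case by (intro exI[of _ 1]) simp
next
 case (Cons a w')
 have "a : set w" using Cons.prems(3) by (metis list.set_intros(1) set_mset_mset)
 then obtain u v where w: "w = u @ a # v" by (meson split_list)
 have m: "mset (u @ v) = mset w'" using Cons.prems(3) w by simp
 have S: "set (u @ v) <= S" "a : S" using Cons.prems(2) w by auto
 obtain s where s: "s ~= 0" "XW (u @ v) = sc s * XW w'" using Cons.IH[OF Cons.prems(1) S(1) m] by blast
 have "XW w = (XW u * X a) * XW v" unfolding w by (simp add: XW_append mult.assoc)
 also have "XW u * X a = sc ((-1) ^ length u) * (X a * XW u)" using XW_move[OF Cons.prems(1)] S by simp
 also have "... * XW v = sc ((-1) ^ length u) * (X a * XW (u @ v))" by (simp add: XW_append mult.assoc)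
 also have "... = sc ((-1) ^ length u * s) * XW (a # w')"
  unfolding s(2) sc_left_comm[of "X a"] sc_mult' by simp
 finally show ?case using s(1) by (intro exI[of _ "(-1) ^ length u * s"]) simp
qed

definition U where "U = op.span (XW ` {w. set w <= {..<d}})"
definition U0 where "U0 = op.span (XW ` {w. set w <= LZ})"

lemma span_term: "(c ~= 0 ==> x : S) ==> sc c * x : op.span S"
 by (cases "c = 0") (simp_all add: op.span_zero op.span_scale op.span_base)

lemma span_mult:
 assumes "x : op.span P" "y : op.span Q" "op.subspace V" "!!p q. p : P ==> q : Q ==> p * q : V"
 shows "x * y : V"
proof -
 have *: "p * y : V" if "p : P" for p
  using assms(2)
 proof (induction rule: op.span_induct_alt)
  case base show ?case using assms(3) by (simp add: op.subspace_0)
 next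
  case (step c x y)
  hence "sc c * (p * x) + p * y : V" using assms that by (intro op.subspace_add op.subspace_scale) auto
  thus ?case by (simp add: distrib_left sc_left_comm[of p])
 qed
 show ?thesis using assms(1)
 proof (induction rule: op.span_induct_alt)
  case base show ?case using assms(3) by (simp add: op.subspace_0)
 next
  case (step c x z)
  hence "sc c * (x * y) + z * y : V" using assms * by (intro op.subspace_add op.subspace_scale) auto
  thus ?case by (simp add: distrib_right mult.assoc)
 qed
qed

lemma span_mult_words:
 assumes "x : op.span (XW ` P)" "y : op.span (XW ` Q)" "!!p q. p : P ==> q : Q ==> p @ q : R"
 shows "x * y : op.span (XW ` R)"
proof (rule span_mult[OF assms(1,2) op.subspace_span])
 fix p q assume "p : XW ` P" "q : XW ` Q"
 then obtain a b where "a : P" "b : Q" "p = XW a" "q = XW b" by blast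
 thus "p * q : op.span (XW ` R)" using assms(3)[of a b] by (auto simp: XW_append[symmetric] intro!: op.span_base)
qed

lemma U_mult: "x : U ==> y : U ==> x * y : U" unfolding U_def by (rule span_mult_words) auto
lemma U0_mult: "x : U0 ==> y : U0 ==> x * y : U0" unfolding U0_def by (rule span_mult_words) auto
lemma U0_U: "x : U0 ==> x : U"
 unfolding U_def U0_def by (elim op.span_mono[THEN subsetD, rotated]) (auto intro!: image_mono simp: d_eq)
lemma U_XW: "set w <= {..<d} ==> XW w : U" unfolding U_def by (auto intro: op.span_base)
lemma U0_XW: "set w <= LZ ==> XW w : U0" unfolding U0_def by (auto intro: op.span_base)
lemma U_X: "a < d ==> X a : U" using U_XW[of "[a]"] by simp
lemma U0_X: "a : LZ ==> X a : U0" using U0_XW[of "[a]"] by simp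
lemma U_sub: "op.subspace U" and U0_sub: "op.subspace U0" by (auto simp: U_def U0_def)
lemma U0_1: "1 : U0" using U0_XW[of "[]"] by simp
lemma U0_std: "U0 = op.span (XW ` {w. set w <= LZ & standard w})"
proof -
 have "XW w : op.span (XW ` {w : {w. set w <= LZ}. standard w})" if "set w <= LZ" for w
 proof (rule XW_std_span)
  fix u a b v k assume "u @ a # b # v : {w. set w <= LZ}" "C a b k ~= 0"
  thus "u @ k # v : {w. set w <= LZ}" using C_Z_Z[of a b k] by simp
 qed (use that in auto)
 hence "XW ` {w. set w <= LZ} <= op.span (XW ` {w. set w <= LZ & standard w})" by auto
 hence "U0 <= op.span (XW ` {w. set w <= LZ & standard w})" unfolding U0_def by (rule op.span_minimal) simp
 moreover have "op.span (XW ` {w. set w <= LZ & standard w}) <= U0" unfolding U0_def by (rule op.span_mono) auto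
 ultimately show ?thesis by blast
qed

lemma U_std: "U = op.span (XW ` {w. set w <= {..<d} & standard w})"
proof -
 have "XW w : op.span (XW ` {w : {w. set w <= {..<d}}. standard w})" if "set w <= {..<d}" for w
 proof (rule XW_std_span)
  fix u a b v k assume "u @ a # b # v : {w. set w <= {..<d}}" "C a b k ~= 0"
  thus "u @ k # v : {w. set w <= {..<d}}" using C_bound[of a b k] by simp
 qed (use that in auto)
 hence "XW ` {w. set w <= {..<d}} <= op.span (XW ` {w. set w <= {..<d} & standard w})" by auto
 hence "U <= op.span (XW ` {w. set w <= {..<d} & standard w})" unfolding U_def by (rule op.span_minimal) simp
 moreover have "op.span (XW ` {w. set w <= {..<d} & standard w}) <= U" unfolding U_def by (rule op.span_mono) auto
 ultimately show ?thesis by blast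
qed

definition Tp where "Tp = XW [M..<M+N]"
definition Tm where "Tm = XW (rev [0..<N])"

lemma E_Tp: "a : LE ==> X a * Tp = 0"
 using XW_not_distinct[OF anti_E, of "a # [M..<M+N]"] by (auto simp: Tp_def)

lemma Tp_U: "Tp : U" and Tm_U: "Tm : U"
 unfolding Tp_def Tm_def by (rule U_XW; simp add: d_eq subset_iff)+

subsection \<open>The induced modules\<close>

lemma even_word:
 assumes "!!b k. b : S ==> C a b k ~= 0 ==> k : S" "a : LZ" "set w <= S"
 shows "X a * XW w - XW w * X a : op.span (XW ` {v. set v <= S & length v = length w})"
 using assms(3)
proof (induction w)
 case Nil thus ?case by (simp add: op.span_zero)
next
 case (Cons b w)
 let ?V = "op.span (XW ` {v. set v <= S & length v = length (b # w)})"
 have sg: "sg a b = 1" using assms(2) N_le_M by (auto simp: sg_def par_iff)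
 have "X b * (X a * XW w - XW w * X a) : ?V"
  by (rule span_mult_words[where P = "{[b]}", OF _ Cons.IH]) (use Cons.prems in \<open>auto intro: op.span_base\<close>)
 moreover have "(\<Sum>k<d. sc (C a b k) * X k) * XW w : ?V"
 proof (rule span_mult_words[where P = "{[k] | k. k : S}" and Q = "{w}"])
  show "(\<Sum>k<d. sc (C a b k) * X k) : op.span (XW ` {[k] |k. k : S})"
  proof (rule op.span_sum)
  fix k
  have "X k : XW ` {[k] |k. k : S}" if "C a b k ~= 0"
  by (rule image_eqI[of _ _ "[k]"]) (use assms(1)[of b k] Cons.prems that in auto)
  thus "sc (C a b k) * X k : op.span (XW ` {[k] |k. k : S})" by (rule span_term)
  qed
 qed (use Cons.prems in \<open>auto intro: op.span_base\<close>)
 moreover have "X a * XW (b # w) - XW (b # w) * X a =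
  X b * (X a * XW w - XW w * X a) + (\<Sum>k<d. sc (C a b k) * X k) * XW w"
 proof -
  have ab: "X a * X b = X b * X a + (\<Sum>k<d. sc (C a b k) * X k)" using X_rel[of a b] sg by simp
  have "X a * XW (b # w) = (X a * X b) * XW w" by (simp add: mult.assoc)
  thus ?thesis unfolding ab by (simp add: algebra_simps)
 qed
 ultimately show ?case by (simp only: op.span_add)
qed

definition HH where "HH a b = (\<Sum>k<d. sc (C a b k) * X k)"

fun DD where "DD a [] = 0" | "DD a (b # w) = XW w * HH a b - X b * DD a w"

lemma HH_span: "a : LE ==> b : LF ==> HH a b : op.span (X ` LZ)"
 unfolding HH_def
proof (rule op.span_sum)
 fix k assume "a : LE" "b : LF"
 thus "sc (C a b k) * X k : op.span (X ` LZ)"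
  using C_E_F[of a b k] by (intro span_term) blast
qed

lemma HH_word: assumes "a : LE" "b : LF" "set w <= LF"
 shows "HH a b * XW w - XW w * HH a b : op.span (XW ` {v. set v <= LF & length v = length w})"
 using HH_span[OF assms(1,2)]
proof (induction rule: op.span_induct_alt)
 case base show ?case by (simp add: op.span_zero)
next
 case (step c x y)
 then obtain e where e: "e : LZ" "x = X e" by blast
 have "(sc c * x + y) * XW w - XW w * (sc c * x + y) = sc c * (X e * XW w - XW w * X e) + (y * XW w - XW w * y)"
  unfolding e(2) by (simp add: algebra_simps sc_left_comm[of "XW w"])
 moreover have "X e * XW w - XW w * X e : op.span (XW ` {v. set v <= LF & length v = length w})"
  by (rule even_word[OF C_Z_F]) (use e assms in auto)
 ultimately show ?case using step by (simp only: op.span_add op.span_scale)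
qed

lemma e_word:
 assumes "a : LE" "set w <= LF"
 shows "X a * XW w - (sc ((-1) ^ length w) * (XW w * X a) + DD a w)
  : op.span (XW ` {v. set v <= LF & Suc (length v) = length w})"
 using assms(2)
proof (induction w)
 case Nil thus ?case by (simp add: op.span_zero)
next
 case (Cons b w)
 let ?V = "op.span (XW ` {v. set v <= LF & Suc (length v) = length (b # w)})"
 let ?t = "X a * XW w - (sc ((-1) ^ length w) * (XW w * X a) + DD a w)"
 have sg: "sg a b = -1" using assms(1) Cons.prems N_le_M by (auto simp: sg_def par_iff)
 have 1: "X b * ?t : ?V"
  by (rule span_mult_words[where P = "{[b]}", OF _ Cons.IH]) (use Cons.prems in \<open>auto intro: op.span_base\<close>)
 have 2: "HH a b * XW w - XW w * HH a b : ?V" using HH_word[OF assms(1), of b w] Cons.prems by simp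
 have ab: "X a * X b = - (X b * X a) + HH a b"
  using X_rel[of a b] sg by (simp add: HH_def sc_uminus)
 have s: "X b * (sc ((- 1) ^ length w) * (XW w * X a)) = sc ((- 1) ^ length w) * (X b * (XW w * X a))"
  by (rule sc_left_comm)
 have "X a * XW (b # w) - (sc ((-1) ^ length (b # w)) * (XW (b # w) * X a) + DD a (b # w)) =
     (HH a b * XW w - XW w * HH a b) - X b * ?t"
 proof -
  have "X a * XW (b # w) = (X a * X b) * XW w" by (simp add: mult.assoc)
  thus ?thesis unfolding ab by (simp add: algebra_simps s sc_uminus)
 qed
 thus ?case using 1 2 by (simp only: op.span_diff)
qed

definition KZ where "KZ Z k = op.span {XW w * z | w z. set w <= LF & length w = k & z : Z}"

definition hw_set where
 "hw_set Z \<longleftrightarrow> (\<forall>a\<in>LZ. \<forall>z\<in>Z. X a * z : Z) & (\<forall>a\<in>LE. \<forall>z\<in>Z. X a * z = 0)"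

lemma KZ_gen: "set w <= LF ==> length w = k ==> z : Z ==> XW w * z : KZ Z k"
 unfolding KZ_def by (rule op.span_base) blast

lemma KZ_span: "t : op.span (XW ` {v. set v <= LF & length v = k}) ==> z : Z ==> t * z : KZ Z k"
proof (induction rule: op.span_induct_alt)
 case base show ?case by (simp add: KZ_def op.span_zero)
next
 case (step c x y)
 hence "sc c * (x * z) + y * z : KZ Z k"
  unfolding KZ_def by (intro op.span_add op.span_scale) (auto intro!: op.span_base)
 thus ?case by (simp add: distrib_right mult.assoc)
qed

lemma KZ_closed:
 assumes "!!w z. set w <= LF ==> length w = k ==> z : Z ==> A * (XW w * z) : V" "op.subspace V" "x : KZ Z k"
 shows "A * x : V"
 using assms(3) unfolding KZ_def
proof (induction rule: op.span_induct_alt)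
 case base show ?case using assms(2) by (simp add: op.subspace_0)
next
 case (step c x y)
 hence "sc c * (A * x) + A * y : V" using assms by (intro op.subspace_add op.subspace_scale) auto
 thus ?case by (simp add: distrib_left sc_left_comm[of A])
qed

lemma KZ_sub: "op.subspace (KZ Z k)" by (simp add: KZ_def)

lemma KZ_even: assumes "hw_set Z" "a : LZ" "x : KZ Z k" shows "X a * x : KZ Z k"
proof (rule KZ_closed[OF _ KZ_sub assms(3)])
 fix w z assume w: "set w <= LF" "length w = k" "z : Z"
 have "XW w * (X a * z) : KZ Z k" using w assms by (intro KZ_gen) (auto simp: hw_set_def)
 moreover have "(X a * XW w - XW w * X a) * z : KZ Z k"
  by (rule KZ_span) (use even_word[of LF a w, OF C_Z_F] assms w in auto)
 ultimately have "XW w * (X a * z) + (X a * XW w - XW w * X a) * z : KZ Z k" by (simp add: op.subspace_add KZ_sub)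
 thus "X a * (XW w * z) : KZ Z k" by (simp add: algebra_simps)
qed

lemma KZ_F: assumes "a : LF" "x : KZ Z k" shows "X a * x : KZ Z (Suc k)"
proof (rule KZ_closed[OF _ KZ_sub assms(2)])
 fix w z assume w: "set w <= LF" "length w = k" "z : Z"
 thus "X a * (XW w * z) : KZ Z (Suc k)" using KZ_gen[of "a # w" "Suc k" z Z] assms by (simp add: mult.assoc)
qed

lemma DD_KZ:
 assumes "hw_set Z" "a : LE" "z : Z"
 shows "set (u @ w) <= LF ==> length (u @ w) = Suc k ==> XW u * DD a w * z : KZ Z k"
proof (induction w arbitrary: u)
 case Nil thus ?case by (simp add: KZ_def op.span_zero)
next
 case (Cons b w)
 have b: "b : LF" using Cons.prems by simp
 have "XW (u @ w) * x * z : KZ Z k" if "x : op.span (X ` LZ)" for x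
  using that
 proof (induction rule: op.span_induct_alt)
  case base show ?case by (simp add: KZ_def op.span_zero)
 next
  case (step c x y)
  then obtain e where e: "e : LZ" "x = X e" by blast
  have "XW (u @ w) * (X e * z) : KZ Z k"
  by (rule KZ_gen) (use Cons.prems e assms in \<open>auto simp: hw_set_def\<close>)
  hence "sc c * (XW (u @ w) * (X e * z)) + XW (u @ w) * y * z : KZ Z k"
  using step by (intro op.subspace_add op.subspace_scale KZ_sub)
  thus ?case unfolding e(2)
  by (simp only: distrib_left distrib_right sc_left_comm[of "XW (u @ w)"] mult.assoc)
 qed
 from this[OF HH_span[OF assms(2) b]] have 1: "XW (u @ w) * HH a b * z : KZ Z k" .
 have 2: "XW (u @ [b]) * DD a w * z : KZ Z k" using Cons.prems by (intro Cons.IH) auto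
 have "XW u * DD a (b # w) * z = XW (u @ w) * HH a b * z - XW (u @ [b]) * DD a w * z"
  by (simp add: XW_append algebra_simps)
 thus ?case using 1 2 by (simp add: op.subspace_diff KZ_sub)
qed

lemma KZ_E: assumes "hw_set Z" "a : LE" "x : KZ Z (Suc k)" shows "X a * x : KZ Z k"
proof (rule KZ_closed[OF _ KZ_sub assms(3)])
 fix w z assume w: "set w <= LF" "length w = Suc k" "z : Z"
 let ?t = "X a * XW w - (sc ((-1) ^ length w) * (XW w * X a) + DD a w)"
 have 1: "?t * z : KZ Z k"
  by (rule KZ_span) (use e_word[OF assms(2) w(1)] w in auto)
 have 2: "DD a w * z : KZ Z k" using DD_KZ[OF assms(1,2) w(3), of "[]" w k] w by simp
 have "X a * z = 0" using assms w by (auto simp: hw_set_def)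
 hence "X a * (XW w * z) = ?t * z + DD a w * z"
  by (simp add: algebra_simps)
 thus "X a * (XW w * z) : KZ Z k" using 1 2 by (simp add: op.subspace_add KZ_sub)
qed

lemma KZ_E0: assumes "hw_set Z" "a : LE" "x : KZ Z 0" shows "X a * x = 0"
proof -
 have "X a * x : {0}"
  by (rule KZ_closed[OF _ _ assms(3)]) (use assms in \<open>auto simp: hw_set_def\<close>)
 thus ?thesis by simp
qed

lemma KZ_kill: assumes "hw_set Z" shows "set v <= LE ==> k < length v ==> x : KZ Z k ==> XW v * x = 0"
proof (induction v arbitrary: k x rule: rev_induct)
 case (snoc a v)
 have "XW (v @ [a]) * x = XW v * (X a * x)" by (simp add: XW_append mult.assoc)
 also have "... = 0"
 proof (cases k)
  case 0 thus ?thesis using KZ_E0[OF assms, of a x] snoc.prems by simp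
 next
  case (Suc j)
  thus ?thesis using snoc.IH[of j "X a * x"] KZ_E[OF assms, of a x j] snoc.prems by simp
 qed
 finally show ?case .
qed simp

definition Sing where "Sing = {z. \<forall>a\<in>LE. X a * z = 0}"
definition ZT where "ZT = {XW y * Tp | y. set y <= LZ}"
abbreviation "K \<equiv> KZ ZT"

lemma E_Z: assumes "a : LE" "b : LZ" shows "X a * X b = X b * X a + (\<Sum>k\<in>LE. sc (C a b k) * X k)"
proof -
 have "(\<Sum>k<d. sc (C a b k) * X k) = (\<Sum>k\<in>LE. sc (C a b k) * X k)"
 proof (rule sum.mono_neutral_right)
  show "\<forall>k\<in>{..<d} - LE. sc (C a b k) * X k = 0"
  proof
  fix k assume "k : {..<d} - LE"
  hence "C b a k = 0" using C_Z_E[OF assms(2,1), of k] by auto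
  thus "sc (C a b k) * X k = 0" using C_skew[of a b k] by simp
  qed
 qed (auto simp: d_eq)
 moreover have "sg a b = 1" using assms N_le_M by (auto simp: sg_def par_iff)
 ultimately show ?thesis using X_rel[of a b] by simp
qed

lemma hw_Sing: "hw_set Sing"
proof -
 have "X a * (X b * z) = 0" if "a : LE" "b : LZ" "z : Sing" for a b z
 proof -
  have "X a * (X b * z) = (X a * X b) * z" by (simp add: mult.assoc)
  also have "... = 0" unfolding E_Z[OF that(1,2)] using that
  by (simp add: Sing_def distrib_right sum_distrib_right mult.assoc)
  finally show ?thesis .
 qed
 thus ?thesis by (auto simp: hw_set_def Sing_def)
qed

lemma ZT_Sing: "ZT <= Sing"
proof -
 have "XW y * Tp : Sing" if "set y <= LZ" for y using that
 proof (induction y)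
  case Nil thus ?case using E_Tp by (simp add: Sing_def)
 next
  case (Cons b y) thus ?case using hw_Sing by (simp add: hw_set_def mult.assoc)
 qed
 thus ?thesis by (auto simp: ZT_def)
qed

lemma hw_ZT: "hw_set ZT"
proof -
 have "X a * z : ZT" if "a : LZ" "z : ZT" for a z
 proof -
  from that obtain y where "z = XW y * Tp" "set y <= LZ" by (auto simp: ZT_def)
  hence "X a * z = XW (a # y) * Tp" "set (a # y) <= LZ" using that by (auto simp: mult.assoc)
  thus ?thesis unfolding ZT_def by blast
 qed
 thus ?thesis using ZT_Sing by (auto simp: hw_set_def Sing_def)
qed

definition Ktot where "Ktot = op.span (\<Union>k. K k)"

lemma K_span: "x : K k ==> x : op.span (\<Union>k. K k)" by (rule op.span_base) blast

lemma Ktot_X: assumes "a < d" "x : Ktot" shows "X a * x : Ktot"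
 using assms(2) unfolding Ktot_def
proof (induction rule: op.span_induct_alt)
 case base show ?case by (simp add: op.span_zero)
next
 case (step c x y)
 then obtain k where k: "x : K k" by blast
 have "X a * x : op.span (\<Union>k. K k)"
 proof -
  consider "a : LF" | "a : LZ" | "a : LE" using assms(1) d_eq N_le_M by fastforce
  thus ?thesis
  proof cases
  case 1 thus ?thesis using KZ_F[OF _ k] K_span by blast
  next
  case 2 thus ?thesis using KZ_even[OF hw_ZT _ k] K_span by blast
  next
  case 3
  show ?thesis
  proof (cases k)
  case 0 thus ?thesis using KZ_E0[OF hw_ZT 3] k by (simp add: op.span_zero)
  next
  case (Suc j) thus ?thesis using KZ_E[OF hw_ZT 3] k K_span by blast
  qed
  qed
 qed
 hence "sc c * (X a * x) + X a * y : op.span (\<Union>k. K k)" using step by (intro op.span_add op.span_scale)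
 thus ?case by (simp add: distrib_left sc_left_comm[of "X a"])
qed

lemma Ktot_sub: "op.subspace Ktot" by (simp add: Ktot_def)

lemma Ktot_U: assumes "u : U" "x : Ktot" shows "u * x : Ktot"
proof -
 have "XW w * x : Ktot" if "set w <= {..<d}" for w using that
  by (induction w) (auto simp: assms Ktot_X mult.assoc)
 thus ?thesis using span_mult[OF assms(1)[unfolded U_def] op.span_base[of x "{x}"] Ktot_sub] by auto
qed

lemma Tp_K0: "x : U0 ==> x * Tp : K 0"
 unfolding U0_def
proof (induction rule: op.span_induct_alt)
 case base show ?case by (simp add: KZ_def op.span_zero)
next
 case (step c x y)
 then obtain w where "x = XW w" "set w <= LZ" by blast
 hence "x * Tp : K 0" using KZ_gen[of "[]" 0 "XW w * Tp" ZT] by (auto simp: ZT_def)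
 hence "sc c * (x * Tp) + y * Tp : K 0" using step KZ_sub by (intro op.subspace_add op.subspace_scale)
 thus ?case by (simp add: distrib_right mult.assoc)
qed

lemma K_Ktot: "x : K k ==> x : Ktot" unfolding Ktot_def by (rule op.span_base) blast

lemma U_Tp: "u : U ==> u * Tp : Ktot"
 using Ktot_U[of u Tp] K_Ktot[of Tp 0] Tp_K0[OF U0_1] by simp

definition fI where "fI I = XW (sorted_list_of_set I)"

lemma K_form_gen:
 assumes "set w <= LF" "x : U0"
 shows "\<exists>y. (\<forall>I. y I : U0) & XW w * (x * Tp) = (\<Sum>I\<in>Pow LF. fI I * (y I * Tp))"
proof (cases "distinct w")
 case True
 let ?I = "set w"
 have "mset w = mset (sorted_list_of_set ?I)"
  using True by (subst set_eq_iff_mset_eq_distinct[symmetric]) auto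
 then obtain s where s: "XW w = sc s * fI ?I" using XW_perm[OF anti_F assms(1)] unfolding fI_def by blast
 have "(\<Sum>I\<in>Pow LF. fI I * ((if I = ?I then sc s * x else 0) * Tp)) =
  (\<Sum>I\<in>Pow LF. if I = ?I then fI I * (sc s * x * Tp) else 0)" by (rule sum.cong) auto
 also have "... = fI ?I * (sc s * x * Tp)" using assms(1) by (simp add: sum.delta)
 also have "... = XW w * (x * Tp)" unfolding s by (simp add: mult.assoc sc_left_comm[of "fI _"])
 finally show ?thesis using assms(2)
  by (intro exI[of _ "%I. if I = ?I then sc s * x else 0"])
  (auto intro: op.subspace_scale[OF U0_sub] op.subspace_0[OF U0_sub])
next
 case False
 hence "XW w = 0" by (rule XW_not_distinct[OF anti_F assms(1)])
 thus ?thesis by (intro exI[of _ "%_. 0"]) (simp add: op.subspace_0[OF U0_sub])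
qed

lemma Ktot_form:
 assumes "x : Ktot"
 shows "\<exists>y. (\<forall>I. y I : U0) & x = (\<Sum>I\<in>Pow LF. fI I * (y I * Tp))"
proof -
 let ?P = "%x. \<exists>y. (\<forall>I. y I : U0) & x = (\<Sum>I\<in>Pow LF. fI I * (y I * Tp))"
 have add: "?P (sc c * x + z)" if xz: "?P x" "?P z" for c x z
 proof -
  obtain y where y: "(\<forall>I. y I : U0) & x = (\<Sum>I\<in>Pow LF. fI I * (y I * Tp))" using xz(1) by (rule exE)
  obtain y' where y': "(\<forall>I. y' I : U0) & z = (\<Sum>I\<in>Pow LF. fI I * (y' I * Tp))" using xz(2) by (rule exE)
  have e: "fI I * ((sc c * y I + y' I) * Tp) = sc c * (fI I * (y I * Tp)) + fI I * (y' I * Tp)" for I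
  by (simp add: distrib_left distrib_right mult.assoc sc_left_comm[of "fI I"])
  show ?thesis
  proof (intro exI[of _ "%I. sc c * y I + y' I"] conjI allI)
  fix I show "sc c * y I + y' I : U0"
  using y y' by (intro op.subspace_add[OF U0_sub] op.subspace_scale[OF U0_sub]) auto
  next
  show "sc c * x + z = (\<Sum>I\<in>Pow LF. fI I * ((sc c * y I + y' I) * Tp))"
  unfolding e sum.distrib sum_distrib_left[symmetric] using y y' by metis
  qed
 qed
 have zero: "?P 0" by (intro exI[of _ "%_. 0"]) (simp add: op.subspace_0[OF U0_sub])
 have K: "?P x" if "x : K k" for x k
  using that unfolding KZ_def
 proof (induction rule: op.span_induct_alt)
  case (step c x y)
  then obtain w v where "x = XW w * (XW v * Tp)" "set w <= LF" "set v <= LZ" by (auto simp: ZT_def)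
  hence "?P x" using K_form_gen[of w "XW v"] U0_XW by simp
  thus ?case by (rule add[OF _ step(2)])
 qed (rule zero)
 show ?thesis using assms unfolding Ktot_def
 proof (induction rule: op.span_induct_alt)
  case (step c x y)
  hence "?P x" using K by blast
  thus ?case by (rule add[OF _ step(2)])
 qed (rule zero)
qed

lemma std_tri:
 assumes "I <= LF" "set w <= LZ" "standard w"
 shows "standard (sorted_list_of_set I @ w @ [M..<M+N])"
proof -
 have fin: "finite I" using assms(1) finite_subset by blast
 have "standard (sorted_list_of_set I)"
  unfolding standard_iff
  by (rule sorted_wrt_mono_rel[OF _ strict_sorted_list_of_set]) (auto simp: bad_def)
 moreover have "standard [M..<M+N]"
  unfolding standard_iff by (rule sorted_wrt_mono_rel[OF _ sorted_wrt_upt]) (auto simp: bad_def)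
 ultimately show ?thesis using assms N_le_M fin by (fastforce simp: standard_append bad_def)
qed

lemma co_tri:
 assumes "I <= LF" "J <= LF" "set w <= LZ" "standard w" "x : U0"
 shows "co (delta (sorted_list_of_set I @ w @ [M..<M+N])) (fI J * (x * Tp)) = (if I = J then co (delta w) x else 0)"
 using assms(5) unfolding U0_std
proof (induction rule: op.span_induct_alt)
 case base show ?case by simp
next
 case (step c x y)
 then obtain v where v: "x = XW v" "set v <= LZ" "standard v" by blast
 have fin: "finite I" "finite J" using assms(1,2) finite_subset by blast+
 have "sorted_list_of_set I @ w @ [M..<M+N] = sorted_list_of_set J @ v @ [M..<M+N] \<longleftrightarrow> I = J & w = v"
 proof
  assume eq: "sorted_list_of_set I @ w @ [M..<M+N] = sorted_list_of_set J @ v @ [M..<M+N]"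
  have 0: "filter (%a. a < N) (sorted_list_of_set I' @ w' @ [M..<M+N]) = sorted_list_of_set I'"
  if "I' <= LF" "set w' <= LZ" "finite I'" for I' w'
  proof -
  have "filter (%a. a < N) (sorted_list_of_set I') = sorted_list_of_set I'" using that by (intro filter_True) auto
  moreover have "filter (%a. a < N) w' = []" "filter (%a. a < N) [M..<M+N] = []"
  using that N_le_M by (auto simp: filter_empty_conv)
  ultimately show ?thesis by simp
  qed
  have "sorted_list_of_set I = filter (%a. a < N) (sorted_list_of_set I @ w @ [M..<M+N])"
  by (rule 0[OF assms(1,3) fin(1), symmetric])
  also have "... = sorted_list_of_set J" unfolding eq by (rule 0[OF assms(2) v(2) fin(2)])
  finally have "sorted_list_of_set I = sorted_list_of_set J" .
  thus "I = J & w = v" using eq fin by (auto dest: sorted_list_of_set_inject)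
 qed auto
 moreover have "fI J * (XW v * Tp) = XW (sorted_list_of_set J @ v @ [M..<M+N])"
  by (simp add: fI_def Tp_def XW_append)
 moreover have "fI J * ((sc c * x + y) * Tp) = sc c * (fI J * (x * Tp)) + fI J * (y * Tp)"
  by (simp add: algebra_simps sc_left_comm[of "fI J"])
 ultimately show ?case using step(2) std_tri[OF assms(2) v(2,3)] v
  by (auto simp: co_add co_sc co_XW ext_standard delta_def)
qed

text \<open>Freeness of \<open>K\<close> over the even part: distinct sorted words in the \<open>f i\<close>, followed by standard even words and by the full
product of the \<open>e i\<close>, are distinct standard words.\<close>

lemma indep:
 assumes "!!I. y I : U0" "(\<Sum>I\<in>Pow LF. fI I * (y I * Tp)) = 0" "I <= LF"
 shows "y I = 0"
proof (rule std_span_zero[of _ "{w. set w <= LZ & standard w}"])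
 show "y I : op.span (XW ` {w. set w <= LZ & standard w})" using assms(1) U0_std by simp
 fix w assume w: "w : {w. set w <= LZ & standard w}"
 have "0 = co (delta (sorted_list_of_set I @ w @ [M..<M+N])) (\<Sum>J\<in>Pow LF. fI J * (y J * Tp))"
  using assms(2) by simp
 also have "... = (\<Sum>J\<in>Pow LF. if I = J then co (delta w) (y J) else 0)"
  unfolding co_sum by (rule sum.cong) (use w assms co_tri in auto)
 also have "... = co (delta w) (y I)" using assms(3) by (simp add: sum.delta')
 finally show "co (delta w) (y I) = 0" by simp
qed auto

lemma Tp_cancel: assumes "x : U0" "x * Tp = 0" shows "x = 0"
proof -
 have "(\<Sum>I\<in>Pow LF. fI I * ((if I = {} then x else 0) * Tp)) = (\<Sum>I\<in>Pow LF. if I = {} then x * Tp else 0)"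
  by (rule sum.cong) (auto simp: fI_def)
 also have "... = 0" using assms(2) by simp
 finally show ?thesis using indep[of "%I. if I = {} then x else 0" "{}"] assms(1) op.subspace_0[OF U0_sub] by simp
qed

end
section \<open>Faithfulness\<close>

context type_I_constants
begin

lemma U0_induct [consumes 1, case_names one X zero lin]:
 assumes "x : U0" and one: "P 1" and X: "!!a x. a : LZ ==> x : U0 ==> P x ==> P (X a * x)"
  and zero: "P 0" and lin: "!!c x y. P x ==> P y ==> P (sc c * x + y)"
 shows "P x"
proof -
 have w: "P (XW w)" if "set w <= LZ" for w using that by (induction w) (auto simp: one X U0_XW)
 show ?thesis using assms(1) unfolding U0_def
 proof (induction rule: op.span_induct_alt)
  case (step c x y) thus ?case using w lin by blast
 qed (rule zero)
qed

lemma top_word_character: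
 assumes S: "anti S" "!!b k. b : S ==> C a b k ~= 0 ==> k : S" and a: "a : LZ" and t: "set t = S" "distinct t"
 shows "\<exists>\<chi>. X a * XW t = XW t * X a + sc \<chi> * XW t"
proof -
 have "XW v : op.span {XW t}" if vS: "set v <= S" "length v = length t" for v
 proof (cases "distinct v")
  case True
  hence "card (set v) = card S" using that t by (metis distinct_card)
  hence "set v = S" using that t by (metis List.finite_set card_subset_eq)
  hence "mset v = mset t" using True t by (metis set_eq_iff_mset_eq_distinct)
  then obtain s where "XW v = sc s * XW t" using XW_perm[OF S(1) vS(1)] by blast
  thus ?thesis by (simp add: op.span_scale op.span_base)
 next
  case False thus ?thesis using XW_not_distinct[OF S(1) that(1)] by (simp add: op.span_zero)
 qed
 hence "op.span (XW ` {v. set v <= S & length v = length t}) <= op.span {XW t}"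
  by (intro op.span_minimal) auto
 moreover have "X a * XW t - XW t * X a : op.span (XW ` {v. set v <= S & length v = length t})"
  by (rule even_word[OF S(2) a]) (use t in auto)
 ultimately obtain \<chi> where "X a * XW t - XW t * X a = sc \<chi> * XW t" using op.span_singleton by blast
 thus ?thesis by (intro exI[of _ \<chi>]) (simp add: algebra_simps)
qed

lemma Tp_character: "a : LZ ==> \<exists>\<chi>. X a * Tp = Tp * X a + sc \<chi> * Tp"
 unfolding Tp_def by (rule top_word_character[OF anti_E C_Z_E]) auto

lemma Tm_character: "a : LZ ==> \<exists>\<chi>. X a * Tm = Tm * X a + sc \<chi> * Tm"
 unfolding Tm_def by (rule top_word_character[OF anti_F C_Z_F]) auto

lemma normal_right:
 assumes "!!a. a : LZ ==> \<exists>\<chi>. X a * T = T * X a + sc \<chi> * T" "x : U0"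
 shows "\<exists>y\<in>U0. x * T = T * y"
 using assms(2)
proof (induction rule: U0_induct)
 case one show ?case using U0_1 by (intro bexI[of _ 1]) auto
next
 case (X a x)
 then obtain y where y: "y : U0" "x * T = T * y" by blast
 obtain \<chi> where \<chi>: "X a * T = T * X a + sc \<chi> * T" using assms(1) X by blast
 have "X a * x * T = (X a * T) * y" by (simp add: mult.assoc y(2))
 also have "... = T * (X a * y + sc \<chi> * y)" unfolding \<chi> by (simp add: algebra_simps sc_left_comm[of T])
 finally show ?case using y(1) X by (auto intro!: op.subspace_add[OF U0_sub] op.subspace_scale[OF U0_sub] U0_mult U0_X)
next
 case zero show ?case using op.subspace_0[OF U0_sub] by (intro bexI[of _ 0]) auto
next
 case (lin c x y)
 then obtain x' y' where "x' : U0" "x * T = T * x'" "y' : U0" "y * T = T * y'" by blast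
 thus ?case
  by (intro bexI[of _ "sc c * x' + y'"])
  (auto simp: distrib_left distrib_right mult.assoc sc_left_comm[of T]
  intro!: op.subspace_add[OF U0_sub] op.subspace_scale[OF U0_sub])
qed

lemma normal_left:
 assumes "!!a. a : LZ ==> \<exists>\<chi>. X a * T = T * X a + sc \<chi> * T" "x : U0"
 shows "\<exists>y\<in>U0. T * x = y * T"
 using assms(2)
proof (induction rule: U0_induct)
 case one show ?case using U0_1 by (intro bexI[of _ 1]) auto
next
 case (X a x)
 then obtain y where y: "y : U0" "T * x = y * T" by blast
 obtain \<chi> where \<chi>: "X a * T = T * X a + sc \<chi> * T" using assms(1) X by blast
 have "T * (X a * x) = (X a * T - sc \<chi> * T) * x" unfolding \<chi> by (simp add: mult.assoc)
 also have "... = (X a * y - sc \<chi> * y) * T" by (simp add: algebra_simps y(2))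
 finally show ?case using y(1) X by (auto intro!: op.subspace_diff[OF U0_sub] op.subspace_scale[OF U0_sub] U0_mult U0_X)
next
 case zero show ?case using op.subspace_0[OF U0_sub] by (intro bexI[of _ 0]) auto
next
 case (lin c x y)
 then obtain x' y' where "x' : U0" "T * x = x' * T" "y' : U0" "T * y = y' * T" by blast
 thus ?case
  by (intro bexI[of _ "sc c * x' + y'"])
  (auto simp: distrib_left distrib_right mult.assoc sc_left_comm[of T]
  intro!: op.subspace_add[OF U0_sub] op.subspace_scale[OF U0_sub])
qed

definition cI where "cI I = XW (sorted_list_of_set (LF - I))"

lemma cI_fI: assumes "I <= LF" shows "\<exists>s. s ~= 0 & cI I * fI I = sc s * Tm"
proof -
 have fin: "finite I" using assms finite_subset by blast
 have "mset (sorted_list_of_set (LF - I) @ sorted_list_of_set I) = mset (rev [0..<N])"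
  by (rule set_eq_iff_mset_eq_distinct[THEN iffD1]) (use assms fin in auto)
 thus ?thesis using XW_perm[OF anti_F, of "sorted_list_of_set (LF - I) @ sorted_list_of_set I" "rev [0..<N]"] assms fin
  by (auto simp: cI_def fI_def Tm_def XW_append)
qed

definition sI where "sI I = (SOME s. s ~= 0 & cI I * fI I = sc s * Tm)"

lemma sI: "I <= LF ==> sI I ~= 0" "I <= LF ==> cI I * fI I = sc (sI I) * Tm"
 using someI_ex[OF cI_fI] unfolding sI_def by blast+

lemma proj:
 assumes "I <= LF" "J <= LF" "z : Sing"
 shows "Tp * (cI I * (fI J * z)) = (if I = J then sc (sI I) * (Tp * (Tm * z)) else 0)"
proof -
 have fin: "finite I" "finite J" using assms finite_subset by blast+
 let ?w = "sorted_list_of_set (LF - I) @ sorted_list_of_set J"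
 have w: "cI I * fI J = XW ?w" by (simp add: cI_def fI_def XW_append)
 have sw: "set ?w <= LF" using assms fin by auto
 consider "I = J" | "I ~= J" "J \<inter> (LF - I) ~= {}" | "J \<subset> I" using assms by blast
 thus ?thesis
 proof cases
  case 1
  have "Tp * (cI I * (fI J * z)) = Tp * ((cI I * fI I) * z)" using 1 by (simp add: mult.assoc)
  also have "... = sc (sI I) * (Tp * (Tm * z))"
  unfolding sI(2)[OF assms(1)] by (simp only: mult.assoc sc_left_comm[of Tp])
  finally show ?thesis using 1 by simp
 next
  case 2
  hence "~ distinct ?w" using fin by auto
  hence "cI I * fI J = 0" unfolding w by (rule XW_not_distinct[OF anti_F sw])
  hence "cI I * (fI J * z) = 0" by (simp add: mult.assoc[symmetric])
  thus ?thesis using 2 by simp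
 next
  case 3
  have "card J < card I" using 3 fin by (simp add: psubset_card_mono)
  moreover have "card (LF - I) = N - card I" "card I <= N"
  using assms(1) fin card_mono[OF _ assms(1)] by (auto simp: card_Diff_subset)
  ultimately have "length ?w < length [M..<M+N]" using fin by simp
  moreover have "XW ?w * z : KZ Sing (length ?w)" by (rule KZ_gen[OF sw _ assms(3)]) simp
  ultimately have "Tp * (XW ?w * z) = 0" unfolding Tp_def by (intro KZ_kill[OF hw_Sing]) auto
  thus ?thesis using 3 w by (auto simp: mult.assoc[symmetric])
 qed
qed

subsection \<open>Evaluating leading terms at the form \<open>h\<close>\<close>

definition gm where "gm m w = (if length w = m & set w <= LZ then prod_list (map h w) else 0)"

lemma gm_low: "length w < m ==> ext (gm m) w = 0"
 by (rule ext_zero) (auto simp: gm_def)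

lemma ext_gm: "set w <= LZ ==> length w = m ==> ext (gm m) w = prod_list (map h w)"
proof (induction w rule: word_induct)
 case (std w) thus ?case by (simp add: ext_standard gm_def)
next
 case (step u a b v)
 have "a ~= b" using step(1) step.prems N_le_M by (auto simp: bad_def par_iff)
 moreover have "sg a b = 1" using step.prems N_le_M by (auto simp: sg_def par_iff)
 moreover have "ext (gm m) (u @ k # v) = 0" for k using step.prems by (intro gm_low) auto
 ultimately show ?case using step(2) step.prems ext_step[OF step(1), of "gm m" u v]
  by (simp add: s1_def mult_ac)
qed

definition U0le where "U0le m = op.span (XW ` {w. set w <= LZ & length w <= m})"
definition ev where "ev m x = co (gm m) x"

lemma U0le_sub: "op.subspace (U0le m)" by (simp add: U0le_def)
lemma U0le_U0: "x : U0le m ==> x : U0"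
 unfolding U0le_def U0_def by (elim op.span_mono[THEN subsetD, rotated]) auto

lemma ev_lin: "ev m (sc c * x + y) = c * ev m x + ev m y" by (simp add: ev_def co_add co_sc)

lemma ev_low: "x : U0le m ==> m < n ==> ev n x = 0"
 unfolding U0le_def
proof (induction rule: op.span_induct_alt)
 case base show ?case by (simp add: ev_def)
next
 case (step c x y) thus ?case by (auto simp: ev_lin) (auto simp: ev_def co_XW gm_low)
qed

lemma ev_X: assumes "x : U0le m" "a : LZ"
 shows "X a * x : U0le (Suc m) & ev (Suc m) (X a * x) = h a * ev m x"
 using assms(1) unfolding U0le_def
proof (induction rule: op.span_induct_alt)
 case base show ?case by (simp add: ev_def op.span_zero)
next
 case (step c x y)
 then obtain w where w: "x = XW w" "set w <= LZ" "length w <= m" by blast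
 have 1: "X a * x : op.span (XW ` {w. set w <= LZ & length w <= Suc m})"
  by (rule op.span_base, rule image_eqI[of _ _ "a # w"]) (use w assms(2) in auto)
 have 2: "ev (Suc m) (X a * x) = h a * ev m x"
  using w assms(2) ext_gm[of "a # w" "Suc m"] ext_gm[of w m] gm_low[of w m] gm_low[of "a # w" "Suc m"]
  by (cases "length w = m") (simp_all add: ev_def XW_simps(2)[symmetric] co_XW del: XW_simps)
 have e: "X a * (sc c * x + y) = sc c * (X a * x) + X a * y" by (simp add: distrib_left sc_left_comm[of "X a"])
 show ?case unfolding e using 1 2 step by (simp add: ev_lin op.span_add op.span_scale distrib_left)
qed

lemma ev_span_X:
 assumes "x : U0le m" "(!!k. c k ~= 0 ==> k : LZ)"
 shows "(\<Sum>k<d. sc (c k) * X k) * x : U0le (Suc m) \<and>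
  ev (Suc m) ((\<Sum>k<d. sc (c k) * X k) * x) = (\<Sum>k<d. c k * h k) * ev m x"
proof -
 have e: "(\<Sum>k<d. sc (c k) * X k) * x = (\<Sum>k<d. sc (c k) * (X k * x))" by (simp add: sum_distrib_right mult.assoc)
 have 1: "sc (c k) * (X k * x) : U0le (Suc m) & co (gm (Suc m)) (sc (c k) * (X k * x)) = c k * h k * ev m x" for k
  using ev_X[OF assms(1), of k] assms(2)[of k]
  by (cases "c k = 0") (auto simp: ev_def co_sc op.subspace_0[OF U0le_sub] op.subspace_scale[OF U0le_sub])
 thus ?thesis unfolding e ev_def co_sum
  by (auto simp: sum_distrib_right ev_def intro: op.subspace_sum[OF U0le_sub])
qed

definition hH where "hH a b = (\<Sum>k<d. C a b k * h k)"

definition Q where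
 "Q P j A \<delta> \<longleftrightarrow> (\<forall>m x. x : U0le m -->
     (\<exists>y\<in>U0le (m + j). P * (A * (x * Tp)) = y * Tp & ev (m + j) y = \<delta> * ev m x))"

lemma Q_lin: assumes "Q P j A \<delta>" "Q P j B \<epsilon>" shows "Q P j (sc c * A + B) (c * \<delta> + \<epsilon>)"
 unfolding Q_def
proof (intro allI impI)
 fix m x assume x: "x : U0le m"
 obtain y z where "y : U0le (m + j)" "P * (A * (x * Tp)) = y * Tp" "ev (m + j) y = \<delta> * ev m x"
  "z : U0le (m + j)" "P * (B * (x * Tp)) = z * Tp" "ev (m + j) z = \<epsilon> * ev m x"
  using assms x unfolding Q_def by meson
 thus "\<exists>y\<in>U0le (m + j). P * ((sc c * A + B) * (x * Tp)) = y * Tp & ev (m + j) y = (c * \<delta> + \<epsilon>) * ev m x"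
  by (intro bexI[of _ "sc c * y + z"])
  (auto simp: ev_lin distrib_left distrib_right mult.assoc sc_left_comm[of P] op.subspace_add[OF U0le_sub] op.subspace_scale[OF U0le_sub])
qed

lemma Q_0: "Q P j 0 0"
 unfolding Q_def by (intro allI impI bexI[of _ 0]) (auto simp: ev_def op.subspace_0[OF U0le_sub])

lemma Q_Suc: assumes "Q P j A \<delta>" shows "Q P (Suc j) A 0"
 unfolding Q_def
proof (intro allI impI)
 fix m x assume x: "x : U0le m"
 then obtain y where y: "y : U0le (m + j)" "P * (A * (x * Tp)) = y * Tp" using assms unfolding Q_def by meson
 have "y : U0le (m + Suc j)"
  using y(1) unfolding U0le_def by (elim op.span_mono[THEN subsetD, rotated]) auto
 thus "\<exists>y\<in>U0le (m + Suc j). P * (A * (x * Tp)) = y * Tp & ev (m + Suc j) y = 0 * ev m x"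
  using y ev_low[OF y(1), of "m + Suc j"] by auto
qed

lemma Q_H: assumes "Q P j A \<delta>" "a : LE" "b : LF" shows "Q P (Suc j) (A * HH a b) (\<delta> * hH a b)"
 unfolding Q_def
proof (intro allI impI)
 fix m x assume x: "x : U0le m"
 have 1: "HH a b * x : U0le (Suc m)" "ev (Suc m) (HH a b * x) = hH a b * ev m x"
  using ev_span_X[OF x, of "C a b"] C_E_F[OF assms(2,3)] by (auto simp: HH_def hH_def)
 obtain y where y: "y : U0le (Suc m + j)" "P * (A * ((HH a b * x) * Tp)) = y * Tp"
  "ev (Suc m + j) y = \<delta> * ev (Suc m) (HH a b * x)"
  using assms(1) 1(1) unfolding Q_def by meson
 thus "\<exists>y\<in>U0le (m + Suc j). P * (A * HH a b * (x * Tp)) = y * Tp & ev (m + Suc j) y = \<delta> * hH a b * ev m x"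
  using 1(2) by (intro bexI[of _ y]) (auto simp: mult.assoc)
qed

lemma Q_DD:
 assumes IH: "!!v. set v <= LF ==> length v = k ==> \<exists>\<delta>. Q P k (XW v) \<delta>" and a: "a : LE"
 shows "set (u @ w) <= LF ==> length (u @ w) = Suc k ==>
  \<exists>\<delta>. Q P (Suc k) (XW u * DD a w) \<delta> & ((\<forall>b\<in>set w. hH a b = 0) --> \<delta> = 0)"
proof (induction w arbitrary: u)
 case Nil show ?case using Q_0 by auto
next
 case (Cons b w)
 obtain \<delta> where d: "Q P k (XW (u @ w)) \<delta>" using IH[of "u @ w"] Cons.prems by auto
 have 1: "Q P (Suc k) (XW (u @ w) * HH a b) (\<delta> * hH a b)" by (rule Q_H[OF d a]) (use Cons.prems in auto)
 obtain \<epsilon> where e: "Q P (Suc k) (XW (u @ [b]) * DD a w) \<epsilon>" "(\<forall>b\<in>set w. hH a b = 0) --> \<epsilon> = 0"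
  using Cons.IH[of "u @ [b]"] Cons.prems by auto
 have "XW u * DD a (b # w) = sc (-1) * (XW (u @ [b]) * DD a w) + XW (u @ w) * HH a b"
  by (simp add: XW_append algebra_simps sc_uminus)
 thus ?case using Q_lin[OF e(1) 1, of "-1"] e(2) by (intro exI[of _ "-1 * \<epsilon> + \<delta> * hH a b"]) auto
qed

lemma Q_span: assumes "t : op.span (XW ` V)" "!!v. v : V ==> \<exists>\<delta>. Q P j (XW v) \<delta>" shows "\<exists>\<delta>. Q P j t \<delta>"
 using assms(1)
proof (induction rule: op.span_induct_alt)
 case base show ?case using Q_0 by blast
next
 case (step c x y) thus ?case using assms(2) Q_lin by (metis imageE)
qed

lemma Q_words:
 "k <= N ==> set J <= LF ==> length J = k ==>
  \<exists>\<delta>. Q (XW [M..<M+k]) k (XW J) \<delta> & (J = rev [0..<k] --> \<delta> = 1)"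
proof (induction k arbitrary: J)
 case 0
 have "Q 1 0 1 1" unfolding Q_def by (auto intro!: exI)
 thus ?case using 0 by auto
next
 case (Suc k)
 let ?P = "XW [M..<M+k]" and ?a = "M + k"
 have a: "?a : LE" using Suc.prems by auto
 have IH: "\<exists>\<delta>. Q ?P k (XW v) \<delta>" if "set v <= LF" "length v = k" for v
  using Suc.IH[OF _ that] Suc.prems by auto
 let ?t = "X ?a * XW J - (sc ((-1) ^ length J) * (XW J * X ?a) + DD ?a J)"
 have "\<exists>\<delta>. Q ?P k ?t \<delta>"
  by (rule Q_span[OF e_word[OF a Suc.prems(2)]]) (use IH Suc.prems(3) in auto)
 then obtain \<tau> where "Q ?P k ?t \<tau>" by blast
 hence t: "Q ?P (Suc k) ?t 0" by (rule Q_Suc)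
 have D: "\<exists>\<delta>. Q ?P (Suc k) (DD ?a J) \<delta> & (J = rev [0..<Suc k] --> \<delta> = 1)"
 proof (cases "J = rev [0..<Suc k]")
  case False
  thus ?thesis using Q_DD[OF IH a, of "[]" J] Suc.prems by auto
 next
  case True
  let ?w = "rev [0..<k]"
  have J: "J = k # ?w" using True by simp
  obtain \<delta> where d: "Q ?P k (XW ?w) \<delta>" "\<delta> = 1" using Suc.IH[of ?w] Suc.prems by (auto simp: subset_iff)
  have hk: "hH ?a b = (if k = b then 1 else 0)" if "b < N" for b
  using dual[of k b] that Suc.prems by (simp add: hH_def)
  have 1: "Q ?P (Suc k) (XW ?w * HH ?a k) (\<delta> * hH ?a k)"
  by (rule Q_H[OF d(1) a]) (use Suc.prems in auto)
  obtain \<epsilon> where e: "Q ?P (Suc k) (XW [k] * DD ?a ?w) \<epsilon>" "(\<forall>b\<in>set ?w. hH ?a b = 0) --> \<epsilon> = 0"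
  using Q_DD[OF IH a, of "[k]" ?w] Suc.prems J by auto
  have "\<epsilon> = 0" using e(2) hk Suc.prems by auto
  have "DD ?a J = sc (-1) * (XW [k] * DD ?a ?w) + XW ?w * HH ?a k"
  unfolding J by (simp add: sc_uminus)
  thus ?thesis using Q_lin[OF e(1) 1, of "-1"] \<open>\<epsilon> = 0\<close> d(2) hk[of k] Suc.prems
  by (intro exI[of _ 1]) auto
 qed
 then obtain \<delta> where d: "Q ?P (Suc k) (DD ?a J) \<delta>" "J = rev [0..<Suc k] --> \<delta> = 1" by blast
 have sum: "Q ?P (Suc k) (?t + DD ?a J) \<delta>" using Q_lin[OF t d(1), of 1] by simp
 have "Q (XW [M..<M+Suc k]) (Suc k) (XW J) \<delta>"
  unfolding Q_def
 proof (intro allI impI)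
  fix m x assume x: "x : U0le m"
  have "x * Tp : K 0" by (rule Tp_K0[OF U0le_U0[OF x]])
  hence "X ?a * (x * Tp) = 0" by (rule KZ_E0[OF hw_ZT a])
  hence "X ?a * (XW J * (x * Tp)) = (?t + DD ?a J) * (x * Tp)"
  by (simp add: algebra_simps)
  hence "XW [M..<M+Suc k] * (XW J * (x * Tp)) = ?P * ((?t + DD ?a J) * (x * Tp))"
  by (simp add: XW_append mult.assoc)
  thus "\<exists>y\<in>U0le (m + Suc k). XW [M..<M+Suc k] * (XW J * (x * Tp)) = y * Tp & ev (m + Suc k) y = \<delta> * ev m x"
  using sum x unfolding Q_def by metis
 qed
 thus ?case using d(2) by blast
qed

lemma Ph_ex: "\<exists>y. y : U0 & y ~= 0 & Tp * (Tm * Tp) = y * Tp"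
proof -
 have "Q Tp N Tm 1" using Q_words[of N "rev [0..<N]"] unfolding Tp_def Tm_def by (auto simp: subset_iff)
 moreover have "1 : U0le 0" unfolding U0le_def by (rule op.span_base, rule image_eqI[of _ _ "[]"]) auto
 ultimately obtain y where y: "y : U0le (0 + N)" "Tp * (Tm * (1 * Tp)) = y * Tp" "ev (0 + N) y = 1 * ev 0 1"
  unfolding Q_def by meson
 have "ev 0 1 = 1" using ext_gm[of "[]" 0] co_XW[of "gm 0" "[]"] by (simp add: ev_def)
 hence "y ~= 0" using y(3) by (auto simp: ev_def)
 thus ?thesis using y U0le_U0 by auto
qed

definition Ph where "Ph = (SOME y. y : U0 & y ~= 0 & Tp * (Tm * Tp) = y * Tp)"

lemma Ph: "Ph : U0" "Ph ~= 0" "Tp * (Tm * Tp) = Ph * Tp"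
 using someI_ex[OF Ph_ex] unfolding Ph_def by auto

lemma standard_even: "set w <= LZ ==> sorted w ==> standard w"
 unfolding standard_iff using N_le_M
 by (induction w) (auto simp: bad_def par_iff)

lemma U0_leading:
 assumes "x : U0" "x ~= 0"
 obtains A a w where "finite A" "x = (\<Sum>w\<in>A. sc (a w) * XW w)" "!!v. v : A ==> set v <= LZ & standard v"
  "w : A" "a w ~= 0" "!!v. v : A ==> length v <= length w"
  "!!v. v : A ==> length v = length w ==> mset v <= mset w"
proof -
 obtain B a where B: "finite B" "B <= {w. set w <= LZ & standard w}" "x = (\<Sum>w\<in>B. sc (a w) * XW w)"
  by (rule span_words[OF assms(1)[unfolded U0_std]])
 let ?A = "{w : B. a w ~= 0}"
 have x: "x = (\<Sum>w\<in>?A. sc (a w) * XW w)" unfolding B(3)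
  by (rule sum.mono_neutral_right) (use B in auto)
 have ne: "?A ~= {}"
 proof
  assume "?A = {}"
  thus False using x assms(2) by (simp only: sum.empty)
 qed
 have fin: "finite ?A" using B by simp
 let ?n = "Max (length ` ?A)"
 let ?A' = "{w : ?A. length w = ?n}"
 have "?n : length ` ?A" using fin ne by (intro Max_in) auto
 hence ne': "?A' ~= {}" by auto
 have fin': "finite ?A'" using fin by (rule rev_finite_subset) auto
 have "Max (mset ` ?A') : mset ` ?A'" using fin' ne' by (intro Max_in) simp_all
 then obtain w where w: "w : ?A'" "mset w = Max (mset ` ?A')" by auto
 show thesis
 proof (rule that[OF fin x])
  show "w : ?A" "a w ~= 0" using w by auto
  fix v assume v: "v : ?A"
  thus "set v <= LZ & standard v" using B by auto
  show "length v <= length w" using w v fin by (auto intro: Max_ge)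
  show "mset v <= mset w" if "length v = length w" unfolding w(2)
  by (rule Max_ge[OF finite_imageI[OF fin']]) (use v that w in auto)
 qed
qed

text \<open>Leading terms multiply, since even letters commute up to shorter words.\<close>

lemma U0_domain: assumes "x : U0" "y : U0" "x * y = 0" shows "x = 0 \<or> y = 0"
proof (rule ccontr)
 assume "~ (x = 0 \<or> y = 0)"
 hence nz: "x ~= 0" "y ~= 0" by auto
 obtain A a w where A: "finite A" "x = (\<Sum>w\<in>A. sc (a w) * XW w)" "!!v. v : A ==> set v <= LZ & standard v"
  "w : A" "a w ~= 0" "!!v. v : A ==> length v <= length w"
  "!!v. v : A ==> length v = length w ==> mset v <= mset w"
  by (rule U0_leading[OF assms(1) nz(1)]) blast
 obtain B b w' where B: "finite B" "y = (\<Sum>w\<in>B. sc (b w) * XW w)" "!!v. v : B ==> set v <= LZ & standard v"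
  "w' : B" "b w' ~= 0" "!!v. v : B ==> length v <= length w'"
  "!!v. v : B ==> length v = length w' ==> mset v <= mset w'"
  by (rule U0_leading[OF assms(2) nz(2)]) blast
 let ?s = "sort (w @ w')"
 have std: "standard ?s" by (rule standard_even) (use A(3)[OF A(4)] B(3)[OF B(4)] in auto)
 have z: "ext (delta ?s) (v @ v') = 0" if v: "v : A" "v' : B" and ne: "(v, v') ~= (w, w')" for v v'
 proof (cases "length v = length w & length v' = length w'")
  case False
  hence "length (v @ v') < length ?s" using A(6)[OF v(1)] B(6)[OF v(2)] by auto
  thus ?thesis by (intro ext_zero) (auto simp: delta_def)
 next
  case True
  have "sort (v @ v') ~= ?s"
  proof
  assume "sort (v @ v') = ?s"
  hence m: "mset v + mset v' = mset w + mset w'" by (metis mset_append mset_sort)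
  have le: "mset v <= mset w" "mset v' <= mset w'" using A(7)[OF v(1)] B(7)[OF v(2)] True by auto
  have "mset v = mset w" "mset v' = mset w'"
  using le m add_less_le_mono[of "mset v" "mset w" "mset v'" "mset w'"]
  add_le_less_mono[of "mset v" "mset w" "mset v'" "mset w'"] by (auto simp: order.order_iff_strict)
  thus False using ne standard_unique A(3)[OF v(1)] A(3)[OF A(4)] B(3)[OF v(2)] B(3)[OF B(4)] by auto
  qed
  moreover obtain \<epsilon> where "!!g. (\<forall>u. length u < length (v @ v') --> g u = 0) ==> ext g (v @ v') = \<epsilon> * g (sort (v @ v'))"
  using ext_top[of "v @ v'"] by blast
  moreover have "\<forall>u. length u < length (v @ v') --> delta ?s u = 0" using True by (auto simp: delta_def)
  ultimately show ?thesis by (simp add: delta_def)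
 qed
 obtain \<epsilon> where e: "\<epsilon> ~= 0" "!!g. (\<forall>u. length u < length (w @ w') --> g u = 0) ==> ext g (w @ w') = \<epsilon> * g (sort (w @ w'))"
  using ext_top[of "w @ w'"] std by blast
 have t: "ext (delta ?s) (w @ w') = \<epsilon>" by (subst e(2)) (auto simp: delta_def)
 have "x * y = (\<Sum>v\<in>A. \<Sum>v'\<in>B. sc (a v * b v') * XW (v @ v'))"
 proof -
  have "sc p * XW v * (sc q * XW v') = sc (p * q) * XW (v @ v')" for p q v v'
  by (simp add: mult.assoc sc_left_comm[of "XW v"] sc_mult' XW_append)
  thus ?thesis unfolding A(2) B(2) by (simp add: sum_product)
 qed
 hence "co (delta ?s) (x * y) = (\<Sum>v\<in>A. \<Sum>v'\<in>B. a v * b v' * ext (delta ?s) (v @ v'))"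
  by (simp add: co_sum co_sc co_XW)
 also have "... = (\<Sum>v\<in>A. if v = w then a w * b w' * \<epsilon> else 0)"
 proof (rule sum.cong[OF refl])
  fix v assume v: "v : A"
  show "(\<Sum>v'\<in>B. a v * b v' * ext (delta ?s) (v @ v')) = (if v = w then a w * b w' * \<epsilon> else 0)"
  proof (cases "v = w")
  case False
  hence "a v * b v' * ext (delta ?s) (v @ v') = 0" if "v' : B" for v' using z[OF v that] by simp
  thus ?thesis using False by simp
  next
  case True
  have "(\<Sum>v'\<in>B. a v * b v' * ext (delta ?s) (v @ v')) = (\<Sum>v'\<in>B. if v' = w' then a w * b w' * \<epsilon> else 0)"
  by (rule sum.cong) (use z[OF v] t True in auto)
  thus ?thesis using True B by simp
  qed
 qed
 also have "... = a w * b w' * \<epsilon>" using A by simp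
 finally show False using assms(3) A(5) B(5) e(1) by simp
qed

lemma Ph_right: "x : U0 ==> x * Ph = 0 ==> x = 0"
 and Ph_left: "x : U0 ==> Ph * x = 0 ==> x = 0"
 using U0_domain Ph by blast+

lemma sorted_split: "sorted w ==> w = filter (%a. a < N) w @ filter (%a. N <= a & a < M) w @ filter (%a. M <= a) w"
proof (induction w)
 case (Cons b w)
 hence IH: "w = filter (%a. a < N) w @ filter (%a. N <= a & a < M) w @ filter (%a. M <= a) w" by simp
 consider "b < N" | "N <= b" "b < M" | "M <= b" by linarith
 thus ?case
 proof cases
  case 1 thus ?thesis using IH N_le_M by simp
 next
  case 2
  hence "filter (%a. a < N) w = []" using Cons.prems by (auto simp: filter_empty_conv)
  thus ?thesis using IH 2 by simp
 next
  case 3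
  hence "filter (%a. a < N) w = []" "filter (%a. N <= a & a < M) w = []"
  using Cons.prems N_le_M by (auto simp: filter_empty_conv)
  thus ?thesis using IH 3 N_le_M by simp
 qed
qed simp

text \<open>If \<open>u \<noteq> 0\<close>, multiply a term of minimal \<open>e\<close>-part by the complementary \<open>e i\<close> and then by \<open>T\<^sup>- T\<^sup>+\<close>; what is left is a nonzero
coefficient times the element \<open>Ph\<close> of a domain.\<close>

lemma faithful:
 assumes u: "u : U" and kill: "!!k x. x : K k ==> u * x = 0"
 shows "u = 0"
proof (rule ccontr)
 assume "u ~= 0"
 have kill': "u * x = 0" if "x : Ktot" for x
  using that unfolding Ktot_def
 proof (induction rule: op.span_induct_alt)
  case (step c x y) thus ?case using kill by (auto simp: distrib_left sc_left_comm[of u])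
 qed simp
 obtain B a where B: "finite B" "B <= {w. set w <= {..<d} & standard w}" "u = (\<Sum>w\<in>B. sc (a w) * XW w)"
  by (rule span_words[OF u[unfolded U_std]])
 let ?A = "{w : B. a w ~= 0}"
 have ux: "u = (\<Sum>w\<in>?A. sc (a w) * XW w)" unfolding B(3)
  by (rule sum.mono_neutral_right) (use B in auto)
 have ne: "?A ~= {}"
 proof
  assume "?A = {}"
  thus False using ux \<open>u ~= 0\<close> by (simp only: sum.empty)
 qed
 have fin: "finite ?A" using B by simp
 define wF where "wF = filter (%a. a < N)"
 define wZ where "wZ = filter (%a. N <= a & a < M)"
 define wE where "wE = filter (%a. M <= a)"
 have split: "w = wF w @ wZ w @ wE w" and std: "standard w" and sd: "set w <= {..<d}" if "w : ?A" for w
  using that B(2) sorted_split[of w] standard_sorted[of w] by (auto simp: wF_def wZ_def wE_def)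
 have setF: "set (wF w) <= LF" and setZ: "set (wZ w) <= LZ" for w by (auto simp: wF_def wZ_def)
 have setE: "set (wE w) <= LE" if "w : ?A" for w using sd[OF that] d_eq by (auto simp: wE_def)
 have dis: "distinct v" if "standard v" "set v <= LF \<or> set v <= LE" for v
  using that by (induction v) (auto simp: standard_iff bad_def par_iff)
 have stdp: "standard (wF w)" "standard (wZ w)" "standard (wE w)" if "w : ?A" for w
  using std[OF that] split[OF that] by (metis standard_append)+
 have dF: "distinct (wF w)" and dE: "distinct (wE w)" if "w : ?A" for w
  using dis stdp[OF that] setF setE[OF that] by auto
 have lF: "wF w = sorted_list_of_set (set (wF w))" if "w : ?A" for w
  using dF[OF that] standard_sorted[OF stdp(1)[OF that]] by (simp add: sorted_list_of_set.idem_if_sorted_distinct)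
 let ?n = "Min ((%w. length (wE w)) ` ?A)"
 have "?n : (%w. length (wE w)) ` ?A" using fin ne by (intro Min_in) auto
 then obtain w0 where w0: "w0 : ?A" "length (wE w0) = ?n" by auto
 have min: "length (wE w0) <= length (wE w)" if "w : ?A" for w
  unfolding w0(2) by (rule Min_le) (use fin that in auto)
 define c where "c = sorted_list_of_set (LE - set (wE w0))"
 have Tpc: "\<exists>s. s ~= 0 & XW (wE w0 @ c) = sc s * Tp"
  unfolding Tp_def
 proof (rule XW_perm[OF anti_E])
  show "mset (wE w0 @ c) = mset [M..<M+N]"
  by (rule set_eq_iff_mset_eq_distinct[THEN iffD1]) (use dE[OF w0(1)] setE[OF w0(1)] in \<open>auto simp: c_def\<close>)
 qed (use setE[OF w0(1)] in \<open>auto simp: c_def\<close>)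
 then obtain s where s: "s ~= 0" "XW (wE w0 @ c) = sc s * Tp" by blast
 let ?A1 = "{w : ?A. wE w = wE w0}"
 have other: "XW (wE w @ c) = 0" if "w : ?A" "wE w ~= wE w0" for w
 proof (rule XW_not_distinct[OF anti_E])
  show "set (wE w @ c) <= LE" using setE[OF that(1)] by (auto simp: c_def)
  show "~ distinct (wE w @ c)"
  proof
  assume "distinct (wE w @ c)"
  hence "set (wE w) <= set (wE w0)" using setE[OF that(1)] by (auto simp: c_def)
  moreover have "card (set (wE w0)) <= card (set (wE w))"
  using min[OF that(1)] dE[OF that(1)] dE[OF w0(1)] by (simp add: distinct_card)
  ultimately have "set (wE w) = set (wE w0)" by (intro card_subset_eq) (auto intro: le_antisym card_mono)
  hence "mset (wE w) = mset (wE w0)"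
  using dE[OF that(1)] dE[OF w0(1)] by (simp add: set_eq_iff_mset_eq_distinct)
  thus False using standard_unique stdp(3)[OF that(1)] stdp(3)[OF w0(1)] that(2) by blast
  qed
 qed
 define y where "y I = (\<Sum>w\<in>{w : ?A1. set (wF w) = I}. sc (s * a w) * XW (wZ w))" for I
 have yU: "y I : U0" for I unfolding y_def
  by (intro op.subspace_sum[OF U0_sub] op.subspace_scale[OF U0_sub] U0_XW setZ)
 have cU: "XW c * (Tm * Tp) : Ktot"
 proof -
  have "XW c : U" by (rule U_XW) (auto simp: c_def d_eq)
  thus ?thesis by (intro Ktot_U[OF _ Ktot_U[OF Tm_U]]) (use K_Ktot[OF Tp_K0[OF U0_1]] in auto)
 qed
 have "0 = u * (XW c * (Tm * Tp))" using kill'[OF cU] by simp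
 also have "... = (\<Sum>w\<in>?A. sc (a w) * (XW w * (XW c * (Tm * Tp))))"
  by (subst ux) (simp add: sum_distrib_right mult.assoc)
 also have "... = (\<Sum>w\<in>?A1. sc (a w) * (XW w * (XW c * (Tm * Tp))))"
 proof (rule sum.mono_neutral_right)
  show "\<forall>w\<in>?A - ?A1. sc (a w) * (XW w * (XW c * (Tm * Tp))) = 0"
  proof
  fix w assume w: "w : ?A - ?A1"
  hence wA: "w : ?A" and n: "wE w ~= wE w0" by auto
  have "XW w * (XW c * (Tm * Tp)) = XW (wF w @ wZ w) * (XW (wE w @ c) * (Tm * Tp))"
  by (subst split[OF wA]) (simp add: XW_append mult.assoc)
  thus "sc (a w) * (XW w * (XW c * (Tm * Tp))) = 0" using other[OF wA n] by simp
  qed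
 qed (use fin in auto)
 also have "... = (\<Sum>w\<in>?A1. fI (set (wF w)) * (sc (s * a w) * XW (wZ w) * Ph * Tp))"
 proof (rule sum.cong[OF refl])
  fix w assume "w : ?A1"
  hence wA: "w : ?A" and e: "wE w = wE w0" by auto
  have "XW w * (XW c * (Tm * Tp)) = XW (wF w) * (XW (wZ w) * (XW (wE w0 @ c) * (Tm * Tp)))"
  by (subst split[OF wA]) (simp add: XW_append mult.assoc e)
  also have "... = sc s * (XW (wF w) * (XW (wZ w) * (Tp * (Tm * Tp))))"
  unfolding s(2) by (simp add: mult.assoc sc_left_comm[of "XW _"])
  also have "... = sc s * (fI (set (wF w)) * (XW (wZ w) * (Ph * Tp)))"
  unfolding Ph(3) fI_def lF[OF wA, symmetric] ..
  finally show "sc (a w) * (XW w * (XW c * (Tm * Tp))) = fI (set (wF w)) * (sc (s * a w) * XW (wZ w) * Ph * Tp)"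
  by (simp add: sc_mult' mult.assoc sc_left_comm[of "fI _"] mult.commute)
 qed
 also have "... = (\<Sum>I\<in>Pow LF. \<Sum>w\<in>{w : ?A1. set (wF w) = I}. fI (set (wF w)) * (sc (s * a w) * XW (wZ w) * Ph * Tp))"
  by (rule sum.group[symmetric]) (use B(1) setF in auto)
 also have "... = (\<Sum>I\<in>Pow LF. fI I * ((y I * Ph) * Tp))"
  by (rule sum.cong[OF refl]) (simp add: y_def sum_distrib_left sum_distrib_right mult.assoc)
 finally have "y (set (wF w0)) * Ph = 0"
  using indep[of "%I. y I * Ph" "set (wF w0)"] yU U0_mult Ph setF by simp
 hence y0: "y (set (wF w0)) = 0" using Ph_right yU by blast
 have "0 = co (delta (wZ w0)) (y (set (wF w0)))" using y0 by simp
 also have "... = (\<Sum>w\<in>{w : ?A1. set (wF w) = set (wF w0)}. s * a w * delta (wZ w0) (wZ w))"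
  unfolding y_def co_sum by (rule sum.cong) (use stdp in \<open>auto simp: co_sc co_XW ext_standard\<close>)
 also have "... = (\<Sum>w\<in>{w : ?A1. set (wF w) = set (wF w0)}. if w = w0 then s * a w0 else 0)"
 proof (rule sum.cong[OF refl])
  fix w assume "w : {w : ?A1. set (wF w) = set (wF w0)}"
  hence w: "w : ?A" "wE w = wE w0" "set (wF w) = set (wF w0)" by auto
  hence "wF w = wF w0" using lF[OF w(1)] lF[OF w0(1)] by simp
  hence "wZ w = wZ w0 \<longleftrightarrow> w = w0" using split[OF w(1)] split[OF w0(1)] w(2) by metis
  thus "s * a w * delta (wZ w0) (wZ w) = (if w = w0 then s * a w0 else 0)" by (auto simp: delta_def)
 qed
 also have "... = s * a w0" using B(1) w0(1) by simp
 finally show False using s(1) w0(1) by simp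
qed

end
section \<open>Twisted centralisers\<close>

context type_I_constants
begin

definition Acent where
 "Acent c = {v : U. (\<forall>a\<in>LZ. X a * v = v * X a) \<and>
     (\<forall>a\<in>LE. X a * v = sc (inverse c) * (kappa v * X a)) \<and>
     (\<forall>a\<in>LF. X a * v = sc c * (kappa v * X a))}"

lemma kappa_span: "x : op.span (XW ` S) ==> kappa x : op.span (XW ` S)"
proof (induction rule: op.span_induct_alt)
 case base show ?case by (simp add: op.span_zero)
next
 case (step c x y)
 then obtain w where "x = XW w" "w : S" by blast
 hence "kappa x : op.span (XW ` S)" by (auto simp: kappa_XW intro: op.span_scale op.span_base)
 thus ?case using step by (simp add: kappa_add kappa_sc op.span_add op.span_scale)
qed

lemma kappa_U: "x : U ==> kappa x : U" unfolding U_def by (rule kappa_span)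

lemma kappa_scalar [simp]: "kappa (sc c) = sc c"
 using kappa_sc[of c 1] by (simp add: kappa_def Sg_Sg)

lemma kappa_E: "a : LE ==> kappa (X a) = - X a"
 and kappa_F: "a : LF ==> kappa (X a) = - X a"
 and kappa_Z: "a : LZ ==> kappa (X a) = X a"
 using N_le_M by (auto simp: kappa_X par_iff sc_uminus)

lemma kappa_U0: "y : U0 ==> kappa y = y"
proof (induction rule: U0_induct)
 case (X a x)
 thus ?case by (simp only: kappa_mult kappa_Z)
qed (auto simp: kappa_add kappa_sc)

lemma kappa_Tp: "kappa Tp = sc (sgnw [M..<M+N]) * Tp" by (simp add: Tp_def kappa_XW)

lemma sgnw_nz: "sgnw w ~= 0" by (induction w) auto

lemma Acent_kappa: assumes "v : Acent c" shows "kappa v : Acent c"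
proof -
 have "X a * kappa v = kappa v * X a" if "a : LZ" for a
 proof -
  have "kappa (X a * v) = kappa (v * X a)" using assms that by (simp add: Acent_def)
  thus ?thesis by (simp only: kappa_mult kappa_Z[OF that])
 qed
 moreover have "X a * kappa v = sc (inverse c) * (v * X a)" if "a : LE" for a
 proof -
  have "kappa (X a * v) = kappa (sc (inverse c) * (kappa v * X a))" using assms that by (simp add: Acent_def)
  thus ?thesis by (simp add: kappa_mult kappa_E[OF that])
 qed
 moreover have "X a * kappa v = sc c * (v * X a)" if "a : LF" for a
 proof -
  have "kappa (X a * v) = kappa (sc c * (kappa v * X a))" using assms that by (simp add: Acent_def)
  thus ?thesis by (simp add: kappa_mult kappa_F[OF that])
 qed
 ultimately show ?thesis using assms kappa_U by (auto simp: Acent_def)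
qed

lemma Acent_sub: "op.subspace (Acent c)"
proof (rule op.subspaceI)
 show "0 : Acent c" by (simp add: Acent_def op.subspace_0[OF U_sub])
next
 fix x y assume "x : Acent c" "y : Acent c"
 thus "x + y : Acent c"
  by (simp add: Acent_def op.subspace_add[OF U_sub] distrib_left distrib_right kappa_add)
next
 fix k x assume "x : Acent c"
 thus "sc k * x : Acent c"
  by (simp add: Acent_def op.subspace_scale[OF U_sub] sc_left_comm[of "X _"] kappa_sc mult.assoc sc_mult' mult.commute)
qed

lemma U0Tp_Sing: "y : U0 ==> y * Tp : Sing"
 using KZ_E0[OF hw_ZT _ Tp_K0] by (auto simp: Sing_def)

lemma Acent_Tp: assumes "v : Acent c" shows "\<exists>F\<in>U0. v * Tp = F * Tp"
proof -
 have vU: "v : U" using assms by (simp add: Acent_def)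
 have sing: "v * Tp : Sing" unfolding Sing_def
 proof (intro CollectI ballI)
  fix a assume a: "a : LE"
  have "X a * (v * Tp) = sc (inverse c) * (kappa v * (X a * Tp))"
  using assms a by (simp add: Acent_def mult.assoc[symmetric])
  thus "X a * (v * Tp) = 0" using E_Tp[OF a] by simp
 qed
 obtain y where yy: "(\<forall>I. y I : U0) & v * Tp = (\<Sum>I\<in>Pow LF. fI I * (y I * Tp))"
  using Ktot_form[OF U_Tp[OF vU]] by (rule exE)
 hence y: "y I : U0" "v * Tp = (\<Sum>I\<in>Pow LF. fI I * (y I * Tp))" for I by auto
 have y0: "y I = 0" if I: "I <= LF" "I ~= {}" for I
 proof -
  let ?w = "sorted_list_of_set (LF - I)"
  have "LF - I \<subset> LF" using I by auto
  hence "card (LF - I) < N" using psubset_card_mono[of LF "LF - I"] by simp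
  hence "length ?w < length [M..<M+N]" by simp
  moreover have "XW ?w * (v * Tp) : KZ Sing (length ?w)" by (rule KZ_gen[OF _ _ sing]) auto
  ultimately have "Tp * (cI I * (v * Tp)) = 0" unfolding Tp_def cI_def
  by (intro KZ_kill[OF hw_Sing]) auto
  moreover have "Tp * (cI I * (v * Tp)) = (\<Sum>J\<in>Pow LF. if I = J then sc (sI I) * (Tp * (Tm * (y I * Tp))) else 0)"
  unfolding y(2) sum_distrib_left by (rule sum.cong) (use proj[OF I(1)] U0Tp_Sing y(1) in auto)
  ultimately have "sc (sI I) * (Tp * (Tm * (y I * Tp))) = 0" using I(1) by (simp add: sum.delta')
  hence z: "Tp * (Tm * (y I * Tp)) = 0" by (rule sc_cancel[OF sI(1)[OF I(1)]])
  obtain z where z': "z : U0" "y I * Tp = Tp * z" using normal_right[OF Tp_character y(1)] by blast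
  have "Ph * y I * Tp = Tp * (Tm * Tp) * z" unfolding Ph(3) by (simp add: mult.assoc z'(2))
  also have "... = 0" using z unfolding z'(2) by (simp add: mult.assoc)
  finally have "Ph * y I * Tp = 0" .
  from Tp_cancel[OF U0_mult[OF Ph(1) y(1)] this] show "y I = 0" by (rule Ph_left[OF y(1)])
 qed
 have "v * Tp = (\<Sum>I\<in>Pow LF. if I = {} then y {} * Tp else 0)"
  unfolding y(2) by (rule sum.cong) (use y0 in \<open>auto simp: fI_def\<close>)
 thus ?thesis using y(1) by (intro bexI[of _ "y {}"]) auto
qed

lemma Acent_F_inv: assumes "v : Acent c" "c ~= 0" "a : LF"
 shows "v * X a = sc (inverse c) * (X a * kappa v)"
proof -
 have "X a * kappa v = sc c * (v * X a)" using Acent_kappa[OF assms(1)] assms(3) by (simp add: Acent_def)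
 thus ?thesis using assms(2) by (simp add: sc_mult')
qed

lemma Acent_Z_word: assumes "v : Acent c" "y : U0" shows "v * y = y * v"
 using assms(2)
proof (induction rule: U0_induct)
 case (X a x)
 have "v * (X a * x) = X a * (v * x)" using assms(1) X(1) by (simp add: Acent_def mult.assoc[symmetric])
 thus ?case using X by (simp add: mult.assoc)
qed (auto simp: distrib_left distrib_right sc_left_comm[of v] mult.assoc)

lemma Acent_act_word:
 assumes "c ~= 0" "set y <= LZ"
 shows "set w <= LF ==> v : Acent c ==> v * Tp = Tp * Ft ==> kappa v * Tp = Tp * Ft ==>
  v * (XW w * (XW y * Tp)) = sc (inverse c ^ length w) * (XW w * (XW y * Tp) * Ft)"
proof (induction w arbitrary: v)
 case Nil
 have "v * (XW y * Tp) = XW y * (v * Tp)"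
  using Acent_Z_word[OF Nil(2) U0_XW[OF assms(2)]] by (simp add: mult.assoc[symmetric])
 thus ?case using Nil by (simp add: mult.assoc)
next
 case (Cons a w)
 have "v * (XW (a # w) * (XW y * Tp)) = (v * X a) * (XW w * (XW y * Tp))" by (simp add: mult.assoc)
 also have "... = sc (inverse c) * (X a * (kappa v * (XW w * (XW y * Tp))))"
  using Acent_F_inv[OF Cons.prems(2) assms(1), of a] Cons.prems(1) by (simp add: mult.assoc)
 also have "kappa v * (XW w * (XW y * Tp)) = sc (inverse c ^ length w) * (XW w * (XW y * Tp) * Ft)"
  using Cons.prems by (intro Cons.IH Acent_kappa) auto
 finally show ?case by (simp add: sc_left_comm[of "X a"] sc_mult' mult.assoc)
qed

lemma Acent_act:
 assumes "v : Acent c" "c ~= 0" "F : U0" "v * Tp = F * Tp" "F * Tp = Tp * Ft" "x : K k"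
 shows "v * x = sc (inverse c ^ k) * (x * Ft)"
proof -
 have "sc (sgnw [M..<M+N]) * (kappa v * Tp) = sc (sgnw [M..<M+N]) * (F * Tp)"
  using arg_cong[OF assms(4), of kappa] kappa_U0[OF assms(3)]
  by (simp add: kappa_mult kappa_Tp sc_left_comm[of "kappa v"] sc_left_comm[of F])
 hence "sc (sgnw [M..<M+N]) * (kappa v * Tp - F * Tp) = 0" by (simp add: right_diff_distrib)
 hence kv: "kappa v * Tp = F * Tp" using sc_cancel[OF sgnw_nz] by (metis right_minus_eq)
 show ?thesis using assms(6) unfolding KZ_def
 proof (induction rule: op.span_induct_alt)
  case (step b x z)
  then obtain w y where x: "x = XW w * (XW y * Tp)" "set w <= LF" "length w = k" "set y <= LZ" by (auto simp: ZT_def)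
  have "v * x = sc (inverse c ^ k) * (x * Ft)"
  unfolding x(1) x(3)[symmetric] by (rule Acent_act_word[OF assms(2) x(4,2) assms(1)]) (simp_all add: kv assms(4,5))
  thus ?case using step(2)
  by (simp add: distrib_left distrib_right sc_left_comm[of v] mult.assoc sc_mult' mult.commute)
 qed simp
qed

lemma faithful2: "u : U ==> v : U ==> (!!k x. x : K k ==> u * x = v * x) ==> u = v"
 using faithful[of "u - v"] op.subspace_diff[OF U_sub, of u v] by (simp add: left_diff_distrib)

subsection \<open>Divisibility by the top products\<close>

definition dd where "dd c a w = X a * w - sc (inverse c) * (kappa w * X a)"

fun ddl where "ddl c [] w = w" | "ddl c (a # L) w = dd c a (ddl c L w)"

lemma dd_lin: "dd c a (sc b * x + y) = sc b * dd c a x + dd c a y"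
 by (simp add: dd_def algebra_simps sc_left_comm[of "X a"] kappa_add kappa_sc sc_mult')


lemma dd_0 [simp]: "dd c a 0 = 0" by (simp add: dd_def)

lemma ddl_lin: "ddl c L (sc b * x + y) = sc b * ddl c L x + ddl c L y"
 by (induction L) (auto simp: dd_lin)

lemma ddl_0: "ddl c L 0 = 0" by (induction L) auto

lemma dd_Tp: "a : LE ==> dd c a u * Tp = X a * (u * Tp)"
 by (simp add: dd_def left_diff_distrib mult.assoc E_Tp)

lemma ddl_Tp: "set L <= LE ==> ddl c L u * Tp = XW L * (u * Tp)"
 by (induction L) (auto simp: dd_Tp mult.assoc)

lemma dd_anti: assumes "a : LE" "b : LE" shows "dd c a (dd c b w) = - dd c b (dd c a w)"
proof -
 let ?t = "sc (inverse c)"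
 have e: "dd c a (dd c b w) = X a * X b * w - ?t * (X a * (kappa w * X b)) + ?t * (X b * (kappa w * X a)) - ?t * (?t * (w * (X b * X a)))"
  if "a : LE" "b : LE" for a b
  using kappa_E[OF that(2)]
  by (simp add: dd_def algebra_simps kappa_minus kappa_mult kappa_sc sc_left_comm[of "X a"])
 have ab: "X a * X b = - (X b * X a)" by (rule antiD[OF anti_E assms])
 show ?thesis unfolding e[OF assms] e[OF assms(2,1)] ab by simp
qed

lemma dd_sq: assumes "a : LE" shows "dd c a (dd c a w) = 0"
proof -
 have "dd c a (dd c a w) + dd c a (dd c a w) = 0" using dd_anti[OF assms assms, of c w] by (metis add.left_inverse)
 hence "sc 2 * dd c a (dd c a w) = 0" by (metis distrib_right mult_1 one_add_one sc_1 sc_add)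
 thus ?thesis by (rule sc_cancel[rotated]) simp
qed

lemma dd_ddl: "set L <= LE ==> a : set L ==> dd c a (ddl c L w) = 0"
proof (induction L)
 case (Cons b L)
 show ?case
 proof (cases "a = b")
  case True thus ?thesis using dd_sq Cons.prems by simp
 next
  case False
  have "a : LE" "b : LE" using Cons.prems by auto
  hence "dd c a (ddl c (b # L) w) = - dd c b (dd c a (ddl c L w))" unfolding ddl.simps by (rule dd_anti)
  also have "dd c a (ddl c L w) = 0" by (rule Cons.IH) (use Cons.prems False in auto)
  finally show ?thesis by simp
 qed
qed simp

definition Ulen where "Ulen n = op.span (XW ` {w. set w <= {..<d} & length w < n})"

lemma Ulen_sub: "op.subspace (Ulen n)" by (simp add: Ulen_def)
lemma Ulen_U: "x : Ulen n ==> x : U"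
 unfolding Ulen_def U_def by (elim op.span_mono[THEN subsetD, rotated]) auto
lemma Ulen_mono: "x : Ulen m ==> m <= n ==> x : Ulen n"
 unfolding Ulen_def by (elim op.span_mono[THEN subsetD, rotated]) auto
lemma kappa_Ulen: "x : Ulen n ==> kappa x : Ulen n" unfolding Ulen_def by (rule kappa_span)
lemma Ulen_XW: "set w <= {..<d} ==> length w < n ==> XW w : Ulen n"
 unfolding Ulen_def by (rule op.span_base) blast
lemma Ulen_mult: "x : Ulen m ==> y : Ulen (Suc n) ==> x * y : Ulen (m + n)"
 unfolding Ulen_def by (rule span_mult_words) auto
lemma Ulen_X_left: "a < d ==> x : Ulen n ==> X a * x : Ulen (Suc n)"
 unfolding Ulen_def by (rule span_mult_words[where P = "{[a]}"]) (auto intro: op.span_base)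
lemma Ulen_X_right: "a < d ==> x : Ulen n ==> x * X a : Ulen (Suc n)"
 unfolding Ulen_def by (rule span_mult_words[where Q = "{[a]}"]) (auto intro: op.span_base)

lemma comm_word: assumes a: "a : LE"
 shows "set w <= {..<d} ==> X a * XW w - sc (sgnw w) * (XW w * X a) : Ulen (Suc (length w))"
proof (induction w)
 case Nil thus ?case by (simp add: op.subspace_0[OF Ulen_sub])
next
 case (Cons b w)
 have pa: "par a" using a by (auto simp: par_iff)
 have ab: "X a * X b = sc (sg a b) * (X b * X a) + (\<Sum>k<d. sc (C a b k) * X k)" by (rule X_rel)
 let ?t = "X a * XW w - sc (sgnw w) * (XW w * X a)"
 have 1: "X b * ?t : Ulen (Suc (length (b # w)))"
  using Ulen_X_left[of b ?t "Suc (length w)"] Cons by auto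
 have "X k * XW w : Ulen (Suc (length (b # w)))" if "k < d" for k
  using Ulen_XW[of "k # w"] Cons.prems that by simp
 hence 2: "(\<Sum>k<d. sc (C a b k) * X k) * XW w : Ulen (Suc (length (b # w)))"
  unfolding sum_distrib_right mult.assoc
  by (intro op.subspace_sum[OF Ulen_sub] op.subspace_scale[OF Ulen_sub]) auto
 have s: "sgnw (b # w) = sg a b * sgnw w" using pa by (auto simp: sg_def)
 have "X a * XW (b # w) = (X a * X b) * XW w" by (simp add: mult.assoc)
 also have "... = sc (sg a b) * (X b * (X a * XW w)) + (\<Sum>k<d. sc (C a b k) * X k) * XW w"
  unfolding ab by (simp add: distrib_right mult.assoc)
 finally have "X a * XW (b # w) - sc (sgnw (b # w)) * (XW (b # w) * X a) =
  sc (sg a b) * (X b * ?t) + (\<Sum>k<d. sc (C a b k) * X k) * XW w"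
  unfolding s by (simp add: right_diff_distrib sc_mult' sc_left_comm[of "X b"] mult.assoc)
 thus ?case using 1 2 by (simp only: op.subspace_add[OF Ulen_sub] op.subspace_scale[OF Ulen_sub])
qed

lemma comm_Ulen: assumes "a : LE" "x : Ulen (Suc m)" shows "X a * x - kappa x * X a : Ulen (Suc m)"
proof -
 have "x : op.span (XW ` {w. set w <= {..<d} & length w < Suc m})" using assms(2) by (simp only: Ulen_def)
 thus ?thesis
proof (induction rule: op.span_induct_alt)
 case base show ?case by (simp add: op.subspace_0[OF Ulen_sub])
next
 case (step c x y)
 then obtain w where w: "x = XW w" "set w <= {..<d}" "length w < Suc m" by blast
 have "X a * x - kappa x * X a : Ulen (Suc m)"
  using Ulen_mono[OF comm_word[OF assms(1) w(2)], of "Suc m"] w by (simp add: kappa_XW mult.assoc)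
 hence "sc c * (X a * x - kappa x * X a) + (X a * y - kappa y * X a) : Ulen (Suc m)"
  using step by (intro op.subspace_add[OF Ulen_sub] op.subspace_scale[OF Ulen_sub])
 thus ?case by (simp add: algebra_simps kappa_add kappa_sc sc_left_comm[of "X a"])
qed
qed

lemma dd_lead: assumes "a : LE" "x : Ulen (Suc m)"
 shows "dd c a x - sc (1 - inverse c) * (kappa x * X a) : Ulen (Suc m)"
proof -
 have "dd c a x - sc (1 - inverse c) * (kappa x * X a) = X a * x - kappa x * X a"
  by (simp add: dd_def sc_minus left_diff_distrib)
 thus ?thesis using comm_Ulen[OF assms] by simp
qed

lemma ddl_lead:
 assumes c: "inverse c ~= 1"
 shows "set L <= LE ==> \<exists>b. b ~= 0 & (\<forall>m. \<forall>y\<in>Ulen (Suc m).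
     ddl c L ((kappa ^^ length L) y) - sc b * (y * XW (rev L)) : Ulen (m + length L))"
proof (induction L)
 case Nil thus ?case by (intro exI[of _ 1]) (auto simp: op.subspace_0[OF Ulen_sub])
next
 case (Cons a L)
 then obtain b where b: "b ~= 0" "!!m y. y : Ulen (Suc m) ==>
     ddl c L ((kappa ^^ length L) y) - sc b * (y * XW (rev L)) : Ulen (m + length L)" by auto
 have a: "a : LE" "a < d" using Cons.prems d_eq by auto
 let ?E = "XW (rev L)" and ?b = "(1 - inverse c) * (b * sgnw (rev L))"
 have "ddl c (a # L) ((kappa ^^ length (a # L)) y) - sc ?b * (y * XW (rev (a # L))) : Ulen (m + length (a # L))"
  if y: "y : Ulen (Suc m)" for m y
 proof -
  define u where "u = ddl c L ((kappa ^^ length L) (kappa y))"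
  define r where "r = u - sc b * (kappa y * ?E)"
  have r: "r : Ulen (m + length L)" unfolding r_def u_def by (rule b(2)[OF kappa_Ulen[OF y]])
  have E: "?E : Ulen (Suc (length L))" by (rule Ulen_XW) (use Cons.prems d_eq in auto)
  have z: "kappa y * ?E : Ulen (Suc (m + length L))" using Ulen_mult[OF kappa_Ulen[OF y] E] by simp
  have dr: "dd c a r : Ulen (Suc (m + length L))" unfolding dd_def
  by (intro op.subspace_diff[OF Ulen_sub] op.subspace_scale[OF Ulen_sub] Ulen_X_left Ulen_X_right kappa_Ulen r a)
  have dz: "dd c a (kappa y * ?E) - sc (1 - inverse c) * (kappa (kappa y * ?E) * X a) : Ulen (Suc (m + length L))"
  by (rule dd_lead[OF a(1) z])
  have k: "kappa (kappa y * ?E) * X a = sc (sgnw (rev L)) * (y * XW (rev (a # L)))"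
  by (simp add: kappa_mult kappa_XW sc_left_comm[of y] XW_append mult.assoc)
  have "u = sc b * (kappa y * ?E) + r" by (simp add: r_def)
  hence du: "dd c a u = sc b * dd c a (kappa y * ?E) + dd c a r" by (simp add: dd_lin)
  have "ddl c (a # L) ((kappa ^^ length (a # L)) y) = dd c a u"
  by (simp add: u_def funpow_swap1)
  hence "ddl c (a # L) ((kappa ^^ length (a # L)) y) - sc ?b * (y * XW (rev (a # L))) =
       sc b * (dd c a (kappa y * ?E) - sc (1 - inverse c) * (kappa (kappa y * ?E) * X a)) + dd c a r"
  unfolding du k by (simp add: right_diff_distrib sc_mult' mult_ac)
  thus ?thesis using dr dz by (simp add: op.subspace_add[OF Ulen_sub] op.subspace_scale[OF Ulen_sub])
 qed
 moreover have "?b ~= 0" using b(1) c sgnw_nz by simp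
 ultimately show ?case by blast
qed

lemma Ulen_std: "Ulen n = op.span (XW ` {w. set w <= {..<d} & length w < n & standard w})"
proof -
 have "XW w : op.span (XW ` {w : {w. set w <= {..<d} & length w < n}. standard w})"
  if "set w <= {..<d} & length w < n" for w
 proof (rule XW_std_span)
  fix u a b v k assume "u @ a # b # v : {w. set w <= {..<d} & length w < n}" "C a b k ~= 0"
  thus "u @ k # v : {w. set w <= {..<d} & length w < n}" using C_bound[of a b k] by simp
 qed (use that in auto)
 hence "XW ` {w. set w <= {..<d} & length w < n} <= op.span (XW ` {w. set w <= {..<d} & length w < n & standard w})"
  by auto
 hence "Ulen n <= op.span (XW ` {w. set w <= {..<d} & length w < n & standard w})"
  unfolding Ulen_def by (rule op.span_minimal) simp
 moreover have "op.span (XW ` {w. set w <= {..<d} & length w < n & standard w}) <= Ulen n"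
  unfolding Ulen_def by (rule op.span_mono) auto
 ultimately show ?thesis by blast
qed

lemma co_Ulen: assumes "x : Ulen n" "!!w. length w < n ==> g w = 0" shows "co g x = 0"
 using assms(1) unfolding Ulen_def
proof (induction rule: op.span_induct_alt)
 case (step c x y)
 then obtain w where "x = XW w" "length w < n" by blast
 hence "co g x = 0" using ext_zero[of w g] assms(2) by (simp add: co_XW)
 thus ?case using step by (simp add: co_add co_sc)
qed simp

lemma full_E_part:
 assumes A: "finite A" "!!w. w : A ==> set w <= {..<d} & length w < Suc n & standard w"
  and v: "v = (\<Sum>w\<in>A. sc (a w) * XW w)" and e: "e : LE" "v * X e : Ulen (Suc n)"
  and w: "w : A" "a w ~= 0" "length w = n"
 shows "e : set w"
proof (rule ccontr)
 assume ne: "e \<notin> set w"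
 let ?s = "sort (w @ [e])"
 have std: "standard ?s"
 proof -
  have "sorted_wrt (%a b. ~ bad a b) ?s"
  proof -
  have cnt: "count (mset (w @ [e])) b <= 1" if "par b" for b
  using standard_count[of w b] A(2)[OF w(1)] that ne by (auto simp: not_in_iff count_mset_0_iff)
  have srt: "sorted l ==> (!!b. par b ==> count (mset l) b <= 1) ==> sorted_wrt (%a b. ~ bad a b) l" for l
  proof (induction l)
  case (Cons b l)
  have "b \<notin> set l" if "par b" using Cons.prems(2)[OF that] by (auto simp: count_mset_0_iff)
  moreover have "count (mset l) b' <= 1" if "par b'" for b'
  by (rule order_trans[OF _ Cons.prems(2)[OF that]]) simp
  ultimately show ?case using Cons by (auto simp: bad_def)
  qed simp
  show ?thesis by (rule srt) (use cnt in simp_all)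
  qed
  thus ?thesis by (simp add: standard_iff)
 qed
 have "0 = co (delta ?s) (v * X e)"
  by (rule co_Ulen[OF e(2), symmetric]) (use w(3) in \<open>auto simp: delta_def\<close>)
 also have "v * X e = (\<Sum>w\<in>A. sc (a w) * XW (w @ [e]))"
  unfolding v by (simp add: sum_distrib_right XW_append mult.assoc)
 also have "co (delta ?s) ... = (\<Sum>w'\<in>A. a w' * ext (delta ?s) (w' @ [e]))" by (simp add: co_sum co_sc co_XW)
 also have "... = (\<Sum>w'\<in>A. if w' = w then a w * ext (delta ?s) (w @ [e]) else 0)"
 proof (rule sum.cong[OF refl])
  fix w' assume w': "w' : A"
  have "ext (delta ?s) (w' @ [e]) = 0" if "w' ~= w"
  proof (cases "length w' = n")
  case False
  hence "length (w' @ [e]) < length ?s" using A(2)[OF w'] w(3) by auto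
  thus ?thesis by (intro ext_zero) (auto simp: delta_def)
  next
  case True
  have "sort (w' @ [e]) ~= ?s"
  proof
  assume "sort (w' @ [e]) = ?s"
  hence "mset (w' @ [e]) = mset (w @ [e])" by (metis mset_sort)
  hence "mset w' = mset w" by simp
  thus False using standard_unique A(2)[OF w'] A(2)[OF w(1)] that by blast
  qed
  moreover obtain \<epsilon> where "!!g. (\<forall>u. length u < length (w' @ [e]) --> g u = 0) ==> ext g (w' @ [e]) = \<epsilon> * g (sort (w' @ [e]))"
  using ext_top[of "w' @ [e]"] by blast
  moreover have "\<forall>u. length u < length (w' @ [e]) --> delta ?s u = 0" using True w(3) by (auto simp: delta_def)
  ultimately show ?thesis by (simp add: delta_def)
  qed
  thus "a w' * ext (delta ?s) (w' @ [e]) = (if w' = w then a w * ext (delta ?s) (w @ [e]) else 0)" by auto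
 qed
 also have "... = a w * ext (delta ?s) (w @ [e])" using A(1) w(1) by simp
 finally have "ext (delta ?s) (w @ [e]) = 0" using w(2) by simp
 moreover obtain \<epsilon> where "\<epsilon> ~= 0" "!!g. (\<forall>u. length u < length (w @ [e]) --> g u = 0) ==> ext g (w @ [e]) = \<epsilon> * g ?s"
  using ext_top[of "w @ [e]"] std by blast
 moreover have "\<forall>u. length u < length (w @ [e]) --> delta ?s u = 0" by (auto simp: delta_def)
 ultimately show False by (simp add: delta_def)
qed

lemma std_full_E: assumes "standard w" "set w <= {..<d}" "LE <= set w"
 obtains u where "w = u @ [M..<M+N]" "set u <= {..<d}"
proof -
 let ?e = "filter (%a. M <= a) w"
 have w: "w = filter (%a. a < N) w @ filter (%a. N <= a & a < M) w @ ?e"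
  using sorted_split standard_sorted[OF assms(1)] by blast
 hence std: "standard ?e" using assms(1) by (metis standard_append)
 have st: "set ?e = LE" using assms(2,3) d_eq by auto
 have "distinct v" if "standard v" "set v <= LE" for v
  using that by (induction v) (auto simp: standard_iff bad_def par_iff)
 hence "distinct ?e" using std st by simp
 hence "?e = [M..<M+N]"
  by (intro sorted_distinct_set_unique) (use std st in \<open>simp_all add: standard_sorted del: set_filter\<close>)
 thus thesis using that[of "filter (%a. a < N) w @ filter (%a. N <= a & a < M) w"] w assms(2) by auto
qed

lemma dd_invariants:
 assumes c: "inverse c ~= 1" and L: "L = rev [M..<M+N]"
 shows "v : Ulen n ==> (!!a. a : LE ==> dd c a v = 0) ==> \<exists>w\<in>U. v = ddl c L w"
proof (induction n arbitrary: v)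
 case 0
 hence "v = 0" by (simp add: Ulen_def)
 thus ?case using ddl_0[of c L] op.subspace_0[OF U_sub] by metis
next
 case (Suc n)
 have LE: "set L <= LE" "length L = N" "rev L = [M..<M+N]" using L by auto
 have vX: "v * X a : Ulen (Suc n)" if a: "a : LE" for a
 proof -
  have "dd c a v - sc (1 - inverse c) * (kappa v * X a) : Ulen (Suc n)" by (rule dd_lead[OF a Suc.prems(1)])
  hence "sc (1 - inverse c) * (kappa v * X a) : Ulen (Suc n)"
  using Suc.prems(2)[OF a] op.subspace_neg[OF Ulen_sub] by fastforce
  hence "sc (inverse (1 - inverse c)) * (sc (1 - inverse c) * (kappa v * X a)) : Ulen (Suc n)"
  by (rule op.subspace_scale[OF Ulen_sub])
  hence "kappa v * X a : Ulen (Suc n)" using c by (simp add: sc_mult')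
  hence "kappa (kappa v * X a) : Ulen (Suc n)" by (rule kappa_Ulen)
  thus ?thesis using op.subspace_neg[OF Ulen_sub] by (fastforce simp: kappa_mult kappa_E[OF a])
 qed
 obtain B a where B: "finite B" "B <= {w. set w <= {..<d} & length w < Suc n & standard w}" "v = (\<Sum>w\<in>B. sc (a w) * XW w)"
  by (rule span_words[OF Suc.prems(1)[unfolded Ulen_std]])
 let ?T = "{w : B. length w = n & a w ~= 0}"
 have full: "\<exists>u. w = u @ [M..<M+N] & set u <= {..<d}" if "w : ?T" for w
 proof -
  have "e : set w" if "e : LE" for e
  by (rule full_E_part[OF B(1) _ B(3) that vX[OF that]]) (use B(2) \<open>w : ?T\<close> in auto)
  hence "LE <= set w" by blast
  moreover have "standard w" "set w <= {..<d}" using B(2) that by auto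
  ultimately obtain u where "w = u @ [M..<M+N]" "set u <= {..<d}" by (elim std_full_E)
  thus ?thesis by blast
 qed
 define q where "q w = take (n - N) w" for w :: "nat list"
 have q: "w = q w @ [M..<M+N]" "set (q w) <= {..<d}" "length (q w) = n - N" "N <= n" if wT: "w : ?T" for w
 proof -
  obtain u where u: "w = u @ [M..<M+N]" "set u <= {..<d}" using full[OF wT] by blast
  hence "length u + N = n" using wT by auto
  thus "w = q w @ [M..<M+N]" "set (q w) <= {..<d}" "length (q w) = n - N" "N <= n"
  using u unfolding q_def by auto
 qed
 define y where "y = (\<Sum>w\<in>?T. sc (a w) * XW (q w))"
 define r where "r = (\<Sum>w\<in>B - ?T. sc (a w) * XW w)"
 have r: "r : Ulen n" unfolding r_def
 proof (rule op.subspace_sum[OF Ulen_sub])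
  fix w assume w: "w : B - ?T"
  show "sc (a w) * XW w : Ulen n"
  proof (cases "a w = 0")
  case False
  hence "length w < n" using w B(2) by auto
  thus ?thesis using w B(2) by (intro op.subspace_scale[OF Ulen_sub] Ulen_XW) auto
  qed (simp add: op.subspace_0[OF Ulen_sub])
 qed
 have "v = (\<Sum>w\<in>?T. sc (a w) * XW w) + r"
  unfolding B(3) r_def by (subst sum.subset_diff[of ?T B]) (use B(1) in \<open>auto simp: add.commute\<close>)
 also have "(\<Sum>w\<in>?T. sc (a w) * XW w) = y * Tp"
  unfolding y_def sum_distrib_right
 proof (rule sum.cong[OF refl])
  fix w assume "w : ?T"
  from q(1)[OF this] have "XW w = XW (q w) * Tp" by (metis XW_append Tp_def)
  thus "sc (a w) * XW w = sc (a w) * XW (q w) * Tp" by (simp add: mult.assoc)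
 qed
 finally have v: "v = y * Tp + r" .
 obtain b where b: "b ~= 0" "!!m y. y : Ulen (Suc m) ==>
     ddl c L ((kappa ^^ length L) y) - sc b * (y * XW (rev L)) : Ulen (m + length L)"
  using ddl_lead[OF c LE(1)] by blast
 have yU: "y : Ulen (Suc (n - N))" unfolding y_def
  by (intro op.subspace_sum[OF Ulen_sub] op.subspace_scale[OF Ulen_sub] Ulen_XW) (use q in auto)
 let ?w1 = "sc (inverse b) * (kappa ^^ N) y"
 have kU: "(kappa ^^ j) x : U" if "x : U" for j x using that by (induction j) (auto intro: kappa_U)
 have w1: "?w1 : U" by (intro op.subspace_scale[OF U_sub] kU Ulen_U[OF yU])
 have d1: "ddl c L ?w1 - y * Tp : Ulen n"
 proof (cases "?T = {}")
  case True
  hence "y = 0" unfolding y_def by (simp only: sum.empty)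
  moreover have "(kappa ^^ j) 0 = 0" for j by (induction j) auto
  ultimately show ?thesis using ddl_0 by (simp add: op.subspace_0[OF Ulen_sub])
 next
  case False
  hence "N <= n" using q(4) by blast
  hence "ddl c L ((kappa ^^ N) y) - sc b * (y * Tp) : Ulen n"
  using b(2)[OF yU] LE by (simp add: Tp_def)
  hence "sc (inverse b) * (ddl c L ((kappa ^^ N) y) - sc b * (y * Tp)) : Ulen n"
  by (rule op.subspace_scale[OF Ulen_sub])
  moreover have "ddl c L ?w1 = sc (inverse b) * ddl c L ((kappa ^^ N) y)"
  using ddl_lin[of c L "inverse b" "(kappa ^^ N) y" 0] by (simp add: ddl_0)
  ultimately show ?thesis using b(1) by (simp add: right_diff_distrib sc_mult')
 qed
 have v': "v - ddl c L ?w1 : Ulen n"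
 proof -
  have "v - ddl c L ?w1 = r - (ddl c L ?w1 - y * Tp)" using v by simp
  thus ?thesis using op.subspace_diff[OF Ulen_sub r d1] by metis
 qed
 have "dd c a' (v - ddl c L ?w1) = 0" if "a' : LE" for a'
 proof -
  have "dd c a' (ddl c L ?w1) = 0" by (rule dd_ddl[OF LE(1)]) (use L that in auto)
  thus ?thesis using dd_lin[of c a' "-1" "ddl c L ?w1" v] Suc.prems(2)[OF that] by (simp add: sc_uminus)
 qed
 then obtain w2 where w2: "w2 : U" "v - ddl c L ?w1 = ddl c L w2" using Suc.IH[OF v'] by blast
 have "v = ddl c L (?w1 + w2)" using w2(2) ddl_lin[of c L 1 ?w1 w2] by (simp add: algebra_simps)
 thus ?case using w1 w2(1) op.subspace_add[OF U_sub] by blast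
qed

lemma U_Ulen: assumes "x : U" shows "\<exists>n. x : Ulen n"
 using assms unfolding U_def
proof (induction rule: op.span_induct_alt)
 case base show ?case using op.subspace_0[OF Ulen_sub] by blast
next
 case (step c x y)
 then obtain w n where "x = XW w" "set w <= {..<d}" "y : Ulen n" by blast
 hence "sc c * x + y : Ulen (max (Suc (length w)) n)"
  by (intro op.subspace_add[OF Ulen_sub] op.subspace_scale[OF Ulen_sub])
  (auto intro: Ulen_XW Ulen_mono)
 thus ?case by blast
qed

text \<open>For \<open>c \<noteq> 1\<close> the operators \<open>w \<mapsto> e w - c\<^bsup>-1\<^esup> \<kappa>(w) e\<close> square to zero and anticommute, and by induction on length their
common kernel is the image of their product. Thus \<open>v\<close> is such an image, and applying it to \<open>T\<^sup>+\<close> leaves only one term.\<close>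

lemma Acent_divisible:
 assumes v: "v : Acent c" and c: "c ~= 1"
 shows "\<exists>x\<in>U0. v * Tp = Tp * (Tm * (x * Tp))"
proof -
 let ?L = "rev [M..<M+N]"
 have c': "inverse c ~= 1" using c by (metis inverse_1 inverse_inverse_eq)
 obtain n where n: "v : Ulen n" using U_Ulen[of v] v by (auto simp: Acent_def)
 have "dd c a v = 0" if "a : LE" for a using v that by (simp add: Acent_def dd_def)
 then obtain w where w: "w : U" "v = ddl c ?L w" using dd_invariants[OF c' refl n] by blast
 obtain s where s: "XW ?L = sc s * Tp"
  using XW_perm[OF anti_E, of ?L "[M..<M+N]"] by (auto simp: Tp_def)
 obtain y where yy: "(\<forall>I. y I : U0) & w * Tp = (\<Sum>I\<in>Pow LF. fI I * (y I * Tp))"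
  using Ktot_form[OF U_Tp[OF w(1)]] by (rule exE)
 hence y: "y I : U0" "w * Tp = (\<Sum>I\<in>Pow LF. fI I * (y I * Tp))" for I by auto
 have "v * Tp = XW ?L * (w * Tp)" unfolding w(2) by (rule ddl_Tp) auto
 also have "... = sc s * (Tp * (cI LF * (w * Tp)))" unfolding s by (simp add: cI_def mult.assoc)
 also have "Tp * (cI LF * (w * Tp)) = (\<Sum>J\<in>Pow LF. if LF = J then sc (sI LF) * (Tp * (Tm * (y LF * Tp))) else 0)"
  unfolding y(2) sum_distrib_left by (rule sum.cong) (use proj[of LF] U0Tp_Sing y(1) in auto)
 also have "... = sc (sI LF) * (Tp * (Tm * (y LF * Tp)))" by (simp add: sum.delta')
 finally have "v * Tp = Tp * (Tm * ((sc (s * sI LF) * y LF) * Tp))"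
  by (simp add: sc_mult' mult.assoc sc_left_comm[of Tp] sc_left_comm[of Tm])
 thus ?thesis using y(1) by (intro bexI[of _ "sc (s * sI LF) * y LF"]) (simp_all add: op.subspace_scale[OF U0_sub])
qed

subsection \<open>Isotypic pieces and the decomposition\<close>

lemma Acent_pieces:
 assumes v: "v : Acent c" "c ~= 0" "c ~= 1"
 shows "\<exists>Ft E. Ft : U0 & (\<forall>k. E k : U) & (\<forall>k j x. x : K j --> E k * x = (if j = k then x * Ft else 0)) \<and>
  (\<forall>k x. x : K k --> v * x = sc (inverse c ^ k) * (x * Ft))"
proof -
 obtain x where x: "x : U0" "v * Tp = Tp * (Tm * (x * Tp))" using Acent_divisible[OF v(1,3)] by blast
 obtain F where F: "F : U0" "v * Tp = F * Tp" using Acent_Tp[OF v(1)] by blast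
 obtain Ft where Ft: "Ft : U0" "F * Tp = Tp * Ft" using normal_right[OF Tp_character F(1)] by blast
 obtain x1 where x1: "x1 : U0" "Tm * x = x1 * Tm" using normal_left[OF Tm_character x(1)] by blast
 obtain x2 where x2: "x2 : U0" "Tp * x1 = x2 * Tp" using normal_left[OF Tp_character x1(1)] by blast
 have key: "x2 * (Tp * (Tm * (y * Tp))) = y * Tp * Ft" if y: "y : U0" for y
 proof -
  obtain z where z: "z : U0" "y * Tp = Tp * z" using normal_right[OF Tp_character y] by blast
  have "x2 * (Tp * (Tm * (y * Tp))) = (x2 * Tp) * Tm * Tp * z" by (simp add: z(2) mult.assoc)
  also have "... = Tp * (x1 * Tm) * Tp * z" unfolding x2(2)[symmetric] by (simp add: mult.assoc)
  also have "... = (v * Tp) * z" unfolding x1(2)[symmetric] x(2) by (simp add: mult.assoc)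
  also have "... = (v * y) * Tp" by (simp add: mult.assoc z(2))
  also have "... = y * (v * Tp)" unfolding Acent_Z_word[OF v(1) y] by (simp add: mult.assoc)
  also have "... = y * Tp * Ft" by (simp add: F(2) Ft(2) mult.assoc)
  finally show ?thesis .
 qed
 define E where "E k = (\<Sum>I\<in>{I : Pow LF. card I = k}. sc (inverse (sI I)) * (fI I * (x2 * (Tp * cI I))))" for k
 have EU: "E k : U" for k unfolding E_def
 proof (intro op.subspace_sum[OF U_sub] op.subspace_scale[OF U_sub] U_mult U0_U[OF x2(1)] Tp_U)
  fix I assume I: "I : {I : Pow LF. card I = k}"
  hence "finite I" using finite_subset by auto
  thus "fI I : U" unfolding fI_def using I d_eq by (intro U_XW) auto
  show "cI I : U" unfolding cI_def using d_eq by (intro U_XW) auto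
 qed
 have Eg: "E k * (fI J * (y * Tp)) = (if card J = k then fI J * (y * Tp) * Ft else 0)"
  if J: "J <= LF" and y: "y : U0" for k J y
 proof -
  have "E k * (fI J * (y * Tp)) = (\<Sum>I\<in>{I : Pow LF. card I = k}. sc (inverse (sI I)) * (fI I * (x2 * (Tp * (cI I * (fI J * (y * Tp)))))))"
  by (simp add: E_def sum_distrib_right mult.assoc)
  also have "... = (\<Sum>I\<in>{I : Pow LF. card I = k}. if I = J then fI J * (y * Tp) * Ft else 0)"
  proof (rule sum.cong[OF refl])
  fix I assume "I : {I : Pow LF. card I = k}"
  hence I: "I <= LF" by simp
  have "sc (inverse (sI J)) * (fI J * (x2 * (sc (sI J) * (Tp * (Tm * (y * Tp)))))) = fI J * (y * Tp) * Ft"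
  using sI(1)[OF J]
  by (simp add: sc_left_comm[of x2] sc_left_comm[of "fI J"] sc_mult' key[OF y] mult.assoc)
  thus "sc (inverse (sI I)) * (fI I * (x2 * (Tp * (cI I * (fI J * (y * Tp)))))) = (if I = J then fI J * (y * Tp) * Ft else 0)"
  unfolding proj[OF I J U0Tp_Sing[OF y]] by auto
  qed
  also have "... = (if card J = k then fI J * (y * Tp) * Ft else 0)" using J by (simp add: sum.delta)
  finally show ?thesis .
 qed
 have Ek: "E k * x = (if j = k then x * Ft else 0)" if "x : K j" for k j x
  using that unfolding KZ_def
 proof (induction rule: op.span_induct_alt)
  case (step b x z)
  then obtain w y where x: "x = XW w * (XW y * Tp)" "set w <= LF" "length w = j" "set y <= LZ" by (auto simp: ZT_def)
  have "E k * x = (if j = k then x * Ft else 0)"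
  proof (cases "distinct w")
  case False
  thus ?thesis using XW_not_distinct[OF anti_F x(2)] x(1) by simp
  next
  case True
  have "mset w = mset (sorted_list_of_set (set w))" using True by (subst set_eq_iff_mset_eq_distinct[symmetric]) auto
  then obtain s where s: "XW w = sc s * fI (set w)" using XW_perm[OF anti_F x(2)] unfolding fI_def by blast
  have "E k * x = sc s * (E k * (fI (set w) * (XW y * Tp)))" unfolding x(1) s by (simp add: mult.assoc sc_left_comm[of "E k"])
  thus ?thesis using Eg[OF x(2) U0_XW[OF x(4)], of k] distinct_card[OF True] x(1,3) s by (simp add: mult.assoc)
  qed
  thus ?case using step(2) by (simp add: distrib_left distrib_right sc_left_comm[of "E k"] mult.assoc)
 qed simp
 show ?thesis using Ft(1) EU Ek Acent_act[OF v(1,2) F Ft(2)] by blast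
qed

lemma K_kappa: "x : K k ==> kappa x = sc ((-1) ^ k * sgnw [M..<M+N]) * x"
 unfolding KZ_def
proof (induction rule: op.span_induct_alt)
 case (step c x z)
 then obtain w y where x: "x = XW w * (XW y * Tp)" "set w <= LF" "length w = k" "set y <= LZ" by (auto simp: ZT_def)
 have "sgnw w = (-1) ^ length w" using x(2) by (induction w) (auto simp: par_iff)
 hence "kappa x = sc ((-1) ^ k * sgnw [M..<M+N]) * x"
  unfolding x(1) kappa_mult kappa_U0[OF U0_XW[OF x(4)]] kappa_Tp kappa_XW[of w]
  using x(3) by (simp add: mult.assoc sc_left_comm[of "XW _"] sc_mult')
 thus ?case using step(2) by (simp add: kappa_add kappa_sc distrib_left sc_mult' mult.commute)
qed simp

text \<open>The defining relations of \<open>Acent\<close> can be tested on \<open>K\<close>, where each \<open>f\<close> raises the degree by one and each \<open>e\<close> lowers it by one.\<close>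

lemma act_Acent:
 assumes w: "w : U" and t: "t ~= 0" and Ft: "Ft : U0"
  and act: "!!k x. x : K k ==> w * x = sc (t ^ k) * (x * Ft)"
 shows "w : Acent (inverse t)"
proof -
 have kw: "kappa w = w"
 proof (rule faithful2[OF kappa_U[OF w] w])
  fix k x assume x: "x : K k"
  let ?s = "(-1) ^ k * sgnw [M..<M+N]"
  have s: "?s ~= 0" using sgnw_nz by simp
  have "sc ?s * (kappa w * x) = kappa (w * x)" by (simp add: kappa_mult K_kappa[OF x] sc_left_comm[of "kappa w"])
  also have "... = sc ?s * (w * x)"
  unfolding act[OF x] kappa_sc kappa_mult kappa_U0[OF Ft] K_kappa[OF x] by (simp add: mult.assoc sc_mult' mult.commute)
  finally have "sc ?s * (kappa w * x - w * x) = 0" by (simp add: right_diff_distrib)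
  thus "kappa w * x = w * x" using sc_cancel[OF s] by (metis right_minus_eq)
 qed
 have 1: "X a * w = w * X a" if a: "a : LZ" for a
 proof (rule faithful2)
  have "a < d" using a d_eq by simp
  thus "X a * w : U" "w * X a : U" by (auto intro!: U_mult U_X w)
  fix k x assume x: "x : K k"
  show "X a * w * x = w * X a * x"
  using act[OF x] act[OF KZ_even[OF hw_ZT a x]] by (simp add: mult.assoc sc_left_comm[of "X a"])
 qed
 have 2: "X a * w = sc t * (w * X a)" if a: "a : LE" for a
 proof (rule faithful2)
  have "a < d" using a d_eq by simp
  thus "X a * w : U" "sc t * (w * X a) : U" by (auto intro!: U_mult U_X w op.subspace_scale[OF U_sub])
  fix k x assume x: "x : K k"
  show "X a * w * x = sc t * (w * X a) * x"
  proof (cases k)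
  case 0
  hence "X a * x = 0" using KZ_E0[OF hw_ZT a] x by simp
  thus ?thesis using act[OF x] by (simp add: mult.assoc sc_left_comm[of "X a"]) (simp add: mult.assoc[symmetric])
  next
  case (Suc j)
  have "w * (X a * x) = sc (t ^ j) * (X a * x * Ft)" by (rule act[OF KZ_E[OF hw_ZT a]]) (use x Suc in simp)
  thus ?thesis using act[OF x] Suc by (simp add: mult.assoc sc_left_comm[of "X a"] sc_mult')
  qed
 qed
 have 3: "X a * w = sc (inverse t) * (w * X a)" if a: "a : LF" for a
 proof (rule faithful2)
  have "a < d" using a d_eq N_le_M by simp
  thus "X a * w : U" "sc (inverse t) * (w * X a) : U" by (auto intro!: U_mult U_X w op.subspace_scale[OF U_sub])
  fix k x assume x: "x : K k"
  show "X a * w * x = sc (inverse t) * (w * X a) * x"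
  using act[OF x] act[OF KZ_F[OF a x]] t
  by (simp add: mult.assoc sc_left_comm[of "X a"] sc_mult')
 qed
 show ?thesis using w 1 2 3 kw by (simp add: Acent_def)
qed

lemma root_sum:
 assumes "\<zeta> ^ Suc N = 1" "!!j. 0 < j ==> j < Suc N ==> \<zeta> ^ j ~= (1::'k)" "l <= N" "k <= N"
 shows "(\<Sum>j\<le>N. (\<zeta> ^ l * inverse \<zeta> ^ k) ^ j) = (if l = k then of_nat (Suc N) else 0)"
proof -
 have z: "\<zeta> ~= 0" using assms(1) by auto
 let ?r = "\<zeta> ^ l * inverse \<zeta> ^ k"
 have rN: "?r ^ Suc N = 1"
 proof -
  have "?r ^ Suc N = (\<zeta> ^ Suc N) ^ l * inverse ((\<zeta> ^ Suc N) ^ k)"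
  by (simp only: power_mult_distrib power_mult[symmetric] power_inverse mult.commute)
  thus ?thesis using assms(1) by simp
 qed
 show ?thesis
 proof (cases "l = k")
  case True
  hence "?r = 1" using z by (simp add: power_inverse)
  thus ?thesis using True by simp
 next
  case False
  have "?r ~= 1"
  proof
  assume "?r = 1"
  hence e: "\<zeta> ^ l = \<zeta> ^ k" using z by (simp add: power_inverse field_simps)
  consider "l < k" | "k < l" using False by linarith
  thus False
  proof cases
  case 1
  hence "\<zeta> ^ l * \<zeta> ^ (k - l) = \<zeta> ^ k" by (simp flip: power_add)
  hence "\<zeta> ^ l * \<zeta> ^ (k - l) = \<zeta> ^ l * 1" using e by simp
  hence "\<zeta> ^ (k - l) = 1" using z by simp
  thus False using assms(2)[of "k - l"] 1 assms(4) by simp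
  next
  case 2
  hence "\<zeta> ^ k * \<zeta> ^ (l - k) = \<zeta> ^ l" by (simp flip: power_add)
  hence "\<zeta> ^ k * \<zeta> ^ (l - k) = \<zeta> ^ k * 1" using e by simp
  hence "\<zeta> ^ (l - k) = 1" using z by simp
  thus False using assms(2)[of "l - k"] 2 assms(3) by simp
  qed
  qed
  hence "(\<Sum>j<Suc N. ?r ^ j) = (?r ^ Suc N - 1) / (?r - 1)" by (rule geometric_sum)
  thus ?thesis using rN False by (simp add: lessThan_Suc_atMost)
 qed
qed

lemma K_vanish: assumes "x : K k" "N < k" shows "x = 0"
 using assms(1) unfolding KZ_def
proof (induction rule: op.span_induct_alt)
 case (step c x z)
 then obtain w y where x: "x = XW w * (XW y * Tp)" "set w <= LF" "length w = k" "set y <= LZ" by (auto simp: ZT_def)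
 have "~ distinct w"
 proof
  assume "distinct w"
  hence "card (set w) = k" using x distinct_card by blast
  thus False using card_mono[OF _ x(2)] assms(2) by simp
 qed
 hence "x = 0" using XW_not_distinct[OF anti_F x(2)] x(1) by simp
 thus ?case using step(2) by simp
qed simp

text \<open>The discrete Fourier transform: \<open>c\<^bsup>-k\<^esup>\<close>, as a function of \<open>k \<le> N\<close>, is a combination of the functions \<open>\<zeta>\<^bsup>-jk\<^esup>\<close>.\<close>

theorem Acent_decompose:
 assumes z: "\<zeta> ^ Suc N = 1" "!!j. 0 < j ==> j < Suc N ==> \<zeta> ^ j ~= (1::'k)"
  and v: "v : Acent c" "c ~= 0"
 shows "\<exists>g. (\<forall>j. g j : Acent (\<zeta> ^ j)) & v = (\<Sum>j\<le>N. g j)"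
proof (cases "c = 1")
 case True
 thus ?thesis using v
  by (intro exI[of _ "%j. if j = 0 then v else 0"]) (auto simp: op.subspace_0[OF Acent_sub])
next
 case False
 have z0: "\<zeta> ~= 0" using z(1) by auto
 obtain Ft E where E: "Ft : U0" "!!k. E k : U" "!!k j x. x : K j ==> E k * x = (if j = k then x * Ft else 0)"
  "!!k x. x : K k ==> v * x = sc (inverse c ^ k) * (x * Ft)"
  using Acent_pieces[OF v False] by blast
 define D where "D t = (\<Sum>k\<le>N. sc (t ^ k) * E k)" for t
 have DU: "D t : U" for t unfolding D_def by (intro op.subspace_sum[OF U_sub] op.subspace_scale[OF U_sub] E)
 have Dx: "D t * x = sc (t ^ k) * (x * Ft)" if x: "x : K k" for t k x
 proof (cases "k <= N")
  case True
  have "D t * x = (\<Sum>j\<le>N. if k = j then sc (t ^ k) * (x * Ft) else 0)"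
  unfolding D_def sum_distrib_right by (rule sum.cong) (auto simp: mult.assoc E(3)[OF x])
  thus ?thesis using True by simp
 next
  case False thus ?thesis using K_vanish[OF x] by simp
 qed
 have DA: "D (inverse \<zeta> ^ j) : Acent (\<zeta> ^ j)" for j
  using act_Acent[OF DU _ E(1) Dx, of "inverse \<zeta> ^ j"] z0 by (simp add: power_inverse)
 define b where "b j = inverse (of_nat (Suc N)) * (\<Sum>l\<le>N. inverse c ^ l * (\<zeta> ^ l) ^ j)" for j
 have bsum: "(\<Sum>j\<le>N. b j * (inverse \<zeta> ^ j) ^ k) = inverse c ^ k" if k: "k <= N" for k
 proof -
  have "(\<Sum>j\<le>N. b j * (inverse \<zeta> ^ j) ^ k) =
  inverse (of_nat (Suc N)) * (\<Sum>j\<le>N. \<Sum>l\<le>N. inverse c ^ l * (\<zeta> ^ l * inverse \<zeta> ^ k) ^ j)"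
  by (simp add: b_def sum_distrib_left sum_distrib_right power_mult_distrib power_mult[symmetric] mult_ac)
  also have "... = inverse (of_nat (Suc N)) * (\<Sum>l\<le>N. inverse c ^ l * (\<Sum>j\<le>N. (\<zeta> ^ l * inverse \<zeta> ^ k) ^ j))"
  by (subst sum.swap) (simp add: sum_distrib_left)
  also have "... = inverse (of_nat (Suc N)) * (\<Sum>l\<le>N. if l = k then inverse c ^ k * of_nat (Suc N) else 0)"
  by (intro arg_cong[where f = "%y. inverse (of_nat (Suc N)) * y"] sum.cong refl) (use root_sum[OF z _ k] in auto)
  also have "... = inverse c ^ k" using k by (simp del: of_nat_Suc)
  finally show ?thesis .
 qed
 have "v = (\<Sum>j\<le>N. sc (b j) * D (inverse \<zeta> ^ j))"
 proof (rule faithful2)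
  show "v : U" using v by (simp add: Acent_def)
  show "(\<Sum>j\<le>N. sc (b j) * D (inverse \<zeta> ^ j)) : U"
  by (intro op.subspace_sum[OF U_sub] op.subspace_scale[OF U_sub] DU)
  fix k x assume x: "x : K k"
  show "v * x = (\<Sum>j\<le>N. sc (b j) * D (inverse \<zeta> ^ j)) * x"
  proof (cases "k <= N")
  case True
  have "(\<Sum>j\<le>N. sc (b j) * D (inverse \<zeta> ^ j)) * x = sc (\<Sum>j\<le>N. b j * (inverse \<zeta> ^ j) ^ k) * (x * Ft)"
  by (simp add: sum_distrib_right mult.assoc Dx[OF x] sc_mult' sc_sum)
  thus ?thesis using bsum[OF True] E(4)[OF x] by simp
  next
  case False thus ?thesis using K_vanish[OF x] by simp
  qed
 qed
 thus ?thesis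
  by (intro exI[of _ "%j. sc (b j) * D (inverse \<zeta> ^ j)"]) (auto intro: op.subspace_scale[OF Acent_sub] DA)
qed

theorem Acent_independent:
 assumes z: "\<zeta> ^ Suc N = 1" "!!j. 0 < j ==> j < Suc N ==> \<zeta> ^ j ~= (1::'k)"
  and g: "!!j. j <= N ==> g j : Acent (\<zeta> ^ j)" "(\<Sum>j\<le>N. g j) = 0" and l: "l <= N"
 shows "g l = 0"
proof -
 have z0: "\<zeta> ~= 0" using z(1) by auto
 have "\<exists>F. F : U0 & g j * Tp = F * Tp" if "j <= N" for j using Acent_Tp[OF g(1)[OF that]] by blast
 then obtain F where F: "!!j. j <= N ==> F j : U0" "!!j. j <= N ==> g j * Tp = F j * Tp" by metis
 have "\<exists>Ft. Ft : U0 & F j * Tp = Tp * Ft" if "j <= N" for j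
  using normal_right[OF Tp_character F(1)[OF that]] by blast
 then obtain Ft where Ft: "!!j. j <= N ==> Ft j : U0" "!!j. j <= N ==> F j * Tp = Tp * Ft j" by metis
 have gx: "g j * x = sc ((inverse \<zeta> ^ j) ^ k) * (x * Ft j)" if "j <= N" "x : K k" for j k x
  using Acent_act[OF g(1)[OF that(1)] _ F(1)[OF that(1)] F(2)[OF that(1)] Ft(2)[OF that(1)] that(2)] z0
  by (simp add: power_inverse)
 have Fk: "(\<Sum>j\<le>N. sc ((inverse \<zeta> ^ j) ^ k) * F j) = 0" if k: "k <= N" for k
 proof -
  let ?I = "{..<k}" and ?y = "\<Sum>j\<le>N. sc ((inverse \<zeta> ^ j) ^ k) * F j"
  have yU: "?y : U0" using F(1) by (intro op.subspace_sum[OF U0_sub] op.subspace_scale[OF U0_sub]) auto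
  have x: "fI ?I * Tp : K k"
  proof -
  have "Tp : ZT" unfolding ZT_def by (intro CollectI exI[of _ "[]"]) simp
  thus ?thesis unfolding fI_def by (intro KZ_gen) (use k in auto)
  qed
  have "0 = (\<Sum>j\<le>N. g j) * (fI ?I * Tp)" using g(2) by simp
  also have "... = (\<Sum>j\<le>N. sc ((inverse \<zeta> ^ j) ^ k) * (fI ?I * (F j * Tp)))"
  unfolding sum_distrib_right by (rule sum.cong) (auto simp: gx[OF _ x] Ft(2) mult.assoc)
  also have "... = fI ?I * (?y * Tp)"
  by (simp add: sum_distrib_left sum_distrib_right mult.assoc sc_left_comm[of "fI _"])
  also have "... = (\<Sum>I\<in>Pow LF. fI I * ((if I = ?I then ?y else 0) * Tp))"
  proof -
  have "(\<Sum>I\<in>Pow LF. fI I * ((if I = ?I then ?y else 0) * Tp)) = (\<Sum>I\<in>Pow LF. if I = ?I then fI ?I * (?y * Tp) else 0)"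
  by (rule sum.cong) auto
  thus ?thesis using k by (simp add: sum.delta)
  qed
  finally show ?thesis
  using indep[of "%I. if I = ?I then ?y else 0" ?I] yU k op.subspace_0[OF U0_sub] by auto
 qed
 have "0 = (\<Sum>k\<le>N. sc ((\<zeta> ^ l) ^ k) * (\<Sum>j\<le>N. sc ((inverse \<zeta> ^ j) ^ k) * F j))" using Fk by simp
 also have "... = (\<Sum>j\<le>N. sc (\<Sum>k\<le>N. (\<zeta> ^ l * inverse \<zeta> ^ j) ^ k) * F j)"
  unfolding sc_sum sum_distrib_left sum_distrib_right
  by (subst sum.swap) (simp add: sc_mult' power_mult_distrib)
 also have "... = (\<Sum>j\<le>N. if j = l then sc (of_nat (Suc N)) * F l else 0)"
  by (rule sum.cong) (use root_sum[OF z l] in auto)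
 also have "... = sc (of_nat (Suc N)) * F l" using l by simp
 finally have "F l = 0" using sc_cancel[of "of_nat (Suc N)" "F l"] by (simp del: of_nat_Suc)
 hence Fl: "Tp * Ft l = 0" using Ft(2)[OF l] by simp
 have xF: "x * Ft l = 0" if "x : K k" for k x
  using that unfolding KZ_def
 proof (induction rule: op.span_induct_alt)
  case (step c x z)
  then obtain w y where "x = XW w * (XW y * Tp)" by (auto simp: ZT_def)
  hence "x * Ft l = 0" by (simp add: mult.assoc Fl)
  thus ?case using step(2) by (simp add: distrib_right mult.assoc)
 qed simp
 have "g l * x = 0" if "x : K k" for k x using gx[OF l that] xF[OF that] by simp
 thus ?thesis by (intro faithful[of "g l"]) (use g(1)[OF l] in \<open>simp_all add: Acent_def\<close>)
qed

end
section \<open>The enveloping algebra as an algebra of operators\<close>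

lemma free_scalar_mult: "free_scalar a * free_scalar b = (free_scalar (a * b) :: 'g free_word \<Rightarrow>\<^sub>0 'k::field)"
 by (simp add: free_scalar_def mult_single)
lemma free_scalar_add: "free_scalar (a + b) = (free_scalar a + free_scalar b :: 'g free_word \<Rightarrow>\<^sub>0 'k::field)"
 by (simp add: free_scalar_def single_add)
lemma free_scalar_1: "free_scalar 1 = (1 :: 'g free_word \<Rightarrow>\<^sub>0 'k::field)"
 by (simp add: free_scalar_def)

interpretation fr: vector_space "%c (t :: 'g free_word \<Rightarrow>\<^sub>0 'k::field). free_scalar c * t"
 by standard (simp_all add: distrib_left distrib_right free_scalar_add free_scalar_mult[symmetric] mult.assoc free_scalar_1)

lemma poly_mapping_sum_single: "t = (\<Sum>w\<in>Poly_Mapping.keys t. Poly_Mapping.single w (Poly_Mapping.lookup t w))"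
 by (rule poly_mapping_eqI) (auto simp: lookup_sum lookup_single when_def in_keys_iff)

lemma free_single: "Poly_Mapping.single w c = free_scalar c * (Poly_Mapping.single w 1 :: 'g free_word \<Rightarrow>\<^sub>0 'k::field)"
 by (simp add: free_scalar_def mult_single)

lemma free_scalar_comm: "free_scalar c * t = t * (free_scalar c :: 'g free_word \<Rightarrow>\<^sub>0 'k::field)"
proof -
 have "free_scalar c * Poly_Mapping.single w a = Poly_Mapping.single w a * free_scalar c" for w :: "'g free_word" and a
  by (simp add: free_scalar_def mult_single mult.commute)
 thus ?thesis
  by (subst (1 2) poly_mapping_sum_single[of t]) (simp add: sum_distrib_left sum_distrib_right)
qed

definition evalT :: "('g => ('a, 'k) operator) => ('g free_word \<Rightarrow>\<^sub>0 'k::field) => ('a, 'k) operator" where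
 "evalT \<rho> t = (\<Sum>w\<in>Poly_Mapping.keys t. sc (Poly_Mapping.lookup t w) * prod_list (map \<rho> (letters w)))"

lemma evalT_superset: "finite A ==> Poly_Mapping.keys t <= A ==>
  evalT \<rho> t = (\<Sum>w\<in>A. sc (Poly_Mapping.lookup t w) * prod_list (map \<rho> (letters w)))"
 unfolding evalT_def by (rule sum.mono_neutral_left) (auto simp: in_keys_iff)

lemma evalT_add: "evalT \<rho> (s + t) = evalT \<rho> s + evalT \<rho> t"
proof -
 let ?A = "Poly_Mapping.keys s \<union> Poly_Mapping.keys t"
 show ?thesis
  using evalT_superset[of ?A s \<rho>] evalT_superset[of ?A t \<rho>] evalT_superset[of ?A "s + t" \<rho>] keys_add[of s t]
  by (simp add: lookup_add sc_add distrib_right sum.distrib)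
qed

lemma evalT_0 [simp]: "evalT \<rho> 0 = 0" by (simp add: evalT_def)

lemma evalT_single: "evalT \<rho> (Poly_Mapping.single w c) = sc c * prod_list (map \<rho> (letters w))"
 using evalT_superset[of "{w}" "Poly_Mapping.single w c" \<rho>] by simp

lemma evalT_uminus: "evalT \<rho> (- t) = - evalT \<rho> t"
 using evalT_add[of \<rho> t "- t"] by (simp add: eq_neg_iff_add_eq_0 add.commute)

lemma evalT_minus: "evalT \<rho> (s - t) = evalT \<rho> s - evalT \<rho> t"
 using evalT_add[of \<rho> s "- t"] by (simp add: evalT_uminus)

lemma evalT_sum: "evalT \<rho> (\<Sum>i\<in>I. f i) = (\<Sum>i\<in>I. evalT \<rho> (f i))"
 by (induction I rule: infinite_finite_induct) (simp_all add: evalT_add)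

lemma evalT_mult: "evalT \<rho> (s * t) = evalT \<rho> s * evalT \<rho> t"
proof -
 have 1: "evalT \<rho> (Poly_Mapping.single w a * Poly_Mapping.single v b) =
  evalT \<rho> (Poly_Mapping.single w a) * evalT \<rho> (Poly_Mapping.single v b)" for w v a b
 proof -
  have "letters (w + v) = letters w @ letters v" by (simp add: plus_free_word_def)
  thus ?thesis
  by (simp add: mult_single evalT_single mult.assoc sc_left_comm[of "prod_list _"] sc_mult')
 qed
 have "s * t = (\<Sum>w\<in>Poly_Mapping.keys s. \<Sum>v\<in>Poly_Mapping.keys t.
  Poly_Mapping.single w (Poly_Mapping.lookup s w) * Poly_Mapping.single v (Poly_Mapping.lookup t v))"
  by (subst poly_mapping_sum_single[of s], subst poly_mapping_sum_single[of t]) (simp add: sum_product)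
 hence "evalT \<rho> (s * t) = (\<Sum>w\<in>Poly_Mapping.keys s. \<Sum>v\<in>Poly_Mapping.keys t.
  evalT \<rho> (Poly_Mapping.single w (Poly_Mapping.lookup s w)) * evalT \<rho> (Poly_Mapping.single v (Poly_Mapping.lookup t v)))"
  by (simp only: evalT_sum 1)
 also have "... = evalT \<rho> s * evalT \<rho> t"
  by (subst (3) poly_mapping_sum_single[of s], subst (3) poly_mapping_sum_single[of t]) (simp add: evalT_sum sum_product)
 finally show ?thesis .
qed

lemma evalT_scalar: "evalT \<rho> (free_scalar c) = sc c" by (simp add: free_scalar_def evalT_single zero_free_word_def)
lemma evalT_gen: "evalT \<rho> (free_gen x) = \<rho> x" by (simp add: free_gen_def evalT_single)
lemma evalT_1: "evalT \<rho> 1 = 1" using evalT_scalar[of \<rho> 1] by (simp add: free_scalar_1)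

abbreviation words_in :: "'g set => ('g free_word \<Rightarrow>\<^sub>0 'k::field) set" where
 "words_in X \<equiv> carrier (free_algebra X)"

lemma words_in_iff: "t : words_in X \<longleftrightarrow> (\<forall>w\<in>Poly_Mapping.keys t. set (letters w) <= X)"
 by (simp add: free_algebra_def)

lemma words_in_add: "s : words_in X ==> t : words_in X ==> s + t : words_in X"
 using keys_add[of s t] by (auto simp: words_in_iff)
lemma words_in_uminus: "s : words_in X ==> - s : words_in X"
 by (auto simp: words_in_iff)
lemma words_in_minus: "s : words_in X ==> t : words_in X ==> s - t : words_in X"
 using words_in_add[of s X "- t"] words_in_uminus by auto
lemma words_in_mult: "s : words_in X ==> t : words_in X ==> s * t : words_in X"
 using keys_mult[of s t] by (fastforce simp: words_in_iff plus_free_word_def)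
lemma words_in_0: "0 : words_in X" by (simp add: words_in_iff)
lemma words_in_1: "1 : words_in X" by (simp add: words_in_iff zero_free_word_def)
lemma words_in_scalar: "free_scalar c : words_in X" by (auto simp: words_in_iff free_scalar_def zero_free_word_def)
lemma words_in_gen: "x : X ==> free_gen x : words_in X" by (auto simp: words_in_iff free_gen_def)
lemma free_algebra_simps:
 "x \<otimes>\<^bsub>free_algebra X\<^esub> y = x * y" "x \<oplus>\<^bsub>free_algebra X\<^esub> y = x + y"
 "\<one>\<^bsub>free_algebra X\<^esub> = 1" "\<zero>\<^bsub>free_algebra X\<^esub> = 0"
 by (simp_all add: free_algebra_def)

lemma free_algebra_ring: "ring (free_algebra X)"
proof (rule ringI)
 show "abelian_group (free_algebra X)"
  by (rule abelian_groupI)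
  (auto simp: free_algebra_simps words_in_add words_in_0 add.assoc add.commute intro!: bexI[of _ "- _"] words_in_uminus)
 show "Group.monoid (free_algebra X)"
  by (rule monoidI) (auto simp: free_algebra_simps words_in_mult words_in_1 mult.assoc)
qed (auto simp: free_algebra_simps algebra_simps)

lemma free_algebra_uminus: assumes "x : words_in X" shows "\<ominus>\<^bsub>free_algebra X\<^esub> x = - x"
proof -
 interpret ring "free_algebra X" by (rule free_algebra_ring)
 show ?thesis by (rule minus_equality) (use assms words_in_uminus in \<open>auto simp: free_algebra_simps\<close>)
qed

lemma component_finsum:
 assumes "internal_direct_sum V I A W" "v : (\<Pi>\<^sub>E i\<in>I. A i)"
 shows "component V I A (\<Oplus>\<^bsub>V\<^esub>i\<in>I. v i) = v"
 using assms unfolding internal_direct_sum_def component_def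
 by (intro the_inv_into_f_f[where f = "%v. \<Oplus>\<^bsub>V\<^esub>i\<in>I. v i", simplified]) (auto simp: bij_betw_def)

lemma component_in:
 assumes "internal_direct_sum V I A W" "x : W"
 shows "component V I A x : (\<Pi>\<^sub>E i\<in>I. A i)" "(\<Oplus>\<^bsub>V\<^esub>i\<in>I. component V I A x i) = x"
proof -
 let ?f = "%v. \<Oplus>\<^bsub>V\<^esub>i\<in>I. v i"
 have b: "bij_betw ?f (\<Pi>\<^sub>E i\<in>I. A i) W" using assms(1) by (simp add: internal_direct_sum_def)
 thus "component V I A x : (\<Pi>\<^sub>E i\<in>I. A i)"
  unfolding component_def using assms(2) by (intro the_inv_into_into) (auto simp: bij_betw_def)
 show "(\<Oplus>\<^bsub>V\<^esub>i\<in>I. component V I A x i) = x"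
  unfolding component_def using b assms(2) f_the_inv_into_f[of ?f _ x] by (auto simp: bij_betw_def)
qed

lemma UNIV_bit: "(UNIV :: bit set) = {0, 1}"
 using bit_not_zero_iff by auto

context lie_superalgebra
begin

definition lin_fun :: "('g => 'k) => bool" where
 "lin_fun F \<longleftrightarrow> (\<forall>x\<in>carrier L. \<forall>y\<in>carrier L. F (x \<oplus> y) = F x + F y) \<and>
     (\<forall>c. \<forall>x\<in>carrier L. F (c \<odot> x) = c * F x)"

lemma lin_add: "lin_fun F ==> x : carrier L ==> y : carrier L ==> F (x \<oplus> y) = F x + F y"
 and lin_smult: "lin_fun F ==> x : carrier L ==> F (c \<odot> x) = c * F x"
 by (auto simp: lin_fun_def)

lemma smult_in: "x : carrier L ==> c \<odot> x : carrier L" by (rule smult_closed) auto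

lemma smult_0: "x : carrier L ==> (0::'k) \<odot> x = \<zero>"
 using lmult_0[of x] by simp

lemma smult_minus_one: "x : carrier L ==> (- 1 :: 'k) \<odot> x = \<ominus> x"
proof -
 assume x: "x : carrier L"
 have "(- 1 :: 'k) \<odot> x \<oplus> 1 \<odot> x = (- 1 + 1) \<odot> x" using smult_l_distr[of "- 1 :: 'k" 1 x] x by simp
 hence "(- 1 :: 'k) \<odot> x \<oplus> x = \<zero>" using x smult_one[of x] by (simp add: smult_0)
 thus ?thesis using x smult_in by (metis minus_equality)
qed

lemma lin_fun_zero: "lin_fun F ==> F \<zero> = 0"
 using lin_smult[of F "\<zero>" 0] smult_0[of "\<zero>"] by simp

lemma lin_fun_uminus: "lin_fun F ==> x : carrier L ==> F (\<ominus> x) = - F x"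
 using lin_smult[of F x "- 1"] smult_minus_one[of x] by simp

lemma lin_fun_finsum:
 assumes "lin_fun F" "finite A" "v : A \<rightarrow> carrier L"
 shows "F (\<Oplus>i\<in>A. v i) = (\<Sum>i\<in>A. F (v i))"
 using assms(2,3)
proof (induction A rule: finite_induct)
 case empty thus ?case by (simp add: lin_fun_zero assms(1))
next
 case (insert a A)
 hence "(\<Oplus>i\<in>A. v i) : carrier L" by (intro finsum_closed) auto
 thus ?case using insert by (simp add: lin_add[OF assms(1)] Pi_def)
qed

lemma part_subspace: "subspace class_ring (part L p) L"
 using parity_decomposition by (simp add: internal_direct_sum_def)

lemma part_in: "x : part L p ==> x : carrier L"
 using part_subspace[of p] by (auto simp: subspace_def dest: submodule.subset)

lemma bracket_lin_right: "lin_fun F ==> x : carrier L ==> lin_fun (%y. F (bracket L x y))"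
 by (simp add: lin_fun_def bracket_closed bracket_add_right bracket_smult_right)
lemma bracket_lin_left: "lin_fun F ==> y : carrier L ==> lin_fun (%x. F (bracket L x y))"
 by (simp add: lin_fun_def bracket_closed bracket_add_left bracket_smult_left)

lemma subspace_finsum:
 assumes W: "subspace class_ring W L" and "finite A" "!!i. i : A ==> v i : W"
 shows "(\<Oplus>i\<in>A. v i) : W"
proof -
 interpret submodule class_ring W L using W by (simp add: subspace_def)
 have c: "W <= carrier L" by (rule subset)
 show ?thesis using assms(2,3)
 proof (induction A rule: finite_induct)
  case (insert a A)
  thus ?case using c by (subst finsum_insert) (auto simp: Pi_def)
 qed simp
qed

lemma subspace_smult: "subspace class_ring W L ==> x : W ==> c \<odot> x : W"
 by (auto simp: subspace_def intro: submodule.smult_closed)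

end

locale type_I_graded = lie_superalgebra L
 for L :: "('k::field_char_0, 'g) lie_superalgebra" (structure) +
 fixes G :: "int => 'g set"
 assumes grading: "type_I_grading L G"
begin

lemma G_zero: "i \<notin> {-1, 0, 1} ==> G i = {\<zero>}"
 and G_bracket: "x : G i ==> y : G j ==> bracket L x y : G (i + j)"
 and G_0: "G 0 = part L 0"
 and G_sum: "internal_direct_sum L {-1, 0, 1} G (carrier L)"
 and G_odd: "internal_direct_sum L {-1, 1} G (part L 1)"
 using grading unfolding type_I_grading_def by blast+

lemma G_subspace: "i : {-1, 0, 1} ==> subspace class_ring (G i) L"
 using G_sum by (auto simp: internal_direct_sum_def)

lemma G_c: "i : {-1, 0, 1} ==> x : G i ==> x : carrier L"
 using G_subspace[of i] by (auto simp: subspace_def dest: submodule.subset)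

lemma G_zero_in: "i : {-1, 0, 1} ==> \<zero> : G i"
 using G_subspace[of i] by (auto simp: subspace_def intro: submodule.zero_closed)

lemma finsum_2: "i ~= j ==> v i : carrier L ==> v j : carrier L ==> (\<Oplus>k\<in>{i, j}. v k) = v i \<oplus> v j"
 by (simp add: Pi_def)

lemma finsum_3: "i ~= j ==> i ~= l ==> j ~= l ==> v i : carrier L ==> v j : carrier L ==> v l : carrier L ==>
  (\<Oplus>k\<in>{i, j, l}. v k) = v i \<oplus> v j \<oplus> v l"
 by (simp add: Pi_def a_assoc)

lemma G_part_1: assumes "i : {-1, 1}" "x : G i" shows "x : part L 1"
proof -
 define v where "v = (\<lambda>j\<in>{-1, 1::int}. if j = i then x else \<zero>)"
 have "v : (\<Pi>\<^sub>E j\<in>{-1, 1}. G j)" using assms G_zero_in by (auto simp: v_def)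
 hence "(\<Oplus>j\<in>{-1, 1}. v j) : part L 1" using G_odd by (auto simp: internal_direct_sum_def bij_betw_def)
 moreover have "(\<Oplus>j\<in>{-1, 1}. v j) = x"
  using assms G_c[of i x] by (subst finsum_2) (auto simp: v_def)
 ultimately show ?thesis by simp
qed

lemma odd_split: assumes "x : part L 1" obtains u w where "u : G (-1)" "w : G 1" "x = u \<oplus> w"
proof -
 let ?v = "component L {-1, 1} G x"
 have v: "?v : (\<Pi>\<^sub>E j\<in>{-1, 1}. G j)" "(\<Oplus>j\<in>{-1, 1}. ?v j) = x" using component_in[OF G_odd assms] by auto
 hence "?v (-1) : G (-1)" "?v 1 : G 1" by auto
 thus thesis using that[of "?v (-1)" "?v 1"] v(2) finsum_2[of "-1" 1 ?v] G_c by auto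
qed

end

text \<open>A graded basis with its coordinate functionals, ordered by degree, such that \<open>hf\<close> makes the first and the last \<open>N\<close> basis
elements dual to each other under the bracket.\<close>

locale graded_lsa_basis = type_I_graded L G
 for L :: "('k::field_char_0, 'g) lie_superalgebra" (structure) and G :: "int => 'g set" +
 fixes N M :: nat and hf :: "'g => 'k" and b :: "nat => 'g" and crd :: "'g => nat => 'k"
 assumes NM: "N <= M"
  and b_G: "k < M + N ==> b k : G (type_I_degree N M k)"
  and crd_lin: "lin_fun (%x. crd x k)"
  and crd_b: "j < M + N ==> crd (b j) k = (if j = k then 1 else 0)"
  and crd_expand: "x : carrier L ==> x = (\<Oplus>k\<in>{..<M+N}. crd x k \<odot> b k)"
  and crd_deg: "x : G D ==> crd x k ~= 0 ==> k < M + N & type_I_degree N M k = D"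
  and hf_lin: "lin_fun hf"
  and hf_dual: "i < N ==> j < N ==> hf (bracket L (b (M + i)) (b j)) = (if i = j then 1 else 0)"
begin

abbreviation "dg \<equiv> type_I_degree N M"

lemma dg_cases: "k < M + N ==> dg k = -1 \<or> dg k = 0 \<or> dg k = 1" by (auto simp: type_I_degree_def)

lemma b_part: "k < M + N ==> b k : part L (if dg k = 0 then 0 else 1)"
 using b_G[of k] dg_cases[of k] G_0 G_part_1[of "dg k"] by auto

lemma b_in: "k < M + N ==> b k : carrier L" using b_part part_in by blast

abbreviation "pr a \<equiv> a < N \<or> M <= a & a < M + N"

lemma pr_dg: "k < M + N ==> pr k \<longleftrightarrow> dg k ~= 0" using NM by (auto simp: type_I_degree_def)

lemma part_crd: assumes "x : part L p" "crd x k ~= 0" shows "k < M + N & (dg k = 0 \<longleftrightarrow> p = 0)"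
proof (cases "p = 0")
 case True thus ?thesis using crd_deg[of x 0 k] assms G_0 by auto
next
 case False
 hence "p = 1" using bit_not_zero_iff by blast
 then obtain u w where u: "u : G (-1)" "w : G 1" "x = u \<oplus> w" using odd_split assms(1) by blast
 have "u : carrier L" "w : carrier L" using u G_c[of "-1" u] G_c[of 1 w] by auto
 hence "crd x k = crd u k + crd w k" using lin_add[OF crd_lin] u(3) by simp
 then consider "crd u k ~= 0" | "crd w k ~= 0" using assms(2) by force
 thus ?thesis using crd_deg[OF u(1), of k] crd_deg[OF u(2), of k] False by cases auto
qed

lemma lin_expand: assumes "lin_fun F" "x : carrier L" shows "F x = (\<Sum>k<M+N. crd x k * F (b k))"
proof -
 have "F x = F (\<Oplus>k\<in>{..<M+N}. crd x k \<odot> b k)" using crd_expand[OF assms(2)] by simp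
 also have "... = (\<Sum>k<M+N. F (crd x k \<odot> b k))"
  by (rule lin_fun_finsum[OF assms(1)]) (auto simp: smult_in b_in)
 also have "... = (\<Sum>k<M+N. crd x k * F (b k))"
  by (rule sum.cong) (auto simp: lin_smult[OF assms(1)] b_in)
 finally show ?thesis .
qed

lemma crd_eqI: assumes "x : carrier L" "y : carrier L" "!!k. k < M + N ==> crd x k = crd y k" shows "x = y"
proof -
 have "(\<Oplus>k\<in>{..<M+N}. crd x k \<odot> b k) = (\<Oplus>k\<in>{..<M+N}. crd y k \<odot> b k)"
  by (rule finsum_cong') (auto simp: assms(3) smult_in b_in)
 thus ?thesis using crd_expand assms(1,2) by metis
qed

definition CC :: "nat => nat => nat => 'k" where
 "CC a c k = (if a < M + N & c < M + N then crd (bracket L (b a) (b c)) k else 0)"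

lemma CC_deg: assumes "CC a c k ~= 0" shows "a < M + N & c < M + N & k < M + N & dg k = dg a + dg c"
proof -
 have ac: "a < M + N" "c < M + N" and nz: "crd (bracket L (b a) (b c)) k ~= 0"
  using assms by (auto simp: CC_def split: if_splits)
 thus ?thesis using crd_deg[OF G_bracket[OF b_G[OF ac(1)] b_G[OF ac(2)]] nz] by auto
qed

definition sgn2 :: "nat => nat => 'k" where "sgn2 a c = (if pr a & pr c then - 1 else 1)"

lemma sgn2_sign: "a < M + N ==> c < M + N ==>
  super_sign (if dg a = 0 then 0 else 1) (if dg c = 0 then 0 else 1) = sgn2 a c"
 using pr_dg[of a] pr_dg[of c] by (auto simp: super_sign_def sgn2_def)

lemma CC_skew: "CC a c k = - (sgn2 a c * CC c a k)"
proof (cases "a < M + N & c < M + N")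
 case True
 hence "bracket L (b a) (b c) = \<ominus> (sgn2 a c \<odot> bracket L (b c) (b a))"
  using super_skew[OF b_part b_part, of a c] sgn2_sign by auto
 hence "crd (bracket L (b a) (b c)) k = - (sgn2 a c * crd (bracket L (b c) (b a)) k)"
  using True by (simp add: lin_fun_uminus[OF crd_lin] lin_smult[OF crd_lin] smult_in bracket_closed b_in)
 thus ?thesis using True by (simp add: CC_def)
qed (auto simp: CC_def)

lemma crd_bracket_right: "x : carrier L ==> y : carrier L ==>
  crd (bracket L x y) l = (\<Sum>k<M+N. crd y k * crd (bracket L x (b k)) l)"
 by (rule lin_expand[OF bracket_lin_right[OF crd_lin]])
lemma crd_bracket_left: "x : carrier L ==> y : carrier L ==>
  crd (bracket L x y) l = (\<Sum>k<M+N. crd x k * crd (bracket L (b k) y) l)"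
 using lin_expand[OF bracket_lin_left[OF crd_lin]] .

lemma CC_jacobi: "(\<Sum>k<M+N. CC c e k * CC a k l) =
   (\<Sum>k<M+N. CC a c k * CC k e l) + sgn2 a c * (\<Sum>k<M+N. CC a e k * CC c k l)"
proof (cases "a < M + N & c < M + N & e < M + N")
 case True
 hence ca: "b a : carrier L" "b c : carrier L" "b e : carrier L" using b_in by auto
 have J: "bracket L (b a) (bracket L (b c) (b e)) =
     bracket L (bracket L (b a) (b c)) (b e) \<oplus> sgn2 a c \<odot> bracket L (b c) (bracket L (b a) (b e))"
  using super_jacobi[OF b_part b_part, of a c "b e"] sgn2_sign True ca by auto
 have "crd (bracket L (b a) (bracket L (b c) (b e))) l = (\<Sum>k<M+N. CC c e k * CC a k l)"
  using True ca by (subst crd_bracket_right) (auto simp: CC_def bracket_closed)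
 moreover have "crd (bracket L (bracket L (b a) (b c)) (b e)) l = (\<Sum>k<M+N. CC a c k * CC k e l)"
  using True ca by (subst crd_bracket_left) (auto simp: CC_def bracket_closed)
 moreover have "crd (bracket L (b c) (bracket L (b a) (b e))) l = (\<Sum>k<M+N. CC a e k * CC c k l)"
  using True ca by (subst crd_bracket_right) (auto simp: CC_def bracket_closed)
 ultimately show ?thesis using arg_cong[OF J, of "%x. crd x l"] ca
  by (simp add: lin_add[OF crd_lin] lin_smult[OF crd_lin] smult_in bracket_closed)
next
 case False
 then consider "~ a < M + N" | "~ c < M + N" | "~ e < M + N" by blast
 thus ?thesis by cases (simp_all add: CC_def)
qed

sublocale tc: type_I_constants "M + N" pr CC N M "%k. hf (b k)"
proof
 show "CC a c k ~= 0 ==> k < M + N" for a c k using CC_deg by blast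
 show "pr k \<longleftrightarrow> pr a ~= pr c" if nz: "CC a c k ~= 0" for a c k
 proof -
  have lt: "a < M + N" "c < M + N" "k < M + N" and deg: "dg k = dg a + dg c" using CC_deg[OF nz] by blast+
  have "(dg k ~= 0) = ((dg a ~= 0) ~= (dg c ~= 0))"
  using dg_cases[OF lt(1)] dg_cases[OF lt(2)] dg_cases[OF lt(3)] deg by linarith
  thus ?thesis using pr_dg[OF lt(1)] pr_dg[OF lt(2)] pr_dg[OF lt(3)] by blast
 qed
 show "CC a c k = - ((if pr a & pr c then - 1 else 1) * CC c a k)" for a c k
  using CC_skew[of a c k] by (simp add: sgn2_def)
 show "(\<Sum>k<M+N. CC c e k * CC a k l) = (\<Sum>k<M+N. CC a c k * CC k e l) +
  (if pr a & pr c then - 1 else 1) * (\<Sum>k<M+N. CC a e k * CC c k l)" for a c e l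
  using CC_jacobi[of c e a l] by (simp add: sgn2_def)
 show "CC a c k ~= 0 ==> a < M + N & c < M + N & dg k = dg a + dg c" for a c k using CC_deg by blast
 show "(\<Sum>k<M+N. CC (M + i) j k * hf (b k)) = (if i = j then 1 else 0)" if "i < N" "j < N" for i j
 proof -
  have ij: "M + i < M + N" "j < M + N" using that NM by auto
  hence "hf (bracket L (b (M + i)) (b j)) = (\<Sum>k<M+N. CC (M + i) j k * hf (b k))"
  by (subst lin_expand[OF hf_lin]) (auto simp: CC_def bracket_closed b_in)
  thus ?thesis using hf_dual[OF that] by simp
 qed
qed (use NM in auto)

definition rho :: "'g => (nat list, 'k) operator" where "rho x = (\<Sum>k<M+N. sc (crd x k) * tc.X k)"

lemma rho_add: "x : carrier L ==> y : carrier L ==> rho (x \<oplus> y) = rho x + rho y"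
 by (simp add: rho_def lin_add[OF crd_lin] sc_add distrib_right sum.distrib)
lemma rho_smult: "x : carrier L ==> rho (c \<odot> x) = sc c * rho x"
 by (simp add: rho_def lin_smult[OF crd_lin] sum_distrib_left sc_mult')
lemma rho_b: "k < M + N ==> rho (b k) = tc.X k"
proof -
 assume k: "k < M + N"
 have "rho (b k) = (\<Sum>j<M+N. if k = j then tc.X k else 0)"
  unfolding rho_def by (rule sum.cong) (use k in \<open>auto simp: crd_b\<close>)
 thus ?thesis using k by simp
qed

lemma rho_bracket:
 assumes "x : part L p" "y : part L q"
 shows "rho x * rho y = sc (super_sign p q) * (rho y * rho x) + rho (bracket L x y)"
proof -
 have xy: "x : carrier L" "y : carrier L" using assms part_in by auto
 have 1: "sc (crd x i) * tc.X i * (sc (crd y j) * tc.X j) =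
     sc (super_sign p q) * (sc (crd y j) * tc.X j * (sc (crd x i) * tc.X i)) +
     (\<Sum>k<M+N. sc (crd x i * crd y j * CC i j k) * tc.X k)" for i j
 proof (cases "crd x i = 0 \<or> crd y j = 0")
  case False
  hence i: "i < M + N" "dg i = 0 \<longleftrightarrow> p = 0" and j: "j < M + N" "dg j = 0 \<longleftrightarrow> q = 0"
  using part_crd[OF assms(1)] part_crd[OF assms(2)] by auto
  have "tc.sg i j = super_sign p q"
  using pr_dg[OF i(1)] pr_dg[OF j(1)] i j bit_not_zero_iff by (auto simp: tc.sg_def super_sign_def)
  hence XX: "tc.X i * tc.X j = sc (super_sign p q) * (tc.X j * tc.X i) + (\<Sum>k<M+N. sc (CC i j k) * tc.X k)"
  using tc.X_rel[of i j] by simp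
  have "sc (crd x i) * tc.X i * (sc (crd y j) * tc.X j) = sc (crd x i * crd y j) * (tc.X i * tc.X j)"
  by (simp add: mult.assoc sc_left_comm[of "tc.X i"] sc_mult')
  also have "... = sc (super_sign p q) * (sc (crd y j) * tc.X j * (sc (crd x i) * tc.X i)) +
     (\<Sum>k<M+N. sc (crd x i * crd y j * CC i j k) * tc.X k)"
  unfolding XX by (simp add: distrib_left sum_distrib_left sc_mult' mult.assoc sc_left_comm[of "tc.X j"] mult_ac)
  finally show ?thesis .
 qed auto
 have "crd (bracket L x y) k = (\<Sum>i<M+N. \<Sum>j<M+N. crd x i * crd y j * CC i j k)" for k
 proof -
  have "crd (bracket L x y) k = (\<Sum>i<M+N. crd x i * crd (bracket L (b i) y) k)" by (rule crd_bracket_left[OF xy])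
  also have "... = (\<Sum>i<M+N. crd x i * (\<Sum>j<M+N. crd y j * CC i j k))"
  by (intro sum.cong refl arg_cong2[where f = "(*)"], subst crd_bracket_right[OF b_in xy(2)]) (auto simp: CC_def)
  finally show ?thesis by (simp add: sum_distrib_left mult.assoc)
 qed
 hence "rho (bracket L x y) = (\<Sum>k<M+N. \<Sum>i<M+N. \<Sum>j<M+N. sc (crd x i * crd y j * CC i j k) * tc.X k)"
  by (simp add: rho_def sc_sum sum_distrib_right)
 also have "... = (\<Sum>i<M+N. \<Sum>k<M+N. \<Sum>j<M+N. sc (crd x i * crd y j * CC i j k) * tc.X k)" by (rule sum.swap)
 also have "... = (\<Sum>i<M+N. \<Sum>j<M+N. \<Sum>k<M+N. sc (crd x i * crd y j * CC i j k) * tc.X k)"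
  by (intro sum.cong refl sum.swap)
 finally have br: "rho (bracket L x y) = ..." .
 have yx: "rho y * rho x = (\<Sum>i<M+N. \<Sum>j<M+N. sc (crd y j) * tc.X j * (sc (crd x i) * tc.X i))"
  unfolding rho_def sum_product by (rule sum.swap)
 have "rho x * rho y = (\<Sum>i<M+N. \<Sum>j<M+N. sc (crd x i) * tc.X i * (sc (crd y j) * tc.X j))"
  unfolding rho_def sum_product ..
 also have "... = sc (super_sign p q) * (rho y * rho x) + rho (bracket L x y)"
  unfolding 1 br yx sum.distrib sum_distrib_left ..
 finally show ?thesis .
qed

abbreviation "TT \<equiv> free_algebra (carrier L)"
abbreviation "JJ \<equiv> env_ideal L"
abbreviation "ev \<equiv> evalT rho"

lemma relations_in: "env_relations L <= carrier TT"
proof -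
 have "x \<oplus> y : carrier L" "c \<odot> x : carrier L" if "x : carrier L" "y : carrier L" for x y c
  using that smult_in by auto
 thus ?thesis
  unfolding env_relations_def
  by (auto intro!: words_in_minus words_in_add words_in_mult words_in_gen words_in_scalar bracket_closed dest: part_in)
qed

lemma JJ_ideal: "ideal JJ TT"
 unfolding env_ideal_def by (rule ring.genideal_ideal[OF free_algebra_ring relations_in])

lemma rel_in_JJ: "r : env_relations L ==> r : JJ"
 unfolding env_ideal_def using ring.genideal_self[OF free_algebra_ring relations_in] by blast

lemma JJ_add: "s : JJ ==> t : JJ ==> s + t : JJ"
 using additive_subgroup.a_closed[OF ideal.axioms(1)[OF JJ_ideal]] by (simp add: free_algebra_simps)
lemma JJ_0: "0 : JJ"
 using additive_subgroup.zero_closed[OF ideal.axioms(1)[OF JJ_ideal]] by (simp add: free_algebra_simps)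
lemma JJ_left: "t : JJ ==> s : carrier TT ==> s * t : JJ"
 and JJ_right: "t : JJ ==> s : carrier TT ==> t * s : JJ"
 using ideal.I_l_closed[OF JJ_ideal] ideal.I_r_closed[OF JJ_ideal] by (simp_all add: free_algebra_simps)
lemma JJ_sub: "fr.subspace JJ"
 by (rule fr.subspaceI) (auto intro: JJ_0 JJ_add JJ_left words_in_scalar)

lemma ev_JJ: assumes "t : JJ" shows "ev t = 0"
proof -
 let ?I = "{t : carrier TT. ev t = 0}"
 have "ideal ?I TT"
 proof (rule idealI[OF free_algebra_ring])
  show "subgroup ?I (add_monoid TT)"
  proof (rule subgroup.intro)
  fix x assume "x : ?I"
  hence "inv\<^bsub>add_monoid TT\<^esub> x = - x" using free_algebra_uminus[of x "carrier L"] by (simp add: a_inv_def)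
  thus "inv\<^bsub>add_monoid TT\<^esub> x : ?I" using \<open>x : ?I\<close> by (simp add: words_in_uminus evalT_uminus)
  qed (auto simp: free_algebra_simps words_in_add words_in_0 evalT_add)
 qed (auto simp: free_algebra_simps words_in_mult evalT_mult)
 moreover have "env_relations L <= ?I"
 proof
  fix r assume r: "r : env_relations L"
  have "ev r = 0" using r unfolding env_relations_def
  proof (elim UnE)
  assume "r : {free_gen (x \<oplus> y) - (free_gen x + free_gen y) |x y. x : carrier L & y : carrier L}"
  thus ?thesis by (auto simp: evalT_minus evalT_add evalT_gen rho_add)
  next
  assume "r : {free_gen (c \<odot> x) - free_scalar c * free_gen x |c x. x : carrier L}"
  thus ?thesis by (auto simp: evalT_minus evalT_mult evalT_scalar evalT_gen rho_smult)
  next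
  assume "r : {free_gen x * free_gen y - free_scalar (super_sign p q) * free_gen y * free_gen x
  - free_gen (bracket L x y) |p q x y. x : part L p & y : part L q}"
  then obtain p q x y where "x : part L p" "y : part L q"
  "r = free_gen x * free_gen y - free_scalar (super_sign p q) * free_gen y * free_gen x - free_gen (bracket L x y)"
  by blast
  thus ?thesis using rho_bracket[of x p y q]
  by (simp only: evalT_minus evalT_mult evalT_scalar evalT_gen mult.assoc) simp
  qed
  thus "r : ?I" using r relations_in by blast
 qed
 ultimately have "JJ <= ?I" unfolding env_ideal_def by (rule ring.genideal_minimal[OF free_algebra_ring])
 thus ?thesis using assms by blast
qed

definition BW :: "nat list => 'g free_word \<Rightarrow>\<^sub>0 'k" where "BW w = prod_list (map (%k. free_gen (b k)) w)"

lemma BW_simps [simp]: "BW [] = 1" "BW (k # w) = free_gen (b k) * BW w" "BW (u @ v) = BW u * BW v"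
 by (simp_all add: BW_def)

lemma BW_in: "set w <= {..<M+N} ==> BW w : carrier TT"
 by (induction w) (auto intro: words_in_1 words_in_mult words_in_gen b_in)

lemma ev_BW: "set w <= {..<M+N} ==> ev (BW w) = tc.XW w"
 by (induction w) (auto simp: evalT_1 evalT_mult evalT_gen rho_b)

lemma rel_add: "x : carrier L ==> y : carrier L ==> free_gen (x \<oplus> y) - (free_gen x + free_gen y) : JJ"
 and rel_smult: "x : carrier L ==> free_gen (c \<odot> x) - free_scalar c * free_gen x : JJ"
 and rel_bracket: "x : part L p ==> y : part L q ==>
  free_gen x * free_gen y - free_scalar (super_sign p q) * free_gen y * free_gen x - free_gen (bracket L x y) : JJ"
 by (rule rel_in_JJ; unfold env_relations_def; blast)+

lemma gen_expand: assumes "x : carrier L"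
 shows "free_gen x - (\<Sum>k<M+N. free_scalar (crd x k) * free_gen (b k)) : JJ"
proof -
 have lin: "free_gen (\<Oplus>k\<in>A. c k \<odot> b k) - (\<Sum>k\<in>A. free_scalar (c k) * free_gen (b k)) : JJ"
  if "finite A" "A <= {..<M+N}" for A and c :: "nat => 'k"
  using that
 proof (induction A rule: finite_induct)
  case empty
  have "free_gen (0 \<odot> \<zero>) - free_scalar 0 * free_gen \<zero> : JJ" by (rule rel_smult) simp
  thus ?case by (simp add: smult_0 free_scalar_def)
 next
  case (insert a A)
  let ?s = "\<Oplus>k\<in>A. c k \<odot> b k"
  have ca: "c a \<odot> b a : carrier L" "b a : carrier L" "?s : carrier L"
  using insert by (auto intro!: smult_in b_in finsum_closed)
  have 1: "free_gen (c a \<odot> b a \<oplus> ?s) - (free_gen (c a \<odot> b a) + free_gen ?s) : JJ"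
  by (rule rel_add) (use ca in auto)
  have 2: "free_gen (c a \<odot> b a) - free_scalar (c a) * free_gen (b a) : JJ"
  by (rule rel_smult) (use ca in auto)
  have 3: "free_gen ?s - (\<Sum>k\<in>A. free_scalar (c k) * free_gen (b k)) : JJ" using insert by auto
  have eq: "(\<Oplus>k\<in>insert a A. c k \<odot> b k) = c a \<odot> b a \<oplus> ?s"
  using insert ca by (subst finsum_insert) (auto simp: Pi_def intro!: smult_in b_in)
  have eqn: "free_gen (c a \<odot> b a \<oplus> ?s) - (\<Sum>k\<in>insert a A. free_scalar (c k) * free_gen (b k)) =
  (free_gen (c a \<odot> b a \<oplus> ?s) - (free_gen (c a \<odot> b a) + free_gen ?s)) +
  (free_gen (c a \<odot> b a) - free_scalar (c a) * free_gen (b a)) +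
  (free_gen ?s - (\<Sum>k\<in>A. free_scalar (c k) * free_gen (b k)))"
  using insert by (simp add: algebra_simps)
  show ?case unfolding eq eqn by (intro JJ_add 1 2 3)
 qed
 show ?thesis using lin[of "{..<M+N}" "crd x"] crd_expand[OF assms] by simp
qed

lemma BW_step:
 assumes "tc.bad a c" "a < M + N" "c < M + N" "set (u @ v) <= {..<M+N}"
 shows "BW (u @ a # c # v) - (free_scalar (tc.s1 a c) * BW (u @ c # a # v) +
  (\<Sum>k<M+N. free_scalar (tc.C1 a c k) * BW (u @ k # v))) : JJ"
proof -
 let ?a = "free_gen (b a) :: 'g free_word \<Rightarrow>\<^sub>0 'k" and ?c = "free_gen (b c) :: 'g free_word \<Rightarrow>\<^sub>0 'k"
 let ?g = "free_gen (bracket L (b a) (b c)) :: 'g free_word \<Rightarrow>\<^sub>0 'k"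
 let ?S = "\<Sum>k<M+N. free_scalar (CC a c k) * free_gen (b k) :: 'g free_word \<Rightarrow>\<^sub>0 'k"
 have "?a * ?c - free_scalar (sgn2 a c) * ?c * ?a - ?g : JJ"
  using rel_bracket[OF b_part[OF assms(2)] b_part[OF assms(3)]] sgn2_sign[OF assms(2,3)] by simp
 moreover have "?g - ?S : JJ"
  using gen_expand[of "bracket L (b a) (b c)"] assms(2,3) b_in bracket_closed by (simp add: CC_def)
 ultimately have "(?a * ?c - free_scalar (sgn2 a c) * ?c * ?a - ?g) + (?g - ?S) : JJ" by (rule JJ_add)
 hence r: "?a * ?c - free_scalar (sgn2 a c) * ?c * ?a - ?S : JJ" by simp
 have r1: "?a * ?c - (free_scalar (tc.s1 a c) * (?c * ?a) + (\<Sum>k<M+N. free_scalar (tc.C1 a c k) * free_gen (b k))) : JJ"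
 proof (cases "a = c")
  case False
  have "tc.s1 a c = sgn2 a c" "!!k. tc.C1 a c k = CC a c k"
  using False by (auto simp: tc.s1_def tc.sg_def sgn2_def tc.C1_def)
  thus ?thesis using r by (simp add: algebra_simps)
 next
  case True
  hence "sgn2 a c = -1" using assms(1) by (auto simp: tc.bad_def sgn2_def)
  hence "?a * ?a + ?a * ?a - ?S : JJ"
  using r True fr.scale_minus_left[of 1] by (simp add: free_scalar_1 algebra_simps)
  hence "free_scalar (1/2) * (?a * ?a + ?a * ?a - ?S) : JJ" by (rule fr.subspace_scale[OF JJ_sub])
  moreover have "free_scalar (1/2) * (?a * ?a + ?a * ?a - ?S) =
       ?a * ?a - (\<Sum>k<M+N. free_scalar (CC a a k / 2) * free_gen (b k))"
  proof -
  have "free_scalar (1/2) * (?a * ?a) + free_scalar (1/2) * (?a * ?a) = free_scalar 1 * (?a * ?a)"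
  by (simp add: distrib_right[symmetric] free_scalar_add[symmetric])
  thus ?thesis using True
  by (simp add: distrib_left right_diff_distrib sum_distrib_left free_scalar_1 mult.assoc[symmetric] free_scalar_mult)
  qed
  ultimately show ?thesis using True by (simp add: tc.s1_def tc.C1_def)
 qed
 have "BW u * (?a * ?c - (free_scalar (tc.s1 a c) * (?c * ?a) + (\<Sum>k<M+N. free_scalar (tc.C1 a c k) * free_gen (b k)))) * BW v : JJ"
  using assms(4) by (intro JJ_right JJ_left r1 BW_in) auto
 moreover have "BW u * (free_scalar z * y) = free_scalar z * (BW u * y)" for z y
  by (metis free_scalar_comm mult.assoc)
 ultimately show ?thesis
  by (simp add: right_diff_distrib left_diff_distrib distrib_left distrib_right sum_distrib_left sum_distrib_right mult.assoc)
qed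

definition STD where "STD = BW ` {w. set w <= {..<M+N} & tc.standard w}"
definition VJ where "VJ = {s + j | s j. s : fr.span STD & j : JJ}"

lemma VJ_sub: "fr.subspace VJ"
 unfolding VJ_def by (rule fr.subspace_sums) (auto intro: JJ_sub)

lemma VJ_JJ: "t : JJ ==> t : VJ" unfolding VJ_def using fr.span_zero by force

lemma BW_VJ: "set w <= {..<M+N} ==> BW w : VJ"
proof (induction w rule: tc.word_induct)
 case (std w)
 hence "BW w : fr.span STD" by (auto simp: STD_def intro: fr.span_base)
 thus ?case unfolding VJ_def using JJ_0 by force
next
 case (step u a c v)
 let ?r = "free_scalar (tc.s1 a c) * BW (u @ c # a # v) + (\<Sum>k<M+N. free_scalar (tc.C1 a c k) * BW (u @ k # v))"
 have "free_scalar (tc.s1 a c) * BW (u @ c # a # v) : VJ"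
  using step(2) step.prems by (cases "a = c")
  (auto simp: tc.s1_def fr.subspace_0[OF VJ_sub] intro!: fr.subspace_scale[OF VJ_sub])
 moreover have "free_scalar (tc.C1 a c k) * BW (u @ k # v) : VJ" for k
  using step(3)[of k] step.prems CC_deg[of a c k] tc.C1_0[of a c k]
  by (cases "CC a c k = 0") (auto simp: fr.subspace_0[OF VJ_sub] intro!: fr.subspace_scale[OF VJ_sub])
 ultimately have "?r : VJ" by (intro fr.subspace_add[OF VJ_sub] fr.subspace_sum[OF VJ_sub])
 moreover have "BW (u @ a # c # v) - ?r : VJ" by (intro VJ_JJ BW_step step(1)) (use step.prems in auto)
 ultimately have "(BW (u @ a # c # v) - ?r) + ?r : VJ" by (rule fr.subspace_add[OF VJ_sub, rotated])
 thus ?case by simp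
qed

lemma span_BW_gen:
 assumes "t : fr.span (BW ` {w. set w <= {..<M+N}})" "x : carrier L"
 shows "\<exists>s\<in>fr.span (BW ` {w. set w <= {..<M+N}}). free_gen x * t - s : JJ"
proof -
 let ?V = "fr.span (BW ` {w. set w <= {..<M+N}})" and ?S = "\<Sum>k<M+N. free_scalar (crd x k) * free_gen (b k)"
 have tw: "t : carrier TT" using assms(1)
 proof (induction rule: fr.span_induct_alt)
  case base show ?case by (rule words_in_0)
 next
  case (step c y z) thus ?case by (auto intro: words_in_add words_in_mult words_in_scalar BW_in)
 qed
 have g: "free_gen (b k) * t : ?V" if "k < M + N" for k using assms(1)
 proof (induction rule: fr.span_induct_alt)
  case base show ?case by (simp add: fr.span_zero)
 next
  case (step c y z)
  then obtain w where w: "y = BW w" "set w <= {..<M+N}" by blast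
  have "free_gen (b k) * y : ?V" by (rule fr.span_base, rule image_eqI[of _ _ "k # w"]) (use w that in auto)
  hence "free_scalar c * (free_gen (b k) * y) + free_gen (b k) * z : ?V" using step by (intro fr.span_add fr.span_scale)
  moreover have "free_gen (b k) * (free_scalar c * y) = free_scalar c * (free_gen (b k) * y)" by (metis free_scalar_comm mult.assoc)
  ultimately show ?case by (simp add: distrib_left)
 qed
 have "?S * t : ?V" unfolding sum_distrib_right mult.assoc using g by (intro fr.span_sum fr.span_scale) auto
 moreover have "(free_gen x - ?S) * t : JJ" by (rule JJ_right[OF gen_expand[OF assms(2)] tw])
 ultimately show ?thesis by (auto simp: left_diff_distrib)
qed

lemma words_VJ: assumes "t : carrier TT" shows "t : VJ"
proof -
 let ?V = "fr.span (BW ` {w. set w <= {..<M+N}})"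
 have VV: "?V <= VJ" by (rule fr.span_minimal[OF _ VJ_sub]) (use BW_VJ in auto)
 have w: "\<exists>s\<in>?V. Poly_Mapping.single (Word xs) 1 - s : JJ" if "set xs <= carrier L" for xs using that
 proof (induction xs)
  case Nil
  have "(1 :: 'g free_word \<Rightarrow>\<^sub>0 'k) : ?V" by (rule fr.span_base, rule image_eqI[of _ _ "[]"]) auto
  moreover have "Poly_Mapping.single (Word []) 1 = (1 :: 'g free_word \<Rightarrow>\<^sub>0 'k)"
  by (simp add: zero_free_word_def[symmetric])
  ultimately show ?case using JJ_0 by (intro bexI[of _ 1]) auto
 next
  case (Cons x xs)
  then obtain s where s: "s : ?V" "Poly_Mapping.single (Word xs) 1 - s : JJ" by auto
  obtain s' where s': "s' : ?V" "free_gen x * s - s' : JJ" using span_BW_gen[OF s(1), of x] Cons.prems by auto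
  have "Poly_Mapping.single (Word (x # xs)) (1::'k) = free_gen x * Poly_Mapping.single (Word xs) 1"
  by (simp add: free_gen_def mult_single plus_free_word_def)
  hence eq: "Poly_Mapping.single (Word (x # xs)) 1 - s' =
  free_gen x * (Poly_Mapping.single (Word xs) 1 - s) + (free_gen x * s - s')"
  by (simp add: right_diff_distrib)
  have "free_gen x * (Poly_Mapping.single (Word xs) 1 - s) + (free_gen x * s - s') : JJ"
  using Cons.prems s s' by (intro JJ_add JJ_left words_in_gen) auto
  thus ?case unfolding eq[symmetric] using s'(1) by blast
 qed
 have "Poly_Mapping.single w (Poly_Mapping.lookup t w) : VJ" if "w : Poly_Mapping.keys t" for w
 proof -
  obtain xs where xs: "w = Word xs" by (cases w)
  hence "set xs <= carrier L" using assms that unfolding words_in_iff by (metis free_word.sel)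
  then obtain s where s: "s : ?V" "Poly_Mapping.single w 1 - s : JJ" using w xs by blast
  have "(Poly_Mapping.single w 1 - s) + s : VJ" using s VV VJ_JJ by (intro fr.subspace_add[OF VJ_sub]) auto
  thus ?thesis unfolding free_single[of w "Poly_Mapping.lookup t w"]
  by (intro fr.subspace_scale[OF VJ_sub]) simp
 qed
 thus ?thesis by (subst poly_mapping_sum_single[of t]) (rule fr.subspace_sum[OF VJ_sub])
qed

text \<open>Modulo the ideal every element is a combination of standard words, and these are independent as operators.\<close>

lemma ev_zero_JJ: assumes "t : carrier TT" "ev t = 0" shows "t : JJ"
proof -
 obtain s j where t: "t = s + j" "s : fr.span STD" "j : JJ" using words_VJ[OF assms(1)] by (auto simp: VJ_def)
 let ?W = "{w. set w <= {..<M+N} & tc.standard w}"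
 from t(2) obtain F r where F: "finite F" "F <= STD" "s = (\<Sum>y\<in>F. free_scalar (r y) * y)"
  by (auto simp: fr.span_explicit)
 let ?inv = "inv_into ?W BW"
 have fi: "?inv y : ?W" "BW (?inv y) = y" if "y : F" for y
 proof -
  have "y : BW ` ?W" using that F(2) by (auto simp: STD_def)
  thus "?inv y : ?W" "BW (?inv y) = y" by (rule inv_into_into, rule f_inv_into_f)
 qed
 have inj: "inj_on ?inv F" by (rule inj_on_inverseI[of _ BW]) (rule fi)
 have "0 = ev s" using assms(2) t ev_JJ by (simp add: evalT_add)
 also have "... = (\<Sum>y\<in>F. sc (r y) * tc.XW (?inv y))"
  unfolding F(3) evalT_sum
 proof (rule sum.cong[OF refl])
  fix y assume "y : F"
  thus "ev (free_scalar (r y) * y) = sc (r y) * tc.XW (?inv y)"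
  using fi[of y] ev_BW[of "?inv y"] by (simp add: evalT_mult evalT_scalar)
 qed
 also have "... = (\<Sum>w\<in>?inv ` F. sc (r (BW w)) * tc.XW w)"
  unfolding sum.reindex[OF inj] by (rule sum.cong) (auto simp: fi)
 finally have z: "(\<Sum>w\<in>?inv ` F. sc (r (BW w)) * tc.XW w) = 0" by simp
 have "r y = 0" if "y : F" for y
 proof -
  have "tc.co (tc.delta (?inv y)) (\<Sum>w\<in>?inv ` F. sc (r (BW w)) * tc.XW w) = r (BW (?inv y))"
  by (rule tc.co_delta_sum) (use F(1) fi that in auto)
  thus ?thesis using z fi[OF that] by simp
 qed
 hence "s = 0" unfolding F(3) by (simp add: free_scalar_def)
 thus ?thesis using t by simp
qed

lemma ev_U: "t : carrier TT ==> ev t : tc.U"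
proof -
 assume "t : carrier TT"
 from words_VJ[OF this] obtain s j where t: "t = s + j" "s : fr.span STD" "j : JJ" by (auto simp: VJ_def)
 have "ev s : tc.U" using t(2)
 proof (induction rule: fr.span_induct_alt)
  case base show ?case by (simp add: op.subspace_0[OF tc.U_sub])
 next
  case (step c y z)
  hence "ev y : tc.U" by (auto simp: STD_def ev_BW tc.U_XW)
  thus ?case using step
  by (auto simp: evalT_add evalT_mult evalT_scalar intro!: op.subspace_add[OF tc.U_sub] op.subspace_scale[OF tc.U_sub])
 qed
 thus ?thesis using t ev_JJ by (simp add: evalT_add)
qed

lemma U_ev: assumes "u : tc.U" shows "\<exists>t\<in>carrier TT. ev t = u"
 using assms unfolding tc.U_def
proof (induction rule: op.span_induct_alt)
 case base show ?case using words_in_0 by (intro bexI[of _ 0]) auto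
next
 case (step c x y)
 then obtain w t where "x = tc.XW w" "set w <= {..<M+N}" "t : carrier TT" "ev t = y" by blast
 thus ?case
  by (intro bexI[of _ "free_scalar c * BW w + t"])
  (auto simp: evalT_add evalT_mult evalT_scalar ev_BW intro!: words_in_add words_in_mult words_in_scalar BW_in)
qed

end
section \<open>The decomposition for a graded basis\<close>

context graded_lsa_basis
begin

abbreviation "EU == carrier (env L)"

lemma env_simps:
 "EU = a_rcosets\<^bsub>TT\<^esub> JJ" "x \<otimes>\<^bsub>env L\<^esub> y = rcoset_mult TT JJ x y"
 "\<one>\<^bsub>env L\<^esub> = JJ +>\<^bsub>TT\<^esub> \<one>\<^bsub>TT\<^esub>" "\<zero>\<^bsub>env L\<^esub> = JJ" "x \<oplus>\<^bsub>env L\<^esub> y = set_add TT x y"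
 "c \<odot>\<^bsub>env L\<^esub> y = rcoset_mult TT JJ (JJ +>\<^bsub>TT\<^esub> free_scalar c) y"
 by (simp_all add: env_def Let_def ring.defs FactRing_def)

definition cs where "cs t = JJ +>\<^bsub>TT\<^esub> t"

lemma env_carrier: "EU = cs ` carrier TT"
 by (auto simp: env_simps A_RCOSETS_def' cs_def)

lemma cs_in: "t : carrier TT ==> cs t : EU" by (simp add: env_carrier)

lemma cs_add: "s : carrier TT ==> t : carrier TT ==> cs s \<oplus>\<^bsub>env L\<^esub> cs t = cs (s + t)"
 using ideal.a_rcos_sum[OF JJ_ideal] by (simp add: env_simps cs_def free_algebra_simps)
lemma cs_mult: "s : carrier TT ==> t : carrier TT ==> cs s \<otimes>\<^bsub>env L\<^esub> cs t = cs (s * t)"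
 using ideal.rcoset_mult_add[OF JJ_ideal] by (simp add: env_simps cs_def free_algebra_simps)
lemma cs_smult: "t : carrier TT ==> c \<odot>\<^bsub>env L\<^esub> cs t = cs (free_scalar c * t)"
 using ideal.rcoset_mult_add[OF JJ_ideal words_in_scalar] by (simp add: env_simps cs_def free_algebra_simps)
lemma cs_one: "\<one>\<^bsub>env L\<^esub> = cs 1" by (simp add: env_simps cs_def free_algebra_simps)
lemma cs_zero: "\<zero>\<^bsub>env L\<^esub> = cs 0"
 using ring.a_rcos_zero[OF free_algebra_ring JJ_ideal JJ_0] by (simp add: env_simps cs_def)

lemma cs_eq: assumes "s : carrier TT" "t : carrier TT" shows "cs s = cs t \<longleftrightarrow> ev s = ev t"
proof -
 have "s \<ominus>\<^bsub>TT\<^esub> t = s - t" using free_algebra_uminus[OF assms(2)] by (simp add: a_minus_def free_algebra_simps)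
 hence "cs s = cs t \<longleftrightarrow> s - t : JJ"
  using ring.quotient_eq_iff_same_a_r_cos[OF free_algebra_ring JJ_ideal assms] by (simp add: cs_def)
 also have "... \<longleftrightarrow> ev (s - t) = 0"
  using ev_JJ ev_zero_JJ words_in_minus[OF assms] by blast
 finally show ?thesis by (simp add: evalT_minus)
qed

definition Pi_op where "Pi_op Y = ev (SOME t. t : carrier TT & Y = cs t)"

lemma Pi_cs: assumes "t : carrier TT" shows "Pi_op (cs t) = ev t"
proof -
 let ?s = "SOME s. s : carrier TT & cs t = cs s"
 have "?s : carrier TT & cs t = cs ?s" by (rule someI[of _ t]) (use assms in simp)
 thus ?thesis using cs_eq[OF assms, of ?s] by (simp add: Pi_op_def)
qed

lemma env_obtain: assumes "Y : EU" obtains t where "t : carrier TT" "Y = cs t"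
 using assms by (auto simp: env_carrier)

lemma Pi_inj: "Y : EU ==> Z : EU ==> Pi_op Y = Pi_op Z ==> Y = Z"
 by (elim env_obtain) (simp add: Pi_cs cs_eq)
lemma Pi_U: "Y : EU ==> Pi_op Y : tc.U"
 by (elim env_obtain) (simp add: Pi_cs ev_U)
lemma Pi_surj: "u : tc.U ==> \<exists>Y\<in>EU. Pi_op Y = u"
 by (drule U_ev, elim bexE exE conjE, rule bexI[OF _ cs_in]) (simp_all add: Pi_cs)

lemma env_closed2:
 assumes "Y : EU" "Z : EU"
 shows "Y \<oplus>\<^bsub>env L\<^esub> Z : EU" "Y \<otimes>\<^bsub>env L\<^esub> Z : EU"
  and Pi_add: "Pi_op (Y \<oplus>\<^bsub>env L\<^esub> Z) = Pi_op Y + Pi_op Z"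
  and Pi_mult: "Pi_op (Y \<otimes>\<^bsub>env L\<^esub> Z) = Pi_op Y * Pi_op Z"
proof -
 obtain s t where st: "s : carrier TT" "Y = cs s" "t : carrier TT" "Z = cs t" by (metis assms env_obtain)
 note w = words_in_add[OF st(1,3)] words_in_mult[OF st(1,3)]
 show "Y \<oplus>\<^bsub>env L\<^esub> Z : EU" "Y \<otimes>\<^bsub>env L\<^esub> Z : EU"
  using w by (simp_all add: st(2,4) cs_add cs_mult st(1,3) cs_in)
 show "Pi_op (Y \<oplus>\<^bsub>env L\<^esub> Z) = Pi_op Y + Pi_op Z" "Pi_op (Y \<otimes>\<^bsub>env L\<^esub> Z) = Pi_op Y * Pi_op Z"
  using w by (simp_all add: st(2,4) cs_add cs_mult st(1,3) Pi_cs evalT_add evalT_mult)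
qed

lemma env_smult:
 assumes "Y : EU"
 shows "c \<odot>\<^bsub>env L\<^esub> Y : EU"
  and Pi_smult: "Pi_op (c \<odot>\<^bsub>env L\<^esub> Y) = sc c * Pi_op Y"
proof -
 obtain t where t: "t : carrier TT" "Y = cs t" by (metis assms env_obtain)
 note w = words_in_mult[OF words_in_scalar t(1), of c]
 show "c \<odot>\<^bsub>env L\<^esub> Y : EU" "Pi_op (c \<odot>\<^bsub>env L\<^esub> Y) = sc c * Pi_op Y"
  using w by (simp_all add: t cs_smult cs_in Pi_cs evalT_mult evalT_scalar)
qed

lemmas env_closed = env_closed2(1,2) env_smult(1)

lemma env_zero_in: "\<zero>\<^bsub>env L\<^esub> : EU" "Pi_op \<zero>\<^bsub>env L\<^esub> = 0"
 by (simp_all add: cs_zero cs_in words_in_0 Pi_cs)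
lemma env_one_in: "\<one>\<^bsub>env L\<^esub> : EU" "Pi_op \<one>\<^bsub>env L\<^esub> = 1"
 by (simp_all add: cs_one cs_in words_in_1 Pi_cs evalT_1)
lemma env_emb_in: "x : carrier L ==> env_emb L x : EU" "x : carrier L ==> Pi_op (env_emb L x) = rho x"
proof -
 assume "x : carrier L"
 hence w: "(free_gen x :: 'g free_word \<Rightarrow>\<^sub>0 'k) : carrier TT" by (rule words_in_gen)
 have "env_emb L x = cs (free_gen x)" by (simp add: env_emb_def cs_def)
 thus "env_emb L x : EU" "Pi_op (env_emb L x) = rho x" using w by (simp_all add: cs_in Pi_cs evalT_gen)
qed

lemma env_vectorspace: "vectorspace class_ring (env L)"
proof -
 have f: "field (class_ring :: 'k ring)" using vectorspace_axioms by (simp add: vectorspace_def)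
 hence cr: "cring (class_ring :: 'k ring)" by (meson domain.axioms(1) field.axioms(1))
 have "Module.module class_ring (env L)"
 proof (rule module_criteria[OF cr])
  show "\<forall>v\<in>EU. \<exists>neg_v\<in>EU. v \<oplus>\<^bsub>env L\<^esub> neg_v = \<zero>\<^bsub>env L\<^esub>"
  proof
  fix v assume v: "v : EU"
  have "v \<oplus>\<^bsub>env L\<^esub> (- 1) \<odot>\<^bsub>env L\<^esub> v = \<zero>\<^bsub>env L\<^esub>"
  by (rule Pi_inj) (use v in \<open>simp_all add: env_closed Pi_add Pi_smult env_zero_in sc_uminus\<close>)
  thus "\<exists>neg_v\<in>EU. v \<oplus>\<^bsub>env L\<^esub> neg_v = \<zero>\<^bsub>env L\<^esub>" using env_closed(3)[OF v] by blast
  qed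
 qed ((intro ballI conjI allI impI)?; (rule Pi_inj)?; simp add: env_closed Pi_add Pi_smult env_zero_in sc_mult' sc_add distrib_left distrib_right add_ac)+
 thus ?thesis using f by (simp add: vectorspace_def)
qed

sublocale envs: vectorspace class_ring "env L" by (rule env_vectorspace)

lemma Pi_uminus: assumes "Y : EU" shows "Pi_op (\<ominus>\<^bsub>env L\<^esub> Y) = - Pi_op Y"
proof -
 have "Pi_op (\<ominus>\<^bsub>env L\<^esub> Y \<oplus>\<^bsub>env L\<^esub> Y) = Pi_op (\<ominus>\<^bsub>env L\<^esub> Y) + Pi_op Y" using assms by (intro Pi_add) auto
 thus ?thesis using assms envs.l_neg[OF assms] env_zero_in by (simp add: eq_neg_iff_add_eq_0)
qed

lemma Pi_minus: assumes "Y : EU" "Z : EU" shows "Pi_op (Y \<ominus>\<^bsub>env L\<^esub> Z) = Pi_op Y - Pi_op Z"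
 using assms by (simp add: a_minus_def Pi_add Pi_uminus)

lemma Pi_finsum: "finite A ==> v : A \<rightarrow> EU ==> Pi_op (\<Oplus>\<^bsub>env L\<^esub>i\<in>A. v i) = (\<Sum>i\<in>A. Pi_op (v i))"
proof (induction A rule: finite_induct)
 case empty thus ?case by (simp add: env_zero_in)
next
 case (insert a A)
 hence "(\<Oplus>\<^bsub>env L\<^esub>i\<in>A. v i) : EU" by (intro envs.finsum_closed) auto
 thus ?case using insert by (simp add: Pi_add Pi_def)
qed

lemma env_subspaceI:
 assumes "W <= EU" "\<zero>\<^bsub>env L\<^esub> : W" "!!v w. v : W ==> w : W ==> v \<oplus>\<^bsub>env L\<^esub> w : W"
  "!!c v. v : W ==> c \<odot>\<^bsub>env L\<^esub> v : W"
 shows "subspace class_ring W (env L)"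
 using assms env_vectorspace envs.module_axioms by (auto simp: subspace_def submodule_def)

subsection \<open>The parity decomposition of the enveloping algebra\<close>

definition sgb :: "bit => 'k" where "sgb p = (if p = 0 then 1 else - 1)"

lemma sgb_add: "sgb (p + q) = sgb p * sgb q" by (cases p; cases q) (auto simp: sgb_def)

definition eig where "eig p = {Y : EU. tc.kappa (Pi_op Y) = sc (sgb p) * Pi_op Y}"

lemma eig_subspace: "subspace class_ring (eig p) (env L)"
 by (rule env_subspaceI)
  (auto simp: eig_def env_zero_in env_closed Pi_add Pi_smult tc.kappa_add tc.kappa_sc distrib_left sc_mult' mult.commute)

lemma kappa_rho: assumes "x : part L p" shows "tc.kappa (rho x) = sc (sgb p) * rho x"
proof -
 have "sc (crd x k) * tc.kappa (tc.X k) = sc (sgb p) * (sc (crd x k) * tc.X k)" for k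
 proof (cases "crd x k = 0")
  case False
  hence k: "k < M + N" "dg k = 0 \<longleftrightarrow> p = 0" using part_crd[OF assms] by auto
  hence "(if pr k then - 1 else 1) = sgb p" using pr_dg[OF k(1)] by (auto simp: sgb_def)
  thus ?thesis by (simp only: tc.kappa_X sc_mult' mult.commute)
 qed simp
 thus ?thesis by (simp add: rho_def tc.kappa_sum tc.kappa_sc sum_distrib_left)
qed

lemma monomial_eig: "env_monomial L p v ==> v : eig p"
proof (induction rule: env_monomial.induct)
 case 1 thus ?case by (simp add: eig_def env_one_in sgb_def)
next
 case (2 x p q v)
 hence "x : carrier L" "v : EU" using part_in by (auto simp: eig_def)
 hence c: "env_emb L x : EU" "Pi_op (env_emb L x) = rho x" "v : EU" by (simp_all add: env_emb_in)
 have k: "tc.kappa (Pi_op v) = sc (sgb q) * Pi_op v" using 2 by (simp add: eig_def)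
 have "tc.kappa (rho x * Pi_op v) = sc (sgb p) * (rho x * (sc (sgb q) * Pi_op v))"
  unfolding tc.kappa_mult kappa_rho[OF 2(1)] k by (simp only: mult.assoc)
 also have "... = sc (sgb (p + q)) * (rho x * Pi_op v)"
  unfolding sgb_add sc_left_comm[of "rho x"] by (simp only: sc_mult')
 finally show ?case unfolding eig_def using env_closed(2)[OF c(1,3)] Pi_mult[OF c(1,3)] c(2) by simp
qed

lemma word_monomial: "set w <= {..<M+N} ==> \<exists>p v. env_monomial L p v & Pi_op v = tc.XW w & sgb p = tc.sgnw w"
proof (induction w)
 case Nil
 have "env_monomial L 0 \<one>\<^bsub>env L\<^esub>" by (rule env_monomial.intros)
 thus ?case using env_one_in by (intro exI[of _ 0] exI[of _ "\<one>\<^bsub>env L\<^esub>"]) (simp add: sgb_def)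
next
 case (Cons k w)
 then obtain q v where v: "env_monomial L q v" "Pi_op v = tc.XW w" "sgb q = tc.sgnw w" by auto
 have k: "k < M + N" using Cons.prems by simp
 let ?p = "if dg k = 0 then 0 else 1 :: bit"
 have "env_monomial L (?p + q) (env_emb L (b k) \<otimes>\<^bsub>env L\<^esub> v)" by (rule env_monomial.intros(2)[OF b_part[OF k] v(1)])
 moreover have "v : EU" using monomial_eig[OF v(1)] by (simp add: eig_def)
 hence "Pi_op (env_emb L (b k) \<otimes>\<^bsub>env L\<^esub> v) = tc.XW (k # w)"
  using v(2) k by (simp add: Pi_mult env_emb_in b_in rho_b)
 moreover have "sgb ?p = (if pr k then - 1 else 1)" using pr_dg[OF k] by (auto simp: sgb_def)
 hence "sgb (?p + q) = tc.sgnw (k # w)" unfolding sgb_add v(3) by (simp only: tc.sgnw_simps)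
 ultimately show ?case by blast
qed

lemma sc_two: "sc (2 :: 'k) * A = (A + A :: (nat list, 'k) operator)"
proof -
 have "sc (2 :: 'k) = (sc 1 + sc 1 :: (nat list, 'k) operator)" by (simp only: sc_add[symmetric] one_add_one)
 hence "sc (2 :: 'k) * A = sc 1 * A + sc 1 * A" by (simp only: distrib_right)
 thus ?thesis by simp
qed

lemma env_part_subspace: "subspace class_ring (env_part L p) (env L)"
 unfolding env_part_def using monomial_eig by (intro envs.span_is_subspace) (auto simp: eig_def)

text \<open>The parity parts are the eigenspaces of the parity automorphism; in particular their sum is direct.\<close>

lemma env_part_eq: "env_part L p = eig p"
proof
 show "env_part L p <= eig p" unfolding env_part_def
 proof (rule envs.span_is_subset)
  show "submodule class_ring (eig p) (env L)" using eig_subspace by (simp add: subspace_def)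
 qed (use monomial_eig in auto)
 have proj: "\<exists>Y\<in>env_part L p. Pi_op Y = sc (1/2) * (u + sc (sgb p) * tc.kappa u)" if "u : tc.U" for u
  using that unfolding tc.U_def
 proof (induction rule: op.span_induct_alt)
  case base
  have "\<zero>\<^bsub>env L\<^esub> : env_part L p" using env_part_subspace[of p] by (auto simp: subspace_def intro: submodule.zero_closed)
  thus ?case using env_zero_in by (intro bexI[of _ "\<zero>\<^bsub>env L\<^esub>"]) auto
 next
  case (step c x y)
  then obtain w where w: "x = tc.XW w" "set w <= {..<M+N}" by blast
  obtain Y where Y: "Y : env_part L p" "Pi_op Y = sc (1/2) * (y + sc (sgb p) * tc.kappa y)" using step by blast
  obtain q v where v: "env_monomial L q v" "Pi_op v = tc.XW w" "sgb q = tc.sgnw w" using word_monomial[OF w(2)] by blast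
  have vin: "v : EU" using monomial_eig[OF v(1)] by (simp add: eig_def)
  have sub: "submodule class_ring (env_part L p) (env L)" using env_part_subspace by (simp add: subspace_def)
  hence Yin: "Y : EU" using Y(1) submodule.subset by blast
  let ?Z = "if p = q then v else \<zero>\<^bsub>env L\<^esub>"
  have Z: "?Z : env_part L p"
  proof (cases "p = q")
  case True
  have "v : env_part L q" unfolding env_part_def using v(1) monomial_eig
  by (intro envs.in_own_span[THEN subsetD]) (auto simp: eig_def)
  thus ?thesis using True by simp
  next
  case False thus ?thesis using submodule.zero_closed[OF sub] by simp
  qed
  have "sc (1/2) * (x + sc (sgb p) * tc.kappa x) = Pi_op ?Z"
  proof -
  have "x + sc (sgb p) * tc.kappa x = sc (1 + sgb p * sgb q) * x"
  using v(3) w(1) by (simp add: tc.kappa_XW sc_mult' sc_add distrib_right)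
  moreover have "1 + sgb p * sgb q = (if p = q then 2 else 0)" by (cases p; cases q) (auto simp: sgb_def)
  ultimately show ?thesis using v(2) w(1) env_zero_in by (simp add: sc_mult')
  qed
  note Z' = this[symmetric]
  have Zin: "?Z : EU" using vin env_zero_in by simp
  have "Pi_op (c \<odot>\<^bsub>env L\<^esub> ?Z \<oplus>\<^bsub>env L\<^esub> Y) = sc c * Pi_op ?Z + Pi_op Y"
  using Pi_add[OF env_closed(3)[OF Zin] Yin] Pi_smult[OF Zin] by simp
  also have "... = sc (1/2) * ((sc c * x + y) + sc (sgb p) * tc.kappa (sc c * x + y))"
  unfolding Z' Y(2) by (simp add: tc.kappa_add tc.kappa_sc distrib_left sc_mult' mult.commute algebra_simps)
  finally have "Pi_op (c \<odot>\<^bsub>env L\<^esub> ?Z \<oplus>\<^bsub>env L\<^esub> Y) = sc (1/2) * ((sc c * x + y) + sc (sgb p) * tc.kappa (sc c * x + y))" .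
  moreover have "c \<odot>\<^bsub>env L\<^esub> ?Z \<oplus>\<^bsub>env L\<^esub> Y : env_part L p"
  using Z Y(1) by (intro submodule.m_closed[OF sub] submodule.smult_closed[OF sub]) auto
  ultimately show ?case by blast
 qed
 show "eig p <= env_part L p"
 proof
  fix Y assume Y: "Y : eig p"
  hence Yc: "Y : EU" and k: "tc.kappa (Pi_op Y) = sc (sgb p) * Pi_op Y" by (auto simp: eig_def)
  obtain Z where Z: "Z : env_part L p" "Pi_op Z = sc (1/2) * (Pi_op Y + sc (sgb p) * tc.kappa (Pi_op Y))"
  using proj[OF Pi_U[OF Yc]] by blast
  have "Pi_op Y + sc (sgb p) * tc.kappa (Pi_op Y) = sc 2 * Pi_op Y"
  unfolding k sc_mult' sc_two by (simp add: sgb_def)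
  hence "Pi_op Z = Pi_op Y" using Z(2) by (simp add: sc_mult')
  moreover have "Z : EU"
  using Z(1) env_part_subspace[of p] submodule.subset by (auto simp: subspace_def)
  ultimately show "Y : env_part L p" using Pi_inj[OF _ Yc] Z(1) by metis
 qed
qed

lemma env_finsum_bit: "v 0 : EU ==> v 1 : EU ==>
  (\<Oplus>\<^bsub>env L\<^esub>i\<in>(UNIV :: bit set). v i) = v 0 \<oplus>\<^bsub>env L\<^esub> v 1"
 by (simp add: UNIV_bit Pi_def)

lemma half_eig:
 assumes "Y : EU"
 shows "\<exists>Z\<in>eig p. Pi_op Z = sc (1/2) * (Pi_op Y + sc (sgb p) * tc.kappa (Pi_op Y))"
proof -
 have u: "sc (1/2) * (Pi_op Y + sc (sgb p) * tc.kappa (Pi_op Y)) : tc.U"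
  by (intro op.subspace_scale[OF tc.U_sub] op.subspace_add[OF tc.U_sub] Pi_U assms tc.kappa_U)
 obtain Z where Z: "Z : EU" "Pi_op Z = sc (1/2) * (Pi_op Y + sc (sgb p) * tc.kappa (Pi_op Y))"
  using Pi_surj[OF u] by blast
 have "sgb p * sgb p = 1" by (simp add: sgb_def)
 hence "tc.kappa (Pi_op Z) = sc (sgb p) * Pi_op Z"
  unfolding Z(2) by (simp add: tc.kappa_sc tc.kappa_add distrib_left sc_mult' mult_ac add.commute)
 thus ?thesis using Z by (auto simp: eig_def)
qed

lemma sc_half_2: "sc (1/2) * (A + A) = (A :: (nat list, 'k) operator)"
proof -
 have "sc (1/2) * (A + A) = (sc (1/2) + sc (1/2)) * A" by (simp add: distrib_left distrib_right)
 also have "... = A" unfolding sc_add[symmetric] by simp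
 finally show ?thesis .
qed

lemma eig_unique:
 assumes "v : eig 0" "w : eig 1" "Pi_op v + Pi_op w = V"
 shows "Pi_op v = sc (1/2) * (V + tc.kappa V)" "Pi_op w = sc (1/2) * (V - tc.kappa V)"
proof -
 have k: "tc.kappa (Pi_op v) = Pi_op v" "tc.kappa (Pi_op w) = - Pi_op w"
  using assms by (auto simp: eig_def sgb_def sc_uminus)
 have "V + tc.kappa V = Pi_op v + Pi_op v" "V - tc.kappa V = Pi_op w + Pi_op w"
  unfolding assms(3)[symmetric] by (simp_all add: tc.kappa_add k)
 thus "Pi_op v = sc (1/2) * (V + tc.kappa V)" "Pi_op w = sc (1/2) * (V - tc.kappa V)" by (simp_all only: sc_half_2)
qed

lemma env_parity: "internal_direct_sum (env L) UNIV (env_part L) (EU)"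
 unfolding internal_direct_sum_def env_part_eq[abs_def]
proof (intro conjI ballI eig_subspace bij_betwI')
 have c: "v p : EU" if "v : (\<Pi>\<^sub>E i\<in>UNIV. eig i)" for v p using that by (auto simp: eig_def PiE_iff)
 have s: "(\<Oplus>\<^bsub>env L\<^esub>i\<in>UNIV. v i) = v 0 \<oplus>\<^bsub>env L\<^esub> v 1" if "v : (\<Pi>\<^sub>E i\<in>UNIV. eig i)" for v
  by (rule env_finsum_bit) (use c[OF that] in auto)
 show "(\<Oplus>\<^bsub>env L\<^esub>i\<in>UNIV. v i) : EU" if "v : (\<Pi>\<^sub>E i\<in>UNIV. eig i)" for v
  unfolding s[OF that] using c[OF that] by (intro env_closed) auto
 show "((\<Oplus>\<^bsub>env L\<^esub>i\<in>UNIV. v i) = (\<Oplus>\<^bsub>env L\<^esub>i\<in>UNIV. w i)) = (v = w)"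
  if v: "v : (\<Pi>\<^sub>E i\<in>UNIV. eig i)" and w: "w : (\<Pi>\<^sub>E i\<in>UNIV. eig i)" for v w
 proof
  assume eq: "(\<Oplus>\<^bsub>env L\<^esub>i\<in>UNIV. v i) = (\<Oplus>\<^bsub>env L\<^esub>i\<in>UNIV. w i)"
  have e: "Pi_op (v 0) + Pi_op (v 1) = Pi_op (w 0) + Pi_op (w 1)"
  using arg_cong[OF eq, of Pi_op] unfolding s[OF v] s[OF w] using c[OF v] c[OF w] by (simp add: Pi_add)
  have ve: "v 0 : eig 0" "v 1 : eig 1" "w 0 : eig 0" "w 1 : eig 1" using v w by (auto simp: PiE_iff)
  have "Pi_op (v 0) = Pi_op (w 0)" "Pi_op (v 1) = Pi_op (w 1)"
  using eig_unique[OF ve(1,2) e] eig_unique[OF ve(3,4) refl] by auto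
  hence "v 0 = w 0" "v 1 = w 1" using c[OF v] c[OF w] Pi_inj by blast+
  hence "v p = w p" for p by (cases p) auto
  thus "v = w" by blast
 qed simp
 show "\<exists>v\<in>(\<Pi>\<^sub>E i\<in>UNIV. eig i). Y = (\<Oplus>\<^bsub>env L\<^esub>i\<in>UNIV. v i)" if Y: "Y : EU" for Y
 proof -
  obtain Z0 Z1 where Z: "Z0 : eig 0" "Pi_op Z0 = sc (1/2) * (Pi_op Y + sc (sgb 0) * tc.kappa (Pi_op Y))"
  "Z1 : eig 1" "Pi_op Z1 = sc (1/2) * (Pi_op Y + sc (sgb 1) * tc.kappa (Pi_op Y))" using half_eig[OF Y] by metis
  define v where "v p = (if p = 0 then Z0 else Z1)" for p :: bit
  have v: "v : (\<Pi>\<^sub>E i\<in>UNIV. eig i)" using Z bit_not_zero_iff by (auto simp: v_def PiE_iff)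
  have "Pi_op Z0 + Pi_op Z1 = sc (1/2) * (Pi_op Y + Pi_op Y)"
  unfolding Z(2,4) by (simp add: sgb_def sc_uminus distrib_left right_diff_distrib)
  hence p: "Pi_op Z0 + Pi_op Z1 = Pi_op Y" by (simp only: sc_half_2)
  have "Pi_op Y = Pi_op (v 0 \<oplus>\<^bsub>env L\<^esub> v 1)"
  using Pi_add[OF c[OF v] c[OF v], of 0 1] p by (simp add: v_def)
  hence "Y = v 0 \<oplus>\<^bsub>env L\<^esub> v 1"
  by (rule Pi_inj[OF Y env_closed(1)[OF c[OF v] c[OF v]]])
  thus ?thesis unfolding s[OF v, symmetric] by (rule bexI[OF _ v])
 qed
qed

lemma env_component:
 assumes "Y : EU"
 defines "v \<equiv> component (env L) UNIV (env_part L) Y"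
 shows "v p : EU" "Pi_op (v 0) + Pi_op (v 1) = Pi_op Y" "Pi_op (v 0) - Pi_op (v 1) = tc.kappa (Pi_op Y)"
proof -
 have v: "v : (\<Pi>\<^sub>E i\<in>UNIV. env_part L i)" "(\<Oplus>\<^bsub>env L\<^esub>i\<in>UNIV. v i) = Y"
  unfolding v_def using component_in[OF env_parity assms(1)] by auto
 have e: "v p : eig p" for p using v(1) by (auto simp: env_part_eq)
 thus c: "v p : EU" for p by (auto simp: eig_def)
 thus s: "Pi_op (v 0) + Pi_op (v 1) = Pi_op Y" using v(2) env_finsum_bit[of v] Pi_add by metis
 have "tc.kappa (Pi_op (v 0)) = Pi_op (v 0)" "tc.kappa (Pi_op (v 1)) = - Pi_op (v 1)"
  using e[of 0] e[of 1] by (auto simp: eig_def sgb_def sc_uminus)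
 thus "Pi_op (v 0) - Pi_op (v 1) = tc.kappa (Pi_op Y)" unfolding s[symmetric] by (simp add: tc.kappa_add)
qed

lemma finsum_bit: "f 0 : carrier L ==> f 1 : carrier L ==> (\<Oplus>i\<in>(UNIV :: bit set). f i) = f 0 \<oplus> f 1"
 unfolding UNIV_bit by (rule finsum_2) simp_all

lemma L_component:
 assumes "u : carrier L"
 shows "component L UNIV (part L) u p : part L p"
  "u = component L UNIV (part L) u 0 \<oplus> component L UNIV (part L) u 1"
proof -
 let ?v = "component L UNIV (part L) u"
 have v: "?v : (\<Pi>\<^sub>E i\<in>UNIV. part L i)" "(\<Oplus>i\<in>UNIV. ?v i) = u" using component_in[OF parity_decomposition assms] by auto
 thus p: "?v p : part L p" for p by auto
 have "(\<Oplus>i\<in>UNIV. ?v i) = ?v 0 \<oplus> ?v 1"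
  by (rule finsum_bit) (rule part_in[OF p])+
 thus "u = ?v 0 \<oplus> ?v 1" using v(2) by simp
qed

lemma part_zero: "\<zero> : part L p"
 using part_subspace[of p] by (auto simp: subspace_def intro: submodule.zero_closed)

lemma L_component_part:
 assumes "u : part L p"
 shows "component L UNIV (part L) u q = (if q = p then u else \<zero>)"
proof -
 define v where "v q = (if q = p then u else \<zero>)" for q :: bit
 have v: "v : (\<Pi>\<^sub>E i\<in>UNIV. part L i)" using assms part_zero by (auto simp: v_def PiE_iff)
 have "(\<Oplus>i\<in>UNIV. v i) = v 0 \<oplus> v 1"
  by (rule finsum_bit) (use v part_in in \<open>auto simp: PiE_iff\<close>)
 also have "... = u" using part_in[OF assms] by (cases p) (auto simp: v_def)
 finally show ?thesis using component_finsum[OF parity_decomposition v] by (simp add: v_def)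
qed

text \<open>For odd \<open>u\<close> the sign \<open>(-1)\<^bsup>|v|\<^esup>\<close> is absorbed by the parity automorphism \<open>kappa\<close>.\<close>

lemma Pi_twisted_ad:
 assumes u: "u : carrier L" and Y: "Y : EU" and \<phi>: "!!x. x : carrier L ==> \<phi> x : carrier L"
 defines "u0 \<equiv> component L UNIV (part L) u 0" and "u1 \<equiv> component L UNIV (part L) u 1"
 shows "twisted_ad L \<phi> u Y : EU"
  "Pi_op (twisted_ad L \<phi> u Y) = (rho u0 * Pi_op Y - Pi_op Y * rho (\<phi> u0)) +
  (rho u1 * Pi_op Y - tc.kappa (Pi_op Y) * rho (\<phi> u1))"
proof -
 let ?u = "component L UNIV (part L) u" and ?v = "component (env L) UNIV (env_part L) Y"
 have uc: "?u p : carrier L" for p using L_component(1)[OF u] part_in by blast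
 note vc = env_component(1)[OF Y]
 define t where "t p q = env_emb L (?u p) \<otimes>\<^bsub>env L\<^esub> ?v q \<ominus>\<^bsub>env L\<^esub>
  super_sign p q \<odot>\<^bsub>env L\<^esub> (?v q \<otimes>\<^bsub>env L\<^esub> env_emb L (\<phi> (?u p)))" for p q
 have tc: "t p q : EU" for p q
  unfolding t_def using uc vc \<phi> by (intro envs.minus_closed env_closed env_emb_in) auto
 have tP: "Pi_op (t p q) = rho (?u p) * Pi_op (?v q) - sc (super_sign p q) * (Pi_op (?v q) * rho (\<phi> (?u p)))" for p q
  unfolding t_def using uc vc \<phi> by (simp add: Pi_minus env_closed env_emb_in Pi_mult Pi_smult)
 have T: "twisted_ad L \<phi> u Y = (t 0 0 \<oplus>\<^bsub>env L\<^esub> t 0 1) \<oplus>\<^bsub>env L\<^esub> (t 1 0 \<oplus>\<^bsub>env L\<^esub> t 1 1)"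
 proof -
  have "(\<Oplus>\<^bsub>env L\<^esub>q\<in>UNIV. t p q) = t p 0 \<oplus>\<^bsub>env L\<^esub> t p 1" for p by (rule env_finsum_bit) (rule tc)+
  thus ?thesis unfolding twisted_ad_def Let_def t_def[symmetric]
  by (simp only: ) (rule env_finsum_bit; intro env_closed tc)
 qed
 show "twisted_ad L \<phi> u Y : EU" unfolding T by (intro env_closed tc)
 have "Pi_op (twisted_ad L \<phi> u Y) = (Pi_op (t 0 0) + Pi_op (t 0 1)) + (Pi_op (t 1 0) + Pi_op (t 1 1))"
  unfolding T by (simp add: Pi_add env_closed tc)
 also have "Pi_op (t 0 0) + Pi_op (t 0 1) = rho u0 * Pi_op Y - Pi_op Y * rho (\<phi> u0)"
  unfolding tP u0_def env_component(2)[OF Y, symmetric] by (simp add: super_sign_def algebra_simps)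
 also have "Pi_op (t 1 0) + Pi_op (t 1 1) = rho u1 * Pi_op Y - tc.kappa (Pi_op Y) * rho (\<phi> u1)"
  unfolding tP u1_def env_component(3)[OF Y, symmetric]
  unfolding env_component(2)[OF Y, symmetric]
  by (simp add: super_sign_def algebra_simps sc_uminus)
 finally show "Pi_op (twisted_ad L \<phi> u Y) = (rho u0 * Pi_op Y - Pi_op Y * rho (\<phi> u0)) +
  (rho u1 * Pi_op Y - tc.kappa (Pi_op Y) * rho (\<phi> u1))" .
qed

subsection \<open>Twisted centres of the scalings\<close>

abbreviation "gs \<equiv> grading_scaling L G"

definition scal :: "'k => nat => 'k" where "scal c k = (if dg k = -1 then c else if dg k = 0 then 1 else inverse c)"

lemma gs_crd:
 assumes x: "x : carrier L"
 shows "gs c x : carrier L" "crd (gs c x) k = scal c k * crd x k"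
proof -
 let ?v = "component L {-1, 0, 1} G x"
 have v: "?v : (\<Pi>\<^sub>E i\<in>{-1, 0, 1}. G i)" "(\<Oplus>i\<in>{-1, 0, 1}. ?v i) = x" using component_in[OF G_sum x] by auto
 hence vG: "?v (-1) : G (-1)" "?v 0 : G 0" "?v 1 : G 1" by auto
 hence vc: "?v (-1) : carrier L" "?v 0 : carrier L" "?v 1 : carrier L"
  using G_c[of "-1"] G_c[of 0] G_c[of 1] by auto
 have xs: "x = ?v (-1) \<oplus> ?v 0 \<oplus> ?v 1" using v(2) finsum_3[of "-1" 0 1 ?v] vc by simp
 have gx: "gs c x = c \<odot> ?v (-1) \<oplus> ?v 0 \<oplus> inverse c \<odot> ?v 1"
  using x by (simp add: grading_scaling_def Let_def)
 show "gs c x : carrier L" unfolding gx using vc by (simp add: smult_in)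
 have 1: "crd (gs c x) k = c * crd (?v (-1)) k + crd (?v 0) k + inverse c * crd (?v 1) k"
  unfolding gx using vc by (simp add: lin_add[OF crd_lin] lin_smult[OF crd_lin] smult_in)
 have 2: "crd x k = crd (?v (-1)) k + crd (?v 0) k + crd (?v 1) k"
  using arg_cong[OF xs, of "%x. crd x k"] vc by (simp add: lin_add[OF crd_lin])
 have 3: "crd (?v (-1)) k ~= 0 --> dg k = -1" "crd (?v 0) k ~= 0 --> dg k = 0" "crd (?v 1) k ~= 0 --> dg k = 1"
  using crd_deg[OF vG(1)] crd_deg[OF vG(2)] crd_deg[OF vG(3)] by blast+
 show "crd (gs c x) k = scal c k * crd x k"
  unfolding 1 2 scal_def using 3
  by (cases "crd (?v (-1)) k = 0"; cases "crd (?v 0) k = 0"; cases "crd (?v 1) k = 0") auto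
qed

lemma gs_even: assumes "x : part L 0" shows "gs c x = x"
proof (rule crd_eqI)
 have x: "x : carrier L" using assms part_in by blast
 thus "gs c x : carrier L" "x : carrier L" using gs_crd by auto
 fix k
 show "crd (gs c x) k = crd x k" using gs_crd(2)[OF x, of c k] part_crd[OF assms, of k]
  by (cases "crd x k = 0") (auto simp: scal_def)
qed

lemma gs_b: assumes "k < M + N" shows "rho (gs c (b k)) = sc (scal c k) * tc.X k"
proof -
 have "rho (gs c (b k)) = (\<Sum>j<M+N. sc (scal c j) * (sc (crd (b k) j) * tc.X j))"
  unfolding rho_def using gs_crd(2)[OF b_in[OF assms]] by (simp add: sc_mult')
 also have "... = (\<Sum>j<M+N. if k = j then sc (scal c k) * tc.X k else 0)"
  by (rule sum.cong) (use assms in \<open>auto simp: crd_b\<close>)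
 finally show ?thesis using assms by simp
qed

lemma dg_F: "k < N ==> dg k = -1" and dg_Z: "N <= k ==> k < M ==> dg k = 0" and dg_E: "M <= k ==> k < M + N ==> dg k = 1"
 using NM by (auto simp: type_I_degree_def)

lemma rho_zero: "rho \<zero> = 0"
 unfolding rho_def by (rule sum.neutral) (simp add: lin_fun_zero[OF crd_lin])

lemma twisted_centre_iff:
 assumes Y: "Y : EU"
 shows "Y : twisted_centre L (gs c) \<longleftrightarrow> Pi_op Y : tc.Acent c"
proof
 let ?V = "Pi_op Y"
 have ad1: "twisted_ad L (gs c) u Y : EU" if "u : carrier L" for u
  by (rule Pi_twisted_ad(1)[OF that Y]) (rule gs_crd(1))
 have ad: "Pi_op (twisted_ad L (gs c) u Y) =
  (rho (component L UNIV (part L) u 0) * ?V - ?V * rho (gs c (component L UNIV (part L) u 0))) +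
  (rho (component L UNIV (part L) u 1) * ?V - tc.kappa ?V * rho (gs c (component L UNIV (part L) u 1)))"
  if "u : carrier L" for u
  by (rule Pi_twisted_ad(2)[OF that Y]) (rule gs_crd(1))
 have tz: "twisted_ad L (gs c) u Y = \<zero>\<^bsub>env L\<^esub> \<longleftrightarrow> Pi_op (twisted_ad L (gs c) u Y) = 0" if "u : carrier L" for u
 proof
  assume "twisted_ad L (gs c) u Y = \<zero>\<^bsub>env L\<^esub>"
  thus "Pi_op (twisted_ad L (gs c) u Y) = 0" by (simp only: env_zero_in(2))
 next
  assume "Pi_op (twisted_ad L (gs c) u Y) = 0"
  thus "twisted_ad L (gs c) u Y = \<zero>\<^bsub>env L\<^esub>"
  by (intro Pi_inj[OF ad1[OF that] env_zero_in(1)]) (simp_all only: env_zero_in(2))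
 qed
 {
  assume t: "Y : twisted_centre L (gs c)"
  have even: "tc.X k * ?V = ?V * tc.X k" if k: "k < M + N" "dg k = 0" for k
  proof -
  have bp: "b k : part L 0" using b_part[OF k(1)] k(2) by simp
  have "Pi_op (twisted_ad L (gs c) (b k) Y) = 0" using t tz[OF b_in[OF k(1)]] b_in[OF k(1)] unfolding twisted_centre_def by blast
  from this[unfolded ad[OF b_in[OF k(1)]]] show ?thesis
  using L_component_part[OF bp] gs_even[OF part_zero] gs_even[OF bp] by (simp add: rho_zero rho_b[OF k(1)])
  qed
  have odd: "tc.X k * ?V = sc (scal c k) * (tc.kappa ?V * tc.X k)" if k: "k < M + N" "dg k ~= 0" for k
  proof -
  have bp: "b k : part L 1" using b_part[OF k(1)] k(2) by simp
  have "Pi_op (twisted_ad L (gs c) (b k) Y) = 0" using t tz[OF b_in[OF k(1)]] b_in[OF k(1)] unfolding twisted_centre_def by blast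
  from this[unfolded ad[OF b_in[OF k(1)]]]
  have "tc.X k * ?V = tc.kappa ?V * (sc (scal c k) * tc.X k)"
  using L_component_part[OF bp] gs_even[OF part_zero] by (simp add: rho_zero rho_b[OF k(1)] gs_b[OF k(1)])
  thus ?thesis by (simp add: sc_left_comm[of "tc.kappa ?V"])
  qed
  show "?V : tc.Acent c" unfolding tc.Acent_def
  proof (intro CollectI conjI ballI Pi_U[OF Y])
  fix a assume "a : {N..<M}" thus "tc.X a * ?V = ?V * tc.X a" using even[of a] dg_Z[of a] by auto
  next
  fix a assume "a : {M..<M+N}" thus "tc.X a * ?V = sc (inverse c) * (tc.kappa ?V * tc.X a)"
  using odd[of a] dg_E[of a] by (auto simp: scal_def)
  next
  fix a assume "a : {..<N}" thus "tc.X a * ?V = sc c * (tc.kappa ?V * tc.X a)"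
  using odd[of a] dg_F[of a] by (auto simp: scal_def)
  qed
 }
 {
  assume V: "?V : tc.Acent c"
  have odd: "tc.X k * ?V = tc.kappa ?V * (sc (scal c k) * tc.X k)" if "k < M + N" "dg k ~= 0" for k
  using V that NM unfolding tc.Acent_def sc_left_comm[of "tc.kappa ?V"]
  by (cases "k < N"; cases "k < M") (auto simp: scal_def type_I_degree_def)
  have even: "tc.X k * ?V = ?V * tc.X k" if "k < M + N" "dg k = 0" for k
  using V that NM unfolding tc.Acent_def by (auto simp: type_I_degree_def split: if_splits)
  have r1: "rho x * ?V = tc.kappa ?V * rho (gs c x)" if x: "x : part L 1" for x
  proof -
  have xc: "x : carrier L" using x part_in by blast
  have "sc (crd x k) * tc.X k * ?V = tc.kappa ?V * (sc (crd (gs c x) k) * tc.X k)" if "k < M + N" for k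
  proof (cases "crd x k = 0")
  case False
  hence "dg k ~= 0" using part_crd[OF x] by auto
  thus ?thesis unfolding mult.assoc odd[OF that \<open>dg k ~= 0\<close>] gs_crd(2)[OF xc] sc_left_comm[of "tc.kappa ?V"]
  by (simp only: sc_mult' mult.commute[of "crd x k"])
  qed (simp add: gs_crd(2)[OF xc])
  thus ?thesis by (simp add: rho_def sum_distrib_left sum_distrib_right)
  qed
  have r0: "rho x * ?V = ?V * rho (gs c x)" if x: "x : part L 0" for x
  proof -
  have "sc (crd x k) * tc.X k * ?V = ?V * (sc (crd x k) * tc.X k)" if "k < M + N" for k
  proof (cases "crd x k = 0")
  case False
  hence "dg k = 0" using part_crd[OF x] by auto
  thus ?thesis unfolding mult.assoc even[OF that \<open>dg k = 0\<close>] sc_left_comm[of ?V] by - (rule refl)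
  qed simp
  thus ?thesis unfolding gs_even[OF x] by (simp add: rho_def sum_distrib_left sum_distrib_right)
  qed
  show "Y : twisted_centre L (gs c)" unfolding twisted_centre_def
  proof (intro CollectI conjI ballI Y)
  fix u assume u: "u : carrier L"
  have "Pi_op (twisted_ad L (gs c) u Y) = 0" unfolding ad[OF u]
  using r0[OF L_component(1)[OF u]] r1[OF L_component(1)[OF u]] by simp
  thus "twisted_ad L (gs c) u Y = \<zero>\<^bsub>env L\<^esub>" using tz[OF u] by simp
  qed
 }
qed

lemma gs_part: assumes "x : part L p" shows "gs c x : part L p"
proof -
 have x: "x : carrier L" using assms part_in by blast
 have "gs c x = (\<Oplus>k\<in>{..<M+N}. crd (gs c x) k \<odot> b k)" by (rule crd_expand[OF gs_crd(1)[OF x]])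
 also have "... : part L p"
 proof (rule subspace_finsum[OF part_subspace])
  fix k assume k: "k : {..<M+N}"
  show "crd (gs c x) k \<odot> b k : part L p"
  proof (cases "crd x k = 0")
  case True
  thus ?thesis using gs_crd(2)[OF x, of c k] k by (simp add: smult_0 b_in part_zero)
  next
  case False
  hence "dg k = 0 \<longleftrightarrow> p = 0" using part_crd[OF assms] by auto
  hence "b k : part L p" using b_part[of k] k bit_not_zero_iff by (cases p) auto
  thus ?thesis by (rule subspace_smult[OF part_subspace])
  qed
 qed simp
 finally show ?thesis .
qed

lemma gs_Aut: assumes c: "c ~= 0" shows "gs c : Aut_even L"
proof -
 have inv: "gs (inverse e) (gs e x) = x" if x: "x : carrier L" and e: "e ~= 0" for x e
 proof (rule crd_eqI)
  show "gs (inverse e) (gs e x) : carrier L" "x : carrier L" using x gs_crd(1) by auto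
  fix k show "crd (gs (inverse e) (gs e x)) k = crd x k"
  using gs_crd(2)[OF gs_crd(1)[OF x]] gs_crd(2)[OF x] e by (simp add: scal_def)
 qed
 have inv': "gs c (gs (inverse c) x) = x" if "x : carrier L" for x using inv[OF that, of "inverse c"] c by simp
 have hom: "gs c : LinearCombinations.module_hom class_ring L L"
  unfolding LinearCombinations.module_hom_def
 proof (intro CollectI conjI allI impI)
  show "gs c : carrier L \<rightarrow> carrier L" using gs_crd(1) by auto
  fix x y assume xy: "x : carrier L & y : carrier L"
  show "gs c (x \<oplus> y) = gs c x \<oplus> gs c y"
  by (rule crd_eqI) (use xy in \<open>simp_all add: gs_crd lin_add[OF crd_lin] distrib_left\<close>)
 next
  fix r x assume rx: "r : carrier (class_ring :: 'k ring) & x : carrier L"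
  show "gs c (r \<odot> x) = r \<odot> gs c x"
  by (rule crd_eqI) (use rx in \<open>simp_all add: gs_crd lin_smult[OF crd_lin] smult_in\<close>)
 qed
 have bij: "bij_betw (gs c) (carrier L) (carrier L)"
  by (rule bij_betw_byWitness[where f' = "gs (inverse c)"]) (use inv[OF _ c] inv' gs_crd(1) in auto)
 have part: "gs c ` part L p = part L p" for p
 proof
  show "gs c ` part L p <= part L p" using gs_part by auto
  show "part L p <= gs c ` part L p"
  proof
  fix x assume x: "x : part L p"
  hence "x = gs c (gs (inverse c) x)" using inv' part_in by simp
  thus "x : gs c ` part L p" using gs_part[OF x] by blast
  qed
 qed
 have br: "gs c (bracket L x y) = bracket L (gs c x) (gs c y)" if xy: "x : carrier L" "y : carrier L" for x y
 proof (rule crd_eqI)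
  note gxy = gs_crd(1)[OF xy(1), of c] gs_crd(1)[OF xy(2), of c]
  show "gs c (bracket L x y) : carrier L" "bracket L (gs c x) (gs c y) : carrier L"
  using xy gxy bracket_closed gs_crd(1) by auto
  fix l assume l: "l < M + N"
  have expand: "crd (bracket L z w) l = (\<Sum>i<M+N. crd z i * (\<Sum>j<M+N. crd w j * CC i j l))"
  if "z : carrier L" "w : carrier L" for z w
  by (subst crd_bracket_left[OF that], intro sum.cong refl arg_cong2[where f = "(*)"],
  subst crd_bracket_right[OF b_in that(2)]) (auto simp: CC_def)
  have "scal c i * scal c j * CC i j l = scal c l * CC i j l" for i j
  proof (cases "CC i j l = 0")
  case False
  hence "i < M + N" "j < M + N" "dg l = dg i + dg j" using CC_deg by auto
  hence "scal c i * scal c j = scal c l"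
  using dg_cases[of i] dg_cases[of j] dg_cases[OF l] c by (auto simp: scal_def)
  thus ?thesis by simp
  qed simp
  hence H: "scal c i * crd x i * (scal c j * crd y j * CC i j l) = scal c l * (crd x i * (crd y j * CC i j l))" for i j
  by (metis (no_types, lifting) mult.assoc mult.left_commute)
  thus "crd (gs c (bracket L x y)) l = crd (bracket L (gs c x) (gs c y)) l"
  unfolding gs_crd(2)[OF bracket_closed[OF xy]] expand[OF xy] expand[OF gxy] gs_crd(2)[OF xy(1)] gs_crd(2)[OF xy(2)]
  unfolding sum_distrib_left by (intro sum.cong refl) (rule H[symmetric])
 qed
 have "gs c : extensional (carrier L)" by (simp add: grading_scaling_def)
 thus ?thesis using hom bij part br gs_even by (auto simp: Aut_even_def lsa_iso_def)
qed

theorem ghost_centre_decomposition: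
 assumes Aut: "!!\<phi>. \<phi> : Aut_even L ==> \<exists>c. c ~= 0 & \<phi> = gs c"
  and z: "primitive_root_of_unity (N + 1) \<zeta>"
 shows "internal_direct_sum (env L) {0..N} (%i. twisted_centre L (gs (\<zeta> ^ i))) (full_ghost_centre L)"
proof -
 let ?A = "%i. twisted_centre L (gs (\<zeta> ^ i))"
 have z': "\<zeta> ^ Suc N = 1" "!!j. 0 < j ==> j < Suc N ==> \<zeta> ^ j ~= 1"
  using z by (auto simp: primitive_root_of_unity_def)
 hence z0: "\<zeta> ^ i ~= 0" for i by auto
 have Ac: "Y : twisted_centre L (gs c) \<longleftrightarrow> Y : EU & Pi_op Y : tc.Acent c" for Y c
  using twisted_centre_iff[of Y c] by (auto simp: twisted_centre_def)
 have sub: "subspace class_ring (twisted_centre L (gs c)) (env L)" for c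
  by (rule env_subspaceI)
  (auto simp: Ac env_zero_in env_closed Pi_add Pi_smult op.subspace_0[OF tc.Acent_sub]
  intro: op.subspace_add[OF tc.Acent_sub] op.subspace_scale[OF tc.Acent_sub])
 let ?W = "\<Union>\<phi>\<in>Aut_even L. twisted_centre L \<phi>"
 have W: "?W <= EU" by (auto simp: twisted_centre_def)
 have span: "full_ghost_centre L = envs.span ?W" by (simp add: full_ghost_centre_def)
 have spanS: "submodule class_ring (envs.span ?W) (env L)" using envs.span_is_subspace[OF W] by (simp add: subspace_def)
 have c: "v i : EU" if "v : (\<Pi>\<^sub>E i\<in>{0..N}. ?A i)" "i : {0..N}" for v i
  using that Ac by (auto simp: PiE_iff)
 have P: "Pi_op (\<Oplus>\<^bsub>env L\<^esub>i\<in>{0..N}. v i) = (\<Sum>i\<le>N. Pi_op (v i))" if "v : (\<Pi>\<^sub>E i\<in>{0..N}. ?A i)" for v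
  using c[OF that] by (subst Pi_finsum) (auto simp: atLeast0AtMost)
 define D where "D = {Y : EU. \<exists>g. (\<forall>j. g j : tc.Acent (\<zeta> ^ j)) & Pi_op Y = (\<Sum>j\<le>N. g j)}"
 have "subspace class_ring D (env L)"
 proof (rule env_subspaceI)
  show "\<zero>\<^bsub>env L\<^esub> : D" unfolding D_def
  by (auto simp: env_zero_in intro!: exI[of _ "%_. 0"] op.subspace_0[OF tc.Acent_sub])
 next
  fix v w assume "v : D" "w : D"
  then obtain g g' where "v : EU" "w : EU" "\<forall>j. g j : tc.Acent (\<zeta> ^ j)" "Pi_op v = (\<Sum>j\<le>N. g j)"
  "\<forall>j. g' j : tc.Acent (\<zeta> ^ j)" "Pi_op w = (\<Sum>j\<le>N. g' j)" unfolding D_def by blast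
  thus "v \<oplus>\<^bsub>env L\<^esub> w : D" unfolding D_def
  by (intro CollectI conjI exI[of _ "%j. g j + g' j"] allI op.subspace_add[OF tc.Acent_sub])
  (simp_all add: env_closed Pi_add sum.distrib)
 next
  fix e v assume "v : D"
  then obtain g where "v : EU" "\<forall>j. g j : tc.Acent (\<zeta> ^ j)" "Pi_op v = (\<Sum>j\<le>N. g j)" unfolding D_def by blast
  thus "e \<odot>\<^bsub>env L\<^esub> v : D" unfolding D_def
  by (intro CollectI conjI exI[of _ "%j. sc e * g j"] allI op.subspace_scale[OF tc.Acent_sub])
  (simp_all add: env_closed Pi_smult sum_distrib_left)
 qed (auto simp: D_def)
 moreover have "?W <= D"
 proof
  fix Y assume "Y : ?W"
  then obtain \<phi> where "\<phi> : Aut_even L" and Y\<phi>: "Y : twisted_centre L \<phi>" by blast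
  obtain e where e0: "e ~= 0" "\<phi> = gs e" using Aut[OF \<open>\<phi> : Aut_even L\<close>] by (elim exE conjE) (rule that)
  have "Y : EU & Pi_op Y : tc.Acent e" using Y\<phi> unfolding e0(2) Ac .
  with e0(1) have e: "e ~= 0" "Y : EU" "Pi_op Y : tc.Acent e" by blast+
  have "\<exists>g. (\<forall>j. g j : tc.Acent (\<zeta> ^ j)) & Pi_op Y = (\<Sum>j\<le>N. g j)"
  by (rule tc.Acent_decompose[OF z'(1) _ e(3,1)]) (rule z'(2))
  then obtain g where "\<forall>j. g j : tc.Acent (\<zeta> ^ j)" "Pi_op Y = (\<Sum>j\<le>N. g j)"
  by (elim exE conjE) (rule that)
  thus "Y : D" unfolding D_def using e(2) by (intro CollectI conjI exI[of _ g])
 qed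
 ultimately have spanD: "envs.span ?W <= D" by (intro envs.span_is_subset) (simp_all add: subspace_def)
 show ?thesis unfolding internal_direct_sum_def
 proof (intro conjI ballI sub bij_betwI')
  fix v w assume v: "v : (\<Pi>\<^sub>E i\<in>{0..N}. ?A i)" and w: "w : (\<Pi>\<^sub>E i\<in>{0..N}. ?A i)"
  show "((\<Oplus>\<^bsub>env L\<^esub>i\<in>{0..N}. v i) = (\<Oplus>\<^bsub>env L\<^esub>i\<in>{0..N}. w i)) = (v = w)"
  proof
  assume "(\<Oplus>\<^bsub>env L\<^esub>i\<in>{0..N}. v i) = (\<Oplus>\<^bsub>env L\<^esub>i\<in>{0..N}. w i)"
  hence s0: "(\<Sum>i\<le>N. Pi_op (v i) - Pi_op (w i)) = 0" using P[OF v] P[OF w] by (simp add: sum_subtractf)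
  have "v i = w i" if i: "i <= N" for i
  proof -
  have "Pi_op (v i) - Pi_op (w i) = 0"
  proof (rule tc.Acent_independent[OF z'(1) _ _ s0 i])
  show "\<zeta> ^ j ~= 1" if "0 < j" "j < Suc N" for j using z'(2) that .
  next
  fix j assume "j <= N"
  hence "Pi_op (v j) : tc.Acent (\<zeta> ^ j)" "Pi_op (w j) : tc.Acent (\<zeta> ^ j)" using v w Ac by (auto simp: PiE_iff)
  thus "Pi_op (v j) - Pi_op (w j) : tc.Acent (\<zeta> ^ j)" by (rule op.subspace_diff[OF tc.Acent_sub])
  qed
  thus ?thesis using c[OF v, of i] c[OF w, of i] i Pi_inj by simp
  qed
  thus "v = w" using v w by (intro PiE_ext[of v _ ?A w]) auto
  qed simp
 next
  fix v assume v: "v : (\<Pi>\<^sub>E i\<in>{0..N}. ?A i)"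
  have in_span: "v i : envs.span ?W" if "i : {0..N}" for i
  proof -
  have "v i : ?W" by (rule UN_I[OF gs_Aut[OF z0, of i]]) (rule PiE_mem[OF v that])
  thus ?thesis using envs.in_own_span[OF W] by blast
  qed
  have "(\<Oplus>\<^bsub>env L\<^esub>i\<in>B. v i) : envs.span ?W" if "finite B" "B <= {0..N}" for B using that
  proof (induction B rule: finite_induct)
  case empty thus ?case using submodule.zero_closed[OF spanS] by simp
  next
  case (insert i B)
  thus ?case using in_span c[OF v] by (subst envs.finsum_insert) (auto simp: Pi_def subset_iff intro!: submodule.m_closed[OF spanS])
  qed
  thus "(\<Oplus>\<^bsub>env L\<^esub>i\<in>{0..N}. v i) : full_ghost_centre L" unfolding span by simp
 next
  fix Y assume "Y : full_ghost_centre L"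
  hence "Y : D" using spanD span by auto
  then obtain g where Y: "Y : EU" and g: "!!j. g j : tc.Acent (\<zeta> ^ j)" "Pi_op Y = (\<Sum>j\<le>N. g j)" unfolding D_def by blast
  have "\<exists>Z. Z : EU & Pi_op Z = g j" for j using Pi_surj[of "g j"] g(1)[of j] by (auto simp: tc.Acent_def)
  then obtain Z where Z: "!!j. Z j : EU" "!!j. Pi_op (Z j) = g j" by metis
  let ?v = "restrict Z {0..N}"
  have v: "?v : (\<Pi>\<^sub>E i\<in>{0..N}. ?A i)" using Z g Ac by auto
  have "(\<Oplus>\<^bsub>env L\<^esub>i\<in>{0..N}. ?v i) : EU" using Z by (intro envs.finsum_closed) auto
  hence "Y = (\<Oplus>\<^bsub>env L\<^esub>i\<in>{0..N}. ?v i)"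
  by (rule Pi_inj[OF Y]) (unfold P[OF v] g(2), rule sum.cong, simp_all add: Z)
  thus "\<exists>v\<in>(\<Pi>\<^sub>E i\<in>{0..N}. ?A i). Y = (\<Oplus>\<^bsub>env L\<^esub>i\<in>{0..N}. v i)" using v by blast
 qed
qed

end
section \<open>Graded bases from rigid dual bases\<close>

lemma kac_type_iso:
 assumes L: "lie_superalgebra L" and iso: "lsa_iso L M \<psi>" and M: "kac_type M"
 shows "kac_type L"
proof -
 interpret lie_superalgebra L by fact
 have bij: "bij_betw \<psi> (carrier L) (carrier M)"
  and part: "!!p. \<psi> ` part L p = part M p"
  and br: "!!x y. x : carrier L ==> y : carrier L ==> \<psi> (bracket L x y) = bracket M (\<psi> x) (\<psi> y)"
  and add: "!!x y. x : carrier L ==> y : carrier L ==> \<psi> (x \<oplus>\<^bsub>L\<^esub> y) = \<psi> x \<oplus>\<^bsub>M\<^esub> \<psi> y"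
  and smult: "!!c x. x : carrier L ==> \<psi> (c \<odot>\<^bsub>L\<^esub> x) = c \<odot>\<^bsub>M\<^esub> \<psi> x"
  using iso by (auto simp: lsa_iso_def LinearCombinations.module_hom_def)
 have im: "\<psi> x : carrier M" if "x : carrier L" for x using bij that by (auto simp: bij_betw_def)
 have inj: "\<psi> x = \<psi> y ==> x = y" if "x : carrier L" "y : carrier L" for x y
  using bij that by (auto simp: bij_betw_def inj_on_def)
 define \<chi> where "\<chi> = inv_into (carrier L) \<psi>"
 have \<chi>\<psi>: "\<chi> (\<psi> x) = x" if "x : carrier L" for x
  unfolding \<chi>_def using bij that by (auto simp: bij_betw_def)
 have lf: "linear_functional L (%x. F (\<psi> x))" if "linear_functional M F" for F
  using that by (auto simp: linear_functional_def add smult im)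
 have "separated L"
 proof -
  obtain r :: nat and lam where lam: "\<forall>t<r. linear_functional M (lam t)"
  "\<forall>x\<in>carrier M. \<forall>y\<in>carrier M. (\<forall>t<r. lam t x = lam t y) --> x = y"
  using M by (auto simp: kac_type_def separated_def)
  have "\<forall>x\<in>carrier L. \<forall>y\<in>carrier L. (\<forall>t<r. lam t (\<psi> x) = lam t (\<psi> y)) --> x = y"
  using lam(2) im inj by blast
  thus ?thesis unfolding separated_def using lam(1) lf
  by (intro exI[of _ r] exI[of _ "%t x. lam t (\<psi> x)"]) auto
 qed
 moreover obtain N e f h where R: "rigid_dual_bases M {..<N::nat} e f h" using M by (auto simp: kac_type_def)
 have e: "e i : part M 1" "f i : part M 1" if "i < N" for i using R that by (auto simp: rigid_dual_bases_def)
 have \<chi>part: "\<chi> z : part L p & \<psi> (\<chi> z) = z" if "z : part M p" for z p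
 proof -
  from that have "z : \<psi> ` part L p" unfolding part .
  then obtain x where x: "x : part L p" "z = \<psi> x" by (elim imageE) (rule that)
  have "\<chi> z = x" unfolding x(2) by (rule \<chi>\<psi>[OF part_in[OF x(1)]])
  thus ?thesis using x by (simp only: simp_thms)
 qed
 note ec = e[THEN \<chi>part]
 have "rigid_dual_bases L {..<N} (%i. \<chi> (e i)) (%i. \<chi> (f i)) (%x. h (\<psi> x))"
  unfolding rigid_dual_bases_def
 proof (intro conjI allI impI ballI)
  show "finite {..<N}" by simp
  show "(%i. \<chi> (e i)) ` {..<N} <= part L 1" "(%i. \<chi> (f i)) ` {..<N} <= part L 1" using ec by auto
  show "spans L ((%i. \<chi> (e i)) ` {..<N} \<union> (%i. \<chi> (f i)) ` {..<N}) (part L 1)" unfolding spans_def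
  proof (intro allI impI subsetI)
  fix W z
  assume W: "W <= carrier L & W ~= {} & (%i. \<chi> (e i)) ` {..<N} \<union> (%i. \<chi> (f i)) ` {..<N} <= W \<and>
  (\<forall>x\<in>W. \<forall>y\<in>W. x \<oplus>\<^bsub>L\<^esub> y : W) & (\<forall>c. \<forall>x\<in>W. c \<odot>\<^bsub>L\<^esub> x : W)" and z: "z : part L 1"
  have sM: "spans M (e ` {..<N} \<union> f ` {..<N}) (part M 1)" using R by (simp add: rigid_dual_bases_def)
  have "part M 1 <= \<psi> ` W"
  proof (rule sM[unfolded spans_def, rule_format], intro conjI ballI allI)
  show "\<psi> ` W <= carrier M" "\<psi> ` W ~= {}" using W im by auto
  have "e i : \<psi> ` W & f i : \<psi> ` W" if "i < N" for i
  using ec[OF that] W that by (metis (no_types, lifting) UnCI image_eqI lessThan_iff subsetD)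
  thus "e ` {..<N} \<union> f ` {..<N} <= \<psi> ` W" by auto
  show "x \<oplus>\<^bsub>M\<^esub> y : \<psi> ` W" if xy: "x : \<psi> ` W" "y : \<psi> ` W" for x y
  proof -
  obtain a b where ab: "a : W" "b : W" "x = \<psi> a" "y = \<psi> b" using xy by blast
  have "a : carrier L" "b : carrier L" "a \<oplus>\<^bsub>L\<^esub> b : W" using W ab(1,2) by blast+
  thus ?thesis unfolding ab(3,4) using add[of a b] by (metis imageI)
  qed
  show "c \<odot>\<^bsub>M\<^esub> x : \<psi> ` W" if x: "x : \<psi> ` W" for c x
  proof -
  obtain a where a: "a : W" "x = \<psi> a" using x by blast
  have "a : carrier L" "c \<odot>\<^bsub>L\<^esub> a : W" using W a(1) by blast+
  thus ?thesis unfolding a(2) using smult[of a c] by (metis imageI)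
  qed
  qed
  then obtain w where w: "w : W" "\<psi> z = \<psi> w" using part[of 1] z by blast
  hence "z = w" using inj[of z w] W part_in[OF z] by blast
  thus "z : W" using w by simp
  qed
  show "linear_functional L (%x. h (\<psi> x))" using R lf by (simp add: rigid_dual_bases_def)
 next
  fix i j assume ij: "i : {..<N}" "j : {..<N}"
  have dual: "\<forall>i\<in>{..<N}. \<forall>j\<in>{..<N}. h (bracket M (e i) (f j)) = (if i = j then 1 else 0)"
  using R[unfolded rigid_dual_bases_def] by (elim conjE)
  have x: "\<chi> (e i) : part L 1" "\<psi> (\<chi> (e i)) = e i" "\<chi> (f j) : part L 1" "\<psi> (\<chi> (f j)) = f j"
  using ec(1)[of i] ec(2)[of j] ij by auto
  show "h (\<psi> (bracket L (\<chi> (e i)) (\<chi> (f j)))) = (if i = j then 1 else 0)"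
  unfolding br[OF part_in[OF x(1)] part_in[OF x(3)]] x(2,4) by (rule dual[rule_format, OF ij])
 next
  fix \<phi> assume \<phi>: "odd_symmetry L \<phi>"
  let ?\<phi> = "%z. \<psi> (\<phi> (\<chi> z))"
  have \<phi>p: "\<phi> z : part L 1" if "z : part L 1" for z using \<phi> that by (auto simp: odd_symmetry_def)
  have 1: "?\<phi> z : part M 1" if "z : part M 1" for z using \<phi>p \<chi>part[OF that] part[of 1] by blast
  have 2: "?\<phi> (c \<odot>\<^bsub>M\<^esub> z) = c \<odot>\<^bsub>M\<^esub> ?\<phi> z" if "z : part M 1" for c z
  proof -
  let ?x = "\<chi> z"
  have x: "?x : part L 1" "z = \<psi> ?x" using \<chi>part[OF that] by simp_all
  hence xc: "?x : carrier L" "\<phi> ?x : carrier L" using \<phi>p part_in by auto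
  have "\<chi> (c \<odot>\<^bsub>M\<^esub> z) = c \<odot>\<^bsub>L\<^esub> ?x" using \<chi>\<psi>[OF smult_in[OF xc(1)], of c] smult[OF xc(1), of c] x(2) by simp
  moreover have "\<phi> (c \<odot>\<^bsub>L\<^esub> ?x) = c \<odot>\<^bsub>L\<^esub> \<phi> ?x" using \<phi> x(1) by (auto simp: odd_symmetry_def)
  ultimately show ?thesis using smult[OF xc(2), of c] by simp
  qed
  have 3: "?\<phi> (bracket M x z) = bracket M x (?\<phi> z)" if "x : part M 0" "z : part M 1" for x z
  proof -
  have x: "\<chi> x : part L 0" "x = \<psi> (\<chi> x)" "\<chi> z : part L 1" "z = \<psi> (\<chi> z)" using that \<chi>part by auto
  hence c: "\<chi> x : carrier L" "\<chi> z : carrier L" "\<phi> (\<chi> z) : carrier L" using \<phi>p part_in by auto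
  have "\<chi> (bracket M x z) = bracket L (\<chi> x) (\<chi> z)"
  using br[OF c(1,2)] x(2,4) \<chi>\<psi>[OF bracket_closed[OF c(1,2)]] by simp
  moreover have "\<phi> (bracket L (\<chi> x) (\<chi> z)) = bracket L (\<chi> x) (\<phi> (\<chi> z))" using \<phi> x(1,3) by (auto simp: odd_symmetry_def)
  ultimately show ?thesis using br[OF c(1,3)] x(2) by simp
  qed
  have 4: "bracket M (?\<phi> z) (?\<phi> w) = bracket M z w" if "z : part M 1" "w : part M 1" for z w
  proof -
  have x: "\<chi> z : part L 1" "z = \<psi> (\<chi> z)" "\<chi> w : part L 1" "w = \<psi> (\<chi> w)" using that \<chi>part by auto
  hence c: "\<chi> z : carrier L" "\<chi> w : carrier L" "\<phi> (\<chi> z) : carrier L" "\<phi> (\<chi> w) : carrier L"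
  using \<phi>p part_in by auto
  have "bracket L (\<phi> (\<chi> z)) (\<phi> (\<chi> w)) = bracket L (\<chi> z) (\<chi> w)" using \<phi> x(1,3) by (auto simp: odd_symmetry_def)
  thus ?thesis using br[OF c(3,4)] br[OF c(1,2)] x(2,4) by simp
  qed
  have "odd_symmetry M ?\<phi>" unfolding odd_symmetry_def using 1 2 3 4 by blast
  hence "\<exists>c. c ~= 0 & (\<forall>i\<in>{..<N}. ?\<phi> (e i) = inverse c \<odot>\<^bsub>M\<^esub> e i & ?\<phi> (f i) = c \<odot>\<^bsub>M\<^esub> f i)"
  using R[unfolded rigid_dual_bases_def] by (elim conjE allE[of _ ?\<phi>] impE)
  then obtain c where c: "c ~= 0" "!!i. i < N ==> ?\<phi> (e i) = inverse c \<odot>\<^bsub>M\<^esub> e i & ?\<phi> (f i) = c \<odot>\<^bsub>M\<^esub> f i"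
  by (elim exE conjE) (rule that, simp_all)
  have pull: "\<phi> (\<chi> z) = a \<odot>\<^bsub>L\<^esub> \<chi> z" if "z : part M 1" "?\<phi> z = a \<odot>\<^bsub>M\<^esub> z" for z a
  proof -
  have x: "\<chi> z : part L 1" "\<psi> (\<chi> z) = z" using that \<chi>part by auto
  have xc: "\<chi> z : carrier L" "\<phi> (\<chi> z) : carrier L" using x(1) \<phi>p part_in by auto
  hence "\<psi> (\<phi> (\<chi> z)) = \<psi> (a \<odot>\<^bsub>L\<^esub> \<chi> z)" using smult x(2) that(2) by simp
  thus ?thesis using inj xc smult_in by blast
  qed
  show "\<exists>c. c ~= 0 & (\<forall>i\<in>{..<N}. \<phi> (\<chi> (e i)) = inverse c \<odot>\<^bsub>L\<^esub> \<chi> (e i) & \<phi> (\<chi> (f i)) = c \<odot>\<^bsub>L\<^esub> \<chi> (f i))"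
  proof (intro exI conjI ballI)
  fix i assume "i : {..<N}"
  hence i: "i < N" by simp
  show "\<phi> (\<chi> (e i)) = inverse c \<odot>\<^bsub>L\<^esub> \<chi> (e i)" by (rule pull[OF e(1)[OF i] conjunct1[OF c(2)[OF i]]])
  show "\<phi> (\<chi> (f i)) = c \<odot>\<^bsub>L\<^esub> \<chi> (f i)" by (rule pull[OF e(2)[OF i] conjunct2[OF c(2)[OF i]]])
  qed (rule c(1))
 qed
 ultimately show ?thesis unfolding kac_type_def by (intro conjI exI)
qed

context lie_superalgebra
begin

lemma linear_functional_iff: "linear_functional L = lin_fun"
 by (rule ext) (simp add: linear_functional_def lin_fun_def)

lemma smult_cancel:
 assumes x: "x : carrier L" and eq: "a \<odot> x = b \<odot> x"
 shows "a = b \<or> x = \<zero>"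
proof (rule disjCI)
 assume nz: "x ~= \<zero>"
 show "a = b"
 proof (rule ccontr)
  assume "a ~= b"
  have "(a - b) \<odot> x = a \<odot> x \<oplus> (- b) \<odot> x" using smult_l_distr[of a "- b" x] x by simp
  also have "... = (b + - b) \<odot> x" unfolding eq using smult_l_distr[of b "- b" x] x by simp
  finally have z: "(a - b) \<odot> x = \<zero>" using smult_0[OF x] by simp
  have "x = (inverse (a - b) * (a - b)) \<odot> x" using \<open>a ~= b\<close> smult_one[of x] x by simp
  also have "... = inverse (a - b) \<odot> ((a - b) \<odot> x)" using smult_assoc1[of "inverse (a - b)" "a - b" x] x by simp
  finally show False using nz z by simp
 qed
qed

lemma eq_of_minus_zero: "x : carrier L ==> y : carrier L ==> x \<oplus> \<ominus> y = \<zero> ==> x = y"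
 by (metis a_assoc a_inv_closed l_neg l_zero r_zero)

lemma bracket_zero: "x : carrier L ==> bracket L \<zero> x = \<zero>" "x : carrier L ==> bracket L x \<zero> = \<zero>"
 using bracket_smult_left[of "\<zero>" x 0] bracket_smult_right[of x "\<zero>" 0] smult_0 bracket_closed by auto

text \<open>Gaussian elimination, one functional at a time. The coordinates are combinations of the given functionals and therefore
defined on the whole algebra.\<close>

lemma finite_coordinates:
 fixes r :: nat
 assumes "subspace class_ring W L" "\<forall>t<r. lin_fun (lam t)" "\<forall>x\<in>W. (\<forall>t<r. lam t x = 0) --> x = \<zero>"
 shows "\<exists>d b crd. (\<forall>k<d. b k : W) & (\<forall>k. lin_fun (%x. crd x k)) \<and>
     (\<forall>j<d. \<forall>k. crd (b j) k = (if j = k then 1 else 0)) & (\<forall>k\<ge>d::nat. \<forall>x. crd x k = 0) \<and>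
     (\<forall>x\<in>W. (\<forall>k<d. crd x k = 0) --> x = \<zero>)"
 using assms
proof (induction r arbitrary: W)
 case 0
 thus ?case by (intro exI[of _ 0] exI[of _ "%_. \<zero>"] exI[of _ "%_ _. 0"]) (auto simp: lin_fun_def)
next
 case (Suc r)
 have sub: "submodule class_ring W L" using Suc.prems(1) by (simp add: subspace_def)
 have Wc: "x : carrier L" if "x : W" for x using that submodule.subset[OF sub] by blast
 have lr: "lin_fun (lam r)" using Suc.prems(2) by simp
 define W' where "W' = {x : W. lam r x = 0}"
 have "submodule class_ring W' L"
  unfolding submodule_def W'_def
  using Wc lr submodule.zero_closed[OF sub] submodule.m_closed[OF sub] submodule.smult_closed[OF sub] module_axioms
  by (auto simp: lin_fun_zero lin_add lin_smult)
 hence W': "subspace class_ring W' L" using vectorspace_axioms by (simp add: subspace_def)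
 have "\<forall>x\<in>W'. (\<forall>t<r. lam t x = 0) --> x = \<zero>" using Suc.prems(3) by (auto simp: W'_def less_Suc_eq)
 then obtain d b crd where IH: "\<forall>k<d. b k : W'" "\<forall>k. lin_fun (%x. crd x k)"
     "\<forall>j<d. \<forall>k. crd (b j) k = (if j = k then 1 else 0)" "\<forall>k\<ge>d::nat. \<forall>x. crd x k = 0"
     "\<forall>x\<in>W'. (\<forall>k<d. crd x k = 0) --> x = \<zero>"
  using Suc.IH[OF W'] Suc.prems(2) by auto
 show ?case
 proof (cases "W' = W")
  case True
  thus ?thesis using IH by blast
 next
  case False
  then obtain y where y: "y : W" "lam r y ~= 0" by (auto simp: W'_def)
  define b0 where "b0 = inverse (lam r y) \<odot> y"
  have b0: "b0 : W" "lam r b0 = 1"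
  using y submodule.smult_closed[OF sub, of "inverse (lam r y)" y] Wc lr by (auto simp: b0_def lin_smult)
  define b' where "b' k = (if k = d then b0 else b k)" for k
  define crd' where "crd' x k = (if k = d then lam r x else crd x k - lam r x * crd b0 k)" for x k
  have "lin_fun (%x. crd' x k)" for k
  using IH(2)[rule_format, of k] lr unfolding crd'_def lin_fun_def
  by (auto simp: algebra_simps)
  moreover have "\<forall>k<Suc d. b' k : W" using IH(1) b0 by (auto simp: b'_def W'_def less_Suc_eq)
  moreover have "crd' (b' j) k = (if j = k then 1 else 0)" if "j < Suc d" for j k
  proof (cases "j = d")
  case True thus ?thesis using b0 by (simp add: b'_def crd'_def)
  next
  case False
  hence "j < d" "lam r (b j) = 0" using that IH(1) by (auto simp: W'_def)
  thus ?thesis using False IH(3) by (auto simp: b'_def crd'_def)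
  qed
  moreover have "\<forall>k\<ge>Suc d. \<forall>x. crd' x k = 0" using IH(4) by (simp add: crd'_def)
  moreover have "x = \<zero>" if x: "x : W" "\<forall>k<Suc d. crd' x k = 0" for x
  proof -
  have l0: "lam r x = 0" using x(2)[rule_format, of d] by (simp add: crd'_def)
  have "crd x k = 0" if "k < d" for k using x(2)[rule_format, of k] that l0 by (simp add: crd'_def)
  thus ?thesis using IH(5) x(1) l0 by (simp add: W'_def)
  qed
  ultimately show ?thesis by (intro exI[of _ "Suc d"] exI[of _ b'] exI[of _ crd']) blast
 qed
qed

lemma rigid_dual_bases_swap:
 assumes R: "rigid_dual_bases L I e f h"
 shows "rigid_dual_bases L I f e h"
proof -
 have ef: "e i : part L 1" "f i : part L 1" if "i : I" for i using R that by (auto simp: rigid_dual_bases_def)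
 have sym: "bracket L (f i) (e j) = bracket L (e j) (f i)" if "i : I" "j : I" for i j
 proof -
  have "bracket L (f i) (e j) = \<ominus> ((- 1) \<odot> bracket L (e j) (f i))"
  using super_skew[OF ef(2)[OF that(1)] ef(1)[OF that(2)]] by (simp add: super_sign_def)
  moreover have B: "bracket L (e j) (f i) : carrier L"
  by (rule bracket_closed[OF part_in[OF ef(1)[OF that(2)]] part_in[OF ef(2)[OF that(1)]]])
  ultimately show ?thesis unfolding smult_minus_one[OF B] by (simp add: minus_minus[OF B])
 qed
 have "\<exists>c. c ~= 0 & (\<forall>i\<in>I. \<phi> (f i) = inverse c \<odot> f i & \<phi> (e i) = c \<odot> e i)" if \<phi>: "odd_symmetry L \<phi>" for \<phi>
 proof -
  obtain c where "c ~= 0" "\<forall>i\<in>I. \<phi> (e i) = inverse c \<odot> e i & \<phi> (f i) = c \<odot> f i"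
  using R \<phi> unfolding rigid_dual_bases_def by blast
  thus ?thesis by (intro exI[of _ "inverse c"]) auto
 qed
 moreover have "h (bracket L (f i) (e j)) = (if i = j then 1 else 0)" if "i : I" "j : I" for i j
  using R that unfolding sym[OF that] rigid_dual_bases_def by auto
 ultimately show ?thesis using R unfolding rigid_dual_bases_def by (simp add: Un_commute)
qed

end

context type_I_graded
begin

definition gpr :: "int => 'g => 'g" where "gpr D x = component L {-1, 0, 1} G x D"

lemma gpr_in: assumes "x : carrier L" shows "gpr (-1) x : G (-1)" "gpr 0 x : G 0" "gpr 1 x : G 1"
 using component_in(1)[OF G_sum assms] by (auto simp: gpr_def)

lemma gpr_c: "x : carrier L ==> gpr (-1) x : carrier L" "x : carrier L ==> gpr 0 x : carrier L"
   "x : carrier L ==> gpr 1 x : carrier L"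
 using gpr_in G_c[of "-1"] G_c[of 0] G_c[of 1] by auto

lemma gpr_sum: assumes "x : carrier L" shows "x = gpr (-1) x \<oplus> gpr 0 x \<oplus> gpr 1 x"
 using component_in(2)[OF G_sum assms] finsum_3[of "-1" 0 1 "component L {-1, 0, 1} G x"] gpr_c[OF assms]
 by (simp add: gpr_def)

lemma gpr_of:
 assumes "u : G (-1)" "x : G 0" "w : G 1"
 shows "gpr (-1) (u \<oplus> x \<oplus> w) = u" "gpr 0 (u \<oplus> x \<oplus> w) = x" "gpr 1 (u \<oplus> x \<oplus> w) = w"
proof -
 define v where "v = (\<lambda>D\<in>{-1, 0, 1::int}. if D = -1 then u else if D = 0 then x else w)"
 have v: "v : (\<Pi>\<^sub>E D\<in>{-1, 0, 1}. G D)" using assms by (auto simp: v_def)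
 have c: "u : carrier L" "x : carrier L" "w : carrier L"
  using assms G_c[of "-1"] G_c[of 0] G_c[of 1] by auto
 have "(\<Oplus>D\<in>{-1, 0, 1}. v D) = u \<oplus> x \<oplus> w"
  using finsum_3[of "-1" 0 1 v] c by (simp add: v_def)
 hence "component L {-1, 0, 1} G (u \<oplus> x \<oplus> w) = v" using component_finsum[OF G_sum v] by simp
 thus "gpr (-1) (u \<oplus> x \<oplus> w) = u" "gpr 0 (u \<oplus> x \<oplus> w) = x" "gpr 1 (u \<oplus> x \<oplus> w) = w"
  by (simp_all add: gpr_def v_def)
qed

lemma G_add: "D : {-1, 0, 1} ==> x : G D ==> y : G D ==> x \<oplus> y : G D"
 using G_subspace[of D] by (auto simp: subspace_def intro: submodule.m_closed)

lemma G_smult: "D : {-1, 0, 1} ==> x : G D ==> c \<odot> x : G D"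
 using subspace_smult[OF G_subspace[of D]] by auto

lemma gpr_add:
 assumes "x : carrier L" "y : carrier L" "D : {-1, 0, 1}"
 shows "gpr D (x \<oplus> y) = gpr D x \<oplus> gpr D y"
proof -
 note x = gpr_in[OF assms(1)] and y = gpr_in[OF assms(2)]
 note xc = gpr_c[OF assms(1)] and yc = gpr_c[OF assms(2)]
 have "x \<oplus> y = (gpr (-1) x \<oplus> gpr 0 x \<oplus> gpr 1 x) \<oplus> (gpr (-1) y \<oplus> gpr 0 y \<oplus> gpr 1 y)"
  using gpr_sum[OF assms(1)] gpr_sum[OF assms(2)] by simp
 also have "... = (gpr (-1) x \<oplus> gpr (-1) y) \<oplus> (gpr 0 x \<oplus> gpr 0 y) \<oplus> (gpr 1 x \<oplus> gpr 1 y)"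
  using xc yc by (simp add: a_ac)
 finally have e: "x \<oplus> y = ..." .
 have g: "gpr (-1) x \<oplus> gpr (-1) y : G (-1)" "gpr 0 x \<oplus> gpr 0 y : G 0" "gpr 1 x \<oplus> gpr 1 y : G 1"
  using x y by (simp_all add: G_add)
 show ?thesis using gpr_of[OF g] assms(3) unfolding e by auto
qed

lemma gpr_smult:
 assumes "x : carrier L" "D : {-1, 0, 1}"
 shows "gpr D (c \<odot> x) = c \<odot> gpr D x"
proof -
 note x = gpr_in[OF assms(1)] and xc = gpr_c[OF assms(1)]
 have "c \<odot> x = c \<odot> (gpr (-1) x \<oplus> gpr 0 x \<oplus> gpr 1 x)" using gpr_sum[OF assms(1)] by simp
 also have "... = c \<odot> gpr (-1) x \<oplus> c \<odot> gpr 0 x \<oplus> c \<odot> gpr 1 x"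
  using xc by (simp add: smult_r_distr smult_in)
 finally have e: "c \<odot> x = ..." .
 have g: "c \<odot> gpr (-1) x : G (-1)" "c \<odot> gpr 0 x : G 0" "c \<odot> gpr 1 x : G 1" using x by (simp_all add: G_smult)
 show ?thesis using gpr_of[OF g] assms(2) unfolding e by auto
qed

lemma gpr_G:
 assumes "x : G D" "D : {-1, 0, 1}" "D' : {-1, 0, 1}"
 shows "gpr D' x = (if D' = D then x else \<zero>)"
proof -
 have z: "\<zero> : G (-1)" "\<zero> : G 0" "\<zero> : G 1" using G_zero_in by auto
 have xc: "x : carrier L" using assms G_c by blast
 consider "D = -1" | "D = 0" | "D = 1" using assms(2) by auto
 thus ?thesis
 proof cases
  case 1 thus ?thesis using gpr_of[of x "\<zero>" "\<zero>"] z assms xc by auto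
 next
  case 2 thus ?thesis using gpr_of[of "\<zero>" x "\<zero>"] z assms xc by auto
 next
  case 3 thus ?thesis using gpr_of[of "\<zero>" "\<zero>" x] z assms xc by auto
 qed
qed

lemma gpr_lin: assumes "lin_fun F" "D : {-1, 0, 1}" shows "lin_fun (%x. F (gpr D x))"
proof -
 have c: "gpr D x : carrier L" if "x : carrier L" for x using gpr_c[OF that] assms(2) by auto
 show ?thesis using assms c by (auto simp: lin_fun_def gpr_add gpr_smult)
qed

lemma scaling_of:
 assumes "u : G (-1)" "w : G 1"
 shows "grading_scaling L G c (u \<oplus> w) = c \<odot> u \<oplus> inverse c \<odot> w"
proof -
 have z: "\<zero> : G 0" using G_zero_in by auto
 have uw: "u : carrier L" "w : carrier L" using assms G_c[of "-1"] G_c[of 1] by auto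
 have e: "u \<oplus> \<zero> \<oplus> w = u \<oplus> w" using uw by simp
 show ?thesis
  using gpr_of[OF assms(1) z assms(2)] uw unfolding e by (simp add: grading_scaling_def gpr_def smult_in)
qed

lemma G_even_bracket:
 assumes "x : part L 0" "u : G D" shows "bracket L x u : G D"
 using G_bracket[of x 0 u D] assms G_0 by simp

lemma scaling_symmetry: assumes c: "c ~= 0" shows "odd_symmetry L (grading_scaling L G c)"
 unfolding odd_symmetry_def
proof (intro conjI allI ballI)
 let ?g = "grading_scaling L G c"
 fix z assume z: "z : part L 1"
 then obtain u w where uw: "u : G (-1)" "w : G 1" "z = u \<oplus> w" by (rule odd_split)
 have cc: "u : carrier L" "w : carrier L" using uw G_c[of "-1"] G_c[of 1] by auto
 have s: "e \<odot> u : G (-1)" "e \<odot> w : G 1" for e using uw by (simp_all add: G_smult)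
 have gz: "?g z = c \<odot> u \<oplus> inverse c \<odot> w" using scaling_of[OF uw(1,2)] uw(3) by simp
 have p: "submodule class_ring (part L 1) L" using part_subspace by (simp add: subspace_def)
 show "?g z : part L 1" unfolding gz
  using G_part_1[of "-1", OF _ s(1)] G_part_1[of 1, OF _ s(2)] by (auto intro: submodule.m_closed[OF p])
 show "?g (e \<odot> z) = e \<odot> ?g z" for e
 proof -
  have "e \<odot> z = e \<odot> u \<oplus> e \<odot> w" using uw(3) cc by (simp add: smult_r_distr)
  hence "?g (e \<odot> z) = c \<odot> (e \<odot> u) \<oplus> inverse c \<odot> (e \<odot> w)" using scaling_of[OF s, of c e e] by simp
  also have "... = e \<odot> (c \<odot> u \<oplus> inverse c \<odot> w)"
  using cc smult_assoc1[of _ _ u, symmetric] smult_assoc1[of _ _ w, symmetric]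
  by (simp add: smult_r_distr smult_in mult.commute)
  finally show ?thesis using gz by simp
 qed
 show "?g (bracket L x z) = bracket L x (?g z)" if x: "x : part L 0" for x
 proof -
  have xc: "x : carrier L" using x part_in by blast
  have "bracket L x z = bracket L x u \<oplus> bracket L x w" using uw(3) cc xc by (simp add: bracket_add_right)
  hence "?g (bracket L x z) = c \<odot> bracket L x u \<oplus> inverse c \<odot> bracket L x w"
  using scaling_of[OF G_even_bracket[OF x uw(1)] G_even_bracket[OF x uw(2)]] by simp
  thus ?thesis using gz cc xc by (simp add: bracket_add_right bracket_smult_right smult_in)
 qed
 show "bracket L (?g z) (?g z') = bracket L z z'" if z': "z' : part L 1" for z'
 proof -
  obtain u' w' where uw': "u' : G (-1)" "w' : G 1" "z' = u' \<oplus> w'" using z' by (rule odd_split)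
  have cc': "u' : carrier L" "w' : carrier L" using uw' G_c[of "-1"] G_c[of 1] by auto
  have gz': "?g z' = c \<odot> u' \<oplus> inverse c \<odot> w'" using scaling_of[OF uw'(1,2)] uw'(3) by simp
  have 0: "bracket L u u' = \<zero>" "bracket L w w' = \<zero>"
  using G_bracket[OF uw(1) uw'(1)] G_bracket[OF uw(2) uw'(2)] G_zero[of "-2"] G_zero[of 2] by auto
  have a: "c \<odot> (inverse c \<odot> y) = y" "inverse c \<odot> (c \<odot> y) = y" if "y : carrier L" for y
  using smult_assoc1[of c "inverse c" y, symmetric] smult_assoc1[of "inverse c" c y, symmetric] that c smult_one[of y]
  by simp_all
  show ?thesis unfolding gz gz' using uw(3) uw'(3) cc cc' 0
  by (simp add: bracket_add_left bracket_add_right bracket_smult_left bracket_smult_right bracket_closed smult_in a)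
 qed
qed

text \<open>The number \<open>2\<close> is used because it differs from its inverse in characteristic zero.\<close>

lemma scaling_eigenvector:
 assumes z: "z : part L 1" "z ~= \<zero>" and eig: "grading_scaling L G 2 z = t \<odot> z"
 shows "t = 2 & z : G (-1) \<or> t = inverse 2 & z : G 1"
proof -
 obtain u w where uw: "u : G (-1)" "w : G 1" "z = u \<oplus> w" using z(1) by (rule odd_split)
 have cc: "u : carrier L" "w : carrier L" using uw G_c[of "-1"] G_c[of 1] by auto
 have G0: "\<zero> : G 0" using G_zero_in by auto
 have s: "e \<odot> u : G (-1)" "e \<odot> w : G 1" for e using uw by (simp_all add: G_smult)
 have "2 \<odot> u \<oplus> inverse 2 \<odot> w = t \<odot> u \<oplus> t \<odot> w"
  using eig scaling_of[OF uw(1,2), of 2] uw(3) cc by (simp add: smult_r_distr)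
 hence e: "2 \<odot> u \<oplus> \<zero> \<oplus> inverse 2 \<odot> w = t \<odot> u \<oplus> \<zero> \<oplus> t \<odot> w" using cc by (simp add: smult_in)
 have "2 \<odot> u = t \<odot> u" using gpr_of(1)[OF s(1) G0 s(2), of 2 "inverse 2"] gpr_of(1)[OF s(1) G0 s(2), of t t] e by simp
 hence 1: "2 = t \<or> u = \<zero>" using smult_cancel[OF cc(1)] by blast
 have "inverse 2 \<odot> w = t \<odot> w" using gpr_of(3)[OF s(1) G0 s(2), of 2 "inverse 2"] gpr_of(3)[OF s(1) G0 s(2), of t t] e by simp
 hence 2: "inverse 2 = t \<or> w = \<zero>" using smult_cancel[OF cc(2)] by blast
 have "inverse 2 ~= (2 :: 'k)"
 proof
  assume "inverse 2 = (2 :: 'k)"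
  hence "(2 :: 'k) * 2 = 1" by (metis right_inverse zero_neq_numeral)
  thus False by simp
 qed
 thus ?thesis using 1 2 uw cc z(2) by auto
qed

text \<open>The scaling by \<open>2\<close> is an odd symmetry, so by rigidity each \<open>e i\<close> and each \<open>f i\<close> is an eigenvector of it, with the same
eigenvalue for all \<open>i\<close>. Its eigenspaces are the two odd pieces of the grading.\<close>

lemma rigid_oriented:
 assumes R: "rigid_dual_bases L I e f h"
 shows "(\<forall>i\<in>I. e i : G 1 & f i : G (-1)) \<or> (\<forall>i\<in>I. f i : G 1 & e i : G (-1))"
proof -
 have ef: "e i : part L 1" "f i : part L 1" if "i : I" for i using R that by (auto simp: rigid_dual_bases_def)
 have "odd_symmetry L (grading_scaling L G 2)" by (rule scaling_symmetry) simp
 then obtain c where c: "\<forall>i\<in>I. grading_scaling L G 2 (e i) = inverse c \<odot> e i & grading_scaling L G 2 (f i) = c \<odot> f i"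
  using R unfolding rigid_dual_bases_def by blast
 have nz: "e i ~= \<zero>" "f i ~= \<zero>" if i: "i : I" for i
 proof -
  have hl: "lin_fun h" and 1: "h (bracket L (e i) (f i)) = 1" using R i linear_functional_iff by (auto simp: rigid_dual_bases_def)
  have "h \<zero> = 0" by (rule lin_fun_zero[OF hl])
  thus "e i ~= \<zero>" "f i ~= \<zero>" using 1 bracket_zero ef[OF i] part_in by fastforce+
 qed
 have ee: "inverse c = 2 & e i : G (-1) \<or> inverse c = inverse 2 & e i : G 1"
  and ff: "c = 2 & f i : G (-1) \<or> c = inverse 2 & f i : G 1" if "i : I" for i
  using scaling_eigenvector[OF ef(1)[OF that] nz(1)[OF that]] scaling_eigenvector[OF ef(2)[OF that] nz(2)[OF that]] c that by auto
 have ne: "inverse 2 ~= (2 :: 'k)"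
 proof
  assume "inverse 2 = (2 :: 'k)"
  hence "(2 :: 'k) * 2 = 1" by (metis right_inverse zero_neq_numeral)
  thus False by simp
 qed
 show ?thesis
 proof (cases "c = 2")
  case True thus ?thesis using ee ff ne by metis
 next
  case False
  hence "inverse c ~= inverse 2" using inverse_eq_iff_eq by blast
  thus ?thesis using ee ff False by metis
 qed
qed

end

lemma (in abelian_monoid) finsum_additive:
 fixes F :: "_ => 'c::comm_monoid_add"
 assumes F: "F \<zero> = 0" "!!x y. x : carrier G ==> y : carrier G ==> F (x \<oplus> y) = F x + F y"
  and A: "finite A" "v : A \<rightarrow> carrier G"
 shows "F (\<Oplus>i\<in>A. v i) = (\<Sum>i\<in>A. F (v i))"
 using A
proof (induction A rule: finite_induct)
 case empty thus ?case by (simp add: F)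
next
 case (insert a A)
 hence "(\<Oplus>i\<in>A. v i) : carrier G" by (intro finsum_closed) auto
 thus ?case using insert by (simp add: F Pi_def)
qed

text \<open>The coordinates on the odd pieces come from the pairing through \<open>h\<close>, those on the even part from elimination.\<close>

lemma (in type_I_graded) rigid_graded_basis:
 assumes sep: "separated L" and R: "rigid_dual_bases L {..<N} e f h"
  and ori: "\<forall>i<N. e i : G 1 & f i : G (-1)"
 shows "\<exists>M b crd. graded_lsa_basis L G N M h b crd"
  "\<forall>\<phi>\<in>Aut_even L. \<exists>c. c ~= 0 & \<phi> = grading_scaling L G c"
  "vectorspace.dim class_ring (L\<lparr>carrier := G 1\<rparr>) = N"
proof -
 obtain r :: nat and lam where lam: "\<forall>t<r. lin_fun (lam t)"
  "\<forall>x\<in>carrier L. \<forall>y\<in>carrier L. (\<forall>t<r. lam t x = lam t y) --> x = y"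
  using sep unfolding separated_def linear_functional_iff by blast
 have sep0: "x = \<zero>" if "x : carrier L" "\<forall>t<r. lam t x = 0" for x
  using lam(2)[rule_format, of x "\<zero>"] that lam(1) by (auto simp: lin_fun_zero)
 have h: "lin_fun h" and dual: "!!i j. i < N ==> j < N ==> h (bracket L (e i) (f j)) = (if i = j then 1 else 0)"
  and span: "spans L (e ` {..<N} \<union> f ` {..<N}) (part L 1)"
  using R linear_functional_iff by (auto simp: rigid_dual_bases_def)
 have eG: "e i : G 1" and fG: "f i : G (-1)" if "i < N" for i using ori that by auto
 have ec: "e i : carrier L" and fc: "f i : carrier L" if "i < N" for i
  using eG[OF that] fG[OF that] G_c[of 1] G_c[of "-1"] by auto
 define E where "E i x = (if i < N then h (bracket L x (f i)) else 0)" for i x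
 define F where "F i x = (if i < N then h (bracket L (e i) x) else 0)" for i x
 have El: "lin_fun (E i)" for i
  using bracket_lin_left[OF h fc[of i]] by (cases "i < N") (auto simp: E_def[abs_def] lin_fun_def)
 have Fl: "lin_fun (F i)" for i
  using bracket_lin_right[OF h ec[of i]] by (cases "i < N") (auto simp: F_def[abs_def] lin_fun_def)
 have odd_sep: "z = \<zero>" if z: "z : part L 1" "\<forall>i<N. E i (gpr 1 z) = 0" "\<forall>i<N. F i (gpr (-1) z) = 0" for z
 proof -
  define Q where "Q t x = (\<Sum>i<N. lam t (e i) * E i (gpr 1 x)) + (\<Sum>i<N. lam t (f i) * F i (gpr (-1) x))" for t x
  define W where "W = {x : carrier L. \<forall>t<r. lam t x = Q t x}"
  have Gl: "lin_fun (%x. E i (gpr 1 x))" "lin_fun (%x. F i (gpr (-1) x))" for i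
  using gpr_lin[OF El, of 1] gpr_lin[OF Fl, of "-1"] by auto
  have Q: "Q t (x \<oplus> y) = Q t x + Q t y" "Q t (c \<odot> x) = c * Q t x" if "x : carrier L" "y : carrier L" for t c x y
  using that unfolding Q_def
  by (simp_all add: lin_add[OF Gl(1)] lin_add[OF Gl(2)] lin_smult[OF Gl(1)] lin_smult[OF Gl(2)]
  distrib_left sum.distrib sum_distrib_left mult.left_commute)
  have delta: "(\<Sum>i<N. g i * (if j = i then 1 else 0)) = g j" if "j < N" for g :: "nat => 'k" and j
  using that by (simp add: if_distrib[of "(*) _"] cong: if_cong)
  have lz: "lin_fun H ==> H \<zero> = 0" for H by (rule lin_fun_zero)
  have "part L 1 <= W"
  proof (rule span[unfolded spans_def, rule_format], intro conjI ballI allI)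
  show "W <= carrier L" by (auto simp: W_def)
  have "\<zero> : W" using lam(1) lz[OF Gl(1)] lz[OF Gl(2)] by (auto simp: W_def Q_def lz)
  thus "W ~= {}" by blast
  have "e j : W" if j: "j < N" for j
  proof -
  have g: "gpr 1 (e j) = e j" "gpr (-1) (e j) = \<zero>" using gpr_G[OF eG[OF j]] by auto
  have "Q t (e j) = (\<Sum>i<N. lam t (e i) * (if j = i then 1 else 0))" for t
  unfolding Q_def g by (simp add: lz[OF Fl]) (rule sum.cong, auto simp: E_def dual j)
  thus ?thesis using delta[OF j] ec[OF j] by (simp add: W_def)
  qed
  moreover have "f j : W" if j: "j < N" for j
  proof -
  have g: "gpr 1 (f j) = \<zero>" "gpr (-1) (f j) = f j" using gpr_G[OF fG[OF j]] by auto
  have "Q t (f j) = (\<Sum>i<N. lam t (f i) * (if j = i then 1 else 0))" for t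
  unfolding Q_def g by (simp add: lz[OF El]) (rule sum.cong, auto simp: F_def dual j)
  thus ?thesis using delta[OF j] fc[OF j] by (simp add: W_def)
  qed
  ultimately show "e ` {..<N} \<union> f ` {..<N} <= W" by auto
  show "x \<oplus> y : W" if "x : W" "y : W" for x y using that lam(1) by (auto simp: W_def Q lin_add)
  show "c \<odot> x : W" if "x : W" for c x using that lam(1) by (auto simp: W_def Q(2)[of x x] lin_smult smult_in)
  qed
  hence "\<forall>t<r. lam t z = Q t z" using z(1) by (auto simp: W_def)
  hence "\<forall>t<r. lam t z = 0" using z(2,3) by (simp add: Q_def)
  thus ?thesis using sep0 z(1) part_in by blast
 qed
 have sep1: "w = \<zero>" if "w : G 1" "\<forall>i<N. E i w = 0" for w
  using odd_sep[of w] G_part_1[of 1 w] gpr_G[OF that(1)] that lin_fun_zero[OF Fl] by auto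
 have sepm1: "w = \<zero>" if "w : G (-1)" "\<forall>i<N. F i w = 0" for w
  using odd_sep[of w] G_part_1[of "-1" w] gpr_G[OF that(1)] that lin_fun_zero[OF El] by auto
 have "\<forall>x\<in>G 0. (\<forall>t<r. lam t x = 0) --> x = \<zero>" using sep0 G_c[of 0] by auto
 then obtain d b0 c0 where b0: "\<forall>k<d. b0 k : G 0" "\<forall>k. lin_fun (%x. c0 x k)"
     "\<forall>j<d. \<forall>k. c0 (b0 j) k = (if j = k then 1 else 0)" "\<forall>k\<ge>d::nat. \<forall>x. c0 x k = 0"
     "\<forall>x\<in>G 0. (\<forall>k<d. c0 x k = 0) --> x = \<zero>"
  using finite_coordinates[OF G_subspace[of 0] lam(1)] by auto
 define M where "M = N + d"
 let ?dg = "type_I_degree N M"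
 define b where "b k = (if k < N then f k else if k < M then b0 (k - N) else e (k - M))" for k
 define C where "C k x = (if k < N then F k x else if k < M then c0 x (k - N) else E (k - M) x)" for k x
 define crd where "crd x k = (if k < M + N then C k (gpr (?dg k) x) else 0)" for x k
 have dg: "?dg k : {-1, 0, 1}" for k by (simp add: type_I_degree_def)
 have Cl: "lin_fun (C k)" for k
  using Fl[of k] El[of "k - M"] b0(2)[rule_format, of "k - N"]
  by (cases "k < N"; cases "k < M") (auto simp: C_def[abs_def])
 have bG: "b k : G (?dg k)" if "k < M + N" for k
  using that b0(1) eG fG by (auto simp: b_def type_I_degree_def M_def)
 have crdl: "lin_fun (%x. crd x k)" for k
  using gpr_lin[OF Cl dg, of k k] by (cases "k < M + N") (auto simp: crd_def lin_fun_def)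
 have crdG: "crd z k = (if k < M + N & ?dg k = D then C k z else 0)" if "z : G D" "D : {-1, 0, 1}" for z k D
  using gpr_G[OF that dg[of k]] lin_fun_zero[OF Cl[of k]] by (cases "?dg k = D") (simp_all add: crd_def)
 have crd_b: "crd (b j) k = (if j = k then 1 else 0)" if j: "j < M + N" for j k
 proof (cases "k < M + N & ?dg k = ?dg j")
  case True
  hence k: "k < M + N" and s: "k < N \<longleftrightarrow> j < N" "k < M \<longleftrightarrow> j < M"
  using j by (auto simp: type_I_degree_def M_def split: if_splits)
  have "crd (b j) k = C k (b j)" using crdG[OF bG[OF j] dg, of k] True by simp
  also have "... = (if j = k then 1 else 0)"
  proof (cases "j < N")
  case True
  hence "k < N" using s(1) by blast
  thus ?thesis using True dual[of k j] by (simp add: C_def b_def F_def eq_commute)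
  next
  case jN: False
  hence kN: "~ k < N" using s(1) by blast
  show ?thesis
  proof (cases "j < M")
  case True
  hence kM: "k < M" and jd: "j - N < d" using s(2) jN by (auto simp: M_def)
  have "C k (b j) = c0 (b0 (j - N)) (k - N)" using jN kN True kM by (simp add: C_def b_def)
  also have "... = (if j - N = k - N then 1 else 0)" using b0(3) jd by blast
  also have "(j - N = k - N) = (j = k)" using jN kN by linarith
  finally show ?thesis .
  next
  case jM: False
  hence kM: "~ k < M" using s(2) by blast
  have lt: "j - M < N" "k - M < N" using j k jM kM by linarith+
  have "C k (b j) = h (bracket L (e (j - M)) (f (k - M)))" using jN kN jM kM lt by (simp add: C_def b_def E_def)
  also have "... = (if j - M = k - M then 1 else 0)" by (rule dual[OF lt])
  also have "(j - M = k - M) = (j = k)" using jM kM by linarith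
  finally show ?thesis .
  qed
  qed
  finally show ?thesis .
 next
  case False
  thus ?thesis using crdG[OF bG[OF j] dg, of k] j by auto
 qed
 have crd_sep: "x = \<zero>" if x: "x : carrier L" "\<forall>k<M+N. crd x k = 0" for x
 proof -
  have "F i (gpr (-1) x) = 0" if "i < N" for i
  using x(2)[rule_format, of i] that by (simp add: crd_def C_def type_I_degree_def)
  hence "gpr (-1) x = \<zero>" using sepm1 gpr_in(1)[OF x(1)] by blast
  moreover have "c0 (gpr 0 x) i = 0" if "i < d" for i
  using x(2)[rule_format, of "N + i"] that by (simp add: crd_def C_def type_I_degree_def M_def)
  hence "gpr 0 x = \<zero>" using b0(5) gpr_in(2)[OF x(1)] by blast
  moreover have "E i (gpr 1 x) = 0" if "i < N" for i
  using x(2)[rule_format, of "M + i"] that by (simp add: crd_def C_def type_I_degree_def M_def)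
  hence "gpr 1 x = \<zero>" using sep1 gpr_in(3)[OF x(1)] by blast
  ultimately show ?thesis using gpr_sum[OF x(1)] by simp
 qed
 have bc: "b k : carrier L" if "k < M + N" for k using G_c[OF dg bG[OF that]] .
 have crd_expand: "x = (\<Oplus>k\<in>{..<M+N}. crd x k \<odot> b k)" if x: "x : carrier L" for x
 proof -
  let ?y = "\<Oplus>k\<in>{..<M+N}. crd x k \<odot> b k"
  have y: "?y : carrier L" using bc by (intro finsum_closed) (auto simp: smult_in)
  have "crd ?y j = crd x j" if j: "j < M + N" for j
  proof -
  have "crd ?y j = (\<Sum>k<M+N. crd (crd x k \<odot> b k) j)"
  by (rule lin_fun_finsum[OF crdl]) (auto simp: smult_in bc)
  also have "... = (\<Sum>k<M+N. if k = j then crd x j else 0)"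
  by (rule sum.cong) (auto simp: lin_smult[OF crdl] bc crd_b)
  finally show ?thesis using j by simp
  qed
  hence "crd (x \<oplus> \<ominus> ?y) j = 0" if "j < M + N" for j
  using that x y by (simp add: lin_add[OF crdl] lin_fun_uminus[OF crdl])
  hence "x \<oplus> \<ominus> ?y = \<zero>" using crd_sep x y by simp
  thus ?thesis using eq_of_minus_zero[OF x y] by blast
 qed
 interpret B: graded_lsa_basis L G N M h b crd
 proof
  show "N <= M" by (simp add: M_def)
  show "x : G D ==> crd x k ~= 0 ==> k < M + N & ?dg k = D" for x D k
  using crdG[of x D k] G_zero[of D] lin_fun_zero[OF crdl[of k]] by (cases "D : {-1, 0, 1}") (auto split: if_splits)
  show "i < N ==> j < N ==> h (bracket L (b (M + i)) (b j)) = (if i = j then 1 else 0)" for i j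
  using dual by (simp add: b_def M_def)
 qed (use bG crdl crd_b crd_expand h in blast)+
 have Aut: "\<exists>c. c ~= 0 & \<phi> = grading_scaling L G c" if \<phi>: "\<phi> : Aut_even L" for \<phi>
 proof -
  have ext: "\<phi> : extensional (carrier L)" and fix0: "!!x. x : part L 0 ==> \<phi> x = x"
  and part: "!!p. \<phi> ` part L p = part L p"
  and br: "!!x y. x : carrier L ==> y : carrier L ==> \<phi> (bracket L x y) = bracket L (\<phi> x) (\<phi> y)"
  and add: "!!x y. x : carrier L ==> y : carrier L ==> \<phi> (x \<oplus> y) = \<phi> x \<oplus> \<phi> y"
  and smult: "!!c x. x : carrier L ==> \<phi> (c \<odot> x) = c \<odot> \<phi> x"
  and im: "!!x. x : carrier L ==> \<phi> x : carrier L"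
  using \<phi> by (auto simp: Aut_even_def lsa_iso_def LinearCombinations.module_hom_def)
  have "odd_symmetry L \<phi>" unfolding odd_symmetry_def
  proof (intro conjI allI ballI)
  fix z assume z: "z : part L 1"
  show "\<phi> z : part L 1" using part z by blast
  show "\<phi> (c \<odot> z) = c \<odot> \<phi> z" for c using smult z part_in by blast
  show "\<phi> (bracket L x z) = bracket L x (\<phi> z)" if "x : part L 0" for x using br[of x z] fix0 z that part_in by simp
  show "bracket L (\<phi> z) (\<phi> w) = bracket L z w" if w: "w : part L 1" for w
  using br[of z w] fix0[of "bracket L z w"] bracket_parity[OF z w] z w part_in by simp
  qed
  hence "\<exists>c. c ~= 0 & (\<forall>i\<in>{..<N}. \<phi> (e i) = inverse c \<odot> e i & \<phi> (f i) = c \<odot> f i)"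
  using R[unfolded rigid_dual_bases_def] by (elim conjE allE[of _ \<phi>] impE)
  then obtain c where c: "c ~= 0" "!!i. i < N ==> \<phi> (e i) = inverse c \<odot> e i & \<phi> (f i) = c \<odot> f i"
  by (elim exE conjE) (rule that, simp_all)
  have pb: "\<phi> (b k) = B.scal c k \<odot> b k" if k: "k < M + N" for k
  proof (cases "k < N \<or> k \<ge> M")
  case True
  have s: "B.scal c k = (if k < N then c else if k < M then 1 else inverse c)"
  using k by (simp add: B.scal_def type_I_degree_def)
  have NM: "N <= M" by (simp add: M_def)
  show ?thesis
  proof (cases "k < N")
  case True thus ?thesis using c(2)[of k] s by (simp add: b_def)
  next
  case False
  hence kM: "~ k < M" "k - M < N" using \<open>k < N \<or> k \<ge> M\<close> k NM by linarith+
  thus ?thesis using False c(2)[of "k - M"] s by (simp add: b_def)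
  qed
  next
  case False
  hence "b k : part L 0" "B.scal c k = 1" using bG[OF k] G_0 by (auto simp: B.scal_def type_I_degree_def)
  thus ?thesis using fix0 smult_one[OF bc[OF k]] by simp
  qed
  have "\<phi> x = grading_scaling L G c x" if x: "x : carrier L" for x
  proof (rule B.crd_eqI[OF im[OF x] B.gs_crd(1)[OF x]])
  fix k assume k: "k < M + N"
  have l: "lin_fun (%x. crd (\<phi> x) k)" using crdl[of k] by (auto simp: lin_fun_def add smult im)
  have "crd (\<phi> x) k = (\<Sum>j<M+N. crd x j * crd (\<phi> (b j)) k)" by (rule B.lin_expand[OF l x])
  also have "... = (\<Sum>j<M+N. if j = k then B.scal c k * crd x k else 0)"
  by (rule sum.cong) (auto simp: pb lin_smult[OF crdl] bc crd_b)
  finally show "crd (\<phi> x) k = crd (grading_scaling L G c x) k" using k B.gs_crd(2)[OF x, of c k] by simp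
  qed
  moreover have "grading_scaling L G c : extensional (carrier L)" by (simp add: grading_scaling_def)
  ultimately have "\<phi> = grading_scaling L G c" using ext by (intro extensionalityI) auto
  thus ?thesis using c(1) by blast
 qed
 let ?V = "L\<lparr>carrier := G 1\<rparr>"
 have V: "vectorspace class_ring ?V" using subspace_is_vs[OF G_subspace[of 1]] by simp
 interpret V: vectorspace class_ring ?V by (rule V)
 have Vl: "H (V.lincomb a A) = (\<Sum>v\<in>A. a v * H v)" if H: "lin_fun H" and A: "finite A" "A <= G 1" for H a A
 proof -
  have c: "x : carrier L" if "x : G 1" for x using that G_c[of 1] by auto
  have "H (finsum ?V (%v. a v \<odot>\<^bsub>?V\<^esub> v) A) = (\<Sum>v\<in>A. H (a v \<odot>\<^bsub>?V\<^esub> v))"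
  by (rule V.finsum_additive) (use H A c in \<open>auto simp: lin_fun_zero lin_add G_smult\<close>)
  also have "... = (\<Sum>v\<in>A. a v * H v)" by (rule sum.cong) (use H A c in \<open>auto simp: lin_smult\<close>)
  finally show ?thesis by (simp add: V.lincomb_def)
 qed
 have inj: "inj_on e {..<N}"
 proof (rule inj_onI)
  fix i j assume "i : {..<N}" "j : {..<N}" "e i = e j"
  thus "i = j" using dual[of i j] dual[of j j] by (auto split: if_splits)
 qed
 let ?A = "e ` {..<N}"
 have AG: "?A <= G 1" using eG by auto
 have Ecomb: "E j (V.lincomb a ?A) = a (e j)" if j: "j < N" for a j
 proof -
  have "E j (V.lincomb a ?A) = (\<Sum>i<N. a (e i) * E j (e i))" by (simp add: Vl[OF El] AG sum.reindex[OF inj])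
  also have "... = (\<Sum>i<N. if i = j then a (e j) else 0)" by (rule sum.cong) (use j in \<open>auto simp: E_def dual\<close>)
  finally show ?thesis using j by simp
 qed
 have "V.basis ?A" unfolding V.basis_def
 proof (intro conjI)
  show "?A <= carrier ?V" using AG by simp
  show "V.lin_indpt ?A"
  proof (rule V.finite_lin_indpt2)
  show "finite ?A" "?A <= carrier ?V" using AG by auto
  fix a :: "'g => 'k" assume "V.lincomb a ?A = \<zero>\<^bsub>?V\<^esub>"
  hence "a (e j) = 0" if "j < N" for j using Ecomb[OF that, of a] lin_fun_zero[OF El] by simp
  thus "\<forall>v\<in>?A. a v = \<zero>\<^bsub>class_ring\<^esub>" by auto
  qed
  show "V.span ?A = carrier ?V"
  proof
  show "V.span ?A <= carrier ?V" using AG V.span_is_subset2[of ?A] by auto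
  show "carrier ?V <= V.span ?A"
  proof
  fix x assume "x : carrier ?V"
  hence x: "x : G 1" by simp
  let ?y = "V.lincomb (%v. E (inv_into {..<N} e v) x) ?A"
  have y: "?y : V.span ?A" unfolding V.span_def by (intro CollectI exI conjI, rule refl) auto
  have yG: "?y : G 1" using V.lincomb_closed[of ?A "%v. E (inv_into {..<N} e v) x"] AG by auto
  have cc: "x : carrier L" "?y : carrier L" using x yG G_c[of 1] by auto
  have "E j ?y = E j x" if "j < N" for j using Ecomb[OF that] inv_into_f_f[OF inj, of j] that by simp
  hence "E j (x \<oplus> \<ominus> ?y) = 0" if "j < N" for j
  using that cc by (simp add: lin_add[OF El] lin_fun_uminus[OF El])
  moreover have "x \<oplus> \<ominus> ?y : G 1"
  using G_add[of 1 x "(- 1) \<odot> ?y"] G_smult[of 1 ?y "- 1"] x yG smult_minus_one[OF cc(2)] by simp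
  ultimately have "x \<oplus> \<ominus> ?y = \<zero>" using sep1 by blast
  hence "x = ?y" using eq_of_minus_zero[OF cc] by blast
  thus "x : V.span ?A" using y by simp
  qed
  qed
 qed
 hence "V.dim = card ?A" by (intro V.dim_basis) simp_all
 thus "vectorspace.dim class_ring ?V = N" using card_image[OF inj] by simp
 show "\<exists>M b crd. graded_lsa_basis L G N M h b crd" using B.graded_lsa_basis_axioms by blast
 show "\<forall>\<phi>\<in>Aut_even L. \<exists>c. c ~= 0 & \<phi> = grading_scaling L G c" using Aut by blast
qed

theorem kac_type_ghost_centre:
 fixes L :: "('k::field_char_0, 'g) lie_superalgebra"
 assumes L: "lie_superalgebra L" and K: "kac_type L" and G: "type_I_grading L G"
  and N: "N = vectorspace.dim class_ring (L\<lparr>carrier := G 1\<rparr>)"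
  and z: "primitive_root_of_unity (N + 1) \<zeta>"
 shows "internal_direct_sum (env L) {0..N}
           (%i. twisted_centre L (grading_scaling L G (\<zeta> ^ i))) (full_ghost_centre L)"
proof -
 interpret type_I_graded L G using L G by (simp add: type_I_graded_def type_I_graded_axioms_def)
 obtain N' :: nat and e f h where sep: "separated L" and R0: "rigid_dual_bases L {..<N'} e f h" using K by (auto simp: kac_type_def)
 obtain e' f' where R: "rigid_dual_bases L {..<N'} e' f' h" and ori: "\<forall>i<N'. e' i : G 1 & f' i : G (-1)"
  using rigid_oriented[OF R0] R0 rigid_dual_bases_swap[OF R0] that by auto
 note basis = rigid_graded_basis[OF sep R ori]
 obtain M b crd where B: "graded_lsa_basis L G N' M h b crd" using basis(1) by (elim exE)
 have "N' = N" using N basis(3) by simp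
 thus ?thesis using graded_lsa_basis.ghost_centre_decomposition[OF B basis(2)[rule_format]] z by simp
qed

section \<open>The full ghost centre\<close>

theorem theorem10p12:
  fixes L :: "('k::{alg_closed_field, field_char_0}, 'g) lie_superalgebra"
    and G :: "int \<Rightarrow> 'g set"
    and N :: nat
    and \<zeta> :: 'k
  assumes "lie_superalgebra L"
    and "(\<exists>m n. lsa_isomorphic L (gl m n))
       \<or> (\<exists>m n. (m, n) \<noteq> (1, 1) \<and> lsa_isomorphic L (sl m n))
       \<or> (\<exists>n>2. lsa_isomorphic L (psl n))
       \<or> (\<exists>n. lsa_isomorphic L (osp 2 n))"
    and "type_I_grading L G"
    and "N = vectorspace.dim class_ring (L\<lparr>carrier := G 1\<rparr>)"
    and "primitive_root_of_unity (N + 1) \<zeta>"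
  shows "internal_direct_sum (env L) {0..N}
           (\<lambda>i. twisted_centre L (grading_scaling L G (\<zeta> ^ i)))
           (full_ghost_centre L)"
proof (rule kac_type_ghost_centre[OF assms(1) _ assms(3-5)])
  note iso = kac_type_iso[OF assms(1)]
  from assms(2) show "kac_type L"
  proof (elim disjE exE conjE)
    fix m n assume "lsa_isomorphic L (gl m n)"
    then show ?thesis using iso gl_kac_type unfolding lsa_isomorphic_def by blast
  next
    fix m n assume "(m, n) \<noteq> (1 :: nat, 1 :: nat)" "lsa_isomorphic L (sl m n)"
    then show ?thesis using iso sl_kac_type unfolding lsa_isomorphic_def by blast
  next
    fix n :: nat assume "n > 2" "lsa_isomorphic L (psl n)"
    then show ?thesis using iso psl_kac_type unfolding lsa_isomorphic_def by blast
  next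
    fix n assume "lsa_isomorphic L (osp 2 n)"
    then show ?thesis using iso osp_kac_type unfolding lsa_isomorphic_def by blast
  qed
qed

end
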